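(* Let $\beta,\kappa>0$ and suppose $V\in\mathcal K(\beta,\kappa)$. (i) If $d\ge2$, there exist $c_1,c_2,c_3,c_4>0$ such that for all $t\ge4$ and $x,y\in\mathbb{R}^d_0$, $$c_1H_{d,\beta,\kappa}(t,|x|)H_{d,\beta,\kappa}(t,|y|)q(c_2t,x,y)\le p(t,x,y)\le c_3H_{d,\beta,\kappa}(t,|x|)H_{d,\beta,\kappa}(t,|y|)q(c_4t,x,y).$$ (ii) If $d=1$, the estimate in (i) holds (for suitable constants) for all $t\ge4$ and $x,y\in\mathbb{R}^1_0$ with $xy>0$.
   Context: Let $d\ge1$, $\mathbb{R}^d_0:=\mathbb{R}^d\setminus\{0\}$. $V$ is a non-negative locally bounded Borel function on $\mathbb{R}^d_0$ with $\sup_{|x|\ge1}V(x)<\infty$ and $\int_{B(0,1)\setminus\{0\}}V(x)dx=\infty$. $V\in\mathcal K(\beta,\kappa)$ means: there exist a Borel function $c:\overline{B(0,1)}\to[0,\infty)$ and constants $C>0$, $\theta>\beta$ with $V(x)=c(x)|x|^{-2-2\beta}$ and $|c(x)-\kappa|\le C|x|^\theta$ for $0<|x|\le1$, and there exist $C_3,\gamma>0$ with $V(x)\le C_3|x|^{-2-\gamma}$ for $|x|>1$. $W$ is Brownian motion with generator $\Delta$ and transition density $q(t,x,y)=(4\pi t)^{-d/2}e^{-|x-y|^2/(4t)}$. $p(t,x,y)$ is the transition density of the process on $\mathbb{R}^d_0$ with semigroup $P_tf(x)=\mathbb{E}_x[e^{-\int_0^tV(W_s)ds}f(W_t);\,t<\tau^W_{\mathbb{R}^d_0}]$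 (generator $\Delta-V$). Notation: $\mathrm{Log}\,r:=\log(e-1+r)$; $h_{\beta,\kappa}(r):=(r\wedge 1)^{-(d-2-\beta)/2}\exp\big(-\frac{\sqrt\kappa}{\beta(r\wedge1)^\beta}\big)$; $H_{d,\beta,\kappa}(t,r):=h_{\beta,\kappa}(r)$ for $d\ge3$, $H_{2,\beta,\kappa}(t,r):=1\wedge\frac{h_{\beta,\kappa}(r)\mathbf 1_{(0,1)}(r)+(\mathrm{Log}\,r)\mathbf 1_{[1,\infty)}(r)}{\mathrm{Log}\sqrt t}$, $H_{1,\beta,\kappa}(t,r):=1\wedge\frac{h_{\beta,\kappa}(r)\mathbf 1_{(0,1)}(r)+r\mathbf 1_{[1,\infty)}(r)}{\sqrt t}$. *)

theory Defs
  imports "HOL-Probability.Probability"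
begin

text \<open>Gaussian kernel of Brownian motion with generator Laplacian in dimension d = CARD('n).\<close>
definition gauss_q :: "real \<Rightarrow> real^'n \<Rightarrow> real^'n \<Rightarrow> real" where
  "gauss_q t x y = (4 * pi * t) powr (- real CARD('n) / 2) * exp (- (norm (x - y))\<^sup>2 / (4 * t))"

definition Logp :: "real \<Rightarrow> real" where
  "Logp r = ln (exp 1 - 1 + r)"

definition h_bk :: "nat \<Rightarrow> real \<Rightarrow> real \<Rightarrow> real \<Rightarrow> real" where
  "h_bk d \<beta> \<kappa> r = (min r 1) powr (- (real d - 2 - \<beta>) / 2)
      * exp (- sqrt \<kappa> / (\<beta> * (min r 1) powr \<beta>))"

definition H_bk :: "nat \<Rightarrow> real \<Rightarrow> real \<Rightarrow> real \<Rightarrow> real \<Rightarrow> real" where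
  "H_bk d \<beta> \<kappa> t r =
     (if d \<ge> 3 then h_bk d \<beta> \<kappa> r
      else if d = 2 then min 1 ((if r < 1 then h_bk d \<beta> \<kappa> r else Logp r) / Logp (sqrt t))
      else min 1 ((if r < 1 then h_bk d \<beta> \<kappa> r else r) / sqrt t))"

definition admissible_V :: "(real^'n \<Rightarrow> real) \<Rightarrow> bool" where
  "admissible_V V \<longleftrightarrow>
     V \<in> borel_measurable borel \<and>
     (\<forall>x. x \<noteq> 0 \<longrightarrow> 0 \<le> V x) \<and>
     (\<forall>K. compact K \<and> 0 \<notin> K \<longrightarrow> bounded (V ` K)) \<and>
     bdd_above (V ` {x. norm x \<ge> 1}) \<and>
     (\<integral>\<^sup>+ x \<in> ball 0 1 - {0}. ennreal (V x) \<partial>lborel) = \<infinity>"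

definition class_K :: "real \<Rightarrow> real \<Rightarrow> (real^'n \<Rightarrow> real) \<Rightarrow> bool" where
  "class_K \<beta> \<kappa> V \<longleftrightarrow>
     (\<exists>c :: real^'n \<Rightarrow> real. \<exists>C \<theta>. c \<in> borel_measurable borel \<and>
        (\<forall>x. norm x \<le> 1 \<longrightarrow> 0 \<le> c x) \<and> C > 0 \<and> \<theta> > \<beta> \<and>
        (\<forall>x. 0 < norm x \<and> norm x \<le> 1 \<longrightarrow>
           V x = c x * norm x powr (-2 - 2 * \<beta>) \<and> \<bar>c x - \<kappa>\<bar> \<le> C * norm x powr \<theta>)) \<and>
     (\<exists>C3 \<gamma>. C3 > 0 \<and> \<gamma> > 0 \<and> (\<forall>x. norm x > 1 \<longrightarrow> V x \<le> C3 * norm x powr (-2 - \<gamma>)))"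

definition brownian_family :: "(real^'n \<Rightarrow> 'w measure) \<Rightarrow> (real^'n \<Rightarrow> real \<Rightarrow> 'w \<Rightarrow> real^'n) \<Rightarrow> bool" where
  "brownian_family M W \<longleftrightarrow>
     (\<forall>x. prob_space (M x) \<and>
        (\<forall>t\<ge>0. W x t \<in> borel_measurable (M x)) \<and>
        (\<forall>\<omega>\<in>space (M x). W x 0 \<omega> = x \<and> continuous_on {0..} (\<lambda>s. W x s \<omega>)) \<and>
        (\<forall>ts :: real list. sorted_wrt (<) ts \<and> (\<forall>s\<in>set ts. 0 \<le> s) \<longrightarrow>
           prob_space.indep_vars (M x) (\<lambda>_. borel)
             (\<lambda>i \<omega>. W x (ts ! Suc i) \<omega> - W x (ts ! i) \<omega>) {..<length ts - 1}) \<and>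
        (\<forall>s t. 0 \<le> s \<and> s < t \<longrightarrow>
           distributed (M x) lborel (\<lambda>\<omega>. W x t \<omega> - W x s \<omega>) (\<lambda>z. ennreal (gauss_q (t - s) 0 z))))"

text \<open>p is the (continuous version of the) transition density of the Feynman-Kac semigroup
  P_t f(x) = E_x[exp(-int_0^t V(W_s) ds) f(W_t); t < tau_{R^d_0}], on R^d_0.
  The event t < tau means the path does not hit 0 on [0,t].\<close>
definition killed_FK_density ::
  "(real^'n \<Rightarrow> 'w measure) \<Rightarrow> (real^'n \<Rightarrow> real \<Rightarrow> 'w \<Rightarrow> real^'n) \<Rightarrow> (real^'n \<Rightarrow> real)
     \<Rightarrow> (real \<Rightarrow> real^'n \<Rightarrow> real^'n \<Rightarrow> real) \<Rightarrow> bool" where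
  "killed_FK_density M W V p \<longleftrightarrow>
     (\<forall>t>0. \<forall>x y. x \<noteq> 0 \<and> y \<noteq> 0 \<longrightarrow> 0 \<le> p t x y) \<and>
     (\<forall>t>0. continuous_on ({x. x \<noteq> 0} \<times> {y. y \<noteq> 0}) (\<lambda>(x, y). p t x y)) \<and>
     (\<forall>t>0. \<forall>x. x \<noteq> 0 \<longrightarrow> (\<forall>A \<in> sets borel.
        (\<integral>\<^sup>+ \<omega>. ennreal (indicator {\<omega>. \<forall>s\<in>{0..t}. W x s \<omega> \<noteq> 0} \<omega>
              * exp (- (LINT s:{0..t}|lborel. V (W x s \<omega>)))
              * indicator A (W x t \<omega>)) \<partial>M x)
        = (\<integral>\<^sup>+ y \<in> A - {0}. ennreal (p t x y) \<partial>lborel)))"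

end

theory Submission
imports Defs "HOL-Real_Asymp.Real_Asymp"
begin

text \<open>The boundary factor in the estimate is, up to constants, a positive radial solution of
  \<open>Delta u = V u\<close> that vanishes at the origin. All radial functions are written in the
  variable \<open>y = |x|^2\<close>. Near 0 the WKB ansatz gives \<open>exp (-k y^(-b)) y^a\<close>
  with \<open>b = \<beta>/2\<close>, \<open>k = sqrt \<kappa> / \<beta>\<close>, which is
  \<open>h_bk\<close>. Far away the solution looks like the growing radial harmonic function:
  \<open>|x|\<close> in dimension 1, a logarithm in dimension 2, a constant from dimension 3 on. The
  function \<open>prof\<close> joins the two regimes, and \<open>H_bk\<close> is comparable with
  \<open>min 1 (prof (|x|^2) / po d t)\<close> (\<open>H_compare\<close>).

  Reduction. Membership in the class traps \<open>V\<close> between two explicit continuous radial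
  potentials \<open>Vm\<close> and \<open>Vp\<close> (\<open>potential_sandwich\<close>), and the
  path functional is monotone in the potential (\<open>killed_sandwich\<close>). For a continuous
  potential the semigroup \<open>P\<close> is a limit of alternating products of heat steps and
  killing factors. This yields the semigroup law and the symmetry (\<open>P_semigroup\<close>,
  \<open>P_symmetric\<close>), and it reduces comparison with super- and subsolutions to an
  inequality for one small time step (\<open>supersolution_bound\<close>,
  \<open>subsolution_bound\<close>), which is a second-order Taylor estimate under a Gaussian
  (\<open>gauss_step_upper\<close>). Multiplying the WKB function by \<open>exp (A y^e)\<close>
  makes it a supersolution for \<open>Vm\<close> near 0 when \<open>A = -1\<close> and a subsolution
  for \<open>Vp\<close> on a bounded range when \<open>A\<close> is large. Gluing it to an outer
  piece, with a concave respectively convex kink, gives the profiles \<open>N\<close>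
  (\<open>super_exists\<close>) and \<open>n\<close> (\<open>sub_exists\<close>), both comparable
  with \<open>prof\<close>.

  Upper bound. From the supersolution \<open>N\<close> one gets that survival up to time
  \<open>T\<close> has probability at most a constant times \<open>min 1 (N (|x|^2) / N T)\<close>
  (\<open>survival_bound\<close>): close to the origin the process must escape through dyadic scales
  before the strong killing acts, and for long times one iterates over halvings of \<open>T\<close>.
  The same bound holds with an exponential weight \<open>exp (l . z)\<close>
  (\<open>exp_bound\<close>). In \<open>P (3T) = P T o P T o P T\<close> the two outer factors
  supply the boundary factors at \<open>x\<close> and \<open>y\<close>; the middle one is bounded by
  the free Gaussian, which is at most a product of an exponential in one variable and an exponential
  in the other (\<open>kernel_upper\<close>). The best \<open>l\<close> turns the exponentials into
  Gaussian decay.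

  Lower bound. The function \<open>n (|x|^2) exp (-|x|^2/T)\<close> is a subsolution up to a rate of
  order \<open>1/T\<close>, so from \<open>x\<close> a mass of order \<open>n (|x|^2) / n T\<close>
  reaches an annulus at distance of order \<open>sqrt T\<close> (\<open>mass_annulus\<close>). On
  half-spaces at that distance the potential is of order \<open>1/T\<close>, and the image kernel of
  the half-space gives a Gaussian lower bound (\<open>half_space_lower\<close>). Overlapping
  half-spaces and a chain of cubes lead from the annulus to one fixed base cube
  (\<open>to_base\<close>). Running this from \<open>x\<close> and, by symmetry, from
  \<open>y\<close>, and letting the two halves meet in the base cube, gives the bound unless
  \<open>x\<close> is far from the origin and \<open>y\<close> is close to \<open>x\<close>; then a
  single half-space contains both points (\<open>kernel_lower\<close>). In dimension 1 the two
  half-lines cannot be joined without hitting 0, hence the sign condition.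

  Both bounds are obtained for integrals over Borel sets and become pointwise by continuity of the
  density (\<open>pointwise_of_integral\<close>).\<close>

abbreviation en :: "real => ennreal" where "en == ennreal"
abbreviation ind :: "'a set => 'a => 'b::zero_neq_one" where "ind == indicator"
abbreviation bm :: "('a::topological_space => 'b::topological_space) set" where "bm == borel_measurable borel"
abbreviation nn_lborel :: "('a::euclidean_space => ennreal) => ennreal" (binder "NN " 10) where "nn_lborel == nn_integral lborel"
abbreviation gd :: "real => 'a::real_normed_vector => real" where "gd T z == exp (- (norm z)\<^sup>2 / (2 * T))"

section \<open>The Gaussian kernel: tilting, convolution, moments\<close>

lemma gauss_q_pos: "t > 0 ==> 0 < gauss_q t x y"
by (simp add: gauss_q_def)

lemma gauss_q_nonneg [simp]: "0 <= gauss_q t x y"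
by (simp add: gauss_q_def)

lemma gauss_q_sym: "gauss_q t x y = gauss_q t y x"
by (simp add: gauss_q_def norm_minus_commute)

lemma gauss_q_translate: "gauss_q t x y = gauss_q t 0 (y - x)"
by (simp add: gauss_q_def norm_minus_commute)

lemma gauss_q_measurable [measurable]: "(%p. gauss_q t (fst p) (snd p)) \<in> borel_measurable (borel \<Otimes>\<^sub>M borel)"
unfolding gauss_q_def by measurable

lemma gauss_q_measurable' [measurable]: "(%p. gauss_q t (fst p) (snd p)) \<in> borel_measurable (lborel \<Otimes>\<^sub>M lborel)"
proof -
have "sets (lborel \<Otimes>\<^sub>M lborel :: ((real^'n) \<times> (real^'n)) measure) = sets (borel \<Otimes>\<^sub>M borel)"
 by (intro sets_pair_measure_cong) auto
from measurable_cong_sets[OF this refl] show ?thesis using gauss_q_measurable by blast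
qed

lemma gauss_q_measurable2 [measurable]: "gauss_q t x \<in> bm"
unfolding gauss_q_def by measurable

lemma gauss_q_eq_prod:
fixes z :: "real^'n"
assumes "t > 0"
shows "gauss_q t 0 z = (\<Prod>b\<in>Basis. normal_density 0 (sqrt (2 * t)) (z \<bullet> b))"
proof -
have "(\<Prod>b\<in>Basis. normal_density 0 (sqrt (2 * t)) (z \<bullet> b))
  = (\<Prod>b\<in>(Basis :: (real^'n) set). (4 * pi * t) powr (- 1 / 2) * exp (- (z \<bullet> b)\<^sup>2 / (4 * t)))"
 using assms by (intro prod.cong refl)
  (simp add: normal_density_def powr_minus powr_half_sqrt field_simps)
also have "... = ((4 * pi * t) powr (- 1 / 2)) ^ CARD('n) * exp (\<Sum>b\<in>(Basis :: (real^'n) set). - (z \<bullet> b)\<^sup>2 / (4 * t))"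
 by (simp add: prod.distrib exp_sum)
also have "(\<Sum>b\<in>(Basis :: (real^'n) set). - (z \<bullet> b)\<^sup>2 / (4 * t)) = - (norm z)\<^sup>2 / (4 * t)"
 unfolding power2_norm_eq_inner by (subst euclidean_inner)
  (simp add: power2_eq_square sum_negf sum_divide_distrib)
also have "((4 * pi * t) powr (- 1 / 2)) ^ CARD('n) = (4 * pi * t) powr (- real CARD('n) / 2)"
 using assms by (simp add: powr_powr flip: powr_realpow)
finally show ?thesis by (simp add: gauss_q_def)
qed

lemma nn_integral_shift:
fixes f :: "'a::euclidean_space => ennreal"
assumes "f \<in> bm"
shows "(NN z. f (z + a)) = (NN z. f z)"
using assms by (subst (2) lborel_distr_plus[symmetric, of a]) (simp add: nn_integral_distr add.commute)

lemma nn_integral_gauss [simp]: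
fixes x :: "real^'n"
assumes "t > 0"
shows "(NN z. gauss_q t x z) = 1"
proof -
have "(NN z. gauss_q t x z) = (NN z. en (gauss_q t 0 (z + (-x))))"
 by (subst gauss_q_translate) simp
also have "... = (NN z. en (gauss_q t (0::real^'n) z))"
 by (rule nn_integral_shift) measurable
also have "... = (NN z. (\<Prod>b\<in>(Basis :: (real^'n) set). en (normal_density 0 (sqrt (2 * t)) (z \<bullet> b))))"
 using assms by (simp add: gauss_q_eq_prod prod_ennreal)
also have "... = (\<Prod>b\<in>(Basis :: (real^'n) set). (NN y. en (normal_density 0 (sqrt (2 * t)) y)))"
 by (rule nn_integral_lborel_prod) auto
also have "... = 1"
proof -
 have "(NN y. en (normal_density 0 (sqrt (2 * t)) y)) = 1"
  using assms by (subst nn_integral_eq_integral) auto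
 thus ?thesis by simp
qed
finally show ?thesis .
qed

text \<open>Completing the square: the tilt moves the mean from \<open>x\<close> to
  \<open>x + 2 t l\<close>, the variance per coordinate being \<open>2 t\<close> for the generator
  Delta.\<close>

lemma gauss_q_exp_tilt:
fixes x z l :: "real^'n"
assumes "t > 0"
shows "gauss_q t x z * exp (l \<bullet> z) = exp (t * (norm l)^2 + l \<bullet> x) * gauss_q t (x + (2 * t) *\<^sub>R l) z"
proof -
have "- (norm (x - z))\<^sup>2 / (4 * t) + l \<bullet> z = t * (norm l)^2 + l \<bullet> x + - (norm (x + (2 * t) *\<^sub>R l - z))\<^sup>2 / (4 * t)"
 using assms unfolding power2_norm_eq_inner
 by (simp add: inner_simps field_simps inner_commute power2_eq_square)
then have "exp (- (norm (x - z))\<^sup>2 / (4 * t)) * exp (l \<bullet> z)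
 = exp (t * (norm l)^2 + l \<bullet> x) * exp (- (norm (x + (2 * t) *\<^sub>R l - z))\<^sup>2 / (4 * t))"
 unfolding exp_add[symmetric] by simp
thus ?thesis unfolding gauss_q_def by simp
qed

lemma nn_integral_gauss_exp:
fixes x l :: "real^'n"
assumes "t > 0"
shows "(NN z. en (gauss_q t x z) * en (exp (l \<bullet> z))) = en (exp (t * (norm l)^2 + l \<bullet> x))"
proof -
have "(NN z. en (gauss_q t x z) * en (exp (l \<bullet> z)))
 = (NN z. en (exp (t * (norm l)^2 + l \<bullet> x)) * en (gauss_q t (x + (2 * t) *\<^sub>R l) z))"
 using gauss_q_exp_tilt[OF assms, of x _ l] by (simp flip: ennreal_mult)
also have "... = en (exp (t * (norm l)^2 + l \<bullet> x)) * (NN z. en (gauss_q t (x + (2 * t) *\<^sub>R l) z))"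
 by (rule nn_integral_cmult) measurable
finally show ?thesis using assms by simp
qed

text \<open>After the tilt only the supremum of the shifted Gaussian is kept, so the kernel is
  bounded by a product of a function of \<open>x\<close> and a function of \<open>z\<close>. The
  vector \<open>l\<close> stays free and is optimised only at the very end of the upper
  bound.\<close>

lemma gauss_q_le_exp:
fixes x z l :: "real^'n"
assumes "t > 0"
shows "gauss_q t x z <= (4 * pi * t) powr (- real CARD('n) / 2) * exp (t * (norm l)^2) * exp (l \<bullet> x) * exp (- (l \<bullet> z))"
proof -
have "gauss_q t x z = gauss_q t x z * exp (l \<bullet> z) * exp (- (l \<bullet> z))"
 by (simp flip: exp_add add: mult.assoc)
also have "... = exp (t * (norm l)^2 + l \<bullet> x) * gauss_q t (x + (2 * t) *\<^sub>R l) z * exp (- (l \<bullet> z))"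
 using gauss_q_exp_tilt[OF assms] by metis
also have "... <= exp (t * (norm l)^2 + l \<bullet> x) * (4 * pi * t) powr (- real CARD('n) / 2) * exp (- (l \<bullet> z))"
 using assms unfolding gauss_q_def by (intro mult_right_mono mult_left_mono) (auto intro!: mult_left_le)
finally show ?thesis by (simp add: exp_add mult_ac)
qed

lemma gauss_q_le: "t > 0 ==> gauss_q t x (z::real^'n) <= (4 * pi * t) powr (- real CARD('n) / 2)"
using gauss_q_le_exp[of t x z 0] by simp

text \<open>Completing the square in \<open>z\<close>: the product is a Gaussian in \<open>z\<close>
  around the weighted mean of \<open>x\<close> and \<open>y\<close>, with the kernel at time
  \<open>s + t\<close> as its constant.\<close>

lemma gauss_q_mult:
fixes x y z :: "real^'n"
assumes "s > 0" "t > 0"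
shows "gauss_q s x z * gauss_q t z y
 = gauss_q (s + t) x y * gauss_q (s * t / (s + t)) ((t / (s + t)) *\<^sub>R x + (s / (s + t)) *\<^sub>R y) z"
proof -
have e: "- (norm (x - z))\<^sup>2 / (4 * s) + - (norm (z - y))\<^sup>2 / (4 * t)
 = - (norm (x - y))\<^sup>2 / (4 * (s + t))
  + - (norm ((t / (s + t)) *\<^sub>R x + (s / (s + t)) *\<^sub>R y - z))\<^sup>2 / (4 * (s * t / (s + t)))"
proof -
 define A where "A = s + t"
 have A: "A > 0" "A = s + t" using assms by (auto simp: A_def)
 have X: "4 * (s * t / A) ~= 0" "4 * A ~= 0" "4 * s ~= 0" "4 * t ~= 0" using assms A by auto
 define xx yy zz xy xz yz where "xx = x \<bullet> x" and "yy = y \<bullet> y" and "zz = z \<bullet> z"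
  and "xy = x \<bullet> y" and "xz = x \<bullet> z" and "yz = y \<bullet> z"
 have 1: "(norm (x - z))^2 = xx - 2 * xz + zz" "(norm (z - y))^2 = zz - 2 * yz + yy"
  "(norm (x - y))^2 = xx - 2 * xy + yy"
  unfolding power2_norm_eq_inner xx_def yy_def zz_def xy_def xz_def yz_def
  by (simp_all add: inner_simps inner_commute)
 have 2: "(norm ((t / A) *\<^sub>R x + (s / A) *\<^sub>R y - z))^2
  = (t / A)^2 * xx + (s / A)^2 * yy + zz + 2 * (t / A) * (s / A) * xy - 2 * (t / A) * xz - 2 * (s / A) * yz"
  unfolding power2_norm_eq_inner xx_def yy_def zz_def xy_def xz_def yz_def
  by (simp add: inner_simps inner_commute power2_eq_square algebra_simps)
 have s: "s = A - t" using A by simp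
 have "A * (- (xx - 2 * xz + zz) * t + - (zz - 2 * yz + yy) * s) 
  = - (xx - 2 * xy + yy) * (s * t) + - (t^2 * xx + s^2 * yy + A^2 * zz + 2 * t * s * xy - 2 * t * A * xz - 2 * s * A * yz)"
  unfolding s by (simp add: power2_eq_square algebra_simps)
 then have N: "- (xx - 2 * xz + zz) * t + - (zz - 2 * yz + yy) * s
  = (- (xx - 2 * xy + yy) * (s * t) + - (t^2 * xx + s^2 * yy + A^2 * zz + 2 * t * s * xy - 2 * t * A * xz - 2 * s * A * yz)) / A"
  using A(1) by (simp add: nonzero_eq_divide_eq mult.commute)
 have S: "(t / A)^2 * xx + (s / A)^2 * yy + zz + 2 * (t / A) * (s / A) * xy - 2 * (t / A) * xz - 2 * (s / A) * yz
  = (t^2 * xx + s^2 * yy + A^2 * zz + 2 * t * s * xy - 2 * t * A * xz - 2 * s * A * yz) / A^2"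
  using A(1) by (simp add: add_divide_distrib diff_divide_distrib power_divide power2_eq_square)
 have L: "- U / (4 * s) + - W / (4 * t) = (- U * t + - W * s) / (4 * (s * t))" for U W
  using assms by (simp add: diff_divide_distrib)
 have R: "- Q / (4 * A) + - (Z / A^2) / (4 * (s * t / A)) = (- Q * (s * t) + - Z) / A / (4 * (s * t))" for Q Z
 proof -
  have "Z / A^2 / (4 * (s * t / A)) = Z / A / (4 * (s * t))" using A(1) by (simp add: power2_eq_square)
  moreover have "Q / (4 * A) = Q * (s * t) / A / (4 * (s * t))" using assms by simp
  moreover have "(- Q * (s * t) + - Z) / A / (4 * (s * t)) = - (Q * (s * t) / A / (4 * (s * t))) - Z / A / (4 * (s * t))"
  by (simp only: add_divide_distrib mult_minus_left minus_divide_left[symmetric])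
  ultimately show ?thesis by (simp only: minus_divide_left[symmetric])
 qed
 have "- (xx - 2 * xz + zz) / (4 * s) + - (zz - 2 * yz + yy) / (4 * t)
  = - (xx - 2 * xy + yy) / (4 * A) + - ((t / A)^2 * xx + (s / A)^2 * yy + zz + 2 * (t / A) * (s / A) * xy - 2 * (t / A) * xz - 2 * (s / A) * yz) / (4 * (s * t / A))"
  by (rule trans[OF L[of "xx - 2 * xz + zz" "zz - 2 * yz + yy"]], subst N, subst S, rule R[symmetric])
 thus ?thesis unfolding 1 A(2)[symmetric] 2 .
qed
have p: "(4 * pi * s) powr a * (4 * pi * t) powr a = (4 * pi * (s + t)) powr a * (4 * pi * (s * t / (s + t))) powr a" for a
proof -
 have "(4 * pi * s) * (4 * pi * t) = (4 * pi * (s + t)) * (4 * pi * (s * t / (s + t)))"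
  using assms by (simp add: divide_simps)
 then have "((4 * pi * s) * (4 * pi * t)) powr a = ((4 * pi * (s + t)) * (4 * pi * (s * t / (s + t)))) powr a"
  by (rule arg_cong)
 then show ?thesis by (simp only: powr_mult)
qed
show ?thesis unfolding gauss_q_def
 using e p[of "- real CARD('n) / 2"] 
 by (simp only: mult.assoc mult.left_commute[of "exp _" "_ powr _"] exp_add[symmetric])
  (simp only: mult.assoc[symmetric])
qed

lemma gauss_q_Chapman_Kolmogorov:
fixes x y :: "real^'n"
assumes "s > 0" "t > 0"
shows "(NN z. en (gauss_q s x z) * en (gauss_q t z y)) = en (gauss_q (s + t) x y)"
proof -
let ?c = "(t / (s + t)) *\<^sub>R x + (s / (s + t)) *\<^sub>R y"
have "(NN z. en (gauss_q s x z) * en (gauss_q t z y))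
 = (NN z. en (gauss_q (s + t) x y) * en (gauss_q (s * t / (s + t)) ?c z))"
 using gauss_q_mult[OF assms, of x _ y] by (simp flip: ennreal_mult)
also have "... = en (gauss_q (s + t) x y) * (NN z. en (gauss_q (s * t / (s + t)) ?c z))"
 by (rule nn_integral_cmult) measurable
also have "(NN z. en (gauss_q (s * t / (s + t)) ?c z)) = 1"
 using assms by (intro nn_integral_gauss) simp
finally show ?thesis by simp
qed

text \<open>Since the norm is at most the sum of the absolute coordinates, one coordinate is at
  least the norm divided by the dimension. This replaces \<open>exp (c |z|)\<close> by exponentials
  of linear functionals, whose Gaussian integrals are known.\<close>

lemma exp_norm_le:
fixes z :: "real^'n"
assumes "c >= 0"
shows "exp (c * norm z) <= (\<Sum>b\<in>Basis. exp (((c * real CARD('n)) *\<^sub>R b) \<bullet> z) + exp ((- (c * real CARD('n)) *\<^sub>R b) \<bullet> z))"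
proof -
define D where "D = real CARD('n)"
have D: "D > 0" by (simp add: D_def)
have "\<exists>b\<in>(Basis :: (real^'n) set). norm z <= D * \<bar>z \<bullet> b\<bar>"
proof (rule ccontr)
 assume "\<not> ?thesis"
 then have "!!b. b \<in> (Basis :: (real^'n) set) ==> \<bar>z \<bullet> b\<bar> < norm z / D" using D by (force simp: field_simps)
 then have "(\<Sum>b\<in>(Basis :: (real^'n) set). \<bar>z \<bullet> b\<bar>) < (\<Sum>b\<in>(Basis :: (real^'n) set). norm z / D)"
  by (intro sum_strict_mono) auto
 also have "... = norm z" using D by (simp add: D_def)
 finally show False using norm_le_l1[of z] by simp
qed
then obtain b where b: "b \<in> (Basis :: (real^'n) set)" "norm z <= D * \<bar>z \<bullet> b\<bar>" by auto
have "exp (c * norm z) <= exp (c * D * \<bar>b \<bullet> z\<bar>)"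
 using b assms by (simp add: mult_left_mono inner_commute mult.assoc)
also have "... <= exp (c * D * (b \<bullet> z)) + exp (- (c * D) * (b \<bullet> z))"
 by (cases "b \<bullet> z >= 0") (auto simp: add_increasing add_increasing2)
also have "... <= (\<Sum>b\<in>(Basis :: (real^'n) set). exp (((c * D) *\<^sub>R b) \<bullet> z) + exp ((- (c * D) *\<^sub>R b) \<bullet> z))"
 using b(1) by (intro member_le_sum[where f = "%b. exp (((c * D) *\<^sub>R b) \<bullet> z) + exp ((- (c * D) *\<^sub>R b) \<bullet> z)", THEN order_trans[rotated]])
  auto
finally show ?thesis by (simp add: D_def)
qed

lemma nn_integral_gauss_exp_norm:
fixes x :: "real^'n"
assumes "t > 0" "c >= 0"
shows "(NN z. en (gauss_q t 0 (z::real^'n)) * en (exp (c * norm z)))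
 <= en (2 * real CARD('n) * exp (t * (c * real CARD('n))^2))"
proof -
let ?D = "real CARD('n)"
let ?B = "Basis :: (real^'n) set"
have "(NN z. en (gauss_q t 0 (z::real^'n)) * en (exp (c * norm z)))
 <= (NN z. (\<Sum>b\<in>?B. en (gauss_q t 0 z) * en (exp (((c * ?D) *\<^sub>R b) \<bullet> z))
   + en (gauss_q t 0 z) * en (exp ((- (c * ?D) *\<^sub>R b) \<bullet> z))))"
proof (intro nn_integral_mono)
 fix z :: "real^'n"
 have "en (gauss_q t 0 z) * en (exp (c * norm z))
  <= en (gauss_q t 0 z) * en (\<Sum>b\<in>?B. exp (((c * ?D) *\<^sub>R b) \<bullet> z) + exp ((- (c * ?D) *\<^sub>R b) \<bullet> z))"
  using exp_norm_le[OF assms(2), of z] by (intro mult_left_mono ennreal_leI) auto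
 also have "... = (\<Sum>b\<in>?B. en (gauss_q t 0 z) * en (exp (((c * ?D) *\<^sub>R b) \<bullet> z))
   + en (gauss_q t 0 z) * en (exp ((- (c * ?D) *\<^sub>R b) \<bullet> z)))"
  by (subst sum_ennreal[symmetric]) (auto simp: sum_distrib_left distrib_left ennreal_plus intro!: add_nonneg_nonneg)
 finally show "en (gauss_q t 0 z) * en (exp (c * norm z)) <= ..." .
qed
also have "... = (\<Sum>b\<in>?B. en (exp (t * (norm ((c * ?D) *\<^sub>R b))^2)) + en (exp (t * (norm (- (c * ?D) *\<^sub>R b))^2)))"
 by (subst nn_integral_sum, simp, rule sum.cong[OF refl], subst nn_integral_add)
  (simp_all only: nn_integral_gauss_exp[OF assms(1)], simp_all)
also have "... = (\<Sum>b\<in>?B. en (2 * exp (t * (c * ?D)^2)))"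
 using assms by (intro sum.cong refl) (simp add: power_mult_distrib flip: ennreal_plus)
also have "... = en (2 * ?D * exp (t * (c * ?D)^2))"
 by (simp add: ennreal_of_nat_eq_real_of_nat mult_ac flip: ennreal_mult)
finally show ?thesis .
qed

lemma integrable_gauss_dominated:
fixes f :: "real^'n => real"
assumes "t > 0" and [measurable]: "f \<in> bm" and "c >= 0" "!!z. \<bar>f z\<bar> <= B * exp (c * norm z)"
shows "integrable lborel (%z. gauss_q t 0 z * f z)"
proof -
have "integrable lborel (%z::real^'n. gauss_q t 0 z * exp (c * norm z))"
proof (rule integrableI_nonneg)
 have "(NN z. en (gauss_q t 0 (z::real^'n) * exp (c * norm z))) <= en (2 * real CARD('n) * exp (t * (c * real CARD('n))^2))"
  using nn_integral_gauss_exp_norm[OF assms(1,3), where 'n='n] by (simp add: ennreal_mult')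
 then show "(NN z. en (gauss_q t 0 (z::real^'n) * exp (c * norm z))) < \<infinity>"
  by (rule le_less_trans) simp
qed auto
then have "integrable lborel (%z::real^'n. B * (gauss_q t 0 z * exp (c * norm z)))" by simp
then show ?thesis
proof (rule Bochner_Integration.integrable_bound)
 have "\<bar>gauss_q t 0 z * f z\<bar> <= \<bar>B * (gauss_q t 0 z * exp (c * norm z))\<bar>" for z :: "real^'n"
 proof -
  have "\<bar>gauss_q t 0 z * f z\<bar> = gauss_q t 0 z * \<bar>f z\<bar>" by (simp add: abs_mult)
  also have "... <= gauss_q t 0 z * (B * exp (c * norm z))" by (intro mult_left_mono assms) auto
  also have "... <= \<bar>B * (gauss_q t 0 z * exp (c * norm z))\<bar>" by (simp add: mult_ac)
  finally show ?thesis .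
 qed
 then show "AE z in lborel. norm (gauss_q t 0 z * f z) <= norm (B * (gauss_q t 0 z * exp (c * norm z)))" by simp
qed measurable
qed

lemma integral_gauss_exp:
fixes l :: "real^'n"
assumes "t > 0"
shows "integral\<^sup>L lborel (%z. gauss_q t 0 z * exp (l \<bullet> z)) = exp (t * (norm l)^2)"
proof -
have "integral\<^sup>L lborel (%z. gauss_q t 0 z * exp (l \<bullet> z)) = enn2real (NN z. en (gauss_q t 0 z * exp (l \<bullet> z)))"
 by (rule integral_eq_nn_integral) auto
also have "(NN z. en (gauss_q t 0 z * exp (l \<bullet> z))) = en (exp (t * (norm l)^2))"
 using nn_integral_gauss_exp[OF assms, of 0 l] by (simp add: ennreal_mult')
finally show ?thesis by simp
qed

lemma exp_second_order_le: "exp (s::real) - 1 - s <= s^2 * exp (abs s) / 2"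
proof -
obtain t where t: "(abs t) <= (abs s)" "exp s = (\<Sum>m<2. s ^ m / fact m) + exp t / fact 2 * s ^ 2"
 using Maclaurin_exp_le[of s 2] by blast
have "exp s = 1 + s + exp t / 2 * s^2" using t(2) by (simp add: eval_nat_numeral)
moreover have "exp t * s^2 <= exp (abs s) * s^2" using t(1) by (intro mult_right_mono) auto
ultimately show ?thesis by (simp add: mult_ac)
qed

lemma inner_abs_exp_le: "\<bar>x \<bullet> z\<bar> <= exp (norm x * norm (z::'a::real_inner))"
using Cauchy_Schwarz_ineq2[of x z] exp_ge_add_one_self[of "norm x * norm z"] by linarith

lemma power_exp_bound: "0 <= (s::real) ==> s ^ k <= fact k * exp s"
proof -
assume s: "0 <= s"
have "s ^ k /\<^sub>R fact k <= (\<Sum>n. s ^ n /\<^sub>R fact n)"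
 using s summable_exp_generic[of s] sum_le_suminf[of "%n. s ^ n /\<^sub>R fact n" "{k}"] by auto
then show ?thesis by (simp add: exp_def divide_simps mult_ac)
qed

text \<open>The second moment is read off the moment generating function: the symmetric second
  difference quotient at step \<open>ta n\<close> tends to \<open>(x . z)^2\<close> pointwise and is
  dominated, and its integral is explicit.\<close>

lemma integral_gauss_second:
fixes x :: "real^'n"
assumes "t > 0"
shows "integral\<^sup>L lborel (%z. gauss_q t 0 z * (x \<bullet> z)^2) = 2 * t * (norm x)^2"
proof -
define ta where "ta n = 1 / real (Suc n)" for n
have ta: "ta n > 0" "ta n <= 1" for n by (auto simp: ta_def)
have lim: "filterlim ta (at_right 0) sequentially"
 unfolding ta_def by real_asymp
define f where "f n z = gauss_q t 0 z * ((exp (ta n * (x \<bullet> z)) + exp (- ta n * (x \<bullet> z)) - 2) / (ta n)^2)" for n z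
have int_exp: "integrable lborel (%z. gauss_q t 0 z * exp (l \<bullet> z))" for l :: "real^'n"
 by (rule integrable_gauss_dominated[where c = "norm l" and B = 1, OF assms])
  (use norm_cauchy_schwarz[of l] in auto)
have f_int: "integral\<^sup>L lborel (f n) = (2 * exp (t * (ta n)^2 * (norm x)^2) - 2) / (ta n)^2" for n
proof -
 have f_eq: "f n = (%z. (gauss_q t 0 z * exp ((ta n *\<^sub>R x) \<bullet> z) + gauss_q t 0 z * exp ((- ta n *\<^sub>R x) \<bullet> z)
   - 2 * (gauss_q t 0 z * exp (0 \<bullet> z))) / (ta n)^2)"
  by (auto simp: f_def fun_eq_iff algebra_simps)
 show ?thesis unfolding f_eq using int_exp[of "ta n *\<^sub>R x"] int_exp[of "- ta n *\<^sub>R x"] int_exp[of 0]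
  integral_gauss_exp[OF assms, of "ta n *\<^sub>R x"] integral_gauss_exp[OF assms, of "- ta n *\<^sub>R x"] integral_gauss_exp[OF assms, of "0::real^'n"]
  by (simp add: power_mult_distrib mult_ac)
qed
have "(%n. integral\<^sup>L lborel (f n)) \<longlonglongrightarrow> integral\<^sup>L lborel (%z. gauss_q t 0 z * (x \<bullet> z)^2)"
proof (rule integral_dominated_convergence[where w = "%z. gauss_q t 0 z * (2 * exp (2 * norm x * norm z))"])
 show "integrable lborel (%z::real^'n. gauss_q t 0 z * (2 * exp (2 * norm x * norm z)))"
  by (rule integrable_gauss_dominated[where c = "2 * norm x" and B = 2, OF assms]) auto
 show "AE z in lborel. (%n. f n z) \<longlonglongrightarrow> gauss_q t 0 z * (x \<bullet> z)^2"
 proof (intro AE_I2)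
  fix z :: "real^'n"
  have "((%s. (exp (s * a) + exp (- s * a) - 2) / s^2) \<longlongrightarrow> a^2) (at_right 0)" for a :: real
  proof (cases "a = 0")
  case False
  then show ?thesis unfolding power2_eq_square[of a] by real_asymp
  qed simp
  from filterlim_compose[OF this lim] show "(%n. f n z) \<longlonglongrightarrow> gauss_q t 0 z * (x \<bullet> z)^2"
  unfolding f_def by (intro tendsto_mult_left) 
 qed
 fix n
 show "AE z in lborel. norm (f n z) <= gauss_q t 0 z * (2 * exp (2 * norm x * norm z))"
 proof (intro AE_I2)
  fix z :: "real^'n"
  let ?a = "x \<bullet> z"
  have 1: "exp (ta n * ?a) + exp (- ta n * ?a) - 2 <= (ta n * ?a)^2 * exp \<bar>?a\<bar>"
  proof -
  have "exp (ta n * ?a) + exp (- ta n * ?a) - 2 <= (ta n * ?a)^2 * exp \<bar>ta n * ?a\<bar>"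
   using exp_second_order_le[of "ta n * ?a"] exp_second_order_le[of "- ta n * ?a"] by simp
  also have "... <= (ta n * ?a)^2 * exp \<bar>?a\<bar>"
   using ta[of n] by (intro mult_left_mono) (auto simp: abs_mult mult_left_le_one_le)
  finally show ?thesis .
  qed
  have 0: "0 <= exp (ta n * ?a) + exp (- ta n * ?a) - 2"
  using exp_ge_add_one_self[of "ta n * ?a"] exp_ge_add_one_self[of "- ta n * ?a"] by linarith
  have "\<bar>(exp (ta n * ?a) + exp (- ta n * ?a) - 2) / (ta n)^2\<bar> <= ?a^2 * exp \<bar>?a\<bar>"
  using 0 1 ta(1)[of n] by (simp add: divide_simps power_mult_distrib mult_ac)
  also have "... <= 2 * exp \<bar>?a\<bar> * exp \<bar>?a\<bar>"
  using power_exp_bound[of "\<bar>?a\<bar>" 2] by (intro mult_right_mono) auto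
  also have "... = 2 * exp (2 * \<bar>?a\<bar>)" by (simp flip: exp_add)
  also have "... <= 2 * exp (2 * norm x * norm z)"
  using Cauchy_Schwarz_ineq2[of x z] by simp
  finally show "norm (f n z) <= gauss_q t 0 z * (2 * exp (2 * norm x * norm z))"
  unfolding f_def real_norm_def abs_mult by (intro mult_mono) auto
 qed
next
 show "f n \<in> borel_measurable lborel" for n unfolding f_def by measurable
qed simp
moreover have "(%n. integral\<^sup>L lborel (f n)) \<longlonglongrightarrow> 2 * t * (norm x)^2"
proof (cases "x = 0")
 case False
 define c where "c = t * (norm x)^2"
 have c: "c > 0" using False assms by (simp add: c_def)
 have "((%s. (2 * exp (s^2 * c) - 2) / s^2) \<longlongrightarrow> 2 * c) (at_right 0)" using c by real_asymp
 from filterlim_compose[OF this lim] show ?thesis unfolding f_int c_def by (simp add: mult_ac)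
qed (simp add: f_int)
ultimately show ?thesis by (rule LIMSEQ_unique)
qed

lemma lborel_distr_negate: "distr lborel borel (%z. - z) = (lborel :: 'a::euclidean_space measure)"
proof -
have "(lborel :: 'a measure) = density (distr lborel borel (%z. 0 + (-1) *\<^sub>R z)) (%_. \<bar>-1::real\<bar> ^ DIM('a))"
 by (rule lborel_affine) simp
also have "... = distr lborel borel (%z. - z)" by (simp add: density_1)
finally show ?thesis ..
qed

lemma gauss_moments:
fixes x :: "real^'n"
assumes "t > 0"
shows "has_bochner_integral lborel (%z::real^'n. gauss_q t 0 z) 1"
 and "has_bochner_integral lborel (%z. gauss_q t 0 z * (x \<bullet> z)) 0"
 and "has_bochner_integral lborel (%z. gauss_q t 0 z * (x \<bullet> z)^2) (2 * t * (norm x)^2)"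
 and "has_bochner_integral lborel (%z::real^'n. gauss_q t 0 z * (norm z)^2) (2 * t * real CARD('n))"
proof -
have i0: "integrable lborel (%z::real^'n. gauss_q t 0 z)"
 using integrable_gauss_dominated[of t "%_. 1 :: real" 0 1] assms by simp
with integral_gauss_exp[OF assms, of "0::real^'n"]
show "has_bochner_integral lborel (%z::real^'n. gauss_q t 0 z) 1" by (simp add: has_bochner_integral_iff)
have i1: "integrable lborel (%z. gauss_q t 0 z * (x \<bullet> z))"
 using inner_abs_exp_le[of x] by (intro integrable_gauss_dominated[where c = "norm x" and B = 1]) (auto simp: assms)
have "integral\<^sup>L lborel (%z. gauss_q t 0 z * (x \<bullet> z)) = integral\<^sup>L (distr lborel borel (%z. -z)) (%z. gauss_q t 0 z * (x \<bullet> z))"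
 by (simp only: lborel_distr_negate)
also have "... = integral\<^sup>L lborel (%z. gauss_q t 0 (-z) * (x \<bullet> (-z)))"
 by (subst integral_distr) auto
also have "... = - integral\<^sup>L lborel (%z. gauss_q t 0 z * (x \<bullet> z))"
 by (simp add: gauss_q_def)
finally show "has_bochner_integral lborel (%z. gauss_q t 0 z * (x \<bullet> z)) 0"
 using i1 by (simp add: has_bochner_integral_iff)
have i2: "integrable lborel (%z. gauss_q t 0 z * (x \<bullet> z)^2)" for x :: "real^'n"
proof (rule integrable_gauss_dominated[where c = "norm x" and B = 2, OF assms])
 fix z
 have "(x \<bullet> z)^2 <= (norm x * norm z)^2" using Cauchy_Schwarz_ineq2[of x z] by (simp add: abs_le_square_iff[symmetric])
 then show "\<bar>(x \<bullet> z)^2\<bar> <= 2 * exp (norm x * norm z)"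
  using power_exp_bound[of "norm x * norm z" 2] by simp
qed auto
show h2: "has_bochner_integral lborel (%z. gauss_q t 0 z * (x \<bullet> z)^2) (2 * t * (norm x)^2)" for x :: "real^'n"
 using i2 integral_gauss_second[OF assms] by (simp add: has_bochner_integral_iff)
have "has_bochner_integral lborel (%z::real^'n. \<Sum>b\<in>Basis. gauss_q t 0 z * (b \<bullet> z)^2) (\<Sum>b\<in>(Basis::(real^'n) set). 2 * t * (norm b)^2)"
 by (intro has_bochner_integral_sum h2)
moreover have "(\<Sum>b\<in>Basis. gauss_q t 0 z * (b \<bullet> z)^2) = gauss_q t 0 z * (norm z)^2" for z :: "real^'n"
 unfolding power2_norm_eq_inner by (subst (2) euclidean_inner) (simp add: sum_distrib_left power2_eq_square inner_commute)
ultimately show "has_bochner_integral lborel (%z::real^'n. gauss_q t 0 z * (norm z)^2) (2 * t * real CARD('n))"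
 by (simp add: mult_ac)
qed

text \<open>Scaling: \<open>|z|^4 <= 24 t^2 exp (|z| / sqrt t)\<close>, and the Gaussian at time
  \<open>t\<close> integrates \<open>exp ((c + 1/sqrt t) |z|)\<close> to a quantity bounded for
  \<open>t <= 1\<close>. The order \<open>t^2\<close> makes fourth-order tails negligible against
  one time step.\<close>

lemma gauss_fourth_moment:
fixes c :: real
assumes "c >= 0"
obtains C where "C >= 0" "!!t. 0 < t ==> t <= 1 ==>
 integral\<^sup>L lborel (%z::real^'n. gauss_q t 0 z * ((norm z) ^ 4 * exp (c * norm z))) <= C * t^2"
proof
let ?D = "real CARD('n)"
let ?C = "24 * (2 * ?D * exp (((c + 1) * ?D)^2))"
show "?C >= 0" by simp
fix t :: real assume t: "0 < t" "t <= 1"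
have b: "(norm z) ^ 4 * exp (c * norm z) <= 24 * t^2 * exp ((c + 1 / sqrt t) * norm z)" for z :: "real^'n"
proof -
 have e3: "(norm z / sqrt t) ^ 4 <= 24 * exp (norm z / sqrt t)"
  using power_exp_bound[of "norm z / sqrt t" 4] t by (simp add: fact_numeral)
 have "sqrt t ^ 4 = (sqrt t ^ 2) ^ 2" by (simp flip: power_mult)
 then have e4: "(norm z / sqrt t) ^ 4 = (norm z) ^ 4 / t^2"
  using t by (simp add: power_divide)
 have "(norm z) ^ 4 / t^2 <= 24 * exp (norm z / sqrt t)" using e3 unfolding e4 .
 then have "(norm z) ^ 4 <= 24 * t^2 * exp (norm z / sqrt t)" using t by (simp add: pos_divide_le_eq mult_ac)
 then have "(norm z) ^ 4 * exp (c * norm z) <= 24 * t^2 * exp (norm z / sqrt t) * exp (c * norm z)"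
  by (intro mult_right_mono) auto
 also have "... = 24 * t^2 * exp ((c + 1 / sqrt t) * norm z)" by (simp add: algebra_simps flip: exp_add)
 finally show ?thesis .
qed
have i: "integrable lborel (%z::real^'n. gauss_q t 0 z * (24 * t^2 * exp ((c + 1 / sqrt t) * norm z)))"
 using assms t by (intro integrable_gauss_dominated[where c = "c + 1 / sqrt t" and B = "24 * t^2"]) auto
have "integral\<^sup>L lborel (%z::real^'n. gauss_q t 0 z * ((norm z) ^ 4 * exp (c * norm z)))
 <= integral\<^sup>L lborel (%z::real^'n. gauss_q t 0 z * (24 * t^2 * exp ((c + 1 / sqrt t) * norm z)))"
 using b i by (intro integral_mono') (auto intro!: mult_left_mono)
also have "... = 24 * t^2 * integral\<^sup>L lborel (%z::real^'n. gauss_q t 0 z * exp ((c + 1 / sqrt t) * norm z))"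
 by (subst integral_mult_right_zero[symmetric]) (simp add: mult_ac)
also have "integral\<^sup>L lborel (%z::real^'n. gauss_q t 0 z * exp ((c + 1 / sqrt t) * norm z))
  <= 2 * ?D * exp (t * ((c + 1 / sqrt t) * ?D)^2)"
proof -
 have "integral\<^sup>L lborel (%z::real^'n. gauss_q t 0 z * exp ((c + 1 / sqrt t) * norm z))
  = enn2real (NN z. en (gauss_q t 0 (z::real^'n) * exp ((c + 1 / sqrt t) * norm z)))"
  by (rule integral_eq_nn_integral) auto
 also have "... <= enn2real (en (2 * ?D * exp (t * ((c + 1 / sqrt t) * ?D)^2)))"
  using nn_integral_gauss_exp_norm[of t "c + 1 / sqrt t", where 'n='n] t assms
  by (intro enn2real_mono) (auto simp: ennreal_mult' ennreal_mult_less_top)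
 finally show ?thesis by simp
qed
also have "t * ((c + 1 / sqrt t) * ?D)^2 <= ((c + 1) * ?D)^2"
proof -
 have "t * ((c + 1 / sqrt t) * ?D)^2 = (sqrt t * ((c + 1 / sqrt t) * ?D))^2"
  using t by (simp add: power_mult_distrib)
 also have "sqrt t * ((c + 1 / sqrt t) * ?D) = (c * sqrt t + 1) * ?D" using t by (simp add: field_simps)
 also have "(...)^2 <= ((c + 1) * ?D)^2"
  using t assms by (intro power_mono mult_right_mono add_right_mono) (auto simp: mult_left_le)
 finally show ?thesis .
qed
finally show "integral\<^sup>L lborel (%z::real^'n. gauss_q t 0 z * ((norm z) ^ 4 * exp (c * norm z))) <= ?C * t^2"
 using t by (simp add: mult_ac)
qed

section \<open>The heat operator and the finite-dimensional distributions of Brownian motion\<close>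

definition heat :: "real => (real^'n => ennreal) => real^'n => ennreal" where
"heat t f x = (NN z. en (gauss_q t x z) * f z)"

lemma heat_measurable [measurable]:
assumes [measurable]: "f \<in> bm"
shows "heat t f \<in> bm"
unfolding heat_def gauss_q_def by measurable

lemma heat_mono: "(!!z. f z <= g z) ==> heat t f x <= heat t g x"
unfolding heat_def by (intro nn_integral_mono mult_left_mono) auto

lemma heat_const [simp]: "t > 0 ==> heat t (%_. c) (x::real^'n) = c"
unfolding heat_def by (subst nn_integral_multc) auto

lemma heat_add:
assumes [measurable]: "f \<in> bm" "g \<in> bm"
shows "heat t (%z. f z + g z) x = heat t f x + heat t g x"
unfolding heat_def by (subst nn_integral_add[symmetric]) (auto simp: distrib_left)

lemma heat_cmult:
assumes [measurable]: "f \<in> bm"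
shows "heat t (%z. c * f z) x = c * heat t f x"
unfolding heat_def by (subst nn_integral_cmult[symmetric]) (auto simp: mult_ac)

lemma heat_shift:
assumes [measurable]: "g \<in> bm"
shows "(NN z. en (gauss_q t 0 z) * g (x + z)) = heat t g (x::real^'n)"
proof -
have "heat t g x = (NN z. en (gauss_q t x (z + x)) * g (z + x))"
 unfolding heat_def by (rule nn_integral_shift[symmetric]) measurable
also have "... = (NN z. en (gauss_q t 0 z) * g (x + z))"
 by (subst gauss_q_translate) (simp add: add.commute)
finally show ?thesis ..
qed

text \<open>The Markov property at the last but one time. The positions up to \<open>t n\<close> are
  functions of the earlier increments, which are independent of the last increment; Fubini on the
  product law integrates the latter out against its Gaussian density.\<close>

lemma brownian_one_step:
fixes M :: "real^'n => 'w measure"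
assumes bf: "brownian_family M W"
 and t0: "t 0 = (0::real)" and tm: "!!i. i <= n ==> t i < t (Suc i)"
 and [measurable]: "!!i. i <= n ==> \<phi> i \<in> bm" "g \<in> bm"
shows "(\<integral>\<^sup>+om. (\<Prod>i\<le>n. \<phi> i (W x (t i) om)) * g (W x (t (Suc n)) om) \<partial>M x)
  = (\<integral>\<^sup>+om. (\<Prod>i\<le>n. \<phi> i (W x (t i) om)) * heat (t (Suc n) - t n) g (W x (t n) om) \<partial>M x)"
proof -
interpret prob_space "M x" using bf by (auto simp: brownian_family_def)
have tmono: "t i < t j" if "i < j" "j <= Suc n" for i j
 using that
proof (induction j)
 case (Suc j)
 then show ?case using tm[of j] by (cases "i = j") (auto simp: less_Suc_eq)
qed simp
have tnn: "0 <= t i" if "i <= Suc n" for i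
 using tmono[of 0 i] t0 that by (cases "i = 0") auto
have Wm: "W x s \<in> borel_measurable (M x)" if "0 <= s" for s
 using bf that by (auto simp: brownian_family_def)
have W0: "W x 0 om = x" if "om \<in> space (M x)" for om
 using bf that by (auto simp: brownian_family_def)
define X where "X i om = W x (t (Suc i)) om - W x (t i) om" for i om
define ts where "ts = map t [0..<Suc (Suc n)]"
have nth: "ts ! i = t i" if "i <= Suc n" for i using that unfolding ts_def by (subst nth_map) (auto simp del: upt_Suc)
have len: "length ts = Suc (Suc n)" by (simp add: ts_def)
have "sorted_wrt (<) ts" "\<forall>s\<in>set ts. 0 <= s"
 using tmono tnn by (auto simp: sorted_wrt_iff_nth_less len nth in_set_conv_nth simp del: upt_Suc)
then have "indep_vars (%_. borel) (%i om. W x (ts ! Suc i) om - W x (ts ! i) om) {..<length ts - 1}"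
 using bf by (auto simp: brownian_family_def)
then have ind: "indep_vars (%_. borel) X {..<Suc n}"
 unfolding len by (subst indep_vars_cong[OF refl _ refl]) (auto simp: X_def nth)
define P where "P = PiM {..<n} (%_. borel :: (real^'n) measure)"
define U where "U om = restrict (%i. X i om) {..<n}" for om
define Q where "Q = PiM {n} (%_. borel :: (real^'n) measure)"
define Y where "Y om = restrict (%i. X i om) {n}" for om
have iv: "indep_var P U Q Y"
 unfolding P_def U_def Q_def Y_def by (rule indep_var_restrict[OF ind]) auto
have Um [measurable]: "U \<in> measurable (M x) P" and Ym [measurable]: "Y \<in> measurable (M x) Q"
 using indep_var_rv1[OF iv] indep_var_rv2[OF iv] by auto
define ev where "ev y = y n" for y :: "nat => real^'n"
have Qn [measurable]: "ev \<in> measurable Q borel"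
 unfolding Q_def ev_def by (rule measurable_component_singleton) simp
have Xm [measurable]: "X n \<in> measurable (M x) borel"
 using measurable_compose[OF Ym Qn] by (simp add: Y_def ev_def)
define w where "w i u = x + (\<Sum>j<i. u j)" for i and u :: "nat => real^'n"
have wm [measurable]: "w i \<in> measurable P borel" if "i <= n" for i
 unfolding w_def P_def using that
 by (intro borel_measurable_add borel_measurable_const borel_measurable_sum measurable_component_singleton) auto
have Ww: "W x (t i) om = w i (U om)" if "i <= n" "om \<in> space (M x)" for i om
 using that(1)
proof (induction i)
 case 0 then show ?case using W0[OF that(2)] by (simp add: w_def t0)
next
 case (Suc i)
 then have "W x (t i) om = w i (U om)" by simp
 then have "W x (t (Suc i)) om = w i (U om) + X i om" by (simp add: X_def)
 then show ?case using Suc.prems by (simp add: w_def U_def add.assoc)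
qed
have WS: "W x (t (Suc n)) om = w n (U om) + X n om" if "om \<in> space (M x)" for om
 using Ww[OF order_refl that] by (simp add: X_def)
define a where "a u = (\<Prod>i\<le>n. \<phi> i (w i u))" for u
have am [measurable]: "a \<in> borel_measurable P" unfolding a_def by measurable
have dd: "distributed (M x) lborel (X n) (%z. en (gauss_q (t (Suc n) - t n) 0 z))"
 unfolding X_def using bf tnn[of n] tm[of n] by (auto simp: brownian_family_def)
have dX: "distr (M x) borel (X n) = density lborel (%z. en (gauss_q (t (Suc n) - t n) 0 z))"
 using distributed_distr_eq_density[OF dd] by (simp cong: distr_cong)
interpret D: prob_space "distr (M x) Q Y" by (rule prob_space_distr) simp
have "(\<integral>\<^sup>+om. (\<Prod>i\<le>n. \<phi> i (W x (t i) om)) * g (W x (t (Suc n)) om) \<partial>M x)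
  = (\<integral>\<^sup>+om. (%(u, y). a u * g (w n u + ev y)) (U om, Y om) \<partial>M x)"
 by (intro nn_integral_cong) (simp add: a_def Ww WS Y_def ev_def)
also have "... = (\<integral>\<^sup>+p. (%(u, y). a u * g (w n u + ev y)) p \<partial>distr (M x) (P \<Otimes>\<^sub>M Q) (%om. (U om, Y om)))"
 by (subst nn_integral_distr) (auto simp: case_prod_beta')
also have "distr (M x) (P \<Otimes>\<^sub>M Q) (%om. (U om, Y om)) = distr (M x) P U \<Otimes>\<^sub>M distr (M x) Q Y"
 using iv unfolding indep_var_distribution_eq by simp
also have "(\<integral>\<^sup>+p. (%(u, y). a u * g (w n u + ev y)) p \<partial>(distr (M x) P U \<Otimes>\<^sub>M distr (M x) Q Y))
 = (\<integral>\<^sup>+u. (\<integral>\<^sup>+y. a u * g (w n u + ev y) \<partial>distr (M x) Q Y) \<partial>distr (M x) P U)"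
 by (subst D.nn_integral_fst[symmetric]) (auto simp: case_prod_beta')
also have "... = (\<integral>\<^sup>+om. (\<integral>\<^sup>+y. a (U om) * g (w n (U om) + ev y) \<partial>distr (M x) Q Y) \<partial>M x)"
 by (rule nn_integral_distr) measurable
also have "... = (\<integral>\<^sup>+om. a (U om) * heat (t (Suc n) - t n) g (w n (U om)) \<partial>M x)"
proof (rule nn_integral_cong)
 fix om
 have "(\<integral>\<^sup>+y. a (U om) * g (w n (U om) + ev y) \<partial>distr (M x) Q Y)
  = a (U om) * (\<integral>\<^sup>+y. g (w n (U om) + ev y) \<partial>distr (M x) Q Y)"
  by (rule nn_integral_cmult) measurable
 also have "(\<integral>\<^sup>+y. g (w n (U om) + ev y) \<partial>distr (M x) Q Y) = (\<integral>\<^sup>+om'. g (w n (U om) + ev (Y om')) \<partial>M x)"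
  by (rule nn_integral_distr) measurable
 also have "... = (\<integral>\<^sup>+om'. g (w n (U om) + X n om') \<partial>M x)" by (simp add: Y_def ev_def)
 also have "... = (\<integral>\<^sup>+z. g (w n (U om) + z) \<partial>distr (M x) borel (X n))"
  by (rule nn_integral_distr[symmetric]) measurable
 also have "... = (NN z. en (gauss_q (t (Suc n) - t n) 0 z) * g (w n (U om) + z))"
  unfolding dX by (rule nn_integral_density) measurable
 also have "... = heat (t (Suc n) - t n) g (w n (U om))" by (rule heat_shift) measurable
 finally show "(\<integral>\<^sup>+y. a (U om) * g (w n (U om) + ev y) \<partial>distr (M x) Q Y) = a (U om) * heat (t (Suc n) - t n) g (w n (U om))" .
qed
also have "... = (\<integral>\<^sup>+om. (\<Prod>i\<le>n. \<phi> i (W x (t i) om)) * heat (t (Suc n) - t n) g (W x (t n) om) \<partial>M x)"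
 by (intro nn_integral_cong) (simp add: a_def Ww)
finally show ?thesis .
qed

text \<open>Peeling off the last time repeatedly turns a product of functions of the path into
  nested heat operators.\<close>

lemma brownian_chain:
fixes M :: "real^'n => 'w measure"
assumes bf: "brownian_family M W"
 and t0: "t 0 = (0::real)" and tm: "!!i. i < n ==> t i < t (Suc i)"
 and \<phi>m: "!!i. \<phi> i \<in> bm" and gm: "g \<in> bm"
shows "(\<integral>\<^sup>+om. (\<Prod>i<n. \<phi> i (W x (t i) om)) * g (W x (t n) om) \<partial>M x)
  = foldr (%i h y. \<phi> i y * heat (t (Suc i) - t i) h y) [0..<n] g x"
using tm gm
proof (induction n arbitrary: g)
case 0
interpret prob_space "M x" using bf by (auto simp: brownian_family_def)
have "(\<integral>\<^sup>+om. g (W x 0 om) \<partial>M x) = (\<integral>\<^sup>+om. g x \<partial>M x)"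
 using bf by (intro nn_integral_cong) (auto simp: brownian_family_def)
then show ?case by (simp add: t0 emeasure_space_1)
next
case (Suc n)
note [measurable] = Suc.prems(2) \<phi>m
have "(\<integral>\<^sup>+om. (\<Prod>i<Suc n. \<phi> i (W x (t i) om)) * g (W x (t (Suc n)) om) \<partial>M x)
 = (\<integral>\<^sup>+om. (\<Prod>i\<le>n. \<phi> i (W x (t i) om)) * heat (t (Suc n) - t n) g (W x (t n) om) \<partial>M x)"
 unfolding lessThan_Suc_atMost
 by (rule brownian_one_step[OF bf]) (use t0 Suc.prems in auto)
also have "... = (\<integral>\<^sup>+om. (\<Prod>i<n. \<phi> i (W x (t i) om)) * (%y. \<phi> n y * heat (t (Suc n) - t n) g y) (W x (t n) om) \<partial>M x)"
 unfolding lessThan_Suc_atMost[symmetric] by (intro nn_integral_cong) (simp add: mult_ac)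
also have "... = foldr (%i h y. \<phi> i y * heat (t (Suc i) - t i) h y) [0..<n] (%y. \<phi> n y * heat (t (Suc n) - t n) g y) x"
 by (rule Suc.IH) (use Suc.prems in auto)
finally show ?case by simp
qed

lemma brownian_marginal:
fixes M :: "real^'n => 'w measure"
assumes "brownian_family M W" "t > 0" "g \<in> bm"
shows "(\<integral>\<^sup>+om. g (W x t om) \<partial>M x) = heat t g x"
using brownian_chain[OF assms(1), of "%i. real i * t" 1 "%_ _. 1" g x] assms(2,3) by simp

section \<open>Survival weights of a path as limits of discrete products\<close>

lemma riemann_sum_tendsto:
fixes f :: "real => real"
assumes "a < b" "continuous_on {a..b} f"
shows "(%n. \<Sum>i<Suc (Suc n). (b - a) / real (Suc n) * f (a + real i * ((b - a) / real (Suc n)))) \<longlonglongrightarrow> integral {a..b} f"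
proof -
define dt where "dt n = (b - a) / real (Suc n)" for n
have dt: "dt n > 0" for n using assms by (simp add: dt_def)
have dt0: "dt \<longlonglongrightarrow> 0" unfolding dt_def by real_asymp
have bend: "a + real (Suc n) * dt n = b" for n by (simp add: dt_def)
have grid: "a <= a + real i * dt n" "a + real i * dt n <= b" if "i <= Suc n" for i n
proof -
 show "a <= a + real i * dt n" using dt[of n] by simp
 have "real i * dt n <= real (Suc n) * dt n" using that dt[of n] by (intro mult_right_mono) auto
 then show "a + real i * dt n <= b" using bend[of n] by linarith
qed
define S where "S n = (\<Sum>i<Suc n. dt n * f (a + real i * dt n))" for n
have "S \<longlonglongrightarrow> integral {a..b} f"
proof (rule LIMSEQ_I)
 fix e :: real assume e: "e > 0"
 define e' where "e' = e / 2 / (b - a)"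
 have e': "e' > 0" using e assms by (simp add: e'_def)
 have "uniformly_continuous_on {a..b} f" using assms by (intro compact_uniformly_continuous) auto
 then obtain d where d: "d > 0" "!!u v. u \<in> {a..b} ==> v \<in> {a..b} ==> dist u v < d ==> dist (f u) (f v) < e'"
  using e' unfolding uniformly_continuous_on_def by metis
 obtain N where N: "!!n. n >= N ==> dt n < d"
  using order_tendstoD(2)[OF dt0 d(1)] unfolding eventually_sequentially by auto
 show "EX N. \<forall>n\<ge>N. norm (S n - integral {a..b} f) < e"
 proof (rule exI[of _ N], intro allI impI)
  fix n assume n: "n >= N"
  define s where "s i = a + real i * dt n" for i
  define F where "F u = integral {a..u} f" for u
  have io: "f integrable_on {a..b}" using assms(2) by (rule integrable_continuous_interval)
  have step: "\<bar>(F (s (Suc i)) - F (s i)) - dt n * f (s i)\<bar> <= e' * dt n" if i: "i < Suc n" for i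
  proof -
  have si: "s i \<in> {a..b}" "s (Suc i) \<in> {a..b}" "s i <= s (Suc i)" "s (Suc i) - s i = dt n"
   using grid[of i n] grid[of "Suc i" n] i dt[of n] by (auto simp: s_def algebra_simps)
  have c: "continuous_on {s i..s (Suc i)} f" using assms(2) si by (auto intro: continuous_on_subset)
  have "F (s i) + integral {s i..s (Suc i)} f = F (s (Suc i))"
   unfolding F_def using si io
   by (intro Henstock_Kurzweil_Integration.integral_combine integrable_on_subinterval[OF io]) auto
  moreover have "integral {s i..s (Suc i)} (%u. f u - f (s i)) = integral {s i..s (Suc i)} f - dt n * f (s i)"
   using c si by (subst Henstock_Kurzweil_Integration.integral_diff) (auto intro!: integrable_continuous_interval)
  moreover have "norm (integral {s i..s (Suc i)} (%u. f u - f (s i))) <= e' * (s (Suc i) - s i)"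
  proof (rule integral_bound)
   show "continuous_on {s i..s (Suc i)} (%u. f u - f (s i))" using c by (intro continuous_intros)
   fix u assume "u \<in> {s i..s (Suc i)}"
   then have "dist (f u) (f (s i)) < e'" using si N[OF n] by (intro d) (auto simp: dist_real_def)
   then show "norm (f u - f (s i)) <= e'" by (simp add: dist_norm)
  qed (use si in auto)
  ultimately show ?thesis using si by simp
  qed
  have "F (s (Suc n)) = (\<Sum>i<Suc n. F (s (Suc i)) - F (s i))"
  using sum_lessThan_telescope[of "%i. F (s i)" "Suc n"] by (simp add: F_def s_def)
  moreover have "F (s (Suc n)) = integral {a..b} f" using bend[of n] by (simp add: F_def s_def)
  ultimately have "integral {a..b} f - S n = (\<Sum>i<Suc n. (F (s (Suc i)) - F (s i)) - dt n * f (s i))"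
  unfolding S_def s_def[symmetric] by (simp only: sum_subtractf)
  then have "\<bar>integral {a..b} f - S n\<bar> <= (\<Sum>i<Suc n. \<bar>(F (s (Suc i)) - F (s i)) - dt n * f (s i)\<bar>)"
  by (simp only: sum_abs)
  also have "... <= (\<Sum>i<Suc n. e' * dt n)" by (rule sum_mono, rule step) simp
  also have "... = e' * (real (Suc n) * dt n)" by simp
  also have "real (Suc n) * dt n = b - a" using bend[of n] by simp
  also have "e' * (b - a) = e / 2" using assms(1) unfolding e'_def by (metis nonzero_eq_divide_eq diff_gt_0_iff_gt less_irrefl)
  also have "... < e" using e by simp
  finally show "norm (S n - integral {a..b} f) < e" by (simp add: abs_minus_commute)
 qed
qed
\<comment> \<open>The sum of the statement has both end points as nodes, because the discrete path
  weights do. Compared with the left Riemann sum \<open>S n\<close> the surplus is this single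
  vanishing term.\<close>
moreover have "(%n. dt n * f b) \<longlonglongrightarrow> 0" using tendsto_mult_right[OF dt0, of "f b"] by simp
ultimately have "(%n. S n + dt n * f b) \<longlonglongrightarrow> integral {a..b} f + 0" by (rule tendsto_add)
moreover have "S n + dt n * f b = (\<Sum>i<Suc (Suc n). dt n * f (a + real i * dt n))" for n
 using bend[of n] unfolding S_def by (subst (2) sum.lessThan_Suc) simp
ultimately show ?thesis unfolding dt_def by simp
qed

text \<open>The killing factor of one time step. Entering the ball of radius \<open>ep\<close> kills
  outright, so \<open>V\<close> is evaluated only away from its singularity.\<close>

definition kfac :: "(real^'n => real) => real => real => real^'n => ennreal" where
"kfac V ep dt y = (if ep <= norm y then en (exp (- dt * V y)) else 0)"

text \<open>The survival weight of a path on \<open>[a, b]\<close>; \<open>ep = 0\<close> is not a special case, since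
\<open>surv0\<close> only asks the path to avoid the origin.\<close>
definition surv :: "(real^'n => real) => real => real => real => (real => real^'n) => ennreal" where
"surv V ep a b w = (if \<forall>s\<in>{a..b}. ep <= norm (w s) then en (exp (- (LINT s:{a..b}|lborel. V (w s)))) else 0)"

definition surv0 :: "(real^'n => real) => real => real => (real => real^'n) => ennreal" where
"surv0 V a b w = (if \<forall>s\<in>{a..b}. w s ~= 0 then en (exp (- (LINT s:{a..b}|lborel. V (w s)))) else 0)"

lemma continuous_potential_path:
fixes V :: "real^'n => real" and w :: "real => real^'n"
assumes "continuous_on {y. y ~= 0} V" "continuous_on {a..b} w" "\<forall>s\<in>{a..b}. w s ~= 0"
shows "continuous_on {a..b} (%s. V (w s))"
using assms by (intro continuous_on_compose2[OF assms(1)]) auto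

lemma LINT_potential_path:
fixes V :: "real^'n => real" and w :: "real => real^'n"
assumes "continuous_on {y. y ~= 0} V" "continuous_on {a..b} w" "\<forall>s\<in>{a..b}. w s ~= 0"
shows "set_integrable lborel {a..b} (%s. V (w s))" "(LINT s:{a..b}|lborel. V (w s)) = integral {a..b} (%s. V (w s))"
proof -
show 1: "set_integrable lborel {a..b} (%s. V (w s))"
 by (rule borel_integrable_atLeastAtMost'[OF continuous_potential_path[OF assms]])
show "(LINT s:{a..b}|lborel. V (w s)) = integral {a..b} (%s. V (w s))"
 by (rule set_borel_integral_eq_integral(2)[OF 1])
qed

text \<open>If the path stays outside the cutoff ball, the product is the exponential of a Riemann
  sum of a continuous function. If it enters the open ball, continuity keeps it there during a time
  interval, which any sufficiently fine grid meets, so the products are eventually 0.\<close>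

lemma surv_tendsto:
fixes w :: "real => real^'n"
assumes V: "continuous_on {y. y ~= 0} V" and w: "continuous_on {a..b} w" and ab: "a < b" and ep: "ep > 0"
shows "(%n. \<Prod>i<Suc (Suc n). kfac V ep ((b - a) / real (Suc n)) (w (a + real i * ((b - a) / real (Suc n)))))
 \<longlonglongrightarrow> surv V ep a b w"
proof (cases "\<forall>s\<in>{a..b}. ep <= norm (w s)")
case True
then have nz: "\<forall>s\<in>{a..b}. w s ~= 0" using ep by force
have grid: "a + real i * ((b - a) / real (Suc n)) \<in> {a..b}" if "i < Suc (Suc n)" for i n
proof -
 have "real i * ((b - a) / real (Suc n)) <= real (Suc n) * ((b - a) / real (Suc n))"
  using that ab by (intro mult_right_mono) auto
 then show ?thesis using ab by auto
qed
have "(\<Prod>i<Suc (Suc n). kfac V ep ((b - a) / real (Suc n)) (w (a + real i * ((b - a) / real (Suc n)))))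
 = en (exp (- (\<Sum>i<Suc (Suc n). (b - a) / real (Suc n) * V (w (a + real i * ((b - a) / real (Suc n)))))))" for n
proof -
 have "(\<Prod>i<Suc (Suc n). kfac V ep ((b - a) / real (Suc n)) (w (a + real i * ((b - a) / real (Suc n)))))
  = (\<Prod>i<Suc (Suc n). en (exp (- ((b - a) / real (Suc n) * V (w (a + real i * ((b - a) / real (Suc n))))))))"
  using True grid[of _ n] by (intro prod.cong refl) (auto simp: kfac_def)
 also have "... = en (\<Prod>i<Suc (Suc n). exp (- ((b - a) / real (Suc n) * V (w (a + real i * ((b - a) / real (Suc n)))))))"
  by (rule prod_ennreal) simp
 also have "(\<Prod>i<Suc (Suc n). exp (- ((b - a) / real (Suc n) * V (w (a + real i * ((b - a) / real (Suc n)))))))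
  = exp (\<Sum>i<Suc (Suc n). - ((b - a) / real (Suc n) * V (w (a + real i * ((b - a) / real (Suc n))))))"
  by (rule exp_sum[symmetric]) simp
 finally show ?thesis by (simp only: sum_negf)
qed
moreover have "(%n. en (exp (- (\<Sum>i<Suc (Suc n). (b - a) / real (Suc n) * V (w (a + real i * ((b - a) / real (Suc n))))))))
 \<longlonglongrightarrow> en (exp (- integral {a..b} (%s. V (w s))))"
 by (intro tendsto_ennrealI tendsto_exp tendsto_minus riemann_sum_tendsto ab continuous_potential_path[OF V w nz])
moreover have "surv V ep a b w = en (exp (- integral {a..b} (%s. V (w s))))"
 unfolding surv_def using True LINT_potential_path(2)[OF V w nz] by simp
ultimately show ?thesis by simp
next
case False
then obtain s0 where s0: "s0 \<in> {a..b}" "norm (w s0) < ep" by force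
then obtain et where et: "et > 0" "!!s. s \<in> {a..b} ==> dist s s0 < et ==> dist (w s) (w s0) < ep - norm (w s0)"
 using w unfolding continuous_on_iff by (metis diff_gt_0_iff_gt)
have small: "norm (w s) < ep" if "s \<in> {a..b}" "dist s s0 < et" for s
 using et(2)[OF that] norm_triangle_ineq2[of "w s" "w s0"] by (simp add: dist_norm)
have "(%n. (b - a) / real (Suc n)) \<longlonglongrightarrow> 0" by real_asymp
then have "eventually (%n. (b - a) / real (Suc n) < et) sequentially" using et(1) by (rule order_tendstoD)
then have "eventually (%n. (\<Prod>i<Suc (Suc n). kfac V ep ((b - a) / real (Suc n)) (w (a + real i * ((b - a) / real (Suc n))))) = 0) sequentially"
proof eventually_elim
 case (elim n)
 define dt where "dt = (b - a) / real (Suc n)"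
 have dt: "dt > 0" "dt < et" using ab elim by (auto simp: dt_def)
 define i where "i = nat \<lfloor>(s0 - a) / dt\<rfloor>"
 have q: "0 <= (s0 - a) / dt" using s0 dt by simp
 have i1: "real i <= (s0 - a) / dt" "(s0 - a) / dt < real i + 1"
  unfolding i_def using q by (simp_all add: of_nat_nat)
 have i2: "real i * dt <= s0 - a" "s0 - a < real i * dt + dt"
  using i1 dt by (simp_all add: pos_le_divide_eq pos_divide_less_eq algebra_simps)
 have "a + real i * dt \<in> {a..b}" "dist (a + real i * dt) s0 < et"
  using i2 dt s0 by (auto simp: dist_real_def)
 then have z: "kfac V ep dt (w (a + real i * dt)) = 0" using small by (auto simp: kfac_def not_le[symmetric])
 have "(s0 - a) / dt <= real (Suc n)" using s0 ab by (simp add: dt_def divide_simps)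
 then have "i < Suc (Suc n)" using i1(1) by linarith
 then show ?case using z unfolding dt_def[symmetric] by (intro prod_zero) auto
qed
then show ?thesis unfolding surv_def using False by (simp only: if_False) (rule tendsto_eventually)
qed

lemma surv_split:
fixes w :: "real => real^'n"
assumes V: "continuous_on {y. y ~= 0} V" and w: "continuous_on {a..c} w" and "a <= b" "b <= c" and ep: "ep > 0"
shows "surv V ep a c w = surv V ep a b w * surv V ep b c w"
proof (cases "\<forall>s\<in>{a..c}. ep <= norm (w s)")
case True
then have nz: "\<forall>s\<in>{a..c}. w s ~= 0" using ep by force
have *: "(LINT s:{p..q}|lborel. V (w s)) = integral {p..q} (%s. V (w s))" if "a <= p" "q <= c" for p q
 using that nz by (intro LINT_potential_path(2) V continuous_on_subset[OF w]) auto
have "integral {a..c} (%s. V (w s)) = integral {a..b} (%s. V (w s)) + integral {b..c} (%s. V (w s))"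
 using assms(3,4) continuous_potential_path[OF V w nz]
 by (intro Henstock_Kurzweil_Integration.integral_combine[symmetric] integrable_continuous_interval) auto
then have "(LINT s:{a..c}|lborel. V (w s)) = (LINT s:{a..b}|lborel. V (w s)) + (LINT s:{b..c}|lborel. V (w s))"
 using *[of a c] *[of a b] *[of b c] assms(3,4) by simp
moreover have "\<forall>s\<in>{a..b}. ep <= norm (w s)" "\<forall>s\<in>{b..c}. ep <= norm (w s)" using True assms(3,4) by auto
ultimately show ?thesis using True by (simp add: surv_def ennreal_mult'[symmetric] flip: exp_add)
next
case False
then obtain s where "s \<in> {a..c}" "\<not> ep <= norm (w s)" by auto
then have "(\<exists>s\<in>{a..b}. \<not> ep <= norm (w s)) | (\<exists>s\<in>{b..c}. \<not> ep <= norm (w s))" by (cases "s <= b") auto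
then show ?thesis using False by (auto simp: surv_def)
qed

section \<open>The Feynman-Kac semigroup as a monotone limit of product formulas\<close>

lemma SUP_mult_incseq_ennreal:
fixes a b :: "nat => ennreal"
assumes "incseq a" "incseq b"
shows "(SUP k. a k) * (SUP k. b k) = (SUP k. a k * b k)"
proof (rule antisym)
have "a i * b j <= (SUP k. a k * b k)" for i j
 by (rule SUP_upper2[of "max i j"]) (auto intro!: mult_mono incseqD[OF assms(1)] incseqD[OF assms(2)])
then show "(SUP k. a k) * (SUP k. b k) <= (SUP k. a k * b k)"
 by (subst SUP_mult_right_ennreal, subst SUP_mult_left_ennreal) (intro SUP_least)
show "(SUP k. a k * b k) <= (SUP k. a k) * (SUP k. b k)"
 by (intro SUP_least mult_mono SUP_upper) auto
qed

text \<open>Truncation in height and in space: bounded and integrable, hence fit for dominated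
  convergence, and increasing to \<open>f\<close>.\<close>

definition trunc :: "nat => (real^'n => ennreal) => real^'n => ennreal" where
"trunc k f x = min (f x) (of_nat k) * ind (ball 0 (real k)) x"

lemma trunc_measurable [measurable]: "f \<in> bm ==> trunc k f \<in> bm"
unfolding trunc_def
by (auto intro!: borel_measurable_times_ennreal borel_measurable_min borel_measurable_indicator)

lemma trunc_le: "trunc k f x <= of_nat k" "trunc k f x <= f x"
by (auto simp: trunc_def split: split_indicator)

lemma incseq_trunc: "incseq (%k. trunc k f x)"
unfolding trunc_def incseq_def
by (auto intro!: mult_mono min.mono of_nat_mono intro: min.coboundedI2 split: split_indicator)

lemma SUP_trunc: "(SUP k. trunc k f x) = f x"
proof (rule antisym)
show "(SUP k. trunc k f x) <= f x" by (intro SUP_least trunc_le)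
obtain k0 :: nat where k0: "norm x < real k0" using reals_Archimedean2 by blast
show "f x <= (SUP k. trunc k f x)"
proof (cases "f x = \<top>")
 case True
 have "of_nat k <= (SUP k. trunc k f x)" for k
  using True k0 by (intro SUP_upper2[of "max k k0"]) (auto simp: trunc_def of_nat_mono)
 then have "(SUP k. of_nat k) <= (SUP k. trunc k f x)" by (intro SUP_least)
 then show ?thesis using True by (simp add: ennreal_SUP_of_nat_eq_top)
next
 case False
 then obtain r where r: "r >= 0" "f x = en r" by (cases "f x") auto
 obtain k1 :: nat where k1: "r < real k1" using reals_Archimedean2 by blast
 have "f x <= trunc (max k0 k1) f x"
  using k0 k1 r by (auto simp: trunc_def min_def ennreal_of_nat_eq_real_of_nat le_max_iff_disj)
 then show ?thesis by (rule SUP_upper2[rotated]) simp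
qed
qed

lemma nn_integral_trunc_finite:
fixes f :: "real^'n => ennreal"
shows "(NN x. trunc k f x) < \<infinity>"
proof -
have "(NN x. trunc k f x) <= (NN x. of_nat k * ind (ball 0 (real k)) (x::real^'n))"
 by (intro nn_integral_mono) (auto simp: trunc_def split: split_indicator)
also have "... = of_nat k * emeasure lborel (ball (0::real^'n) (real k))" by (rule nn_integral_cmult_indicator) simp
also have "... < \<infinity>" using emeasure_bounded_finite[of "ball (0::real^'n) (real k)"]
 by (simp add: ennreal_mult_less_top ennreal_of_nat_eq_real_of_nat)
finally show ?thesis .
qed

lemma heat_symmetric:
fixes a b :: "real^'n => ennreal"
assumes [measurable]: "a \<in> bm" "b \<in> bm"
shows "(NN x. a x * heat t b x) = (NN x. heat t a x * b x)"
proof -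
have m: "(%(x, y). a x * (en (gauss_q t x y) * b y)) \<in> borel_measurable (lborel \<Otimes>\<^sub>M lborel)"
 unfolding gauss_q_def by measurable
have "(NN x. a x * heat t b x) = (NN x. (NN y. a x * (en (gauss_q t x y) * b y)))"
 unfolding heat_def by (subst nn_integral_cmult) auto
also have "... = (NN y. (NN x. a x * (en (gauss_q t x y) * b y)))"
 using lborel_pair.Fubini'[OF m] by simp
also have "... = (NN y. heat t a y * b y)"
proof (rule nn_integral_cong)
 fix y
 have "(NN x. a x * (en (gauss_q t x y) * b y)) = (NN x. en (gauss_q t y x) * a x * b y)"
  by (simp add: gauss_q_sym[of t _ y] mult_ac)
 also have "... = heat t a y * b y" unfolding heat_def by (rule nn_integral_multc) measurable
 finally show "(NN x. a x * (en (gauss_q t x y) * b y)) = heat t a y * b y" .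
qed
finally show ?thesis .
qed

text \<open>Continuity of the potential off the origin makes its Riemann sums along paths converge.
  The Borel potential of the theorem is not an instance; it is trapped between two instances
  later.\<close>

locale brownian_killing =
fixes M :: "real^'n => 'w measure" and W :: "real^'n => real => 'w => real^'n" and V :: "real^'n => real"
assumes bf: "brownian_family M W"
 and V_cont: "continuous_on {y. y ~= 0} V"
 and V_nonneg: "!!y. y ~= 0 ==> 0 <= V y"
begin

lemma prob_space_M: "prob_space (M x)"
using bf by (auto simp: brownian_family_def)

lemma W_measurable: "0 <= s ==> W x s \<in> borel_measurable (M x)"
using bf by (auto simp: brownian_family_def)

lemma W_continuous: "om \<in> space (M x) ==> 0 <= a ==> continuous_on {a..b} (%s. W x s om)"
by (rule continuous_on_subset[of "{0..}"]) (use bf in \<open>auto simp: brownian_family_def\<close>)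

lemma kfac_measurable [measurable]:
assumes "ep > 0"
shows "kfac V ep dt \<in> bm"
proof -
have [measurable]: "(%y. ind {y. y ~= 0} y *\<^sub>R V y) \<in> bm"
 by (rule borel_measurable_continuous_on_indicator[OF _ V_cont]) measurable
have "kfac V ep dt = (%y. if ep <= norm y then en (exp (- dt * (ind {y. y ~= 0} y *\<^sub>R V y))) else 0)"
 using assms by (auto simp: kfac_def fun_eq_iff split: split_indicator)
also have "... \<in> bm" by measurable
finally show ?thesis .
qed

lemma kfac_le_1: "ep > 0 ==> dt >= 0 ==> kfac V ep dt y <= 1"
using V_nonneg[of y] by (cases "y = 0") (auto simp: kfac_def simp flip: ennreal_1)

text \<open>One factor of the Trotter product: a heat step followed by killing at the starting
  point.\<close>

definition Lop :: "real => real => (real^'n => ennreal) => real^'n => ennreal" where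
"Lop ep dt h y = kfac V ep dt y * heat dt h y"

lemma Lop_measurable: "ep > 0 ==> h \<in> bm ==> Lop ep dt h \<in> bm"
unfolding Lop_def by measurable

lemma Lop_pow_measurable: "ep > 0 ==> h \<in> bm ==> (Lop ep dt ^^ n) h \<in> bm"
by (induction n) (auto intro: Lop_measurable)

lemma Lop_mono: "(!!y. f y <= g y) ==> Lop ep dt f y <= Lop ep dt g y"
unfolding Lop_def by (intro mult_left_mono heat_mono) auto

lemma Lop_pow_mono: "(!!y. f y <= g y) ==> (Lop ep dt ^^ n) f y <= (Lop ep dt ^^ n) g y"
by (induction n arbitrary: y) (auto intro: Lop_mono)

lemma foldr_const_fun: "foldr (%i. h) [a..<a + n] g = (h ^^ n) g"
by (induction n arbitrary: g) (auto simp: funpow_swap1)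

text \<open>The product runs over \<open>n + 1\<close> nodes but there are only \<open>n\<close>
  steps, so the terminal killing factor is attached to \<open>f\<close>. This end-to-end form makes
  the discrete operators symmetric.\<close>

lemma discrete:
assumes "ep > 0" "dt > 0" and [measurable]: "f \<in> bm"
shows "(\<integral>\<^sup>+om. (\<Prod>i<Suc n. kfac V ep dt (W x (real i * dt) om)) * f (W x (real n * dt) om) \<partial>M x)
 = (Lop ep dt ^^ n) (%y. kfac V ep dt y * f y) x"
proof -
note kfac_measurable[OF assms(1), measurable]
have "(\<integral>\<^sup>+om. (\<Prod>i<Suc n. kfac V ep dt (W x (real i * dt) om)) * f (W x (real n * dt) om) \<partial>M x)
 = (\<integral>\<^sup>+om. (\<Prod>i<n. kfac V ep dt (W x (real i * dt) om)) * (%y. kfac V ep dt y * f y) (W x (real n * dt) om) \<partial>M x)"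
 by (simp add: mult_ac)
also have "... = foldr (%i h y. kfac V ep dt y * heat (real (Suc i) * dt - real i * dt) h y) [0..<n] (%y. kfac V ep dt y * f y) x"
 by (rule brownian_chain[OF bf, where t = "%i. real i * dt" and \<phi> = "%_. kfac V ep dt"])
  (use assms in auto)
also have "(%i h y. kfac V ep dt y * heat (real (Suc i) * dt - real i * dt) h y) = (%i. Lop ep dt)"
 by (simp add: Lop_def fun_eq_iff algebra_simps)
finally show ?thesis using foldr_const_fun[of "Lop ep dt" 0 n] by simp
qed

text \<open>For the semigroup law two grids of different mesh are needed, as \<open>s\<close> and
  \<open>t\<close> may be incommensurable. The grids meet at time \<open>n * dt\<close>, where the
  killing factors of both phases are applied.\<close>

lemma two_phase:
assumes "ep > 0" "dt > 0" "dt' > 0" and [measurable]: "f \<in> bm"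
shows "(\<integral>\<^sup>+om. (\<Prod>i<Suc n. kfac V ep dt (W x (real i * dt) om)) *
  ((\<Prod>i<Suc n. kfac V ep dt' (W x (real n * dt + real i * dt') om)) * f (W x (real n * dt + real n * dt') om)) \<partial>M x)
 = (Lop ep dt ^^ n) (%y. kfac V ep dt y * (Lop ep dt' ^^ n) (%y. kfac V ep dt' y * f y) y) x"
proof (cases n)
case 0
then show ?thesis using discrete[OF assms(1,2), where f = "%y. kfac V ep dt' y * f y" and n = 0 and x = x] kfac_measurable[OF assms(1)]
 by (simp add: mult_ac)
next
case (Suc m)
note kfac_measurable[OF assms(1), measurable]
define t where "t i = (if i <= n then real i * dt else real n * dt + real (i - n) * dt')" for i
\<comment> \<open>The middle index carries two factors, one as the last node of the first grid and
  one as the first node of the second.\<close>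
define \<phi> where "\<phi> i y = (if i < n then kfac V ep dt y else if i = n then kfac V ep dt y * kfac V ep dt' y else kfac V ep dt' y)" for i y
have tn: "t (n + n) = real n * dt + real n * dt'" using Suc by (simp add: t_def)
have "(\<Prod>i<n + n. \<phi> i (W x (t i) om)) = (\<Prod>i<Suc n. kfac V ep dt (W x (real i * dt) om)) *
  (\<Prod>i<n. kfac V ep dt' (W x (real n * dt + real i * dt') om))" for om
proof -
 have "(\<Prod>i<n + n. \<phi> i (W x (t i) om)) = (\<Prod>i<n. \<phi> i (W x (t i) om)) * (\<Prod>i<n. \<phi> (n + i) (W x (t (n + i)) om))"
 proof (induction n)
  case 0 then show ?case by simp
 next
  have *: "(\<Prod>i<a + b. g i) = (\<Prod>i<a. g i) * (\<Prod>i<b. g (a + i))" for a b and g :: "nat => ennreal"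
  by (induction b) (auto simp: mult_ac)
  case (Suc n) show ?case by (rule *)
 qed
 also have "(\<Prod>i<n. \<phi> i (W x (t i) om)) = (\<Prod>i<n. kfac V ep dt (W x (real i * dt) om))"
  by (intro prod.cong) (auto simp: \<phi>_def t_def)
 also have "(\<Prod>i<n. \<phi> (n + i) (W x (t (n + i)) om)) = kfac V ep dt (W x (real n * dt) om) *
  (\<Prod>i<n. kfac V ep dt' (W x (real n * dt + real i * dt') om))"
  unfolding Suc by (subst (1 2) prod.lessThan_Suc_shift) (simp add: \<phi>_def t_def Suc mult_ac)
 finally show ?thesis by (simp add: mult_ac)
qed
then have "(\<integral>\<^sup>+om. (\<Prod>i<Suc n. kfac V ep dt (W x (real i * dt) om)) *
  ((\<Prod>i<Suc n. kfac V ep dt' (W x (real n * dt + real i * dt') om)) * f (W x (real n * dt + real n * dt') om)) \<partial>M x)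
 = (\<integral>\<^sup>+om. (\<Prod>i<n + n. \<phi> i (W x (t i) om)) * (%y. kfac V ep dt' y * f y) (W x (t (n + n)) om) \<partial>M x)"
 by (intro nn_integral_cong) (simp add: tn mult_ac)
also have "... = foldr (%i h y. \<phi> i y * heat (t (Suc i) - t i) h y) [0..<n + n] (%y. kfac V ep dt' y * f y) x"
proof (rule brownian_chain[OF bf])
 show "t i < t (Suc i)" if "i < n + n" for i
  using assms by (auto simp: t_def not_le Suc_diff_le less_Suc_eq_le algebra_simps)
 show "\<phi> i \<in> bm" for i unfolding \<phi>_def by (cases "i < n"; cases "i = n") simp_all
qed (simp_all add: t_def)
also have "[0..<n + n] = [0..<n] @ [n..<n + n]" by (rule upt_add_eq_append) simp
also have "foldr (%i h y. \<phi> i y * heat (t (Suc i) - t i) h y) ([0..<n] @ [n..<n + n]) (%y. kfac V ep dt' y * f y)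
 = foldr (%i. Lop ep dt) [0..<n] (foldr (%i h y. \<phi> i y * heat (t (Suc i) - t i) h y) [n..<n + n] (%y. kfac V ep dt' y * f y))"
 unfolding foldr_append by (rule foldr_cong) (auto simp: \<phi>_def t_def Lop_def fun_eq_iff algebra_simps)
also have "[n..<n + n] = n # [Suc n..<Suc n + m]" using Suc by (subst upt_rec) simp
also have "foldr (%i h y. \<phi> i y * heat (t (Suc i) - t i) h y) (n # [Suc n..<Suc n + m]) (%y. kfac V ep dt' y * f y)
 = (%y. kfac V ep dt y * Lop ep dt' (foldr (%i. Lop ep dt') [Suc n..<Suc n + m] (%y. kfac V ep dt' y * f y)) y)"
proof -
 have F: "foldr (%i h y. \<phi> i y * heat (t (Suc i) - t i) h y) [Suc n..<Suc n + m] (%y. kfac V ep dt' y * f y)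
  = foldr (%i. Lop ep dt') [Suc n..<Suc n + m] (%y. kfac V ep dt' y * f y)"
  by (rule foldr_cong) (auto simp: \<phi>_def t_def Lop_def fun_eq_iff algebra_simps of_nat_diff)
 have p1: "\<phi> n y = kfac V ep dt y * kfac V ep dt' y" for y by (simp add: \<phi>_def)
 have p2: "t (Suc n) - t n = dt'" by (simp add: t_def)
 show ?thesis unfolding foldr.simps o_apply F p1 p2 by (simp only: Lop_def mult.assoc)
qed
also have "foldr (%i. Lop ep dt') [Suc n..<Suc n + m] (%y. kfac V ep dt' y * f y) = (Lop ep dt' ^^ m) (%y. kfac V ep dt' y * f y)"
 by (rule foldr_const_fun)
finally show ?thesis using foldr_const_fun[of "Lop ep dt" 0 n] Suc by simp
qed

lemma surv_le_1:
assumes "ep > 0"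
shows "surv V ep a b w <= 1"
proof (cases "\<forall>s\<in>{a..b}. ep <= norm (w s)")
case True
have nz: "w s ~= 0" if "s \<in> {a..b}" for s using True assms that by force
have "0 <= (LINT s:{a..b}|lborel. V (w s))"
 unfolding set_lebesgue_integral_def
 using nz by (intro integral_nonneg_AE AE_I2) (auto intro!: V_nonneg split: split_indicator)
then show ?thesis using True by (simp add: surv_def)
qed (auto simp: surv_def)

lemma W_surv_tendsto:
assumes "ep > 0" "0 <= a" "a < b" "om \<in> space (M x)"
shows "(%n. \<Prod>i<Suc (Suc n). kfac V ep ((b - a) / real (Suc n)) (W x (a + real i * ((b - a) / real (Suc n))) om))
 \<longlonglongrightarrow> surv V ep a b (%s. W x s om)"
by (rule surv_tendsto[OF V_cont W_continuous[OF assms(4,2)] assms(3,1)])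

lemma surv_measurable:
assumes "ep > 0" "0 <= a" "a < b"
shows "(%om. surv V ep a b (%s. W x s om)) \<in> borel_measurable (M x)"
proof (rule borel_measurable_LIMSEQ_order[OF W_surv_tendsto[OF assms]])
fix n
show "(%om. \<Prod>i<Suc (Suc n). kfac V ep ((b - a) / real (Suc n)) (W x (a + real i * ((b - a) / real (Suc n))) om)) \<in> borel_measurable (M x)"
 using assms
 by (intro borel_measurable_prod_ennreal measurable_compose[OF W_measurable kfac_measurable]) auto
qed

text \<open>The version with killing also on entering the ball of radius \<open>ep\<close>. The
  operator \<open>P\<close> below is its increasing limit as the radius shrinks
  (\<open>P_SUP\<close>), and is the semigroup of interest.\<close>

definition fk :: "real => real => (real^'n => ennreal) => real^'n => ennreal" where
"fk ep t f x = (\<integral>\<^sup>+om. surv V ep 0 t (%s. W x s om) * f (W x t om) \<partial>M x)"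

definition P :: "real => (real^'n => ennreal) => real^'n => ennreal" where
"P t f x = (\<integral>\<^sup>+om. surv0 V 0 t (%s. W x s om) * f (W x t om) \<partial>M x)"

lemma discrete_le:
assumes "ep > 0" "dt > 0" "!!y. f y <= c" "f \<in> bm"
shows "(Lop ep dt ^^ n) (%y. kfac V ep dt y * f y) x <= c"
proof -
interpret prob_space "M x" by (rule prob_space_M)
have "(Lop ep dt ^^ n) (%y. kfac V ep dt y * f y) x <= (\<integral>\<^sup>+om. 1 * c \<partial>M x)"
 unfolding discrete[OF assms(1,2,4), symmetric] 
 by (intro nn_integral_mono mult_mono prod_le_1 conjI assms(3) kfac_le_1) (use assms in auto)
then show ?thesis by (simp add: emeasure_space_1)
qed

text \<open>The Trotter formula, by dominated convergence: all discrete weights are at most 1, and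
  \<open>f (W x t om)\<close> has mean \<open>heat t f x\<close>.\<close>

lemma fk_tendsto:
assumes "ep > 0" "t > 0" and [measurable]: "f \<in> bm" and "heat t f x < \<infinity>"
shows "(%n. (Lop ep (t / real (Suc n)) ^^ Suc n) (%y. kfac V ep (t / real (Suc n)) y * f y) x) \<longlonglongrightarrow> fk ep t f x"
proof -
note W_measurable[measurable]
have [measurable]: "W x t \<in> borel_measurable (M x)" using assms by auto
have "(%n. \<integral>\<^sup>+om. (\<Prod>i<Suc (Suc n). kfac V ep ((t - 0) / real (Suc n)) (W x (0 + real i * ((t - 0) / real (Suc n))) om)) * f (W x t om) \<partial>M x)
 \<longlonglongrightarrow> fk ep t f x"
 unfolding fk_def
proof (rule nn_integral_dominated_convergence[where w = "%om. f (W x t om)"])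
 show "(\<integral>\<^sup>+om. f (W x t om) \<partial>M x) < \<infinity>" using brownian_marginal[OF bf assms(2,3)] assms(4) by simp
 show "AE om in M x. (\<Prod>i<Suc (Suc n). kfac V ep ((t - 0) / real (Suc n)) (W x (0 + real i * ((t - 0) / real (Suc n))) om)) * f (W x t om) <= f (W x t om)" for n
 proof (intro AE_I2)
  fix om
  have "(\<Prod>i<Suc (Suc n). kfac V ep ((t - 0) / real (Suc n)) (W x (0 + real i * ((t - 0) / real (Suc n))) om)) <= 1"
  by (intro prod_le_1 conjI kfac_le_1) (use assms in auto)
  from mult_right_mono[OF this, of "f (W x t om)"]
  show "(\<Prod>i<Suc (Suc n). kfac V ep ((t - 0) / real (Suc n)) (W x (0 + real i * ((t - 0) / real (Suc n))) om)) * f (W x t om) <= f (W x t om)" by simp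
 qed
 have fin: "AE om in M x. f (W x t om) ~= \<infinity>"
  by (rule nn_integral_PInf_AE) (use brownian_marginal[OF bf assms(2,3)] assms(4) in auto)
 show "AE om in M x. (%n. (\<Prod>i<Suc (Suc n). kfac V ep ((t - 0) / real (Suc n)) (W x (0 + real i * ((t - 0) / real (Suc n))) om)) * f (W x t om))
  \<longlonglongrightarrow> surv V ep 0 t (%s. W x s om) * f (W x t om)"
  using fin AE_space
 proof eventually_elim
  case (elim om)
  then show ?case
  by (intro tendsto_mult_ennreal W_surv_tendsto tendsto_const)
   (use assms surv_le_1[OF assms(1), of 0 t "%s. W x s om"] in \<open>auto simp: top_unique\<close>)
 qed
 show "(%om. surv V ep 0 t (%s. W x s om) * f (W x t om)) \<in> borel_measurable (M x)"
  using surv_measurable[OF assms(1) order_refl assms(2)] by measurable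
 show "(%om. (\<Prod>i<Suc (Suc n). kfac V ep ((t - 0) / real (Suc n)) (W x (0 + real i * ((t - 0) / real (Suc n))) om)) * f (W x t om)) \<in> borel_measurable (M x)" for n
  by (intro borel_measurable_times_ennreal borel_measurable_prod_ennreal measurable_compose[OF W_measurable kfac_measurable]
    measurable_compose[OF W_measurable assms(3)]) (use assms in auto)
qed measurable
moreover have "(\<integral>\<^sup>+om. (\<Prod>i<Suc (Suc n). kfac V ep ((t - 0) / real (Suc n)) (W x (0 + real i * ((t - 0) / real (Suc n))) om)) * f (W x t om) \<partial>M x)
 = (Lop ep (t / real (Suc n)) ^^ Suc n) (%y. kfac V ep (t / real (Suc n)) y * f y) x" for n
 using discrete[OF assms(1) _ assms(3), where dt = "t / real (Suc n)" and n = "Suc n" and x = x] assms(2) by simp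
ultimately show ?thesis by simp
qed

lemma heat_bounded: "t > 0 ==> (!!y. f y <= en c) ==> heat t f x < \<infinity>"
by (rule le_less_trans[OF heat_mono[of f "%_. en c" t x]]) auto

lemma fk_measurable_bounded:
assumes "ep > 0" "t > 0" and f: "f \<in> bm" "!!y. f y <= en c"
shows "fk ep t f \<in> bm"
proof (rule borel_measurable_LIMSEQ_order)
show "(%n. (Lop ep (t / real (Suc n)) ^^ Suc n) (%y. kfac V ep (t / real (Suc n)) y * f y) x) \<longlonglongrightarrow> fk ep t f x" for x
 using heat_bounded[of t f c x] assms by (intro fk_tendsto) auto
show "(Lop ep (t / real (Suc n)) ^^ Suc n) (%y. kfac V ep (t / real (Suc n)) y * f y) \<in> bm" for n
 using kfac_measurable[OF assms(1)] f by (intro Lop_pow_measurable assms) auto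
qed

lemma fk_le_bounded:
assumes "ep > 0" "!!y. f y <= c"
shows "fk ep t f x <= c"
proof -
interpret prob_space "M x" by (rule prob_space_M)
have "fk ep t f x <= (\<integral>\<^sup>+om. 1 * c \<partial>M x)"
 unfolding fk_def by (intro nn_integral_mono mult_mono surv_le_1 assms) auto
then show ?thesis by (simp add: emeasure_space_1)
qed

text \<open>Both sides are limits of the same discrete quantity. Read as a two-phase expectation it
  converges to the left side; with the second phase evaluated first, \<open>h n\<close> converges to
  \<open>fk ep t f\<close> and the expectation to the right side.\<close>

lemma fk_semigroup:
assumes "ep > 0" "s > 0" "t > 0" and [measurable]: "f \<in> bm" and fc: "!!y. f y <= en c"
shows "fk ep (s + t) f x = fk ep s (fk ep t f) x"
proof -
interpret prob_space "M x" by (rule prob_space_M)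
have [measurable]: "W x s \<in> borel_measurable (M x)" "W x (s + t) \<in> borel_measurable (M x)" using assms W_measurable by auto
have fkm [measurable]: "fk ep t f \<in> bm" by (rule fk_measurable_bounded[OF assms(1,3,4) fc])
define A where "A n om = (\<Prod>i<Suc (Suc n). kfac V ep ((s - 0) / real (Suc n)) (W x (0 + real i * ((s - 0) / real (Suc n))) om))" for n om
define B where "B n om = (\<Prod>i<Suc (Suc n). kfac V ep ((s + t - s) / real (Suc n)) (W x (s + real i * ((s + t - s) / real (Suc n))) om))" for n om
define h where "h n = (Lop ep (t / real (Suc n)) ^^ Suc n) (%y. kfac V ep (t / real (Suc n)) y * f y)" for n
have A1: "A n om <= 1" and B1: "B n om <= 1" for n om
 unfolding A_def B_def by (intro prod_le_1 conjI kfac_le_1; use assms in auto)+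
have Am [measurable]: "A n \<in> borel_measurable (M x)" and Bm [measurable]: "B n \<in> borel_measurable (M x)" for n
 unfolding A_def B_def
 by (intro borel_measurable_prod_ennreal measurable_compose[OF W_measurable kfac_measurable]; use assms in auto)+
have hm [measurable]: "h n \<in> bm" for n
 unfolding h_def using kfac_measurable[OF assms(1)] by (intro Lop_pow_measurable assms) auto
have hc: "h n y <= en c" for n y
 unfolding h_def using assms by (intro discrete_le) auto
have hlim: "(%n. h n y) \<longlonglongrightarrow> fk ep t f y" for y
 unfolding h_def using heat_bounded[of t f c y] assms by (intro fk_tendsto) auto
have fin: "f y ~= \<top>" "fk ep t f y ~= \<top>" for y
 by (rule neq_top_trans[OF ennreal_neq_top], rule fc, rule neq_top_trans[OF ennreal_neq_top], rule fk_le_bounded[OF assms(1) fc])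
have sfin: "surv V ep a b w ~= \<top>" for a b w
 using surv_le_1[OF assms(1), of a b w] by (auto simp: top_unique)
have sm [measurable]: "(%om. surv V ep 0 s (%s. W x s om)) \<in> borel_measurable (M x)"
 "(%om. surv V ep s (s + t) (%s. W x s om)) \<in> borel_measurable (M x)"
 by (intro surv_measurable; use assms in simp)+
have Alim: "(%n. A n om) \<longlonglongrightarrow> surv V ep 0 s (%s. W x s om)" if "om \<in> space (M x)" for om
 unfolding A_def by (rule W_surv_tendsto) (use assms that in auto)
have Blim: "(%n. B n om) \<longlonglongrightarrow> surv V ep s (s + t) (%s. W x s om)" if "om \<in> space (M x)" for om
 unfolding B_def by (rule W_surv_tendsto) (use assms that in auto)
have "(%n. \<integral>\<^sup>+om. A n om * (B n om * f (W x (s + t) om)) \<partial>M x) \<longlonglongrightarrow> 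
 (\<integral>\<^sup>+om. surv V ep 0 s (%s. W x s om) * (surv V ep s (s + t) (%s. W x s om) * f (W x (s + t) om)) \<partial>M x)"
proof (rule nn_integral_dominated_convergence[where w = "%_. 1 * (1 * en c)"])
 show "AE om in M x. A n om * (B n om * f (W x (s + t) om)) <= 1 * (1 * en c)" for n
  by (intro AE_I2 mult_mono A1 B1 fc) auto
 show "AE om in M x. (%n. A n om * (B n om * f (W x (s + t) om))) \<longlonglongrightarrow>
  surv V ep 0 s (%s. W x s om) * (surv V ep s (s + t) (%s. W x s om) * f (W x (s + t) om))"
  by (intro AE_I2 tendsto_mult_ennreal Alim Blim tendsto_const)
   (auto simp: fin sfin ennreal_mult_eq_top_iff)
qed (auto simp: emeasure_space_1)
also have "(\<integral>\<^sup>+om. surv V ep 0 s (%s. W x s om) * (surv V ep s (s + t) (%s. W x s om) * f (W x (s + t) om)) \<partial>M x) = fk ep (s + t) f x"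
 unfolding fk_def
proof (rule nn_integral_cong)
 fix om assume "om \<in> space (M x)"
 then have "surv V ep 0 (s + t) (%s. W x s om) = surv V ep 0 s (%s. W x s om) * surv V ep s (s + t) (%s. W x s om)"
  by (intro surv_split V_cont W_continuous) (use assms in auto)
 then show "surv V ep 0 s (%s. W x s om) * (surv V ep s (s + t) (%s. W x s om) * f (W x (s + t) om))
  = surv V ep 0 (s + t) (%s. W x s om) * f (W x (s + t) om)" by (simp add: mult_ac)
qed
finally have 1: "(%n. \<integral>\<^sup>+om. A n om * (B n om * f (W x (s + t) om)) \<partial>M x) \<longlonglongrightarrow> fk ep (s + t) f x" .
have "(%n. \<integral>\<^sup>+om. A n om * h n (W x s om) \<partial>M x) \<longlonglongrightarrow> fk ep s (fk ep t f) x"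
 unfolding fk_def[of ep s]
proof (rule nn_integral_dominated_convergence[where w = "%_. 1 * en c"])
 show "AE om in M x. A n om * h n (W x s om) <= 1 * en c" for n
  by (intro AE_I2 mult_mono A1 hc) auto
 show "AE om in M x. (%n. A n om * h n (W x s om)) \<longlonglongrightarrow> surv V ep 0 s (%s. W x s om) * fk ep t f (W x s om)"
  by (intro AE_I2 tendsto_mult_ennreal Alim hlim) (auto simp: fin sfin)
qed (auto simp: emeasure_space_1)
moreover have "(\<integral>\<^sup>+om. A n om * (B n om * f (W x (s + t) om)) \<partial>M x) = (\<integral>\<^sup>+om. A n om * h n (W x s om) \<partial>M x)" for n
 unfolding A_def B_def h_def
 using two_phase[OF assms(1) _ _ assms(4), where dt = "s / real (Suc n)" and dt' = "t / real (Suc n)" and n = "Suc n" and x = x]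
  discrete[OF assms(1) _ hm[of n, unfolded h_def], where dt = "s / real (Suc n)" and n = "Suc n" and x = x] assms(2,3)
 by simp
ultimately show ?thesis using LIMSEQ_unique[OF 1] by simp
qed

text \<open>The operator is the palindrome killing, heat, killing, ..., heat, killing, and each
  letter is symmetric with respect to Lebesgue measure.\<close>

lemma discrete_symmetric:
assumes "ep > 0"
shows "a \<in> bm ==> b \<in> bm ==>
 (NN x. a x * (Lop ep dt ^^ n) (%y. kfac V ep dt y * b y) x)
  = (NN x. (Lop ep dt ^^ n) (%y. kfac V ep dt y * a y) x * b x)"
proof (induction n arbitrary: a b)
case 0 then show ?case by (simp add: mult_ac)
next
case (Suc n)
note [measurable] = Suc.prems kfac_measurable[OF assms] 
define h where "h = (Lop ep dt ^^ n) (%y. kfac V ep dt y * b y)"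
have [measurable]: "h \<in> bm" unfolding h_def by (intro Lop_pow_measurable assms) measurable
have "(NN x. a x * (Lop ep dt ^^ Suc n) (%y. kfac V ep dt y * b y) x)
 = (NN x. (kfac V ep dt x * a x) * heat dt h x)"
 by (simp add: Lop_def h_def mult_ac)
also have "... = (NN x. heat dt (%x. kfac V ep dt x * a x) x * h x)"
 by (rule heat_symmetric) measurable
also have "... = (NN x. (Lop ep dt ^^ n) (%y. kfac V ep dt y * heat dt (%x. kfac V ep dt x * a x) y) x * b x)"
 unfolding h_def by (rule Suc.IH) measurable
also have "(%y. kfac V ep dt y * heat dt (%x. kfac V ep dt x * a x) y) = Lop ep dt (%x. kfac V ep dt x * a x)"
 by (simp add: Lop_def fun_eq_iff)
also have "(Lop ep dt ^^ n) (Lop ep dt (%x. kfac V ep dt x * a x)) = (Lop ep dt ^^ Suc n) (%x. kfac V ep dt x * a x)"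
 by (simp add: funpow_swap1)
finally show ?case .
qed

lemma fk_symmetric:
assumes "ep > 0" "t > 0" and [measurable]: "a \<in> bm" "b \<in> bm"
 and "!!y. a y <= en c" "!!y. b y <= en c"
 and "(NN x. a x) < \<infinity>" "(NN x. b x) < \<infinity>"
shows "(NN x. a x * fk ep t b x) = (NN x. fk ep t a x * b x)"
proof -
have *: "(%n. \<integral>\<^sup>+x. a x * (Lop ep (t / real (Suc n)) ^^ Suc n) (%y. kfac V ep (t / real (Suc n)) y * b y) x \<partial>lborel)
 \<longlonglongrightarrow> (NN x. a x * fk ep t b x)"
 if [measurable]: "a \<in> bm" "b \<in> bm"
  and ac: "!!y. a y <= en c" and bc: "!!y. b y <= en c" and fin: "(NN x. a x) < \<infinity>" for a b
proof (rule nn_integral_dominated_convergence[where w = "%x. a x * en c"])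
 note [measurable] = fk_measurable_bounded[OF assms(1,2) that(2) bc]
 have [measurable]: "(Lop ep (t / real (Suc n)) ^^ Suc n) (%y. kfac V ep (t / real (Suc n)) y * b y) \<in> bm" for n
  using kfac_measurable[OF assms(1)] by (intro Lop_pow_measurable assms) auto
 show "(%x. a x * (Lop ep (t / real (Suc n)) ^^ Suc n) (%y. kfac V ep (t / real (Suc n)) y * b y) x) \<in> borel_measurable lborel" for n
  by measurable
 show "(%x. a x * fk ep t b x) \<in> borel_measurable lborel" by measurable
 have "(NN x. a x * en c) = (NN x. a x) * en c" by (rule nn_integral_multc) measurable
 then show "(NN x. a x * en c) < \<infinity>" using fin by (simp add: ennreal_mult_less_top)
 show "AE x in lborel. a x * (Lop ep (t / real (Suc n)) ^^ Suc n) (%y. kfac V ep (t / real (Suc n)) y * b y) x <= a x * en c" for n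
  using assms bc by (intro AE_I2 mult_left_mono discrete_le) auto
 have nt: "a x ~= \<top>" "fk ep t b x ~= \<top>" for x
  by (rule neq_top_trans[OF ennreal_neq_top], rule ac, rule neq_top_trans[OF ennreal_neq_top], rule fk_le_bounded[OF assms(1) bc])
 show "AE x in lborel. (%n. a x * (Lop ep (t / real (Suc n)) ^^ Suc n) (%y. kfac V ep (t / real (Suc n)) y * b y) x) \<longlonglongrightarrow> a x * fk ep t b x"
  by (intro AE_I2 tendsto_mult_ennreal tendsto_const fk_tendsto heat_bounded[where c = c]) (use assms bc nt in auto)
qed measurable
have "(NN x. a x * fk ep t b x) = (NN x. b x * fk ep t a x)"
proof (rule LIMSEQ_unique[OF *[of a b]])
 show "(%n. \<integral>\<^sup>+x. a x * (Lop ep (t / real (Suc n)) ^^ Suc n) (%y. kfac V ep (t / real (Suc n)) y * b y) x \<partial>lborel)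
  \<longlonglongrightarrow> (NN x. b x * fk ep t a x)"
  using *[of b a] assms by (subst discrete_symmetric) (auto simp: mult_ac)
qed (use assms in auto)
then show ?thesis by (simp add: mult_ac)
qed

lemma incseq_surv: "incseq (%k. surv V (1 / real (Suc k)) a b w)"
unfolding incseq_def surv_def
proof safe
fix m n :: nat assume "m <= n"
then have "1 / real (Suc n) <= 1 / real (Suc m)" by (simp add: field_simps)
then show "(if \<forall>s\<in>{a..b}. 1 / real (Suc m) <= norm (w s) then en (exp (- (LINT s:{a..b}|lborel. V (w s)))) else 0)
 <= (if \<forall>s\<in>{a..b}. 1 / real (Suc n) <= norm (w s) then en (exp (- (LINT s:{a..b}|lborel. V (w s)))) else 0)"
 by (auto intro: order_trans)
qed

text \<open>By compactness a continuous path avoiding 0 on \<open>[a, b]\<close> keeps a positive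
  distance, so some cutoff radius does not affect it.\<close>

lemma SUP_surv:
assumes "continuous_on {a..b} w"
shows "(SUP k. surv V (1 / real (Suc k)) a b w) = surv0 V a b w"
proof (rule antisym)
show "(SUP k. surv V (1 / real (Suc k)) a b w) <= surv0 V a b w"
proof (rule SUP_least)
 fix k
 have "0 < 1 / real (Suc k)" by simp
 then show "surv V (1 / real (Suc k)) a b w <= surv0 V a b w"
  by (auto simp: surv_def surv0_def simp del: of_nat_Suc)
qed
show "surv0 V a b w <= (SUP k. surv V (1 / real (Suc k)) a b w)"
proof (cases "(\<forall>s\<in>{a..b}. w s ~= 0) & a <= b")
 case True
 have "\<exists>s\<in>{a..b}. \<forall>u\<in>{a..b}. norm (w s) <= norm (w u)"
  using True by (intro continuous_attains_inf) (auto intro!: continuous_intros assms)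
 then obtain s where s: "s \<in> {a..b}" "\<forall>u\<in>{a..b}. norm (w s) <= norm (w u)" by auto
 have "norm (w s) > 0" using s True by auto
 then obtain k where k: "1 / real (Suc k) < norm (w s)" using nat_approx_posE by blast
 then have "surv0 V a b w <= surv V (1 / real (Suc k)) a b w"
  using s by (force simp: surv0_def surv_def simp del: of_nat_Suc)
 then show ?thesis by (rule SUP_upper2[rotated]) simp
next
 case False
 then show ?thesis
 proof (cases "a <= b")
  case False
  then show ?thesis by (auto simp: surv_def surv0_def)
 qed (auto simp: surv0_def)
qed
qed

text \<open>One index drives both the cutoff radius and the function; monotone convergence then
  handles the two limits together. The algebraic laws of \<open>P\<close> follow from those of
  \<open>fk\<close> through this formula.\<close>

lemma P_SUP:
assumes "t > 0" and [measurable]: "!!k. f k \<in> bm" and inc: "!!y. incseq (%k. f k y)"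
shows "P t (%y. SUP k. f k y) x = (SUP k. fk (1 / real (Suc k)) t (f k) x)"
proof -
have [measurable]: "W x t \<in> borel_measurable (M x)" using assms W_measurable by auto
have [measurable]: "(%om. surv V (1 / real (Suc k)) 0 t (%s. W x s om)) \<in> borel_measurable (M x)" for k
 by (rule surv_measurable) (use assms in auto)
have "P t (%y. SUP k. f k y) x = (\<integral>\<^sup>+om. (SUP k. surv V (1 / real (Suc k)) 0 t (%s. W x s om) * f k (W x t om)) \<partial>M x)"
 unfolding P_def
 by (intro nn_integral_cong, subst SUP_surv[symmetric])
  (use assms in \<open>auto intro!: W_continuous SUP_mult_incseq_ennreal incseq_surv simp del: of_nat_Suc\<close>)
also have "... = (SUP k. fk (1 / real (Suc k)) t (f k) x)"
 unfolding fk_def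
proof (rule nn_integral_monotone_convergence_SUP)
 show "incseq (%k om. surv V (1 / real (Suc k)) 0 t (%s. W x s om) * f k (W x t om))"
  using inc incseq_surv unfolding incseq_def le_fun_def by (auto intro!: mult_mono simp del: of_nat_Suc)
qed measurable
finally show ?thesis .
qed

lemma P_SUP_trunc:
assumes "t > 0" "f \<in> bm"
shows "P t f x = (SUP k. fk (1 / real (Suc k)) t (trunc k f) x)"
using P_SUP[OF assms(1), where f = "%k. trunc k f" and x = x] assms(2) by (simp add: SUP_trunc incseq_trunc del: of_nat_Suc)

lemma trunc_le': "trunc k f y <= en (real k)"
using trunc_le(1)[of k f y] by (simp add: ennreal_of_nat_eq_real_of_nat)

lemma fk_measurable_trunc: "ep > 0 ==> t > 0 ==> f \<in> bm ==> fk ep t (trunc k f) \<in> bm"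
by (rule fk_measurable_bounded[where c = "real k"]) (auto intro: trunc_le')

lemma fk_semigroup_trunc: "ep > 0 ==> s > 0 ==> t > 0 ==> f \<in> bm ==>
 fk ep s (fk ep t (trunc k f)) x = fk ep (s + t) (trunc k f) x"
by (rule fk_semigroup[symmetric, where c = "real k"]) (auto intro: trunc_le')

lemma P_measurable [measurable]:
assumes "t > 0" "f \<in> bm"
shows "P t f \<in> bm"
unfolding P_SUP_trunc[OF assms, abs_def]
by (intro borel_measurable_SUP fk_measurable_trunc) (use assms in auto)

lemma fk_mono: "ep' <= ep ==> (!!y. f y <= g y) ==> fk ep t f x <= fk ep' t g x"
unfolding fk_def surv_def by (intro nn_integral_mono mult_mono) auto

lemma incseq_fk_trunc: "incseq (%k. fk (1 / real (Suc k)) t (trunc k f) y)"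
unfolding incseq_def using incseq_trunc[of f]
by (auto intro!: fk_mono simp: incseq_def field_simps)

lemma P_semigroup:
assumes "s > 0" "t > 0" and [measurable]: "f \<in> bm"
shows "P (s + t) f x = P s (P t f) x"
proof -
have "P s (P t f) x = P s (%y. SUP k. fk (1 / real (Suc k)) t (trunc k f) y) x"
proof -
 have "P t f = (%y. SUP k. fk (1 / real (Suc k)) t (trunc k f) y)"
  by (rule ext) (rule P_SUP_trunc[OF assms(2,3)])
 then show ?thesis by (rule arg_cong)
qed
also have "... = (SUP k. fk (1 / real (Suc k)) s (fk (1 / real (Suc k)) t (trunc k f)) x)"
 by (intro P_SUP assms incseq_fk_trunc fk_measurable_trunc) (use assms in auto)
also have "... = (SUP k. fk (1 / real (Suc k)) (s + t) (trunc k f) x)"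
 by (intro SUP_cong refl fk_semigroup_trunc) (use assms in auto)
also have "... = P (s + t) f x" using assms by (subst P_SUP_trunc) auto
finally show ?thesis ..
qed

lemma P_symmetric:
assumes "t > 0" and [measurable]: "a \<in> bm" "b \<in> bm"
shows "(NN x. a x * P t b x) = (NN x. P t a x * b x)"
proof -
have *: "(NN x. a x * P t b x) = (SUP k. \<integral>\<^sup>+x. trunc k a x * fk (1 / real (Suc k)) t (trunc k b) x \<partial>lborel)"
 if [measurable]: "a \<in> bm" "b \<in> bm" for a b
proof -
 have [measurable]: "fk (1 / real (Suc k)) t (trunc k b) \<in> bm" for k
  by (rule fk_measurable_bounded[where c = "real k"]) (use assms trunc_le' in auto)
 have "(NN x. a x * P t b x) = (NN x. (SUP k. trunc k a x * fk (1 / real (Suc k)) t (trunc k b) x))"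
  by (intro nn_integral_cong, subst P_SUP_trunc[OF assms(1)])
   (auto simp: SUP_mult_incseq_ennreal[symmetric] incseq_trunc incseq_fk_trunc SUP_trunc simp del: of_nat_Suc)
 also have "... = (SUP k. \<integral>\<^sup>+x. trunc k a x * fk (1 / real (Suc k)) t (trunc k b) x \<partial>lborel)"
 proof (rule nn_integral_monotone_convergence_SUP)
  show "incseq (%k x. trunc k a x * fk (1 / real (Suc k)) t (trunc k b) x)"
  using incseq_trunc[of a] incseq_fk_trunc[of t b] unfolding incseq_def le_fun_def
  by (auto intro!: mult_mono simp del: of_nat_Suc)
 qed measurable
 finally show ?thesis .
qed
have "(NN x. a x * P t b x) = (NN x. b x * P t a x)"
 unfolding *[OF assms(2,3)] *[OF assms(3,2)]
proof (intro SUP_cong refl)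
 fix k
 have "(NN x. trunc k a x * fk (1 / real (Suc k)) t (trunc k b) x) = (NN x. fk (1 / real (Suc k)) t (trunc k a) x * trunc k b x)"
  by (rule fk_symmetric[where c = "real k"]) (use assms trunc_le' nn_integral_trunc_finite in auto)
 then show "(NN x. trunc k a x * fk (1 / real (Suc k)) t (trunc k b) x) = (NN x. trunc k b x * fk (1 / real (Suc k)) t (trunc k a) x)"
  by (simp add: mult_ac)
qed
then show ?thesis by (simp add: mult_ac)
qed

lemma surv0_measurable:
assumes "t > 0"
shows "(%om. surv0 V 0 t (%s. W x s om)) \<in> borel_measurable (M x)"
proof -
have "(%om. SUP k. surv V (1 / real (Suc k)) 0 t (%s. W x s om)) \<in> borel_measurable (M x)"
 by (intro borel_measurable_SUP surv_measurable) (use assms in auto)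
then show ?thesis
 by (rule measurable_cong[THEN iffD1, rotated]) (intro SUP_surv W_continuous, auto)
qed

lemma surv0_le_1: "surv0 V a b w <= 1"
proof (cases "\<forall>s\<in>{a..b}. w s ~= 0")
case True
have "0 <= (LINT s:{a..b}|lborel. V (w s))"
 unfolding set_lebesgue_integral_def
 using True by (intro integral_nonneg_AE AE_I2) (auto intro!: V_nonneg split: split_indicator)
then show ?thesis using True by (simp add: surv0_def)
qed (auto simp: surv0_def)

lemma P_mono: "(!!y. f y <= g y) ==> P t f x <= P t g x"
unfolding P_def by (intro nn_integral_mono mult_left_mono) auto

lemma P_le_heat:
assumes "t > 0" "f \<in> bm"
shows "P t f x <= heat t f x"
unfolding P_def brownian_marginal[OF bf assms, symmetric]
by (intro nn_integral_mono order_trans[OF mult_right_mono[OF surv0_le_1]]) auto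

lemma P_add:
assumes "t > 0" and [measurable]: "f \<in> bm" "g \<in> bm"
shows "P t (%y. f y + g y) x = P t f x + P t g x"
proof -
have [measurable]: "W x t \<in> borel_measurable (M x)" using assms W_measurable by auto
note surv0_measurable[OF assms(1), measurable]
show ?thesis unfolding P_def by (subst nn_integral_add[symmetric]) (auto simp: distrib_left)
qed

lemma P_cmult:
assumes "t > 0" and [measurable]: "f \<in> bm"
shows "P t (%y. c * f y) x = c * P t f x"
proof -
have [measurable]: "W x t \<in> borel_measurable (M x)" using assms W_measurable by auto
note surv0_measurable[OF assms(1), measurable]
show ?thesis unfolding P_def by (subst nn_integral_cmult[symmetric]) (auto simp: mult_ac)
qed

lemma P_const_le: "t > 0 ==> P t (%_. c) x <= c"
using P_le_heat[of t "%_. c" x] by simp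

lemma fk_le_P: 
assumes "ep > 0"
shows "fk ep t f x <= P t f x"
unfolding fk_def P_def surv_def surv0_def using assms by (intro nn_integral_mono mult_mono) auto

end

section \<open>One small time step on radial functions\<close>

lemma taylor2_uniform:
fixes F F1 F2 :: "real => real"
assumes dF: "!!y. y > 0 ==> DERIV F y :> F1 y"
 and dF1: "!!y. y > 0 ==> DERIV F1 y :> F2 y"
 and c: "continuous_on {0<..} F2" and al: "0 < al" and om: "om > 0"
obtains rh where "0 < rh" "!!y et. al <= y ==> y <= be ==> \<bar>et\<bar> < rh ==>
 F (y + et) <= F y + F1 y * et + F2 y / 2 * et^2 + om * et^2"
proof -
have "uniformly_continuous_on {al / 2..be + 1} F2"
 using al by (intro compact_uniformly_continuous continuous_on_subset[OF c]) auto
then obtain d where d: "d > 0" "!!u v. u \<in> {al / 2..be + 1} ==> v \<in> {al / 2..be + 1} ==> dist u v < d ==> dist (F2 u) (F2 v) < om"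
 using om unfolding uniformly_continuous_on_def by metis
define rh where "rh = min d (min (al / 2) 1)"
have rh: "rh > 0" "rh <= d" "rh <= al / 2" "rh <= 1" using d al by (auto simp: rh_def)
show thesis
proof (rule that[OF rh(1)])
 fix y et assume y: "al <= y" "y <= be" "\<bar>et\<bar> < rh"
 show "F (y + et) <= F y + F1 y * et + F2 y / 2 * et^2 + om * et^2"
 proof (cases "et = 0")
  case False
  define D where "D m = (if m = 0 then F else if m = 1 then F1 else F2)" for m :: nat
  have "EX s. (if y + et < y then y + et < s & s < y else y < s & s < y + et) &
   F (y + et) = (\<Sum>m<2. D m y / fact m * (y + et - y) ^ m) + D 2 s / fact 2 * (y + et - y) ^ 2"
  proof (rule Taylor[where a = "min y (y + et)" and b = "max y (y + et)"])
  show "ALL m t. m < 2 & min y (y + et) <= t & t <= max y (y + et) --> (D m has_real_derivative D (Suc m) t) (at t)"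
  proof (intro allI impI)
   fix m :: nat and t assume mt: "m < 2 & min y (y + et) <= t & t <= max y (y + et)"
   then have "t > 0" using y rh al by (auto simp: min_def split: if_splits)
   moreover have "m = 0 | m = 1" using mt by auto
   ultimately show "(D m has_real_derivative D (Suc m) t) (at t)" using dF dF1 by (auto simp: D_def)
  qed
  qed (use False in \<open>auto simp: D_def\<close>)
  then obtain s where s: "(if et < 0 then y + et < s & s < y else y < s & s < y + et)"
  "F (y + et) = F y + F1 y * et + F2 s / 2 * et^2"
  by (auto simp: D_def eval_nat_numeral split: if_splits)
  have "s \<in> {al / 2..be + 1}" "y \<in> {al / 2..be + 1}" "dist s y < d"
  using s(1) y rh al by (auto simp: dist_real_def split: if_splits)
  then have "\<bar>F2 s - F2 y\<bar> < om" using d(2) by (metis dist_real_def)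
  then have "F2 s / 2 * et^2 <= (F2 y / 2 + om) * et^2" using om by (intro mult_right_mono) auto
  then show ?thesis using s(2) by (simp add: algebra_simps)
 qed simp
qed
qed

lemma integral_gauss_shift:
fixes u :: "real^'n => real"
assumes [measurable]: "u \<in> bm"
shows "(LINT z|lborel. gauss_q t x z * u z) = (LINT z|lborel. gauss_q t 0 z * u (x + z))"
proof -
have "(LINT z|lborel. gauss_q t x z * u z) = (LINT z|distr lborel borel ((+) x). gauss_q t x z * u z)"
 by (simp only: lborel_distr_plus)
also have "... = (LINT z|lborel. gauss_q t x (x + z) * u (x + z))"
 by (subst integral_distr) auto
also have "... = (LINT z|lborel. gauss_q t 0 z * u (x + z))" by (simp add: gauss_q_def)
finally show ?thesis .
qed

text \<open>The Euler step of the heat semigroup on a function that is locally dominated by a radial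
\<open>C^2\<close> profile \<open>F\<close> of \<open>(abs z)^2\<close>: the Laplacian of the profile is \<open>4yF'' + 2dF'\<close> at \<open>y = (abs x)^2\<close>.\<close>
lemma gauss_step_upper:
fixes F F1 F2 :: "real => real"
assumes dF: "!!y. y > 0 ==> DERIV F y :> F1 y"
 and dF1: "!!y. y > 0 ==> DERIV F1 y :> F2 y"
 and c: "continuous_on {0<..} F2" and al: "0 < al" and R: "R > 0" and b: "b >= 0" and B: "B >= 0" and e: "e > 0"
shows "\<exists>dt0>0. \<forall>dt (x::real^'n) u. 0 < dt & dt < dt0 & al <= (norm x)^2 & (norm x)^2 <= be & u \<in> bm
  & (ALL z. \<bar>u z\<bar> <= B * exp (b * norm z)) & (ALL z. norm (z - x) < R --> u z <= F ((norm z)^2))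
 --> (LINT z|lborel. gauss_q dt x z * u z)
  <= F ((norm x)^2) + dt * (4 * (norm x)^2 * F2 ((norm x)^2) + 2 * real CARD('n) * F1 ((norm x)^2)) + e * dt"
proof (cases "al <= be")
case False
then show ?thesis by (intro exI[of _ 1]) auto
next
case ab: True
define d where "d = real CARD('n)"
have d: "d > 0" by (simp add: d_def)
have be: "be > 0" using ab al by simp
define s where "s = sqrt be"
have s: "s > 0" using be by (simp add: s_def)
have Fc: "continuous_on {al..be} F" "continuous_on {al..be} F1" "continuous_on {al..be} F2"
proof -
 show "continuous_on {al..be} F"
  by (rule DERIV_continuous_on[of _ _ F1], rule has_field_derivative_at_within, rule dF) (use al in auto)
 show "continuous_on {al..be} F1"
  by (rule DERIV_continuous_on[of _ _ F2], rule has_field_derivative_at_within, rule dF1) (use al in auto)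
 show "continuous_on {al..be} F2" by (rule continuous_on_subset[OF c]) (use al in auto)
qed
have "EX K. \<forall>y\<in>{al..be}. \<bar>G y\<bar> <= K" if "continuous_on {al..be} G" for G :: "real => real"
proof -
 have "bounded (G ` {al..be})" using that by (intro compact_imp_bounded compact_continuous_image) auto
 then show ?thesis unfolding bounded_iff by auto
qed
then obtain K0 K1 K2 where K012: "\<forall>y\<in>{al..be}. \<bar>F y\<bar> <= K0" "\<forall>y\<in>{al..be}. \<bar>F1 y\<bar> <= K1" "\<forall>y\<in>{al..be}. \<bar>F2 y\<bar> <= K2"
 using Fc by metis
define K where "K = (abs K0) + (abs K1) + (abs K2) + 1"
have K: "K > 0" "!!y. y \<in> {al..be} ==> \<bar>F y\<bar> <= K & \<bar>F1 y\<bar> <= K & \<bar>F2 y\<bar> <= K"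
 using K012 unfolding K_def by (fastforce, fastforce)
\<comment> \<open>For \<open>|z| <= 1\<close> the increment of \<open>|x|^2\<close> is at most
  \<open>S |z|\<close> in absolute value. The constants \<open>om\<close> and \<open>R0\<close>
  below are set so that the Taylor remainder and the mixed term of second order each cost at most a
  quarter of \<open>e\<close>, and \<open>L\<close> is so large that the quartic term covers all
  \<open>z\<close> with \<open>|z| >= R0\<close>.\<close>
define S where "S = 2 * s + 1"
have S: "S > 1" using s by (simp add: S_def)
define om where "om = e / (8 * d * S^2)"
have om: "om > 0" using e d S by (simp add: om_def)
obtain rh where rh: "0 < rh" "!!y et. al <= y ==> y <= be ==> \<bar>et\<bar> < rh ==>
 F (y + et) <= F y + F1 y * et + F2 y / 2 * et^2 + om * et^2"
 using taylor2_uniform[OF dF dF1 c al om, of be] by blast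
define R0 where "R0 = min (min R 1) (min (rh / S) (e / (8 * d * K * S)))"
have R0: "R0 > 0" "R0 <= R" "R0 <= 1" "R0 <= rh / S" "R0 <= e / (8 * d * K * S)"
 using R rh(1) S e d K(1) by (auto simp: R0_def)
define L where "L = (B * exp (b * s) + K * (3 + 2 * s + 4 * be)) / R0 ^ 4"
have L: "L >= 0" using B K s be R0 by (simp add: L_def)
obtain C where C: "C >= 0" "!!t. 0 < t ==> t <= 1 ==>
 integral\<^sup>L lborel (%z::real^'n. gauss_q t 0 z * ((norm z) ^ 4 * exp ((b + 1) * norm z))) <= C * t^2"
 by (rule gauss_fourth_moment[of "b + 1", where 'n='n]) (use b in auto)
define dt0 where "dt0 = min 1 (e / (2 * (L * C + 1)))"
have dt0: "dt0 > 0" "dt0 <= 1" "L * C * dt0 <= e / 2"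
proof -
 show "dt0 > 0" using e L C by (simp add: dt0_def add_nonneg_pos)
 show "dt0 <= 1" by (simp add: dt0_def)
 have LC: "L * C >= 0" using L C by simp
 have "L * C * dt0 <= (L * C + 1) * (e / (2 * (L * C + 1)))"
  using LC e by (intro mult_mono) (auto simp: dt0_def)
 also have "... = e / 2" using LC by (simp add: field_simps)
 finally show "L * C * dt0 <= e / 2" .
qed
show ?thesis
proof (intro exI[of _ dt0] conjI allI impI dt0(1))
 fix dt and x :: "real^'n" and u :: "real^'n => real"
 assume H: "0 < dt & dt < dt0 & al <= (norm x)^2 & (norm x)^2 <= be & u \<in> bm
  & (ALL z. \<bar>u z\<bar> <= B * exp (b * norm z)) & (ALL z. norm (z - x) < R --> u z <= F ((norm z)^2))"
 define y where "y = (norm x)^2"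
 have dt: "0 < dt" "dt < dt0" and y: "al <= y" "y <= be" and um [measurable]: "u \<in> bm"
  and ub: "!!z. \<bar>u z\<bar> <= B * exp (b * norm z)" and uF: "!!z. norm (z - x) < R ==> u z <= F ((norm z)^2)"
  using H by (auto simp: y_def)
 have xs: "norm x <= s" using y unfolding y_def s_def by (metis norm_ge_zero real_le_rsqrt)
 have Ky: "\<bar>F y\<bar> <= K" "\<bar>F1 y\<bar> <= K" "\<bar>F2 y\<bar> <= K" using K(2)[of y] y by auto
 define poly where "poly z = F y + F1 y * (2 * (x \<bullet> z) + (norm z)^2) + 2 * F2 y * (x \<bullet> z)^2" for z
 define om' where "om' = om * S^2 + K * S * R0"
 have xz: "\<bar>x \<bullet> z\<bar> <= s * norm z" for z
  using Cauchy_Schwarz_ineq2[of x z] mult_right_mono[OF xs, of "norm z"] by simp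
 \<comment> \<open>Pointwise majorant: the second-order polynomial, a small multiple of
   \<open>|z|^2\<close>, and a quartic tail. The Gaussian moments give exactly the generator from
   the first, \<open>O(e dt)\<close> from the second and \<open>O(dt^2)\<close> from the
   third.\<close>
 have main: "u (x + z) <= poly z + om' * (norm z)^2 + L * ((norm z) ^ 4 * exp ((b + 1) * norm z))" for z
 proof (cases "norm z < R0")
  case True
  define et where "et = 2 * (x \<bullet> z) + (norm z)^2"
  have z1: "norm z <= 1" using True R0 by simp
  have "\<bar>et\<bar> <= 2 * \<bar>x \<bullet> z\<bar> + (norm z)^2" unfolding et_def by (simp add: abs_triangle_ineq order_trans[OF abs_triangle_ineq] abs_mult)
  also have "... <= 2 * (s * norm z) + norm z * 1"
  unfolding power2_eq_square using xz[of z] z1 by (intro add_mono mult_left_mono) auto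
  finally have etS: "\<bar>et\<bar> <= S * norm z" by (simp add: S_def algebra_simps)
  also have "... < S * (rh / S)" using True R0 S by (intro mult_strict_left_mono) auto
  finally have etrh: "\<bar>et\<bar> < rh" using S by simp
  have ny: "(norm (x + z))^2 = y + et"
  unfolding y_def et_def power2_norm_eq_inner by (simp add: inner_simps inner_commute)
  have "u (x + z) <= F ((norm (x + z))^2)" using True R0 by (intro uF) auto
  also have "... <= F y + F1 y * et + F2 y / 2 * et^2 + om * et^2"
  unfolding ny by (rule rh(2)[OF y etrh])
  also have "om * et^2 <= om * S^2 * (norm z)^2"
  proof -
  have "et^2 <= (S * norm z)^2" using etS by (metis abs_ge_zero power2_abs power_mono)
  then show ?thesis using om by (simp add: power_mult_distrib mult.assoc)
  qed
  also have "F2 y / 2 * et^2 <= 2 * F2 y * (x \<bullet> z)^2 + K * S * R0 * (norm z)^2"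
  proof -
  have "F2 y / 2 * et^2 = 2 * F2 y * (x \<bullet> z)^2 + F2 y * ((2 * (x \<bullet> z) + (norm z)^2 / 2) * (norm z)^2)"
   unfolding et_def by (simp add: power2_eq_square algebra_simps)
  also have "F2 y * ((2 * (x \<bullet> z) + (norm z)^2 / 2) * (norm z)^2) <= K * ((S * R0) * (norm z)^2)"
  proof -
   have "\<bar>2 * (x \<bullet> z) + (norm z)^2 / 2\<bar> <= 2 * (s * norm z) + norm z * 1"
   proof -
    have "\<bar>2 * (x \<bullet> z) + (norm z)^2 / 2\<bar> <= 2 * \<bar>x \<bullet> z\<bar> + (norm z)^2 / 2"
    by (rule order_trans[OF abs_triangle_ineq]) (simp add: abs_mult)
    also have "(norm z)^2 / 2 <= norm z * 1"
    proof -
    have "(norm z)^2 <= norm z" using mult_left_mono[OF z1, of "norm z"] by (simp add: power2_eq_square)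
    moreover have "0 <= norm z" by simp
    ultimately show ?thesis by linarith
    qed
    finally show ?thesis using xz[of z] by simp
   qed
   also have "... = S * norm z" by (simp add: S_def algebra_simps)
   also have "... <= S * R0" using True S by simp
   finally have "\<bar>(2 * (x \<bullet> z) + (norm z)^2 / 2) * (norm z)^2\<bar> <= (S * R0) * (norm z)^2"
    by (simp add: abs_mult mult_right_mono)
   with Ky(3) have "\<bar>F2 y * ((2 * (x \<bullet> z) + (norm z)^2 / 2) * (norm z)^2)\<bar> <= K * ((S * R0) * (norm z)^2)"
    unfolding abs_mult[of "F2 y"] using K(1) by (intro mult_mono) auto
   then show ?thesis by linarith
  qed
  finally show ?thesis by (simp add: mult.assoc)
  qed
  finally have "u (x + z) <= poly z + om' * (norm z)^2"
  unfolding poly_def et_def om'_def by (simp add: algebra_simps)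
  then show ?thesis using L by (simp add: add_increasing2)
 next
  case False
  have p1: "u (x + z) <= B * exp (b * s) * exp ((b + 1) * norm z)"
  proof -
  have "u (x + z) <= B * exp (b * norm (x + z))" using ub[of "x + z"] by simp
  also have "... <= B * exp (b * s + (b + 1) * norm z)"
  proof -
   have "b * norm (x + z) <= b * (s + norm z)"
    using norm_triangle_ineq[of x z] xs b by (intro mult_left_mono) auto
   moreover have "b * (s + norm z) = b * s + b * norm z" "(b + 1) * norm z = b * norm z + norm z" "0 <= norm z"
    by (simp_all add: algebra_simps)
   ultimately have "b * norm (x + z) <= b * s + (b + 1) * norm z" by linarith
   then show ?thesis using B by (intro mult_left_mono) auto
  qed
  finally show ?thesis by (simp add: exp_add mult_ac)
  qed
  have E: "1 <= exp (norm z)" "norm z <= exp (norm z)" "(norm z)^2 <= 2 * exp (norm z)"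
  using power_exp_bound[of "norm z" 2] power_exp_bound[of "norm z" 1] by auto
  have "- poly z <= K + K * (2 * (s * norm z) + (norm z)^2) + 2 * K * (s * norm z)^2"
  proof -
  have "x \<bullet> z <= s * norm z" "- (x \<bullet> z) <= s * norm z" using xz[of z] by auto
  then have "\<bar>2 * (x \<bullet> z) + (norm z)^2\<bar> <= 2 * (s * norm z) + (norm z)^2"
   using zero_le_power2[of "norm z"] by (intro abs_leI) linarith+
  then have "\<bar>F1 y * (2 * (x \<bullet> z) + (norm z)^2)\<bar> <= K * (2 * (s * norm z) + (norm z)^2)"
   unfolding abs_mult[of "F1 y"] using K(1) Ky by (intro mult_mono) auto
  moreover have "\<bar>2 * F2 y * (x \<bullet> z)^2\<bar> <= 2 * K * (s * norm z)^2"
  proof -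
   have "(x \<bullet> z)^2 <= (s * norm z)^2" using xz[of z] by (metis abs_ge_zero power2_abs power_mono)
   then show ?thesis unfolding abs_mult using K(1) Ky by (intro mult_mono) auto
  qed
  ultimately show ?thesis using Ky(1) unfolding poly_def by linarith
  qed
  also have "... = K * (1 + 2 * s * norm z + (1 + 2 * be) * (norm z)^2)"
  using be unfolding s_def by (simp add: algebra_simps power_mult_distrib)
  also have "... <= K * ((3 + 2 * s + 4 * be) * exp (norm z))"
  proof -
  have "1 + 2 * s * norm z + (1 + 2 * be) * (norm z)^2 <= exp (norm z) + 2 * s * exp (norm z) + (1 + 2 * be) * (2 * exp (norm z))"
   using E s be by (intro add_mono mult_left_mono) auto
  also have "... = (3 + 2 * s + 4 * be) * exp (norm z)" by (simp add: algebra_simps)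
  finally show ?thesis using K(1) by (intro mult_left_mono) auto
  qed
  also have "... <= K * (3 + 2 * s + 4 * be) * exp ((b + 1) * norm z)"
  proof -
  have "norm z <= (b + 1) * norm z" using b by (simp add: distrib_right)
  then show ?thesis unfolding mult.assoc using K(1) s be by (intro mult_left_mono) auto
  qed
  finally have "- poly z <= K * (3 + 2 * s + 4 * be) * exp ((b + 1) * norm z)" .
  then have "u (x + z) - poly z <= (B * exp (b * s) + K * (3 + 2 * s + 4 * be)) * exp ((b + 1) * norm z)"
  unfolding distrib_right[of _ _ "exp _"] using p1 by linarith
  also have "... = L * (R0 ^ 4 * exp ((b + 1) * norm z))" using R0 by (simp add: L_def)
  also have "... <= L * ((norm z) ^ 4 * exp ((b + 1) * norm z))"
  using False L R0 by (intro mult_left_mono mult_right_mono power_mono) auto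
  finally have "u (x + z) <= poly z + L * ((norm z) ^ 4 * exp ((b + 1) * norm z))" by simp
  moreover have "om' * (norm z)^2 >= 0" using om K S R0 by (simp add: om'_def)
  ultimately show ?thesis by simp
 qed
 note mom = gauss_moments[OF dt(1)]
 have i4: "integrable lborel (%z::real^'n. gauss_q dt 0 z * ((norm z) ^ 4 * exp ((b + 1) * norm z)))"
 proof (rule integrable_gauss_dominated[where c = "b + 2" and B = 24, OF dt(1)])
  fix z :: "real^'n"
  have "(norm z) ^ 4 * exp ((b + 1) * norm z) <= 24 * exp (norm z) * exp ((b + 1) * norm z)"
  using power_exp_bound[of "norm z" 4] by (intro mult_right_mono) (auto simp: fact_numeral)
  also have "... = 24 * exp ((b + 2) * norm z)" by (simp add: algebra_simps flip: exp_add)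
  finally show "\<bar>(norm z) ^ 4 * exp ((b + 1) * norm z)\<bar> <= 24 * exp ((b + 2) * norm z)" by simp
 qed (use b in auto)
 define I4 where "I4 = integral\<^sup>L lborel (%z::real^'n. gauss_q dt 0 z * ((norm z) ^ 4 * exp ((b + 1) * norm z)))"
 have hi4: "has_bochner_integral lborel (%z::real^'n. gauss_q dt 0 z * ((norm z) ^ 4 * exp ((b + 1) * norm z))) I4"
  using i4 by (simp add: has_bochner_integral_iff I4_def)
 have "has_bochner_integral lborel (%z. F y * gauss_q dt 0 z + (2 * F1 y) * (gauss_q dt 0 z * (x \<bullet> z))
  + (F1 y + om') * (gauss_q dt 0 z * (norm z)^2) + (2 * F2 y) * (gauss_q dt 0 z * (x \<bullet> z)^2)
  + L * (gauss_q dt 0 z * ((norm z) ^ 4 * exp ((b + 1) * norm z))))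
  (F y * 1 + (2 * F1 y) * 0 + (F1 y + om') * (2 * dt * real CARD('n)) + (2 * F2 y) * (2 * dt * (norm x)^2) + L * I4)"
  by (intro has_bochner_integral_add has_bochner_integral_mult_right mom hi4)
 moreover have "(%z. F y * gauss_q dt 0 z + (2 * F1 y) * (gauss_q dt 0 z * (x \<bullet> z))
  + (F1 y + om') * (gauss_q dt 0 z * (norm z)^2) + (2 * F2 y) * (gauss_q dt 0 z * (x \<bullet> z)^2)
  + L * (gauss_q dt 0 z * ((norm z) ^ 4 * exp ((b + 1) * norm z))))
  = (%z. gauss_q dt 0 z * (poly z + om' * (norm z)^2 + L * ((norm z) ^ 4 * exp ((b + 1) * norm z))))"
  unfolding poly_def by (auto simp: fun_eq_iff algebra_simps)
 ultimately have hb: "has_bochner_integral lborel (%z. gauss_q dt 0 z * (poly z + om' * (norm z)^2 + L * ((norm z) ^ 4 * exp ((b + 1) * norm z))))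
  (F y + (F1 y + om') * (2 * dt * d) + (2 * F2 y) * (2 * dt * y) + L * I4)"
  by (simp add: d_def y_def)
 have "(LINT z|lborel. gauss_q dt x z * u z) = (LINT z|lborel. gauss_q dt 0 z * u (x + z))"
  by (rule integral_gauss_shift) measurable
 also have "... <= (LINT z|lborel. gauss_q dt 0 z * (poly z + om' * (norm z)^2 + L * ((norm z) ^ 4 * exp ((b + 1) * norm z))))"
 proof (rule integral_mono)
  show "integrable lborel (%z. gauss_q dt 0 z * u (x + z))"
  proof (rule integrable_gauss_dominated[where c = b and B = "B * exp (b * norm x)", OF dt(1)])
  fix z
  have "\<bar>u (x + z)\<bar> <= B * exp (b * norm (x + z))" by (rule ub)
  also have "... <= B * exp (b * norm x + b * norm z)"
   using norm_triangle_ineq[of x z] b B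
   by (intro mult_left_mono) (auto simp: distrib_left[symmetric] intro!: mult_left_mono)
  finally show "\<bar>u (x + z)\<bar> <= B * exp (b * norm x) * exp (b * norm z)" by (simp add: exp_add mult_ac)
  qed (use b in auto)
  show "integrable lborel (%z. gauss_q dt 0 z * (poly z + om' * (norm z)^2 + L * ((norm z) ^ 4 * exp ((b + 1) * norm z))))"
  using hb by (simp add: has_bochner_integral_iff)
 qed (intro mult_left_mono main, simp)
 also have "... = F y + (F1 y + om') * (2 * dt * d) + (2 * F2 y) * (2 * dt * y) + L * I4"
  using hb by (simp add: has_bochner_integral_iff)
 also have "... <= F y + dt * (4 * y * F2 y + 2 * d * F1 y) + e * dt"
 proof -
  have "om' * (2 * d) <= e / 2"
  proof -
  have "om * S^2 * (2 * d) = e / 4" using S d by (simp add: om_def field_simps)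
  moreover have "K * S * R0 * (2 * d) <= K * S * (e / (8 * d * K * S)) * (2 * d)"
   using R0 K S d by (intro mult_right_mono mult_left_mono) auto
  moreover have "K * S * (e / (8 * d * K * S)) * (2 * d) = e / 4" using K S d by (simp add: field_simps)
  ultimately show ?thesis unfolding om'_def by (simp add: distrib_right)
  qed
  then have "om' * (2 * dt * d) <= e / 2 * dt"
  using mult_right_mono[of "om' * (2 * d)" "e / 2" dt] dt by (simp add: mult_ac)
  moreover have "L * I4 <= e / 2 * dt"
  proof -
  have "L * I4 <= L * (C * dt^2)" using C(2)[of dt] dt dt0 L unfolding I4_def by (intro mult_left_mono) auto
  also have "... = (L * C * dt) * dt" by (simp add: power2_eq_square)
  also have "... <= (L * C * dt0) * dt" using dt L C by (intro mult_right_mono mult_left_mono) auto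
  also have "... <= e / 2 * dt" using dt0 dt by (intro mult_right_mono) auto
  finally show ?thesis .
  qed
  ultimately show ?thesis by (simp add: algebra_simps)
 qed
 finally show "(LINT z|lborel. gauss_q dt x z * u z)
  <= F ((norm x)^2) + dt * (4 * (norm x)^2 * F2 ((norm x)^2) + 2 * real CARD('n) * F1 ((norm x)^2)) + e * dt"
  by (simp add: y_def d_def)
qed
qed

lemma heat_eq_integral:
fixes u :: "real^'n => real"
assumes t: "t > 0" and [measurable]: "u \<in> bm" and nn: "!!z. 0 <= u z"
 and b: "b >= 0" and bd: "!!z. \<bar>u z\<bar> <= B * exp (b * norm z)"
shows "heat t (%z. en (u z)) x = en (LINT z|lborel. gauss_q t x z * u z)"
 and "integrable lborel (%z. gauss_q t x z * u z)"
proof -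
have B: "B >= 0" using bd[of 0] nn[of 0] by simp
have i: "integrable lborel (%z. gauss_q t 0 z * u (x + z))"
proof (rule integrable_gauss_dominated[where c = b and B = "B * exp (b * norm x)", OF t])
 fix z
 have "\<bar>u (x + z)\<bar> <= B * exp (b * norm (x + z))" by (rule bd)
 also have "... <= B * exp (b * norm x + b * norm z)"
  using norm_triangle_ineq[of x z] b B
  by (intro mult_left_mono) (auto simp: distrib_left[symmetric] intro!: mult_left_mono)
 finally show "\<bar>u (x + z)\<bar> <= B * exp (b * norm x) * exp (b * norm z)" by (simp add: exp_add mult_ac)
qed (use b in auto)
have "heat t (%z. en (u z)) x = (NN z. en (gauss_q t 0 z) * en (u (x + z)))"
 by (rule heat_shift[symmetric]) measurable
also have "... = (NN z. en (gauss_q t 0 z * u (x + z)))"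
 by (simp add: ennreal_mult nn)
also have "... = en (LINT z|lborel. gauss_q t 0 z * u (x + z))"
 using i nn by (intro nn_integral_eq_integral) auto
also have "(LINT z|lborel. gauss_q t 0 z * u (x + z)) = (LINT z|lborel. gauss_q t x z * u z)"
 by (rule integral_gauss_shift[symmetric]) measurable
finally show 1: "heat t (%z. en (u z)) x = en (LINT z|lborel. gauss_q t x z * u z)" .
have "(NN z. en (gauss_q t x z * u z)) = heat t (%z. en (u z)) x"
 unfolding heat_def by (simp add: ennreal_mult nn)
then show "integrable lborel (%z. gauss_q t x z * u z)"
 using nn 1 by (intro integrableI_nonneg) auto
qed

text \<open>The inequality \<open>exp (-s) (1 + s) <= 1\<close> turns the differential inequality
  into a one-step inequality with error \<open>e * dt\<close>. Only domination of \<open>u\<close>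
  by \<open>F\<close> near \<open>x\<close> enters, besides a global exponential bound, so that
  glued functions can be treated chart by chart; \<open>dt0\<close> is uniform over the annulus and
  over all such \<open>u\<close>.\<close>

lemma step_super:
fixes F F1 F2 :: "real => real" and V :: "real^'n => real"
assumes dF: "!!y. y > 0 ==> DERIV F y :> F1 y"
 and dF1: "!!y. y > 0 ==> DERIV F1 y :> F2 y"
 and c: "continuous_on {0<..} F2" and al: "0 < al" and R: "R > 0" and b: "b >= 0" and B: "B >= 0" and e: "e > 0"
 and V: "!!x. al <= (norm x)^2 ==> (norm x)^2 <= be ==> 0 <= V x &
  4 * (norm x)^2 * F2 ((norm x)^2) + 2 * real CARD('n) * F1 ((norm x)^2) <= V x * F ((norm x)^2)"
 and F: "!!y. al <= y ==> y <= be ==> 0 <= F y"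
shows "\<exists>dt0>0. \<forall>dt (x::real^'n) u. 0 < dt & dt < dt0 & al <= (norm x)^2 & (norm x)^2 <= be & u \<in> bm
  & (ALL z. 0 <= u z & u z <= B * exp (b * norm z)) & (ALL z. norm (z - x) < R --> u z <= F ((norm z)^2))
 --> en (exp (- dt * V x)) * heat dt (%z. en (u z)) x <= en (F ((norm x)^2) + e * dt)"
proof -
obtain dt0 where dt0: "dt0 > 0" and st: "!!dt (x::real^'n) u. 0 < dt & dt < dt0 & al <= (norm x)^2 & (norm x)^2 <= be & u \<in> bm
  & (ALL z. \<bar>u z\<bar> <= B * exp (b * norm z)) & (ALL z. norm (z - x) < R --> u z <= F ((norm z)^2))
 ==> (LINT z|lborel. gauss_q dt x z * u z)
  <= F ((norm x)^2) + dt * (4 * (norm x)^2 * F2 ((norm x)^2) + 2 * real CARD('n) * F1 ((norm x)^2)) + e * dt"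
 using gauss_step_upper[OF dF dF1 c al R b B e, of be, where 'n='n] by blast
show ?thesis
proof (intro exI[of _ dt0] conjI allI impI dt0)
 fix dt and x :: "real^'n" and u :: "real^'n => real"
 assume H: "0 < dt & dt < dt0 & al <= (norm x)^2 & (norm x)^2 <= be & u \<in> bm
  & (ALL z. 0 <= u z & u z <= B * exp (b * norm z)) & (ALL z. norm (z - x) < R --> u z <= F ((norm z)^2))"
 define y where "y = (norm x)^2"
 have y: "al <= y" "y <= be" using H by (auto simp: y_def)
 have V0: "0 <= V x" and VF: "4 * y * F2 y + 2 * real CARD('n) * F1 y <= V x * F y"
  using V[of x] H by (auto simp: y_def)
 have F0: "0 <= F y" using F y by auto
 define I where "I = (LINT z|lborel. gauss_q dt x z * u z)"
 have "I <= F y + dt * (4 * y * F2 y + 2 * real CARD('n) * F1 y) + e * dt"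
  unfolding I_def y_def using H by (intro st) auto
 also have "... <= F y + dt * (V x * F y) + e * dt" using VF H e by (intro add_mono mult_left_mono) auto
 finally have I: "I <= F y * (1 + dt * V x) + e * dt" by (simp add: algebra_simps)
 have "exp (- dt * V x) * I <= exp (- dt * V x) * (F y * (1 + dt * V x) + e * dt)"
  by (intro mult_left_mono I) auto
 also have "... = F y * (exp (- dt * V x) * (1 + dt * V x)) + exp (- dt * V x) * (e * dt)" by (simp add: algebra_simps)
 also have "... <= F y * 1 + 1 * (e * dt)"
 proof (intro add_mono mult_left_mono mult_right_mono)
  have "exp (- dt * V x) * (1 + dt * V x) <= exp (- dt * V x) * exp (dt * V x)"
  by (intro mult_left_mono) (auto simp: exp_ge_add_one_self)
  then show "exp (- dt * V x) * (1 + dt * V x) <= 1" by (simp flip: exp_add)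
 qed (use H V0 F0 e in auto)
 finally have "exp (- dt * V x) * I <= F y + e * dt" by simp
 moreover have "heat dt (%z. en (u z)) x = en I"
  unfolding I_def using H b by (intro heat_eq_integral(1)[where b = b and B = B]) auto
 ultimately show "en (exp (- dt * V x)) * heat dt (%z. en (u z)) x <= en (F ((norm x)^2) + e * dt)"
  by (simp add: y_def ennreal_leI flip: ennreal_mult')
qed
qed

text \<open>The mirror image, obtained from \<open>gauss_step_upper\<close> for \<open>-F\<close>.
  Now \<open>exp (-dt V)\<close> has to be expanded from below, which uses a bound \<open>v\<close>
  on the potential. \<open>La\<close> is a permitted exponential loss and \<open>E\<close> a
  permitted additive loss per unit time.\<close>

lemma step_sub:
fixes F F1 F2 :: "real => real" and V :: "real^'n => real"
assumes dF: "!!y. y > 0 ==> DERIV F y :> F1 y"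
 and dF1: "!!y. y > 0 ==> DERIV F1 y :> F2 y"
 and c: "continuous_on {0<..} F2" and al: "0 < al" and R: "R > 0" and B: "B >= 0" and e: "e > 0"
 and La: "La >= 0" and E: "E >= 0"
 and V: "!!x. al <= (norm x)^2 ==> (norm x)^2 <= be ==> 0 <= V x & V x <= v &
  (V x - La) * F ((norm x)^2) - E <= 4 * (norm x)^2 * F2 ((norm x)^2) + 2 * real CARD('n) * F1 ((norm x)^2)"
shows "\<exists>dt0>0. \<forall>dt (x::real^'n) u. 0 < dt & dt < dt0 & al <= (norm x)^2 & (norm x)^2 <= be & u \<in> bm
  & (ALL z. 0 <= u z & u z <= B) & (ALL z. norm (z - x) < R --> F ((norm z)^2) <= u z) & 0 <= F ((norm x)^2) & F ((norm x)^2) <= B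
 --> en (exp (- La * dt) * F ((norm x)^2)) <= en (exp (- dt * V x)) * heat dt (%z. en (u z)) x + en ((E + e) * dt)"
proof -
have e2: "e / 2 > 0" using e by simp
have "\<exists>dt0>0. \<forall>dt (x::real^'n) u. 0 < dt & dt < dt0 & al <= (norm x)^2 & (norm x)^2 <= be & u \<in> bm
  & (ALL z. \<bar>u z\<bar> <= B * exp (0 * norm z)) & (ALL z. norm (z - x) < R --> u z <= - F ((norm z)^2))
 --> (LINT z|lborel. gauss_q dt x z * u z)
  <= - F ((norm x)^2) + dt * (4 * (norm x)^2 * - F2 ((norm x)^2) + 2 * real CARD('n) * - F1 ((norm x)^2)) + e / 2 * dt"
 by (rule gauss_step_upper[of "%y. - F y" "%y. - F1 y" "%y. - F2 y" al R 0 B "e / 2" be])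
  (use al R B e2 in \<open>auto intro!: derivative_intros continuous_intros dF dF1 c\<close>)
then obtain dt1 where dt1: "dt1 > 0" and st: "!!dt (x::real^'n) u. 0 < dt & dt < dt1 & al <= (norm x)^2 & (norm x)^2 <= be & u \<in> bm
  & (ALL z. \<bar>u z\<bar> <= B * exp (0 * norm z)) & (ALL z. norm (z - x) < R --> u z <= - F ((norm z)^2))
 ==> (LINT z|lborel. gauss_q dt x z * u z)
  <= - F ((norm x)^2) + dt * (4 * (norm x)^2 * - F2 ((norm x)^2) + 2 * real CARD('n) * - F1 ((norm x)^2)) + e / 2 * dt"
 by blast
\<comment> \<open>Collects the second-order errors of \<open>1 - dt V <= exp (-dt V)\<close> and of
  the expansion of \<open>exp (-La dt)\<close>, multiplied by the bound \<open>B\<close> on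
  \<open>F\<close>.\<close>
define Q where "Q = B * (v^2 + 2 * La^2) + 1"
have Q: "Q > 0" using B by (simp add: Q_def add_nonneg_pos)
define dt0 where "dt0 = min dt1 (min (1 / (La + 1)) (e / (2 * Q)))"
have dt0: "dt0 > 0" using dt1 La Q e by (simp add: dt0_def)
show ?thesis
proof (intro exI[of _ dt0] conjI allI impI dt0)
 fix dt and x :: "real^'n" and u :: "real^'n => real"
 assume H: "0 < dt & dt < dt0 & al <= (norm x)^2 & (norm x)^2 <= be & u \<in> bm
  & (ALL z. 0 <= u z & u z <= B) & (ALL z. norm (z - x) < R --> F ((norm z)^2) <= u z) & 0 <= F ((norm x)^2) & F ((norm x)^2) <= B"
 define y where "y = (norm x)^2"
 have [measurable]: "u \<in> bm" using H by auto
 have Vx: "0 <= V x" "V x <= v" "(V x - La) * F y - E <= 4 * y * F2 y + 2 * real CARD('n) * F1 y"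
  using V[of x] H by (auto simp: y_def)
 have F0: "0 <= F y" "F y <= B" using H by (auto simp: y_def)
 have dt: "0 < dt" "dt < dt1" "dt * (La + 1) <= 1" "dt * (2 * Q) <= e"
  using H La Q by (auto simp: dt0_def pos_less_divide_eq intro: less_imp_le)
 have dtLa: "0 <= dt * La" "dt * La <= 1" using dt La by (auto simp: algebra_simps)
 define I where "I = (LINT z|lborel. gauss_q dt x z * u z)"
 have "(LINT z|lborel. gauss_q dt x z * (- u z)) <= - F y + dt * (4 * y * - F2 y + 2 * real CARD('n) * - F1 y) + e / 2 * dt"
  unfolding y_def using H dt by (intro st) auto
 then have "- I <= - F y + dt * (4 * y * - F2 y + 2 * real CARD('n) * - F1 y) + e / 2 * dt"
  by (simp add: I_def)
 then have "I >= F y + dt * (4 * y * F2 y + 2 * real CARD('n) * F1 y) - e / 2 * dt"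
  by (simp add: algebra_simps)
 moreover have "dt * (4 * y * F2 y + 2 * real CARD('n) * F1 y) >= dt * ((V x - La) * F y - E)"
  using Vx dt by (intro mult_left_mono) auto
 ultimately have I: "I >= F y * (1 + dt * V x - dt * La) - (E + e / 2) * dt" by (simp add: algebra_simps)
 have "exp (- dt * V x) * (F y * (1 + dt * V x - dt * La) - (E + e / 2) * dt) >= F y * (1 - dt * La - dt\<^sup>2 * v^2) - (E + e / 2) * dt"
 proof -
  have "1 - dt * La - dt\<^sup>2 * v^2 <= (1 - dt * V x) * (1 + dt * V x - dt * La)"
  proof -
  have "(1 - dt * V x) * (1 + dt * V x - dt * La) = 1 - dt * La - dt\<^sup>2 * (V x)^2 + dt^2 * (V x * La)"
   by (simp add: power2_eq_square algebra_simps)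
  moreover have "dt^2 * (V x)^2 <= dt^2 * v^2" using Vx by (intro mult_left_mono power_mono) auto
  moreover have "dt^2 * (V x * La) >= 0" using Vx La by simp
  ultimately show ?thesis by linarith
  qed
  also have "... <= exp (- dt * V x) * (1 + dt * V x - dt * La)"
  proof (rule mult_right_mono)
  show "1 - dt * V x <= exp (- dt * V x)" using exp_ge_add_one_self[of "- dt * V x"] by simp
  have "0 <= dt * V x" using dt Vx by simp
  then show "0 <= 1 + dt * V x - dt * La" using dtLa by simp
  qed
  finally have 1: "F y * (1 - dt * La - dt\<^sup>2 * v^2) <= F y * (exp (- dt * V x) * (1 + dt * V x - dt * La))"
  using F0 by (intro mult_left_mono) auto
  have "exp (- dt * V x) * ((E + e / 2) * dt) <= 1 * ((E + e / 2) * dt)"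
  using dt Vx E e by (intro mult_right_mono) auto
  then show ?thesis using 1 by (simp add: algebra_simps)
 qed
 moreover have "exp (- dt * V x) * I >= exp (- dt * V x) * (F y * (1 + dt * V x - dt * La) - (E + e / 2) * dt)"
  using I by (intro mult_left_mono) auto
 ultimately have X: "exp (- dt * V x) * I >= F y * (1 - dt * La - dt\<^sup>2 * v^2) - (E + e / 2) * dt" by linarith
 have "exp (- La * dt) <= 1 - dt * La + 2 * dt^2 * La^2"
 proof -
  have "exp (- (dt * La)) - 1 - (- (dt * La)) <= (dt * La)^2 * exp \<bar>- (dt * La)\<bar> / 2" using exp_second_order_le[of "- (dt * La)"] by simp
  also have "... <= (dt * La)^2 * exp 1 / 2" using dtLa by (intro divide_right_mono mult_left_mono) auto
  also have "... <= (dt * La)^2 * 4 / 2" using exp_le by (intro divide_right_mono mult_left_mono) auto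
  finally show ?thesis by (simp add: power_mult_distrib mult_ac)
 qed
 then have "exp (- La * dt) * F y <= (1 - dt * La + 2 * dt^2 * La^2) * F y" using F0 by (intro mult_right_mono) auto
 also have "... = F y * (1 - dt * La - dt\<^sup>2 * v^2) + F y * (dt^2 * (v^2 + 2 * La^2))" by (simp add: algebra_simps)
 also have "F y * (dt^2 * (v^2 + 2 * La^2)) <= e / 2 * dt"
 proof -
  have "F y * (dt^2 * (v^2 + 2 * La^2)) <= B * (dt^2 * (v^2 + 2 * La^2))" using F0 by (intro mult_right_mono) auto
  also have "... <= Q * dt * dt" unfolding Q_def using dt by (simp add: power2_eq_square algebra_simps)
  also have "... <= e / 2 * dt" using dt by (intro mult_right_mono) (auto simp: mult_ac)
  finally show ?thesis .
 qed
 finally have "exp (- La * dt) * F y <= exp (- dt * V x) * I + (E + e) * dt"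
  using X by (simp add: algebra_simps)
 moreover have "heat dt (%z. en (u z)) x = en I"
  unfolding I_def using H by (intro heat_eq_integral(1)[where b = 0 and B = B]) auto
 moreover have "I >= 0" unfolding I_def using H by (intro integral_nonneg_AE) auto
 ultimately show "en (exp (- La * dt) * F ((norm x)^2)) <= en (exp (- dt * V x)) * heat dt (%z. en (u z)) x + en ((E + e) * dt)"
  using E e dt by (simp add: y_def ennreal_leI flip: ennreal_mult' ennreal_plus)
qed
qed

section \<open>Comparison: monotonicity in the potential, supersolutions and subsolutions\<close>

lemma surv0_antimono:
fixes V1 V2 :: "real^'n => real"
assumes "continuous_on {y. y ~= 0} V1" "continuous_on {y. y ~= 0} V2" "!!y. y ~= 0 ==> V1 y <= V2 y" "continuous_on {a..b} w"
shows "surv0 V2 a b w <= surv0 V1 a b w"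
proof (cases "\<forall>s\<in>{a..b}. w s ~= 0")
case True
have "(LINT s:{a..b}|lborel. V1 (w s)) <= (LINT s:{a..b}|lborel. V2 (w s))"
 using True assms by (intro set_integral_mono LINT_potential_path) auto
then show ?thesis using True by (simp add: surv0_def ennreal_leI)
qed (auto simp: surv0_def)

lemma P_antimono:
assumes "brownian_killing M W V1" "brownian_killing M W V2" "!!y. y ~= 0 ==> V1 y <= V2 y"
shows "brownian_killing.P M W V2 t f x <= brownian_killing.P M W V1 t f x"
unfolding brownian_killing.P_def[OF assms(1)] brownian_killing.P_def[OF assms(2)]
using assms brownian_killing.W_continuous[OF assms(1)]
by (intro nn_integral_mono mult_right_mono surv0_antimono) (auto simp: brownian_killing_def)

context brownian_killing
begin

lemma Lop_eq: "Lop ep dt h y = (if ep <= norm y then en (exp (- dt * V y)) * heat dt h y else 0)"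
by (simp add: Lop_def kfac_def)

lemma Lop_const_le: "ep > 0 ==> dt > 0 ==> Lop ep dt (%_. c) y <= c"
unfolding Lop_def using kfac_le_1[of ep dt y] by (simp add: mult_left_le_one_le mult_le_one) (metis mult_right_mono mult_1 zero_le)

lemma Lop_add: "f \<in> bm ==> g \<in> bm ==> Lop ep dt (%z. f z + g z) y = Lop ep dt f y + Lop ep dt g y"
unfolding Lop_def by (simp add: heat_add distrib_left)

lemma Lop_cmult: "f \<in> bm ==> Lop ep dt (%z. c * f z) y = c * Lop ep dt f y"
unfolding Lop_def by (simp add: heat_cmult mult_ac)

lemma Lop_pow_cmult: "ep > 0 ==> f \<in> bm ==> (Lop ep dt ^^ n) (%z. c * f z) y = c * (Lop ep dt ^^ n) f y"
proof (induction n arbitrary: y)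
case (Suc n)
have "(Lop ep dt ^^ n) (%z. c * f z) = (%z. c * (Lop ep dt ^^ n) f z)" using Suc by auto
then show ?case using Suc.prems by (simp add: Lop_cmult Lop_pow_measurable)
qed simp

text \<open>Iterating the one-step inequality over \<open>n\<close> steps accumulates an error of at
  most \<open>t * e * exp (La * t)\<close>. The mesh goes to 0 for fixed \<open>e\<close> and
  cutoff, then \<open>e\<close> goes to 0, then the cutoff is removed by taking suprema.\<close>

lemma supersolution_bound:
fixes u :: "real^'n => real"
assumes nn: "!!y. 0 <= u y" and [measurable]: "u \<in> bm" and La: "La >= 0"
 and st: "!!ep e. ep > 0 ==> e > 0 ==> \<exists>dt0>0. \<forall>dt x. 0 < dt & dt < dt0 & ep <= norm x -->
  en (exp (- dt * V x)) * heat dt (%z. en (u z)) x <= en (exp (La * dt) * u x + e * dt)"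
 and t: "t > 0" and [measurable]: "f \<in> bm" and fu: "!!y. f y <= en (u y)"
shows "P t f x <= en (exp (La * t) * u x)"
proof -
have "fk ep t (trunc k f) x <= en (exp (La * t) * u x)" if ep: "ep > 0" for ep k
proof -
 have "fk ep t (trunc k f) x <= en (exp (La * t) * (u x + t * e))" if e: "e > 0" for e
 proof -
  obtain dt0 where dt0: "dt0 > 0" and s: "!!dt x. 0 < dt ==> dt < dt0 ==> ep <= norm x ==>
  en (exp (- dt * V x)) * heat dt (%z. en (u z)) x <= en (exp (La * dt) * u x + e * dt)"
  using st[OF ep e] by blast
  have pw: "(Lop ep dt ^^ n) (%z. en (u z)) y <= en (exp (La * (real n * dt)) * (u y + real n * dt * e))"
  if dt: "0 < dt" "dt < dt0" for n dt y
  proof (induction n arbitrary: y)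
  case (Suc n)
  have "(Lop ep dt ^^ Suc n) (%z. en (u z)) y <= Lop ep dt (%z. en (exp (La * (real n * dt))) * (en (u z) + en (real n * dt * e))) y"
   using Suc dt e nn by (auto intro!: Lop_mono simp: ennreal_mult' ennreal_plus)
  also have "... = en (exp (La * (real n * dt))) * (Lop ep dt (%z. en (u z)) y + Lop ep dt (%_. en (real n * dt * e)) y)"
   by (simp add: Lop_cmult Lop_add)
  also have "... <= en (exp (La * (real n * dt))) * (en (exp (La * dt) * u y + e * dt) + en (real n * dt * e))"
   using s[OF dt, of y] dt ep by (intro mult_left_mono add_mono Lop_const_le) (auto simp: Lop_eq)
  also have "... = en (exp (La * (real n * dt)) * (exp (La * dt) * u y + e * dt + real n * dt * e))"
  proof -
   have a: "0 <= exp (La * dt) * u y + e * dt" "0 <= real n * dt * e" using nn[of y] dt e by auto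
   show ?thesis unfolding ennreal_plus[OF a, symmetric] by (rule ennreal_mult'[symmetric]) simp
  qed
  also have "... <= en (exp (La * (real (Suc n) * dt)) * (u y + real (Suc n) * dt * e))"
  proof (rule ennreal_leI)
   have "exp (La * dt) >= 1" using La dt by simp
   from mult_right_mono[OF this, of "e * dt + real n * dt * e"]
   have "e * dt + real n * dt * e <= exp (La * dt) * (e * dt + real n * dt * e)" using e dt by simp
   then have "exp (La * dt) * u y + e * dt + real n * dt * e <= exp (La * dt) * (u y + real (Suc n) * dt * e)"
    by (simp add: algebra_simps)
   then have "exp (La * (real n * dt)) * (exp (La * dt) * u y + e * dt + real n * dt * e) <= exp (La * (real n * dt)) * (exp (La * dt) * (u y + real (Suc n) * dt * e))"
    by (rule mult_left_mono) simp
   also have "... = exp (La * (real (Suc n) * dt)) * (u y + real (Suc n) * dt * e)"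
    by (simp add: algebra_simps exp_add)
   finally show "exp (La * (real n * dt)) * (exp (La * dt) * u y + e * dt + real n * dt * e) <= exp (La * (real (Suc n) * dt)) * (u y + real (Suc n) * dt * e)" .
  qed
  finally show ?case .
  qed simp
  have lim: "(%n. (Lop ep (t / real (Suc n)) ^^ Suc n) (%y. kfac V ep (t / real (Suc n)) y * trunc k f y) x) \<longlonglongrightarrow> fk ep t (trunc k f) x"
  using ep t by (intro fk_tendsto heat_bounded[where c = "real k"] trunc_le') auto
  have "(%n. t / real (Suc n)) \<longlonglongrightarrow> 0" using t by real_asymp
  then have ev: "eventually (%n. t / real (Suc n) < dt0) sequentially" using dt0 by (rule order_tendstoD)
  show ?thesis
  proof (rule tendsto_upperbound[OF lim])
  show "\<forall>\<^sub>F n in sequentially. (Lop ep (t / real (Suc n)) ^^ Suc n) (%y. kfac V ep (t / real (Suc n)) y * trunc k f y) x <= en (exp (La * t) * (u x + t * e))"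
   using ev
  proof eventually_elim
   case (elim n)
   have "(Lop ep (t / real (Suc n)) ^^ Suc n) (%y. kfac V ep (t / real (Suc n)) y * trunc k f y) x
    <= (Lop ep (t / real (Suc n)) ^^ Suc n) (%z. en (u z)) x"
   proof (rule Lop_pow_mono)
    fix y
    have "kfac V ep (t / real (Suc n)) y * trunc k f y <= 1 * en (u y)"
    using ep t fu by (intro mult_mono kfac_le_1 order_trans[OF trunc_le(2)]) auto
    then show "kfac V ep (t / real (Suc n)) y * trunc k f y <= en (u y)" by simp
   qed
   also have "... <= en (exp (La * (real (Suc n) * (t / real (Suc n)))) * (u x + real (Suc n) * (t / real (Suc n)) * e))"
    using elim t by (intro pw) auto
   also have "real (Suc n) * (t / real (Suc n)) = t" by simp
   finally show ?case by (simp add: mult_ac)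
  qed
  qed simp
 qed
 then have *: "fk ep t (trunc k f) x <= en (exp (La * t) * u x) + en (exp (La * t) * t * e)" if "e > 0" for e
  using that t nn[of x] by (simp add: distrib_left ennreal_plus mult.assoc)
 show ?thesis
 proof (rule ennreal_le_epsilon)
  fix e' :: real assume "e' > 0"
  then show "fk ep t (trunc k f) x <= en (exp (La * t) * u x) + en e'"
  using *[of "e' / (exp (La * t) * t)"] t by simp
 qed
qed
then show ?thesis unfolding P_SUP_trunc[OF t assms(6)] by (intro SUP_least) (auto simp del: of_nat_Suc)
qed

text \<open>Here the one-step inequality is asked only where \<open>u > 0\<close>; elsewhere it is
  trivial. As \<open>u\<close> vanishes near the origin, a fixed cutoff radius suffices and
  \<open>fk_le_P\<close> passes to \<open>P\<close>.\<close>

lemma subsolution_bound: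
fixes u :: "real^'n => real"
assumes nn: "!!y. 0 <= u y" and uB: "!!y. u y <= B" and [measurable]: "u \<in> bm" and La: "La >= 0" and E: "E >= 0"
 and ep: "ep > 0" and V: "!!y. ep <= norm y ==> V y <= v" and u0: "!!y. norm y < ep ==> u y = 0"
 and st: "!!e. e > 0 ==> \<exists>dt0>0. \<forall>dt x. 0 < dt & dt < dt0 & u x > 0 -->
  en (exp (- La * dt) * u x) <= en (exp (- dt * V x)) * heat dt (%z. en (u z)) x + en ((E + e) * dt)"
 and t: "t > 0"
shows "en (exp (- La * t) * u x) <= P t (%z. en (u z)) x + en (t * E)"
proof -
have B: "B >= 0" using nn[of 0] uB[of 0] by simp
have *: "en (exp (- La * t) * u x) <= fk ep t (%z. en (u z)) x + en (t * (E + e))" if e: "e > 0" for e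
proof -
 obtain dt0 where dt0: "dt0 > 0" and s: "!!dt x. 0 < dt ==> dt < dt0 ==> u x > 0 ==>
  en (exp (- La * dt) * u x) <= en (exp (- dt * V x)) * heat dt (%z. en (u z)) x + en ((E + e) * dt)"
  using st[OF e] by blast
 have s': "en (exp (- La * dt)) * en (u y) <= Lop ep dt (%z. en (u z)) y + en ((E + e) * dt)"
  if "0 < dt" "dt < dt0" for dt y
 proof (cases "u y > 0")
  case True
  then have "ep <= norm y" using u0[of y] by force
  then show ?thesis using s[OF that True] by (simp add: Lop_eq ennreal_mult')
 next
  case False
  then have "u y = 0" using nn[of y] by simp
  then show ?thesis by simp
 qed
 have pw: "en (exp (- La * (real n * dt))) * en (u y) <= (Lop ep dt ^^ n) (%z. en (u z)) y + en (real n * dt * (E + e))"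
  if dt: "0 < dt" "dt < dt0" for n dt y
 proof (induction n arbitrary: y)
  case (Suc n)
  have [measurable]: "(Lop ep dt ^^ n) (%z. en (u z)) \<in> bm" using ep by (intro Lop_pow_measurable) auto
  have "en (exp (- La * (real (Suc n) * dt))) * en (u y) = en (exp (- La * (real n * dt))) * (en (exp (- La * dt)) * en (u y))"
  proof -
  have "exp (- La * (real (Suc n) * dt)) = exp (- La * (real n * dt)) * exp (- La * dt)"
   by (simp add: algebra_simps flip: exp_add)
  then show ?thesis by (simp add: ennreal_mult' mult.assoc)
  qed
  also have "... <= en (exp (- La * (real n * dt))) * (Lop ep dt (%z. en (u z)) y + en ((E + e) * dt))"
  by (intro mult_left_mono s' dt) auto
  also have "... <= en (exp (- La * (real n * dt))) * Lop ep dt (%z. en (u z)) y + 1 * en ((E + e) * dt)"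
  unfolding distrib_left using La dt by (intro add_mono mult_right_mono) auto
  also have "en (exp (- La * (real n * dt))) * Lop ep dt (%z. en (u z)) y = Lop ep dt (%z. en (exp (- La * (real n * dt))) * en (u z)) y"
  by (rule Lop_cmult[symmetric]) measurable
  also have "... <= Lop ep dt (%z. (Lop ep dt ^^ n) (%z. en (u z)) z + en (real n * dt * (E + e))) y"
  by (intro Lop_mono Suc)
  also have "... <= (Lop ep dt ^^ Suc n) (%z. en (u z)) y + en (real n * dt * (E + e))"
  by (subst Lop_add) (auto intro!: add_mono Lop_const_le ep dt)
  finally have "en (exp (- La * (real (Suc n) * dt))) * en (u y) <= (Lop ep dt ^^ Suc n) (%z. en (u z)) y + en (real n * dt * (E + e)) + 1 * en ((E + e) * dt)"
  by (simp add: add_right_mono)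
  also have "... = (Lop ep dt ^^ Suc n) (%z. en (u z)) y + en (real (Suc n) * dt * (E + e))"
  using dt E e by (simp add: add.assoc algebra_simps flip: ennreal_plus)
  finally show ?case .
 qed simp
 have lim: "(%n. (Lop ep (t / real (Suc n)) ^^ Suc n) (%y. kfac V ep (t / real (Suc n)) y * en (u y)) x + en (t * (E + e)))
  \<longlonglongrightarrow> fk ep t (%z. en (u z)) x + en (t * (E + e))"
  using ep t uB by (intro tendsto_add tendsto_const fk_tendsto heat_bounded[where c = B] ennreal_leI) auto
 \<comment> \<open>The product formula contains one more killing factor, at the final node. On the
   support of \<open>u\<close> it is at least \<open>exp (- dt * v)\<close>, which disappears in the
   limit.\<close>
 have lim2: "(%n. en (exp (- (t / real (Suc n)) * v) * (exp (- La * t) * u x))) \<longlonglongrightarrow> en (exp (- 0 * v) * (exp (- La * t) * u x))"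
 proof -
  have "(%n. t / real (Suc n)) \<longlonglongrightarrow> 0" using t by real_asymp
  then show ?thesis by (intro tendsto_ennrealI tendsto_intros)
 qed
 have "(%n. t / real (Suc n)) \<longlonglongrightarrow> 0" using t by real_asymp
 then have ev: "eventually (%n. t / real (Suc n) < dt0) sequentially" using dt0 by (rule order_tendstoD)
 have "en (exp (- 0 * v) * (exp (- La * t) * u x)) <= fk ep t (%z. en (u z)) x + en (t * (E + e))"
 proof (rule tendsto_le[OF _ lim lim2])
  show "\<forall>\<^sub>F n in sequentially. en (exp (- (t / real (Suc n)) * v) * (exp (- La * t) * u x))
  <= (Lop ep (t / real (Suc n)) ^^ Suc n) (%y. kfac V ep (t / real (Suc n)) y * en (u y)) x + en (t * (E + e))"
  using ev
  proof eventually_elim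
  case (elim n)
  define dt where "dt = t / real (Suc n)"
  have dt: "0 < dt" "dt < dt0" "real (Suc n) * dt = t" using elim t by (auto simp: dt_def)
  have v0: "0 <= v"
  proof -
   obtain i :: 'n where True by simp
   have "0 <= V (axis i ep)" using ep by (intro V_nonneg) (auto simp: axis_eq_0_iff)
   also have "... <= v" using ep by (intro V) (auto simp: norm_eq_sqrt_inner inner_axis_axis)
   finally show ?thesis .
  qed
  have "en (exp (- dt * v) * (exp (- La * t) * u x)) = en (exp (- dt * v)) * (en (exp (- La * (real (Suc n) * dt))) * en (u x))"
   unfolding dt(3) by (simp add: ennreal_mult')
  also have "... <= en (exp (- dt * v)) * ((Lop ep dt ^^ Suc n) (%z. en (u z)) x + en (real (Suc n) * dt * (E + e)))"
   by (intro mult_left_mono pw dt) auto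
  also have "... <= en (exp (- dt * v)) * (Lop ep dt ^^ Suc n) (%z. en (u z)) x + 1 * en (t * (E + e))"
   unfolding distrib_left dt(3) using dt v0 by (intro add_mono mult_right_mono) auto
  also have "en (exp (- dt * v)) * (Lop ep dt ^^ Suc n) (%z. en (u z)) x = (Lop ep dt ^^ Suc n) (%z. en (exp (- dt * v)) * en (u z)) x"
   by (rule Lop_pow_cmult[OF ep, symmetric]) measurable
  also have "... <= (Lop ep dt ^^ Suc n) (%y. kfac V ep dt y * en (u y)) x"
  proof (rule Lop_pow_mono)
   fix y show "en (exp (- dt * v)) * en (u y) <= kfac V ep dt y * en (u y)"
    using u0[of y] V[of y] dt by (cases "ep <= norm y") (auto simp: kfac_def intro!: mult_right_mono ennreal_leI)
  qed
  finally show ?case by (simp add: dt_def add_right_mono)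
  qed
 qed simp
 then show ?thesis by simp
qed
have **: "en (exp (- La * t) * u x) <= P t (%z. en (u z)) x + en (t * E)"
proof (rule ennreal_le_epsilon)
 fix e' :: real assume e': "e' > 0"
 have "en (exp (- La * t) * u x) <= fk ep t (%z. en (u z)) x + en (t * (E + e' / t))"
  using e' t by (intro *) auto
 also have "... <= P t (%z. en (u z)) x + en (t * (E + e' / t))"
  by (intro add_right_mono fk_le_P ep)
 also have "... = P t (%z. en (u z)) x + en (t * E) + en e'"
  using t e' E by (simp add: distrib_left ennreal_plus add.assoc)
 finally show "en (exp (- La * t) * u x) <= P t (%z. en (u z)) x + en (t * E) + en e'" .
qed
then show ?thesis .
qed

end

section \<open>Reflection in the hyperplane \<open>z $ i = a\<close> and the half-space lower
  bound\<close>

definition hflip :: "'n::finite => real => real^'n => real^'n" where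
"hflip i a w = (\<chi> j. if j = i then 2 * a - w $ j else w $ j)"

lemma hflip_hflip [simp]: "hflip i a (hflip i a w) = w"
by (simp add: hflip_def vec_eq_iff)

lemma hflip_nth: "hflip i a w $ j = (if j = i then 2 * a - w $ j else w $ j)"
by (simp add: hflip_def)

lemma hflip_affine:
fixes i :: "'n::finite" and w :: "real^'n"
shows "hflip i a w = (2 * a) *\<^sub>R axis i 1 + (\<Sum>b\<in>Basis. ((if b = axis i 1 then -1 else 1) * (w \<bullet> b)) *\<^sub>R b)"
proof (rule euclidean_eqI)
fix b :: "real^'n" assume b: "b \<in> Basis"
then obtain k where k: "b = axis k 1" by (auto simp: Basis_vec_def)
have axk: "axis i (1::real) $ k = (if k = i then 1 else 0)" for k by (simp add: axis_def)
have "((2 * a) *\<^sub>R axis i 1 + (\<Sum>b\<in>Basis. ((if b = axis i 1 then -1 else 1) * (w \<bullet> b)) *\<^sub>R b)) \<bullet> b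
 = (2 * a) * (axis i 1 \<bullet> b) + (if b = axis i 1 then -1 else 1) * (w \<bullet> b)"
 using b by (subst inner_add_left, subst inner_sum_left_Basis) auto
also have "... = hflip i a w \<bullet> b"
 unfolding k using axk[of k] by (auto simp: inner_axis hflip_nth inner_axis_axis axis_eq_axis)
finally show "hflip i a w \<bullet> b = ((2 * a) *\<^sub>R axis i 1 + (\<Sum>b\<in>Basis. ((if b = axis i 1 then -1 else 1) * (w \<bullet> b)) *\<^sub>R b)) \<bullet> b" ..
qed

lemma hflip_measurable [measurable]: "hflip i a \<in> bm"
unfolding hflip_affine[abs_def] by measurable

lemma nn_integral_hflip:
fixes i :: "'n::finite" and g :: "real^'n => ennreal"
assumes [measurable]: "g \<in> bm"
shows "(NN w. g (hflip i a w)) = (NN w. g w)"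
proof -
have c: "(lborel :: (real^'n) measure) = density (distr lborel borel (%x. (2 * a) *\<^sub>R axis i 1 + (\<Sum>j\<in>Basis. ((if j = axis i 1 then -1 else 1) * (x \<bullet> j)) *\<^sub>R j)))
 (%_. \<Prod>j\<in>(Basis :: (real^'n) set). \<bar>(if j = axis i 1 then -1 else 1 :: real)\<bar>)"
 by (rule lborel_affine_euclidean) auto
have p: "(\<Prod>j\<in>(Basis :: (real^'n) set). \<bar>(if j = axis i 1 then -1 else 1 :: real)\<bar>) = 1"
 by (intro prod.neutral) auto
have "(lborel :: (real^'n) measure) = distr lborel borel (hflip i a)"
proof -
 have r: "hflip i a = (%x. (2 * a) *\<^sub>R axis i 1 + (\<Sum>j\<in>Basis. ((if j = axis i 1 then -1 else 1) * (x \<bullet> j)) *\<^sub>R j))"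
  by (rule ext) (rule hflip_affine)
 show ?thesis unfolding r using c unfolding p by (simp add: density_1)
qed
then have "(NN w. g w) = (\<integral>\<^sup>+w. g w \<partial>(distr lborel borel (hflip i a)))" by (rule arg_cong)
also have "... = (NN w. g (hflip i a w))" by (rule nn_integral_distr) measurable
finally show ?thesis ..
qed

lemma norm_hflip_diff: "norm (hflip i a z - hflip i a w) = norm (z - w)"
proof -
have "norm (hflip i a z - hflip i a w) = norm (\<chi> j. if j = i then - ((z - w) $ j) else (z - w) $ j)"
 by (intro arg_cong[of _ _ norm]) (simp add: vec_eq_iff hflip_nth)
also have "... = norm (z - w)"
 unfolding norm_eq_sqrt_inner inner_vec_def by (intro arg_cong[of _ _ sqrt] sum.cong) (auto simp: algebra_simps)
finally show ?thesis .
qed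

lemma gauss_hflip: "gauss_q t (hflip i a z) w = gauss_q t z (hflip i a w)"
using norm_hflip_diff[of i a z "hflip i a w"] by (simp add: gauss_q_def)

text \<open>The method of images: on either side of the hyperplane this is the heat kernel with
  absorption at the hyperplane.\<close>

definition gref :: "'n::finite => real => real => real^'n => real^'n => real" where
"gref i a t z w = gauss_q t z w - gauss_q t z (hflip i a w)"

text \<open>The reflected point is further away by \<open>4 (z_i - a) (w_i - a)\<close> in squared
  distance, which displays the sign of the kernel and a quantitative lower bound.\<close>

lemma gref_eq:
assumes "t > 0"
shows "gref i a t z w = gauss_q t z w * (1 - exp (- ((z $ i - a) * (w $ i - a) / t)))"
proof -
have "(norm (z - hflip i a w))^2 = (norm (z - w))^2 + 4 * ((z $ i - a) * (w $ i - a))"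
proof -
 have "(norm (z - hflip i a w))^2 - (norm (z - w))^2 = (\<Sum>j\<in>UNIV. if j = i then 4 * ((z $ i - a) * (w $ i - a)) else 0)"
  unfolding power2_norm_eq_inner inner_vec_def sum_subtractf[symmetric]
  by (intro sum.cong) (auto simp: hflip_nth algebra_simps)
 then show ?thesis by simp
qed
then have "- (norm (z - hflip i a w))\<^sup>2 / (4 * t) = - (norm (z - w))\<^sup>2 / (4 * t) + - ((z $ i - a) * (w $ i - a) / t)"
 using assms by (simp add: add_divide_distrib diff_divide_distrib)
then have "exp (- (norm (z - hflip i a w))\<^sup>2 / (4 * t)) = exp (- (norm (z - w))\<^sup>2 / (4 * t)) * exp (- ((z $ i - a) * (w $ i - a) / t))"
 by (simp only: exp_add)
then show ?thesis unfolding gref_def gauss_q_def by (simp add: algebra_simps)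
qed

lemma gref_antisym: "gref i a t (hflip i a z) w = - gref i a t z w" "gref i a t z (hflip i a w) = - gref i a t z w"
by (simp_all add: gref_def gauss_hflip)

lemma gref_measurable [measurable]: "(%p. gref i a t (fst p) (snd p)) \<in> borel_measurable (borel \<Otimes>\<^sub>M borel)"
unfolding gref_def gauss_q_def by measurable

lemma gref_measurable1 [measurable]: "gref i a t z \<in> bm" "(%z. gref i a t z w) \<in> bm"
unfolding gref_def gauss_q_def by measurable

lemma gauss_CK_integral:
fixes z w :: "real^'n"
assumes "s > 0" "t > 0"
shows "has_bochner_integral lborel (%v. gauss_q s z v * gauss_q t v w) (gauss_q (s + t) z w)"
proof (rule has_bochner_integral_nn_integral)
show "(%v. gauss_q s z v * gauss_q t v w) \<in> borel_measurable lborel" unfolding gauss_q_def by measurable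
show "(NN v. en (gauss_q s z v * gauss_q t v w)) = en (gauss_q (s + t) z w)"
 using gauss_q_Chapman_Kolmogorov[OF assms, of z w] by (simp add: ennreal_mult)
qed auto

text \<open>Both factors are odd under reflection of the intermediate point, so their product is
  even, and the integral over the half-space is half of the integral over the whole space. The
  latter is \<open>2 gref\<close> by the Gaussian Chapman-Kolmogorov identity. The sign
  \<open>sgm\<close> selects the side of the hyperplane.\<close>

lemma gref_CK:
fixes z w :: "real^'n"
assumes st: "s > 0" "t > 0" and sgm: "sgm = 1 | sgm = -1" and z: "h < sgm * z $ i" and w: "h < sgm * w $ i"
shows "en (gref i (sgm * h) (s + t) z w) <=
 (NN v. ind {v. h < sgm * v $ i} v * (en (gref i (sgm * h) s z v) * en (gref i (sgm * h) t v w)))"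
proof -
define a where "a = sgm * h"
have sgmsgm: "sgm * sgm = 1" using sgm by auto
have prod: "(u $ i - a) * (v $ i - a) = (sgm * u $ i - h) * (sgm * v $ i - h)" for u v :: "real^'n"
 using sgm by (auto simp: a_def algebra_simps)
define g where "g v = gref i a s z v * gref i a t v w" for v
have grefz: "gref i a s z v = gauss_q s z v * (1 - exp (- ((sgm * z $ i - h) * (sgm * v $ i - h) / s)))" for v
 using gref_eq[OF st(1), of i a z v] by (simp add: prod)
have grefw: "gref i a t v w = gauss_q t v w * (1 - exp (- ((sgm * v $ i - h) * (sgm * w $ i - h) / t)))" for v
 using gref_eq[OF st(2), of i a v w] by (simp add: prod)
have pos: "0 <= gref i a s z v & 0 <= gref i a t v w" if "h <= sgm * v $ i" for v
 unfolding grefz grefw using that z w st by (auto intro!: mult_nonneg_nonneg)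
have neg: "gref i a s z v <= 0 & gref i a t v w <= 0" if "sgm * v $ i <= h" for v
proof -
 have "(sgm * z $ i - h) * (sgm * v $ i - h) <= 0" "(sgm * v $ i - h) * (sgm * w $ i - h) <= 0"
  using that z w by (auto intro: mult_nonneg_nonpos mult_nonpos_nonneg)
 then show ?thesis unfolding grefz grefw using st
  by (auto intro!: mult_nonneg_nonpos simp: divide_nonpos_pos)
qed
have g0: "0 <= g v" for v
 unfolding g_def using pos[of v] neg[of v] by (cases "h <= sgm * v $ i") (auto intro: mult_nonneg_nonneg mult_nonpos_nonpos)
have gr: "g (hflip i a v) = g v" for v by (simp add: g_def gref_antisym)
have [measurable]: "g \<in> bm" unfolding g_def by measurable
have "g v = gauss_q s z v * gauss_q t v w - gauss_q s z v * gauss_q t v (hflip i a w)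
  - gauss_q s (hflip i a z) v * gauss_q t v w + gauss_q s (hflip i a z) v * gauss_q t v (hflip i a w)" for v
 by (simp add: g_def gref_def gauss_hflip algebra_simps)
then have g_eq: "g = (%v. gauss_q s z v * gauss_q t v w - gauss_q s z v * gauss_q t v (hflip i a w)
  - gauss_q s (hflip i a z) v * gauss_q t v w + gauss_q s (hflip i a z) v * gauss_q t v (hflip i a w))"
 by blast
have "has_bochner_integral lborel g (gauss_q (s + t) z w - gauss_q (s + t) z (hflip i a w)
 - gauss_q (s + t) (hflip i a z) w + gauss_q (s + t) (hflip i a z) (hflip i a w))"
 unfolding g_eq by (intro has_bochner_integral_add has_bochner_integral_diff gauss_CK_integral st)
then have hb: "has_bochner_integral lborel g (2 * gref i a (s + t) z w)"
 by (simp add: gref_def gauss_hflip)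
have "en (2 * gref i a (s + t) z w) = (NN v. en (g v))"
 using hb g0 nn_integral_eq_integral[of lborel g] by (simp add: has_bochner_integral_iff)
also have "... <= (NN v. ind {v. h < sgm * v $ i} v * en (g v)
  + ind {v. h < sgm * v $ i} (hflip i a v) * en (g (hflip i a v)))"
proof (rule nn_integral_mono)
 fix v
 have r: "sgm * hflip i a v $ i = 2 * h - sgm * v $ i" using sgm by (auto simp: hflip_nth a_def)
 consider "h < sgm * v $ i" | "sgm * v $ i < h" | "sgm * v $ i = h" by linarith
 then show "en (g v) <= ind {v. h < sgm * v $ i} v * en (g v)
  + ind {v. h < sgm * v $ i} (hflip i a v) * en (g (hflip i a v))"
 proof cases
  case 3 then show ?thesis by (simp add: g_def grefz)
 qed (use r gr in auto)
qed
also have "... = (NN v. ind {v. h < sgm * v $ i} v * en (g v))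
 + (NN v. ind {v. h < sgm * v $ i} (hflip i a v) * en (g (hflip i a v)))"
 by (rule nn_integral_add) measurable
also have "(NN v. ind {v. h < sgm * v $ i} (hflip i a v) * en (g (hflip i a v)))
 = (NN v. ind {v. h < sgm * v $ i} v * en (g v))"
 by (rule nn_integral_hflip[where g = "%v. ind {v. h < sgm * v $ i} v * en (g v)"]) measurable
finally have "2 * en (gref i a (s + t) z w) <= 2 * (NN v. ind {v. h < sgm * v $ i} v * en (g v))"
proof -
 assume "en (2 * gref i a (s + t) z w) <= (NN v. ind {v. h < sgm * v $ i} v * en (g v))
  + (NN v. ind {v. h < sgm * v $ i} v * en (g v))"
 moreover have "en (2 * gref i a (s + t) z w) = 2 * en (gref i a (s + t) z w)"
  by (simp add: ennreal_mult')
 ultimately show ?thesis by (simp only: mult_2)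
qed
then have "en (gref i a (s + t) z w) <= (NN v. ind {v. h < sgm * v $ i} v * en (g v))"
 by (subst (asm) ennreal_mult_le_mult_iff) auto
also have "... = (NN v. ind {v. h < sgm * v $ i} v * (en (gref i a s z v) * en (gref i a t v w)))"
 by (intro nn_integral_cong) (use pos in \<open>auto simp: g_def ennreal_mult split: split_indicator\<close>)
finally show ?thesis unfolding a_def .
qed

context brownian_killing
begin

text \<open>Inside the half-space each killing factor is at least \<open>exp (- C * dt)\<close> and
  the image kernel is below the Gaussian. \<open>gref_CK\<close> restores the image kernel after
  each step. There are \<open>Suc n\<close> steps and one terminal killing factor, hence
  \<open>n + 2\<close>.\<close>

lemma half_space_discrete:
assumes ep: "ep > 0" "ep <= h" and dt: "dt > 0" and sgm: "sgm = 1 | sgm = -1"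
 and V: "!!v. h < sgm * v $ i ==> V v <= C" and [measurable]: "f \<in> bm"
 and z: "h < sgm * z $ i"
shows "en (exp (- C * dt * (real n + 2))) *
 (NN w. ind {w. h < sgm * w $ i} w * (en (gref i (sgm * h) (real (Suc n) * dt) z w) * f w))
 <= (Lop ep dt ^^ Suc n) (%y. kfac V ep dt y * f y) z"
proof -
let ?H = "{w. h < sgm * w $ i}"
have nv: "ep <= norm v" if "h < sgm * v $ i" for v
 using that component_le_norm_cart[of v i] ep sgm by auto
have kf: "en (exp (- C * dt)) <= kfac V ep dt v" if "h < sgm * v $ i" for v
 using nv[OF that] V[OF that] dt by (auto simp: kfac_def intro!: ennreal_leI)
have gle: "gref i a t z w <= gauss_q t z w" for a t z w by (simp add: gref_def)
have "h < sgm * z $ i ==> ennreal (exp (- C * dt * (real n + 2))) *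
 (NN w. ind {w. h < sgm * w $ i} w * (en (gref i (sgm * h) (real (Suc n) * dt) z w) * f w))
 <= (Lop ep dt ^^ Suc n) (%y. kfac V ep dt y * f y) z" for z n
proof (induction n arbitrary: z)
 case 0
 have "en (exp (- C * dt * (real 0 + 2))) * (NN w. ind ?H w * (en (gref i (sgm * h) (real (Suc 0) * dt) z w) * f w))
  = en (exp (- C * dt)) * (en (exp (- C * dt)) * (NN w. ind ?H w * (en (gref i (sgm * h) dt z w) * f w)))"
 proof -
  have "exp (- C * dt * (real 0 + 2)) = exp (- C * dt) * exp (- C * dt)" by (simp flip: exp_add)
  then show ?thesis by (simp add: ennreal_mult' mult.assoc)
 qed
 also have "... = en (exp (- C * dt)) * (NN w. en (exp (- C * dt)) * (ind ?H w * (en (gref i (sgm * h) dt z w) * f w)))"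
  by (subst nn_integral_cmult) auto
 also have "... <= kfac V ep dt z * heat dt (%y. kfac V ep dt y * f y) z"
  unfolding heat_def
 proof (rule mult_mono[OF kf[OF 0] nn_integral_mono])
  fix w
  show "en (exp (- C * dt)) * (ind ?H w * (en (gref i (sgm * h) dt z w) * f w)) <= en (gauss_q dt z w) * (kfac V ep dt w * f w)"
  proof (cases "h < sgm * w $ i")
  case True
  have "en (gref i (sgm * h) dt z w) * (en (exp (- C * dt)) * f w) <= en (gauss_q dt z w) * (kfac V ep dt w * f w)"
   using kf[OF True] gle by (intro mult_mono ennreal_leI) auto
  then show ?thesis using True by (simp add: mult_ac)
  qed simp
 qed auto
 finally show ?case by (simp add: Lop_def)
next
 case (Suc n)
 define K where "K = (Lop ep dt ^^ Suc n) (%y. kfac V ep dt y * f y)"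
 define G where "G v = (NN w. ind ?H w * (en (gref i (sgm * h) (real (Suc n) * dt) v w) * f w))" for v
 have [measurable]: "G \<in> bm" unfolding G_def gref_def gauss_q_def by measurable
 have IH: "en (exp (- C * dt * (real n + 2))) * G v <= K v" if "h < sgm * v $ i" for v
  unfolding G_def K_def by (rule Suc.IH[OF that])
 have m: "(%(v, w). ind ?H w * f w * (ind ?H v * (en (gref i (sgm * h) dt z v) * en (gref i (sgm * h) (real (Suc n) * dt) v w))))
  \<in> borel_measurable (lborel \<Otimes>\<^sub>M lborel)"
  unfolding gref_def gauss_q_def by measurable
 have "(NN w. ind ?H w * (en (gref i (sgm * h) (real (Suc (Suc n)) * dt) z w) * f w))
  <= (NN w. ind ?H w * f w * (NN v. ind ?H v * (en (gref i (sgm * h) dt z v) * en (gref i (sgm * h) (real (Suc n) * dt) v w))))"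
 proof (intro nn_integral_mono)
  fix w
  have e: "dt + real (Suc n) * dt = real (Suc (Suc n)) * dt" by (simp add: algebra_simps)
  have p: "real (Suc n) * dt > 0" using dt by simp
  show "ind ?H w * (en (gref i (sgm * h) (real (Suc (Suc n)) * dt) z w) * f w) <=
   ind ?H w * f w * (NN v. ind ?H v * (en (gref i (sgm * h) dt z v) * en (gref i (sgm * h) (real (Suc n) * dt) v w)))"
  proof (cases "h < sgm * w $ i")
  case True
  from gref_CK[OF dt p sgm Suc.prems True, unfolded e]
  show ?thesis using True by (simp add: mult.commute[of _ "f w"] mult_left_mono)
  qed simp
 qed
 also have "... = (NN w. (NN v. ind ?H w * f w * (ind ?H v * (en (gref i (sgm * h) dt z v) * en (gref i (sgm * h) (real (Suc n) * dt) v w)))))"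
  by (intro nn_integral_cong nn_integral_cmult[symmetric]) measurable
 also have "... = (NN v. (NN w. ind ?H w * f w * (ind ?H v * (en (gref i (sgm * h) dt z v) * en (gref i (sgm * h) (real (Suc n) * dt) v w)))))"
  using lborel_pair.Fubini'[OF m] by simp
 also have "... = (NN v. ind ?H v * en (gref i (sgm * h) dt z v) * G v)"
 proof (rule nn_integral_cong)
  fix v
  have "(NN w. ind ?H w * f w * (ind ?H v * (en (gref i (sgm * h) dt z v) * en (gref i (sgm * h) (real (Suc n) * dt) v w))))
  = (NN w. ind ?H v * en (gref i (sgm * h) dt z v) * (ind ?H w * (en (gref i (sgm * h) (real (Suc n) * dt) v w) * f w)))"
  by (simp only: mult_ac)
  also have "... = ind ?H v * en (gref i (sgm * h) dt z v) * G v"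
  unfolding G_def by (rule nn_integral_cmult) measurable
  finally show "(NN w. ind ?H w * f w * (ind ?H v * (en (gref i (sgm * h) dt z v) * en (gref i (sgm * h) (real (Suc n) * dt) v w))))
  = ind ?H v * en (gref i (sgm * h) dt z v) * G v" .
 qed
 finally have 1: "(NN w. ind ?H w * (en (gref i (sgm * h) (real (Suc (Suc n)) * dt) z w) * f w))
  <= (NN v. ind ?H v * en (gref i (sgm * h) dt z v) * G v)" .
 have ex: "exp (- C * dt * (real (Suc n) + 2)) = exp (- C * dt) * exp (- C * dt * (real n + 2))"
  by (simp add: algebra_simps flip: exp_add)
 have "en (exp (- C * dt * (real (Suc n) + 2))) * (NN w. ind ?H w * (en (gref i (sgm * h) (real (Suc (Suc n)) * dt) z w) * f w))
  <= en (exp (- C * dt)) * (en (exp (- C * dt * (real n + 2))) * (NN v. ind ?H v * en (gref i (sgm * h) dt z v) * G v))"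
  using 1 unfolding ex by (simp add: ennreal_mult' mult.assoc mult_left_mono)
 also have "en (exp (- C * dt * (real n + 2))) * (NN v. ind ?H v * en (gref i (sgm * h) dt z v) * G v)
  = (NN v. en (exp (- C * dt * (real n + 2))) * (ind ?H v * en (gref i (sgm * h) dt z v) * G v))"
  by (rule nn_integral_cmult[symmetric]) measurable
 also have "en (exp (- C * dt)) * (NN v. en (exp (- C * dt * (real n + 2))) * (ind ?H v * en (gref i (sgm * h) dt z v) * G v))
  <= kfac V ep dt z * heat dt K z"
  unfolding heat_def
 proof (rule mult_mono[OF kf[OF Suc.prems] nn_integral_mono])
  fix v
  show "en (exp (- C * dt * (real n + 2))) * (ind ?H v * en (gref i (sgm * h) dt z v) * G v) <= en (gauss_q dt z v) * K v"
  proof (cases "h < sgm * v $ i")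
  case True
  have "en (gref i (sgm * h) dt z v) * (en (exp (- C * dt * (real n + 2))) * G v) <= en (gauss_q dt z v) * K v"
   using IH[OF True] gle by (intro mult_mono ennreal_leI) auto
  then show ?thesis using True by (simp add: mult_ac)
  qed simp
 qed auto
 also have "kfac V ep dt z * heat dt K z = (Lop ep dt ^^ Suc (Suc n)) (%y. kfac V ep dt y * f y) z"
  unfolding K_def Lop_def[of ep dt "(Lop ep dt ^^ Suc n) (%y. kfac V ep dt y * f y)" z, symmetric]
  by (simp only: funpow.simps o_apply)
 finally show ?case .
qed
then show ?thesis using z .
qed

text \<open>Discarding all paths that leave the half-space leaves the image kernel, damped by at
  most \<open>exp (- C * t)\<close>. Proved for truncated \<open>f\<close> as the mesh goes to 0,
  then by monotone convergence.\<close>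

lemma half_space_lower:
assumes h: "h > 0" and sgm: "sgm = 1 | sgm = -1" and t: "t > 0"
 and V: "!!v. h < sgm * v $ i ==> V v <= C" and [measurable]: "f \<in> bm"
 and z: "h < sgm * z $ i"
shows "en (exp (- C * t)) *
 (NN w. ind {w. h < sgm * w $ i} w *
  (en (gauss_q t z w * (1 - exp (- ((sgm * z $ i - h) * (sgm * w $ i - h) / t)))) * f w))
 <= P t f z"
proof -
let ?H = "{w. h < sgm * w $ i}"
define J where "J f = (NN w. ind ?H w * (en (gref i (sgm * h) t z w) * f w))" for f
obtain k0 where k0: "1 / real (Suc k0) < h" using h nat_approx_posE by blast
have fk: "en (exp (- C * t)) * J (trunc k f) <= fk (1 / real (Suc k)) t (trunc k f) z" if "k >= k0" for k
proof -
 have ep: "1 / real (Suc k) > 0" "1 / real (Suc k) <= h"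
 proof -
  have "1 / real (Suc k) <= 1 / real (Suc k0)" using that by (intro divide_left_mono) auto
  then show "1 / real (Suc k) <= h" using k0 by simp
 qed simp
 have lim: "(%n. (Lop (1 / real (Suc k)) (t / real (Suc n)) ^^ Suc n) (%y. kfac V (1 / real (Suc k)) (t / real (Suc n)) y * trunc k f y) z)
  \<longlonglongrightarrow> fk (1 / real (Suc k)) t (trunc k f) z"
  using ep t by (intro fk_tendsto heat_bounded[where c = "real k"] trunc_le') auto
 have "(%n. t / real (Suc n)) \<longlonglongrightarrow> 0" using t by real_asymp
 then have "(%n. exp (- C * (t + t / real (Suc n)))) \<longlonglongrightarrow> exp (- C * (t + 0))" by (intro tendsto_intros)
 then have lim2: "(%n. en (exp (- C * (t + t / real (Suc n)))) * J (trunc k f)) \<longlonglongrightarrow> en (exp (- C * (t + 0))) * J (trunc k f)"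
  by (intro tendsto_mult_ennreal tendsto_ennrealI tendsto_const) auto
 have "en (exp (- C * (t + 0))) * J (trunc k f) <= fk (1 / real (Suc k)) t (trunc k f) z"
 proof (rule tendsto_le[OF _ lim lim2])
  show "\<forall>\<^sub>F n in sequentially. en (exp (- C * (t + t / real (Suc n)))) * J (trunc k f) <=
   (Lop (1 / real (Suc k)) (t / real (Suc n)) ^^ Suc n) (%y. kfac V (1 / real (Suc k)) (t / real (Suc n)) y * trunc k f y) z"
  proof (rule always_eventually, rule allI)
  fix n
  have "t / real (Suc n) * (real n + 2) = t + t / real (Suc n)" by (simp add: field_simps)
  then have e1: "- C * (t / real (Suc n)) * (real n + 2) = - C * (t + t / real (Suc n))" by (simp only: mult.assoc)
  have e2: "real (Suc n) * (t / real (Suc n)) = t" by simp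
  show "en (exp (- C * (t + t / real (Suc n)))) * J (trunc k f) <=
   (Lop (1 / real (Suc k)) (t / real (Suc n)) ^^ Suc n) (%y. kfac V (1 / real (Suc k)) (t / real (Suc n)) y * trunc k f y) z"
   using half_space_discrete[OF ep _ sgm V _ z, of "t / real (Suc n)" "trunc k f" n] t
   unfolding e1 e2 J_def by simp
  qed
 qed simp
 then show ?thesis by simp
qed
have "J f = (SUP k. J (trunc k f))"
proof -
 have "J f = (NN w. (SUP k. ind ?H w * (en (gref i (sgm * h) t z w) * trunc k f w)))"
  unfolding J_def by (intro nn_integral_cong) (simp add: SUP_mult_left_ennreal[symmetric] SUP_trunc)
 also have "... = (SUP k. J (trunc k f))"
  unfolding J_def
 proof (rule nn_integral_monotone_convergence_SUP)
  show "incseq (%k w. ind ?H w * (en (gref i (sgm * h) t z w) * trunc k f w))"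
  using incseq_trunc[of f] unfolding incseq_def le_fun_def by (auto intro!: mult_left_mono)
 qed measurable
 finally show ?thesis .
qed
then have "en (exp (- C * t)) * J f = (SUP k. en (exp (- C * t)) * J (trunc k f))"
 by (simp add: SUP_mult_left_ennreal)
also have "... <= P t f z"
 unfolding P_SUP_trunc[OF t assms(5)]
proof (rule SUP_least)
 fix k
 have "J (trunc k f) <= J (trunc (max k k0) f)"
  unfolding J_def using incseq_trunc[of f] by (intro nn_integral_mono mult_left_mono) (auto simp: incseq_def)
 then have "en (exp (- C * t)) * J (trunc k f) <= fk (1 / real (Suc (max k k0))) t (trunc (max k k0) f) z"
  using fk[of "max k k0"] by (meson max.cobounded2 mult_left_mono order_trans zero_le)
 also have "... <= (SUP k. fk (1 / real (Suc k)) t (trunc k f) z)" by (rule SUP_upper) simp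
 finally show "en (exp (- C * t)) * J (trunc k f) <= (SUP k. fk (1 / real (Suc k)) t (trunc k f) z)" .
qed
also have "J f = (NN w. ind ?H w *
  (en (gauss_q t z w * (1 - exp (- ((sgm * z $ i - h) * (sgm * w $ i - h) / t)))) * f w))"
 unfolding J_def using sgm by (intro nn_integral_cong) (auto simp: gref_eq[OF t] algebra_simps)
finally show ?thesis .
qed

end

section \<open>Superharmonic profiles: the cost of leaving a ball\<close>

lemma sq_dist_le:
fixes x z :: "'a::real_normed_vector"
assumes "norm (z - x) < R" "R <= 1"
shows "\<bar>(norm z)^2 - (norm x)^2\<bar> <= R * (2 * norm x + 1)"
proof -
have 1: "\<bar>norm z - norm x\<bar> <= R" using assms norm_triangle_ineq3[of z x] by linarith
have "(norm z)^2 - (norm x)^2 = (norm z - norm x) * (norm z + norm x)"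
 by (simp add: power2_eq_square algebra_simps)
then have "\<bar>(norm z)^2 - (norm x)^2\<bar> = \<bar>norm z - norm x\<bar> * (norm z + norm x)" by (simp add: abs_mult)
also have "... <= R * (2 * norm x + 1)" using 1 assms by (intro mult_mono) auto
finally show ?thesis .
qed

text \<open>The iterates of 1 stay below \<open>u + exp (- v * time)\<close> up to errors. Where
  \<open>u < 1\<close> the constant part is damped by the killing, whose rate is at least
  \<open>v\<close>; where \<open>u >= 1\<close> the bound 1 is already enough.\<close>

lemma (in brownian_killing) supersolution_decay:
fixes u :: "real^'n => real"
assumes nn: "!!y. 0 <= u y" and u1: "!!y. u y <= 1" and [measurable]: "u \<in> bm" and v: "v >= 0"
 and Vv: "!!x. x ~= 0 ==> u x < 1 ==> v <= V x"
 and st: "!!ep e. ep > 0 ==> e > 0 ==> \<exists>dt0>0. \<forall>dt x. 0 < dt & dt < dt0 & ep <= norm x -->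
  en (exp (- dt * V x)) * heat dt (%z. en (u z)) x <= en (u x + e * dt)"
 and t: "t > 0"
shows "P t (%_. 1) x <= en (u x + exp (- v * t))"
proof -
have "fk ep t (trunc k (%_. 1)) x <= en (u x + exp (- v * t))" if ep: "ep > 0" for ep k
proof -
 have *: "fk ep t (trunc k (%_. 1)) x <= en (u x + exp (- v * t)) + en e'" if e': "e' > 0" for e'
 proof -
  define e where "e = e' / t"
  have e: "e > 0" using e' t by (simp add: e_def)
  obtain dt0 where dt0: "dt0 > 0" and s: "!!dt x. 0 < dt ==> dt < dt0 ==> ep <= norm x ==>
  en (exp (- dt * V x)) * heat dt (%z. en (u z)) x <= en (u x + e * dt)"
  using st[OF ep e] by blast
  have pw: "(Lop ep dt ^^ n) (%_. 1) y <= en (u y + exp (- v * (real n * dt)) + real n * dt * e)"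
  if dt: "0 < dt" "dt < dt0" for n dt y
  proof (induction n arbitrary: y)
  case 0 then show ?case using nn[of y] by (simp flip: ennreal_1 add: ennreal_leI)
  next
  case (Suc n)
  define c where "c = exp (- v * (real n * dt)) + real n * dt * e"
  have c: "c >= 0" using dt e by (simp add: c_def)
  have ex: "exp (- v * (real (Suc n) * dt)) = exp (- dt * v) * exp (- v * (real n * dt))"
   by (simp add: algebra_simps flip: exp_add)
  have nn': "0 <= real (Suc n) * dt * e" using dt e by simp
  have le1: "(Lop ep dt ^^ Suc n) (%_. 1) y <= 1"
  proof (induction n arbitrary: y)
   case 0 then show ?case using Lop_const_le[OF ep dt(1), of 1 y] by simp
  next
   case (Suc n)
   have "(Lop ep dt ^^ Suc (Suc n)) (%_. 1) y <= Lop ep dt (%_. 1) y"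
    using Lop_mono[of "(Lop ep dt ^^ Suc n) (%_. 1)" "%_. 1" ep dt y] Suc by simp
   also have "... <= 1" by (rule Lop_const_le[OF ep dt(1)])
   finally show ?case .
  qed
  show ?case
  proof (cases "ep <= norm y & u y < 1")
   case True
   then have y: "y ~= 0" using ep by auto
   have "(Lop ep dt ^^ Suc n) (%_. 1) y <= Lop ep dt (%z. en (u z) + en c) y"
    using Suc nn c by (auto intro!: Lop_mono simp: c_def add.assoc simp flip: ennreal_plus)
   also have "... = Lop ep dt (%z. en (u z)) y + Lop ep dt (%_. en c) y" by (rule Lop_add) auto
   also have "... <= en (u y + e * dt) + en (exp (- dt * V y) * c)"
    using True s[OF dt, of y] dt c by (intro add_mono) (auto simp: Lop_eq ennreal_mult')
   also have "... = en (u y + e * dt + exp (- dt * V y) * c)"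
    using nn[of y] e dt c by (simp flip: ennreal_plus)
   also have "... <= en (u y + exp (- v * (real (Suc n) * dt)) + real (Suc n) * dt * e)"
   proof (rule ennreal_leI)
    have m: "exp (- dt * V y) <= exp (- dt * v)" "exp (- dt * V y) <= 1"
    using Vv[OF y] V_nonneg[OF y] True dt by auto
    have "exp (- dt * V y) * c = exp (- dt * V y) * exp (- v * (real n * dt)) + exp (- dt * V y) * (real n * dt * e)"
    by (simp add: c_def distrib_left)
    also have "... <= exp (- dt * v) * exp (- v * (real n * dt)) + 1 * (real n * dt * e)"
    using m dt e by (intro add_mono mult_right_mono) auto
    finally show "u y + e * dt + exp (- dt * V y) * c <= u y + exp (- v * (real (Suc n) * dt)) + real (Suc n) * dt * e"
    unfolding ex by (simp add: algebra_simps)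
   qed
   finally show ?thesis .
  next
   case False
   then consider "norm y < ep" | "1 <= u y" by force
   then show ?thesis
   proof cases
    case 1 then show ?thesis by (simp add: Lop_eq)
   next
    case 2
    have "en 1 <= en (u y + exp (- v * (real (Suc n) * dt)) + real (Suc n) * dt * e)"
    using 2 nn' by (intro ennreal_leI) (simp add: add_increasing2)
    then have "1 <= en (u y + exp (- v * (real (Suc n) * dt)) + real (Suc n) * dt * e)"
    by (simp only: ennreal_1)
    with le1 show ?thesis by (rule order_trans)
   qed
  qed
  qed
  have lim: "(%n. (Lop ep (t / real (Suc n)) ^^ Suc n) (%y. kfac V ep (t / real (Suc n)) y * trunc k (%_. 1) y) x) \<longlonglongrightarrow> fk ep t (trunc k (%_. 1)) x"
  using ep t by (intro fk_tendsto heat_bounded[where c = "real k"] trunc_le') auto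
  have "(%n. t / real (Suc n)) \<longlonglongrightarrow> 0" using t by real_asymp
  then have ev: "eventually (%n. t / real (Suc n) < dt0) sequentially" using dt0 by (rule order_tendstoD)
  have "fk ep t (trunc k (%_. 1)) x <= en (u x + exp (- v * t) + t * e)"
  proof (rule tendsto_upperbound[OF lim])
  show "\<forall>\<^sub>F n in sequentially. (Lop ep (t / real (Suc n)) ^^ Suc n) (%y. kfac V ep (t / real (Suc n)) y * trunc k (%_. 1) y) x <= en (u x + exp (- v * t) + t * e)"
   using ev
  proof eventually_elim
   case (elim n)
   have "(Lop ep (t / real (Suc n)) ^^ Suc n) (%y. kfac V ep (t / real (Suc n)) y * trunc k (%_. 1) y) x
    <= (Lop ep (t / real (Suc n)) ^^ Suc n) (%_. 1) x"
   proof (rule Lop_pow_mono)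
    fix y :: "real^'n"
    have "kfac V ep (t / real (Suc n)) y * trunc k (%_. 1) y <= 1 * 1"
    using ep t by (intro mult_mono kfac_le_1 order_trans[OF trunc_le(2)]) auto
    then show "kfac V ep (t / real (Suc n)) y * trunc k (%_. 1) y <= 1" by simp
   qed
   also have "... <= en (u x + exp (- v * (real (Suc n) * (t / real (Suc n)))) + real (Suc n) * (t / real (Suc n)) * e)"
    using elim t by (intro pw) auto
   also have "real (Suc n) * (t / real (Suc n)) = t" by simp
   finally show ?case .
  qed
  qed simp
  also have "t * e = e'" using t by (simp add: e_def)
  finally show ?thesis using nn[of x] e' by (simp add: ennreal_plus add_nonneg_nonneg)
 qed
 show ?thesis by (rule ennreal_le_epsilon) (use * in auto)
qed
then show ?thesis unfolding P_SUP_trunc[OF t, of "%_. 1", simplified] by (intro SUP_least) (auto simp del: of_nat_Suc)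
qed

text \<open>A superharmonic radial profile \<open>N\<close>, as a function of \<open>y = (abs x)^2\<close>: the inner piece \<open>F0\<close> and the
outer piece \<open>Q0\<close> are glued at \<open>y0\<close> with a concave kink.\<close>
locale super_profile = brownian_killing M W V
for M :: "real^'n => 'w measure" and W V +
fixes N F0 F1 F2 Q0 Q1 Q2 :: "real => real" and y0 rh :: real
assumes dF: "!!y. y > 0 ==> DERIV F0 y :> F1 y" "!!y. y > 0 ==> DERIV F1 y :> F2 y"
 "continuous_on {0<..} F2"
 and dQ: "!!y. y > 0 ==> DERIV Q0 y :> Q1 y" "!!y. y > 0 ==> DERIV Q1 y :> Q2 y"
 "continuous_on {0<..} Q2"
 and N_eq: "!!y. N y = (if y <= y0 then F0 y else Q0 y)"
 and y0: "y0 > 0" and rh: "rh > 0"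
 and kink: "!!y. y0 <= y ==> y < y0 + rh ==> Q0 y <= F0 y" "!!y. y0 - rh < y ==> y <= y0 ==> F0 y <= Q0 y"
 and N_pos: "!!y. y > 0 ==> N y > 0"
 and N_mono: "!!y y'. 0 < y ==> y <= y' ==> N y <= N y'"
 and V_inner: "!!x. x ~= 0 ==> (norm x)^2 <= y0 ==>
  4 * (norm x)^2 * F2 ((norm x)^2) + 2 * real CARD('n) * F1 ((norm x)^2) <= V x * F0 ((norm x)^2)"
 and V_outer: "!!x. (norm x)^2 >= y0 ==>
  4 * (norm x)^2 * Q2 ((norm x)^2) + 2 * real CARD('n) * Q1 ((norm x)^2) <= V x * Q0 ((norm x)^2)"
begin

lemma N_cont: "continuous_on {0<..} N"
proof -
have F: "continuous_on {0<..} F0" "continuous_on {0<..} Q0"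
 using dF(1) dQ(1) by (auto intro!: continuous_at_imp_continuous_on DERIV_isCont)
have "F0 y0 = Q0 y0" using kink(1)[of y0] kink(2)[of y0] rh by simp
then have "continuous_on {0<..} (%y. if y <= y0 then F0 y else Q0 y)"
 by (intro continuous_on_cases_le continuous_on_subset[OF F(1)] continuous_on_subset[OF F(2)] continuous_intros) auto
then show ?thesis by (simp add: N_eq[abs_def])
qed

definition Kc :: "real^'n => real => real" where
"Kc l Y = exp (norm l * (sqrt Y + 1)) / N Y"

text \<open>A minimum of supersolutions: the exponential grows at rate \<open>|l|^2\<close> under
  the heat flow, and \<open>Kc l Y * N\<close> is stationary. The constant \<open>Kc\<close> makes
  the second function dominate the exponential on the shell just outside the sphere
  \<open>|z|^2 = Y\<close>, so the truncation at the sphere creates no upward jump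
  (\<open>us_le_KN\<close>). For \<open>l = 0\<close> this is the capped ratio
  \<open>N / N Y\<close>.\<close>

definition us :: "real^'n => real => real^'n => real" where
"us l Y z = (if z ~= 0 & (norm z)^2 < Y then min (exp (l \<bullet> z)) (Kc l Y * N ((norm z)^2)) else exp (l \<bullet> z))"

lemma us_measurable [measurable]: "us l Y \<in> bm"
proof -
have c: "continuous_on {z. z ~= (0::real^'n)} (%z. N ((norm z)^2))"
 by (rule continuous_on_compose2[OF N_cont]) (auto intro!: continuous_intros)
have [measurable]: "(%z::real^'n. ind {z. z ~= 0} z *\<^sub>R N ((norm z)^2)) \<in> bm"
 by (rule borel_measurable_continuous_on_indicator[OF _ c]) measurable
have "us l Y = (%z. if z ~= 0 & (norm z)^2 < Y then min (exp (l \<bullet> z)) (Kc l Y * (ind {z. z ~= 0} z *\<^sub>R N ((norm z)^2))) else exp (l \<bullet> z))"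
 by (auto simp: us_def fun_eq_iff)
also have "... \<in> bm" by measurable
finally show ?thesis .
qed

lemma Kc_pos: "Y > 0 ==> Kc l Y > 0"
using N_pos by (simp add: Kc_def)

lemma us_nonneg: "Y > 0 ==> 0 <= us l Y z"
using Kc_pos[of Y l] N_pos[of "(norm z)^2"] by (auto simp: us_def)

lemma us_le_exp: "us l Y z <= exp (l \<bullet> z)"
by (auto simp: us_def)

lemma us_le_norm: "us l Y z <= 1 * exp (norm l * norm z)"
using us_le_exp[of l Y z] norm_cauchy_schwarz[of l z] by (simp add: order_trans)

lemma us_le_KN:
assumes Y: "Y > 0" and z: "z ~= 0" "norm z <= sqrt Y + 1"
shows "us l Y z <= Kc l Y * N ((norm z)^2)"
proof (cases "(norm z)^2 < Y")
case True then show ?thesis using z by (simp add: us_def)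
next
case False
have "us l Y z <= exp (norm l * norm z)" using us_le_norm[of l Y z] by simp
also have "... <= exp (norm l * (sqrt Y + 1))" using z by (simp add: mult_left_mono)
also have "... = Kc l Y * N Y" using N_pos[OF Y] by (simp add: Kc_def)
also have "... <= Kc l Y * N ((norm z)^2)" using False Y Kc_pos[OF Y] by (intro mult_left_mono N_mono) (auto intro: less_imp_le)
finally show ?thesis .
qed

text \<open>At every point \<open>us\<close> equals the exponential or \<open>K\<close> times one of
  the two pieces of \<open>N\<close>, and it lies below that same function nearby: for the pieces
  because the kink is concave. So either the explicit heat evolution of the exponential or
  \<open>step_super\<close> for the active piece applies.\<close>

lemma us_step:
assumes Y: "Y > 0" and ep: "ep > 0" and e: "e > 0"
shows "\<exists>dt0>0. \<forall>dt x. 0 < dt & dt < dt0 & ep <= norm x -->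
  en (exp (- dt * V x)) * heat dt (%z. en (us l Y z)) x <= en (exp ((norm l)^2 * dt) * us l Y x + e * dt)"
proof -
define K where "K = Kc l Y"
have K: "K > 0" using Kc_pos[OF Y] by (simp add: K_def)
\<comment> \<open>Within this radius \<open>|z|^2\<close> moves by less than \<open>rh\<close>, so
  the comparison of the two pieces at the kink is available, and \<open>R <= ep\<close> keeps
  \<open>z\<close> away from the origin.\<close>
define R where "R = min (min ep 1) (rh / (2 * sqrt Y + 2))"
have sY: "2 * sqrt Y + 2 > 0" using Y by (simp add: add_nonneg_pos)
have R: "R > 0" "R <= ep" "R <= 1" "R * (2 * sqrt Y + 2) <= rh"
proof -
 show "R > 0" "R <= ep" "R <= 1" using ep rh sY by (auto simp: R_def)
 have "R <= rh / (2 * sqrt Y + 2)" by (simp add: R_def)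
 then show "R * (2 * sqrt Y + 2) <= rh" using sY by (simp only: pos_le_divide_eq)
qed
have near: "\<bar>(norm z)^2 - (norm x)^2\<bar> < rh & us l Y z <= K * N ((norm z)^2) & z ~= 0"
 if x: "ep <= norm x" "(norm x)^2 <= Y" and z: "norm (z - x) < R" for x z :: "real^'n"
proof -
 have xs: "norm x <= sqrt Y" using x(2) by (rule real_le_rsqrt)
 have "\<bar>(norm z)^2 - (norm x)^2\<bar> <= R * (2 * norm x + 1)" by (rule sq_dist_le[OF z R(3)])
 also have "... < R * (2 * sqrt Y + 2)" using xs R by (intro mult_strict_left_mono) auto
 also have "... <= rh" by (rule R(4))
 finally have 1: "\<bar>(norm z)^2 - (norm x)^2\<bar> < rh" .
 have 2: "z ~= 0" using x z R by auto
 have "norm z <= sqrt Y + 1" using xs z R norm_triangle_ineq2[of z x] by linarith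
 with us_le_KN[OF Y 2, of l] 1 2 show ?thesis by (simp add: K_def)
qed
have ep2: "ep^2 > 0" using ep by simp
have "\<exists>dt0>0. \<forall>dt (x::real^'n) u. 0 < dt & dt < dt0 & ep^2 <= (norm x)^2 & (norm x)^2 <= min y0 Y & u \<in> bm
  & (ALL z. 0 <= u z & u z <= 1 * exp (norm l * norm z)) & (ALL z. norm (z - x) < R --> u z <= K * F0 ((norm z)^2))
 --> en (exp (- dt * V x)) * heat dt (%z. en (u z)) x <= en (K * F0 ((norm x)^2) + e * dt)"
proof (rule step_super[of "%y. K * F0 y" "%y. K * F1 y" "%y. K * F2 y"])
 show "((%y. K * F0 y) has_real_derivative K * F1 y) (at y)" "((%y. K * F1 y) has_real_derivative K * F2 y) (at y)" if "y > 0" for y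
  using dF(1,2)[OF that] by (auto intro: DERIV_cmult)
 show "continuous_on {0<..} (%y. K * F2 y)" by (intro continuous_intros dF)
 fix x :: "real^'n" assume x: "ep^2 <= (norm x)^2" "(norm x)^2 <= min y0 Y"
 then have x0: "x ~= 0" using ep2 by auto
 show "0 <= V x & 4 * (norm x)^2 * (K * F2 ((norm x)^2)) + 2 * real CARD('n) * (K * F1 ((norm x)^2)) <= V x * (K * F0 ((norm x)^2))"
  using V_nonneg[OF x0] mult_left_mono[OF V_inner[OF x0], of K] x K by (auto simp: algebra_simps)
next
 fix y assume y: "ep^2 <= y" "y <= min y0 Y"
 have "0 < y" using y ep2 by linarith
 then have "0 <= F0 y" using N_pos[of y] y by (simp add: N_eq)
 then show "0 <= K * F0 y" using K by simp
qed (use R e ep2 in auto)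
then obtain dt1 where dt1: "dt1 > 0" and s1: "!!dt (x::real^'n) u. 0 < dt & dt < dt1 & ep^2 <= (norm x)^2 & (norm x)^2 <= min y0 Y & u \<in> bm
  & (ALL z. 0 <= u z & u z <= 1 * exp (norm l * norm z)) & (ALL z. norm (z - x) < R --> u z <= K * F0 ((norm z)^2))
 ==> ennreal (exp (- dt * V x)) * heat dt (%z. en (u z)) x <= en (K * F0 ((norm x)^2) + e * dt)"
 by blast
have "\<exists>dt0>0. \<forall>dt (x::real^'n) u. 0 < dt & dt < dt0 & y0 <= (norm x)^2 & (norm x)^2 <= Y & u \<in> bm
  & (ALL z. 0 <= u z & u z <= 1 * exp (norm l * norm z)) & (ALL z. norm (z - x) < R --> u z <= K * Q0 ((norm z)^2))
 --> en (exp (- dt * V x)) * heat dt (%z. en (u z)) x <= en (K * Q0 ((norm x)^2) + e * dt)"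
proof (rule step_super[of "%y. K * Q0 y" "%y. K * Q1 y" "%y. K * Q2 y"])
 show "((%y. K * Q0 y) has_real_derivative K * Q1 y) (at y)" "((%y. K * Q1 y) has_real_derivative K * Q2 y) (at y)" if "y > 0" for y
  using dQ(1,2)[OF that] by (auto intro: DERIV_cmult)
 show "continuous_on {0<..} (%y. K * Q2 y)" by (intro continuous_intros dQ)
 fix x :: "real^'n" assume x: "y0 <= (norm x)^2" "(norm x)^2 <= Y"
 then have x0: "x ~= 0" using y0 by auto
 show "0 <= V x & 4 * (norm x)^2 * (K * Q2 ((norm x)^2)) + 2 * real CARD('n) * (K * Q1 ((norm x)^2)) <= V x * (K * Q0 ((norm x)^2))"
  using V_nonneg[OF x0] mult_left_mono[OF V_outer[OF x(1)], of K] K by (auto simp: algebra_simps)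
next
 fix y assume y: "y0 <= y" "y <= Y"
 have "F0 y0 = Q0 y0" using kink(1)[of y0] kink(2)[of y0] rh by simp
 then have "N y = Q0 y" using y by (auto simp: N_eq)
 then show "0 <= K * Q0 y" using K N_pos[of y] y y0 by simp
qed (use R e y0 in auto)
then obtain dt2 where dt2: "dt2 > 0" and s2: "!!dt (x::real^'n) u. 0 < dt & dt < dt2 & y0 <= (norm x)^2 & (norm x)^2 <= Y & u \<in> bm
  & (ALL z. 0 <= u z & u z <= 1 * exp (norm l * norm z)) & (ALL z. norm (z - x) < R --> u z <= K * Q0 ((norm z)^2))
 ==> ennreal (exp (- dt * V x)) * heat dt (%z. en (u z)) x <= en (K * Q0 ((norm x)^2) + e * dt)"
 by blast
show ?thesis
proof (intro exI[of _ "min dt1 dt2"] conjI allI impI)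
 show "min dt1 dt2 > 0" using dt1 dt2 by simp
 fix dt and x :: "real^'n" assume H: "0 < dt & dt < min dt1 dt2 & ep <= norm x"
 then have x0: "x ~= 0" using ep by auto
 have xep: "ep^2 <= (norm x)^2" using H ep by (intro power_mono) auto
 have m1: "en (exp (- dt * V x)) <= 1" using V_nonneg[OF x0] H by simp
 have ex1: "1 <= exp ((norm l)^2 * dt)" using H by simp
 show "en (exp (- dt * V x)) * heat dt (%z. en (us l Y z)) x <= en (exp ((norm l)^2 * dt) * us l Y x + e * dt)"
 proof (cases "us l Y x = exp (l \<bullet> x)")
  case True
  have "en (exp (- dt * V x)) * heat dt (%z. en (us l Y z)) x <= 1 * heat dt (%z. en (exp (l \<bullet> z))) x"
  by (intro mult_mono m1 heat_mono ennreal_leI us_le_exp) auto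
  also have "... = en (exp ((norm l)^2 * dt) * us l Y x)"
  unfolding heat_def using H by (subst nn_integral_gauss_exp) (auto simp: True exp_add mult.commute)
  also have "... <= en (exp ((norm l)^2 * dt) * us l Y x + e * dt)" using e H by (intro ennreal_leI) simp
  finally show ?thesis .
 next
  case False
  then have xY: "(norm x)^2 < Y" and ux: "us l Y x = K * N ((norm x)^2)"
  by (auto simp: us_def K_def min_def split: if_splits)
  have le: "en (us l Y x + e * dt) <= en (exp ((norm l)^2 * dt) * us l Y x + e * dt)"
  using mult_right_mono[OF ex1 us_nonneg[OF Y, of l x]] by (intro ennreal_leI) simp
  show ?thesis
  proof (cases "(norm x)^2 <= y0")
  case True
  have "en (exp (- dt * V x)) * heat dt (%z. en (us l Y z)) x <= en (K * F0 ((norm x)^2) + e * dt)"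
  proof (rule s1, intro conjI allI impI)
   fix z assume z: "norm (z - x) < R"
   have n: "\<bar>(norm z)^2 - (norm x)^2\<bar> < rh" "us l Y z <= K * N ((norm z)^2)" using near[of x z] H xY z by auto
   have "N ((norm z)^2) <= F0 ((norm z)^2)" using kink(1)[of "(norm z)^2"] n True by (auto simp: N_eq)
   then show "us l Y z <= K * F0 ((norm z)^2)" using n(2) K by (meson mult_left_mono less_imp_le order_trans)
  qed (use H True xY xep us_nonneg[OF Y] us_le_norm in auto)
  also have "K * F0 ((norm x)^2) = us l Y x" using True ux by (simp add: N_eq)
  finally show ?thesis using le by (rule order_trans)
  next
  case F: False
  have "en (exp (- dt * V x)) * heat dt (%z. en (us l Y z)) x <= en (K * Q0 ((norm x)^2) + e * dt)"
  proof (rule s2, intro conjI allI impI)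
   fix z assume z: "norm (z - x) < R"
   have n: "\<bar>(norm z)^2 - (norm x)^2\<bar> < rh" "us l Y z <= K * N ((norm z)^2)" using near[of x z] H xY z by auto
   have "N ((norm z)^2) <= Q0 ((norm z)^2)" using kink(2)[of "(norm z)^2"] n F by (auto simp: N_eq)
   then show "us l Y z <= K * Q0 ((norm z)^2)" using n(2) K by (meson mult_left_mono less_imp_le order_trans)
  qed (use H F xY us_nonneg[OF Y] us_le_norm in auto)
  also have "K * Q0 ((norm x)^2) = us l Y x" using F ux by (simp add: N_eq)
  finally show ?thesis using le by (rule order_trans)
  qed
 qed
qed
qed

lemma P_us_le:
assumes "Y > 0" "t > 0" "f \<in> bm" "!!z. f z <= en (us l Y z)"
shows "P t f x <= en (exp ((norm l)^2 * t) * us l Y x)"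
by (rule supersolution_bound) (use assms us_nonneg us_step[OF assms(1)] in auto)

text \<open>Outside the ball \<open>us\<close> is the full exponential, whereas at \<open>x\<close>
  inside it is at most \<open>Kc * N\<close>; reaching the outside therefore costs
  \<open>N (|x|^2) / N Y\<close>.\<close>

lemma P_exp_outside:
assumes Y: "Y > 0" and t: "t > 0" and x: "x ~= 0" "(norm x)^2 < Y"
shows "P t (%z. en (exp (l \<bullet> z)) * ind {z. Y <= (norm z)^2} z) x
 <= en (exp ((norm l)^2 * t + norm l * (sqrt Y + 1)) * (N ((norm x)^2) / N Y))"
proof -
have "P t (%z. en (exp (l \<bullet> z)) * ind {z. Y <= (norm z)^2} z) x <= en (exp ((norm l)^2 * t) * us l Y x)"
 by (rule P_us_le[OF Y t]) (auto simp: us_def split: split_indicator)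
also have "... <= en (exp ((norm l)^2 * t) * (Kc l Y * N ((norm x)^2)))"
 using x by (intro ennreal_leI mult_left_mono) (auto simp: us_def)
also have "exp ((norm l)^2 * t) * (Kc l Y * N ((norm x)^2)) = exp ((norm l)^2 * t + norm l * (sqrt Y + 1)) * (N ((norm x)^2) / N Y)"
 by (simp add: Kc_def exp_add)
finally show ?thesis .
qed

lemma us0: "Y > 0 ==> us 0 Y z = (if z ~= 0 & (norm z)^2 < Y then N ((norm z)^2) / N Y else 1)"
using N_mono[of "(norm z)^2" Y] N_pos[of Y] by (auto simp: us_def Kc_def min_def field_simps)

lemma us0_le: "Y > 0 ==> x ~= 0 ==> us 0 Y x <= N ((norm x)^2) / N Y"
using N_mono[of Y "(norm x)^2"] N_pos[of Y] by (auto simp: us0)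

text \<open>Survival up to time \<open>t\<close> requires leaving the ball or resisting the rate
  \<open>v\<close> all the time.\<close>

lemma P_decay:
assumes Y: "Y > 0" and t: "t > 0" and v: "v >= 0" and Vv: "!!x. x ~= 0 ==> (norm x)^2 < Y ==> v <= V x"
shows "P t (%_. 1) x <= en (us 0 Y x) + en (exp (- v * t))"
proof -
have "P t (%_. 1) x <= en (us 0 Y x + exp (- v * t))"
proof (rule supersolution_decay[OF _ _ _ v _ _ t])
 show "us 0 Y y <= 1" for y using us_le_exp[of 0 Y y] by simp
 show "v <= V x" if "x ~= 0" "us 0 Y x < 1" for x using that Vv[of x] us0[OF Y, of x] by (auto split: if_splits)
qed (use us_nonneg[OF Y] us_step[OF Y, of _ _ 0] in auto)
then show ?thesis using us_nonneg[OF Y] by (simp add: ennreal_plus)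
qed

lemma P_sum:
assumes "t > 0" "!!j. f j \<in> bm"
shows "P t (%z. \<Sum>j<J. c j * f j z) x = (\<Sum>j<(J::nat). c j * P t (f j) x)"
proof (induction J)
case 0
show ?case by (simp add: P_def)
next
case (Suc J)
have "P t (%z. \<Sum>j<Suc J. c j * f j z) x = P t (%z. \<Sum>j<J. c j * f j z) x + P t (%z. c J * f J z) x"
 using assms by (subst P_add[symmetric]) auto
then show ?case using Suc assms by (simp add: P_cmult)
qed

lemma P_1_antimono:
assumes "0 < s" "s <= t"
shows "P t (%_. 1) x <= P s (%_. 1) x"
proof (cases "s = t")
case False
then have "P (s + (t - s)) (%_. 1) x = P s (P (t - s) (%_. 1)) x"
 using assms by (intro P_semigroup) auto
also have "... <= P s (%_. 1) x" using assms False by (intro P_mono P_const_le) auto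
finally show ?thesis by simp
qed simp

text \<open>Survival started near the origin: on the dyadic scales \<open>y j\<close> the process either leaves the ball,
which costs \<open>N ((abs x)^2) / N (y j)\<close>, or is killed at rate \<open>v j\<close> during time \<open>ta j\<close>.\<close>
lemma P_1_dyadic:
fixes y ta v :: "nat => real"
assumes "!!j. y j > 0" "!!j. ta j > 0" "!!j. v j >= 0" "!!j x. x ~= 0 ==> (norm x)^2 < y j ==> v j <= V x"
shows "P (\<Sum>j\<le>J. ta j) (%_. 1) x <= en (us 0 (y 0) x) + (\<Sum>j<J. en (exp (- v j * ta j)) * en (us 0 (y (Suc j)) x))
 + en (exp (- v J * ta J))"
proof (induction J arbitrary: x)
case 0
show ?case using P_decay[of "y 0" "ta 0" "v 0" x] assms by simp
next
case (Suc J)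
define S where "S = (\<Sum>j\<le>J. ta j)"
have S: "S > 0" unfolding S_def using assms by (intro sum_pos) auto
define g where "g x = en (us 0 (y 0) x) + (\<Sum>j<J. en (exp (- v j * ta j)) * en (us 0 (y (Suc j)) x))" for x
have [measurable]: "g \<in> bm" unfolding g_def by measurable
define \<theta> where "\<theta> j = en (exp (- v j * ta j))" for j
have us_inv: "P (ta (Suc J)) (%z. en (us 0 (y j) z)) x <= en (us 0 (y j) x)" for j
 using P_us_le[of "y j" "ta (Suc J)" "%z. en (us 0 (y j) z)" 0 x] assms by simp
have g_inv: "P (ta (Suc J)) g x <= g x"
proof -
 have "P (ta (Suc J)) g x = P (ta (Suc J)) (%x. en (us 0 (y 0) x)) x
  + P (ta (Suc J)) (%x. \<Sum>j<J. \<theta> j * en (us 0 (y (Suc j)) x)) x"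
  unfolding g_def \<theta>_def using assms by (intro P_add) auto
 also have "P (ta (Suc J)) (%x. \<Sum>j<J. \<theta> j * en (us 0 (y (Suc j)) x)) x
  = (\<Sum>j<J. \<theta> j * P (ta (Suc J)) (%x. en (us 0 (y (Suc j)) x)) x)"
  using assms by (intro P_sum) auto
 finally show ?thesis unfolding g_def \<theta>_def[symmetric] by (simp add: add_mono us_inv sum_mono mult_left_mono)
qed
have "P (\<Sum>j\<le>Suc J. ta j) (%_. 1) x = P (ta (Suc J)) (P S (%_. 1)) x"
 using P_semigroup[of "ta (Suc J)" S "%_. 1" x] S assms by (simp add: S_def add.commute)
also have "... <= P (ta (Suc J)) (%z. g z + \<theta> J * 1) x"
 using Suc unfolding S_def g_def \<theta>_def by (intro P_mono) simp
also have "... = P (ta (Suc J)) g x + \<theta> J * P (ta (Suc J)) (%_. 1) x"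
 using assms by (subst P_add) (auto simp: P_cmult[symmetric])
also have "... <= g x + \<theta> J * (en (us 0 (y (Suc J)) x) + \<theta> (Suc J))"
 unfolding \<theta>_def using assms by (intro add_mono g_inv mult_left_mono P_decay) auto
also have "... <= g x + (\<theta> J * en (us 0 (y (Suc J)) x) + 1 * \<theta> (Suc J))"
proof -
 have "0 <= v J * ta J" using assms(2,3)[of J] by simp
 then show ?thesis unfolding distrib_left by (intro add_mono mult_right_mono) (auto simp: \<theta>_def)
qed
finally show ?case by (simp add: g_def \<theta>_def add.assoc)
qed

end

section \<open>Survival probabilities and the integrated upper bound for the kernel\<close>

definition cube :: "real^'n => real => (real^'n) set" where
"cube c s = cbox (c - vec s) (c + vec s)"

lemma mem_cube: "z \<in> cube c s \<longleftrightarrow> (ALL i. \<bar>z $ i - c $ i\<bar> <= s)"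
by (auto simp: cube_def mem_box_cart abs_le_iff algebra_simps)

lemma cube_measurable [measurable]: "cube c s \<in> sets borel"
by (simp add: cube_def)

lemma emeasure_cube:
fixes c :: "real^'n"
assumes "s >= 0"
shows "emeasure lborel (cube c s) = en ((2 * s) ^ CARD('n))"
proof -
have b: "(c + vec s - (c - vec s)) \<bullet> b = 2 * s" "(c - vec s) \<bullet> b <= (c + vec s) \<bullet> b" if "b \<in> Basis" for b
proof -
 have "(vec s :: real^'n) \<bullet> b = s" using that by (auto simp: Basis_vec_def inner_axis)
 then show "(c + vec s - (c - vec s)) \<bullet> b = 2 * s" "(c - vec s) \<bullet> b <= (c + vec s) \<bullet> b"
  unfolding inner_diff_left inner_add_left using assms by linarith+
qed
have "emeasure lborel (cube c s) = (\<Prod>b\<in>(Basis :: (real^'n) set). (c + vec s - (c - vec s)) \<bullet> b)"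
 unfolding cube_def by (intro emeasure_lborel_cbox b)
also have "(\<Prod>b\<in>(Basis :: (real^'n) set). (c + vec s - (c - vec s)) \<bullet> b) = (\<Prod>b\<in>(Basis :: (real^'n) set). 2 * s)"
 by (intro prod.cong refl b)
finally show ?thesis by simp
qed

lemma gauss_norm_const: "s > 0 ==> (4 * pi * s) powr (- real n / 2) = (1 / sqrt (4 * pi * s)) ^ n"
proof -
assume s: "s > 0"
have "(4 * pi * s) powr (- real n / 2) = ((4 * pi * s) powr (- 1 / 2)) powr real n"
 by (simp add: powr_powr)
also have "(4 * pi * s) powr (- 1 / 2) = 1 / sqrt (4 * pi * s)"
 using s powr_minus_divide[of "4 * pi * s" "1 / 2"] powr_half_sqrt[of "4 * pi * s"] by simp
also have "(1 / sqrt (4 * pi * s)) powr real n = (1 / sqrt (4 * pi * s)) ^ n"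
 using s by (intro powr_realpow) simp
finally show ?thesis .
qed

text \<open>The ball lies in a cube of side \<open>2 a sqrt T\<close> and the density at time
  \<open>T / 2\<close> is at most \<open>(2 pi T)^(-d/2)\<close>. The resulting
  \<open>(2 a / sqrt (2 pi))^d\<close> is at most \<open>a\<close>, since the dimension is at least
  1.\<close>

lemma heat_ball_le:
fixes x :: "real^'n"
assumes T: "T > 0" and a: "0 < a" "a <= 1"
shows "heat (T / 2) (ind {z. (norm z)^2 < a^2 * T}) x <= en a"
proof -
define s where "s = a * sqrt T"
have s: "s > 0" using T a by (simp add: s_def)
have sub: "{z :: real^'n. (norm z)^2 < a^2 * T} \<subseteq> cube 0 s"
proof
 fix z :: "real^'n" assume "z \<in> {z. (norm z)^2 < a^2 * T}"
 then have "(norm z)^2 <= s^2" using T by (simp add: s_def power_mult_distrib)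
 then have "norm z <= s" using s by (simp add: power2_le_iff_abs_le)
 then show "z \<in> cube 0 s" using component_le_norm_cart[of z] by (auto simp: mem_cube intro: order_trans)
qed
have "heat (T / 2) (ind {z. (norm z)^2 < a^2 * T}) x
 <= (NN z. en ((4 * pi * (T / 2)) powr (- real CARD('n) / 2)) * ind (cube (0::real^'n) s) z)"
 unfolding heat_def using T sub
 by (intro nn_integral_mono mult_mono ennreal_leI gauss_q_le) (auto split: split_indicator)
also have "... = en ((4 * pi * (T / 2)) powr (- real CARD('n) / 2)) * emeasure lborel (cube (0::real^'n) s)"
 by (rule nn_integral_cmult_indicator) simp
also have "... = en ((1 / sqrt (4 * pi * (T / 2))) ^ CARD('n) * (2 * s) ^ CARD('n))"
 using T s by (subst gauss_norm_const) (simp_all add: emeasure_cube ennreal_mult''[symmetric] del: times_divide_eq_right)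
also have "(1 / sqrt (4 * pi * (T / 2))) ^ CARD('n) * (2 * s) ^ CARD('n) = ((1 / sqrt (4 * pi * (T / 2))) * (2 * s)) ^ CARD('n)"
 by (rule power_mult_distrib[symmetric])
also have "(1 / sqrt (4 * pi * (T / 2))) * (2 * s) = a * (2 / sqrt (2 * pi))"
 using T by (simp add: s_def real_sqrt_mult field_simps)
also have "en ((a * (2 / sqrt (2 * pi))) ^ CARD('n)) <= en a"
proof (rule ennreal_leI)
 have "sqrt (2^2) <= sqrt (2 * pi)" using pi_gt3 by (intro real_sqrt_le_mono) simp
 then have "2 <= sqrt (2 * pi)" by simp
 then have "2 / sqrt (2 * pi) <= 1" by simp
 then have "a * (2 / sqrt (2 * pi)) <= a * 1" using a by (intro mult_left_mono) auto
 then have q: "0 <= a * (2 / sqrt (2 * pi))" "a * (2 / sqrt (2 * pi)) <= a"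
  using a by simp_all
 have "(a * (2 / sqrt (2 * pi))) ^ CARD('n) <= (a * (2 / sqrt (2 * pi))) ^ 1"
  using q a(2) by (intro power_decreasing) (auto simp: Suc_le_eq simp del: times_divide_eq_right)
 also have "... <= a" using q(2) by (simp only: power_one_right)
 finally show "(a * (2 / sqrt (2 * pi))) ^ CARD('n) <= a" .
qed
finally show ?thesis .
qed

lemma (in brownian_killing) P_ball_le:
assumes T: "T > 0" and a: "0 < a" "a <= 1"
shows "P T (ind {z. (norm z)^2 < a^2 * T}) x <= en a * P (T / 2) (%_. 1) x"
proof -
let ?B = "{z. (norm z)^2 < a^2 * T}"
have "P T (ind ?B) x = P (T / 2) (P (T / 2) (ind ?B)) x"
 using P_semigroup[of "T / 2" "T / 2" "ind ?B" x] T by simp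
also have "... <= P (T / 2) (%_. en a * 1) x"
proof (rule P_mono)
 fix z
 have "P (T / 2) (ind ?B) z <= heat (T / 2) (ind ?B) z"
  using T by (intro P_le_heat) auto
 also have "... <= en a" by (rule heat_ball_le[OF T a])
 finally show "P (T / 2) (ind ?B) z <= en a * 1" by simp
qed
also have "... = en a * P (T / 2) (%_. 1) x" using T by (intro P_cmult) auto
finally show ?thesis .
qed

text \<open>Quantitative data on the profile. \<open>growth\<close> is doubling with at most linear
  growth in \<open>y\<close>. Below the scale \<open>ys j\<close> the killing rate is at least
  \<open>vs j\<close>, and \<open>dyadic\<close> says that resisting this rate for a time
  \<open>ta / 2^(j+1)\<close> is less likely than \<open>N\<close> at the next scale, with a
  summable factor to spare.\<close>

locale super_growth = super_profile M W V N F0 F1 F2 Q0 Q1 Q2 y0 rh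
for M :: "real^'n => 'w measure" and W V N F0 F1 F2 Q0 Q1 Q2 y0 rh +
fixes ys vs :: "nat => real"
assumes growth: "!!y1. y1 > 0 ==> \<exists>C\<ge>1. \<forall>y\<ge>y1. \<forall>c\<ge>1. N (c * y) <= C * c * N y"
 and ys_pos: "!!j. ys j > 0" and ys_small: "!!y. y > 0 ==> EX j. ys j <= y"
 and vs_nonneg: "!!j. vs j >= 0" and vs_V: "!!j x. x ~= 0 ==> (norm x)^2 < ys j ==> vs j <= V x"
 and dyadic: "!!ta. ta > 0 ==> \<exists>C\<ge>0. ALL j. exp (- vs j * (ta / 2 ^ Suc j)) * 2 ^ Suc j <= C * N (ys (Suc j))"
begin

text \<open>The times \<open>ta / 2^(j+1)\<close> sum to at most \<open>ta\<close>, so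
  \<open>P_1_dyadic\<close> applies. The scale \<open>j\<close> contributes
  \<open>exp (- vs j * ta / 2^(j+1)) * N (|x|^2) / N (ys (j+1))\<close>, and \<open>dyadic\<close>
  makes these terms a geometric series times \<open>N (|x|^2)\<close>.\<close>

lemma survival_small:
assumes ta: "ta > 0"
shows "\<exists>C>0. ALL x. x ~= 0 --> P ta (%_. 1) x <= en (C * N ((norm x)^2))"
proof -
obtain C where C: "C >= 0" "!!j. exp (- vs j * (ta / 2 ^ Suc j)) * 2 ^ Suc j <= C * N (ys (Suc j))"
 using dyadic[OF ta] by blast
define \<theta> where "\<theta> j = exp (- vs j * (ta / 2 ^ Suc j))" for j
have Ny: "N (ys j) > 0" for j using N_pos ys_pos by auto
have \<theta>: "\<theta> j / N (ys (Suc j)) <= C * (1 / 2) ^ Suc j" for j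
 using C(2)[of j] Ny[of "Suc j"] unfolding \<theta>_def[symmetric] by (simp add: field_simps power_one_over)
have geo: "(\<Sum>j<J. C * (1 / 2 :: real) ^ Suc j) <= C" for J
proof -
 have "(\<Sum>j<J. (1 / 2 :: real) ^ Suc j) = 1 - (1 / 2) ^ J" by (induction J) auto
 then have "(\<Sum>j<J. C * (1 / 2 :: real) ^ Suc j) = C * (1 - (1 / 2) ^ J)" by (simp only: sum_distrib_left[symmetric])
 also have "... <= C * 1" using C by (intro mult_left_mono) auto
 finally show ?thesis by simp
qed
have sumta: "(\<Sum>j\<le>J. ta / 2 ^ Suc j) <= ta" for J
proof -
 have "(\<Sum>j\<le>J. ta / 2 ^ Suc j) = ta * (1 - (1 / 2) ^ Suc J)"
  by (induction J) (auto simp: field_simps power_one_over)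
 also have "... <= ta * 1" using ta by (intro mult_left_mono) auto
 finally show ?thesis by simp
qed
define C' where "C' = 1 / N (ys 0) + 2 * C"
have C': "C' > 0" "C' * N (ys 0) >= 1" using Ny[of 0] C(1) by (auto simp: C'_def field_simps add_pos_nonneg)
show ?thesis
proof (intro exI[of _ C'] conjI allI impI C'(1))
 fix x :: "real^'n" assume x: "x ~= 0"
 define n where "n = N ((norm x)^2)"
 have n: "n > 0" using N_pos x by (simp add: n_def)
 show "P ta (%_. 1) x <= en (C' * N ((norm x)^2))"
 proof (cases "ys 0 <= (norm x)^2")
  case True
  have NN: "C' * N (ys 0) <= C' * N ((norm x)^2)"
  using C'(1) by (intro mult_left_mono N_mono[OF ys_pos True]) simp
  have "P ta (%_. 1) x <= en 1" using P_const_le[OF ta, of 1 x] by simp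
  also have "... <= en (C' * N ((norm x)^2))"
  using C'(2) NN by (intro ennreal_leI) linarith
  finally show ?thesis .
 next
  case False
  \<comment> \<open>The first scale not above \<open>|x|^2\<close>. The dyadic estimate is stopped
    at its predecessor \<open>J'\<close>, so that the last term, resisting the rate at scale
    \<open>J'\<close>, is bounded through \<open>N (ys J) <= N (|x|^2)\<close>.\<close>
  define J where "J = (LEAST j. ys j <= (norm x)^2)"
  have "EX j. ys j <= (norm x)^2" using ys_small[of "(norm x)^2"] x by simp
  then have J1: "ys J <= (norm x)^2" unfolding J_def by (rule LeastI_ex)
  with False obtain J' where J': "J = Suc J'" by (cases J) auto
  have th: "\<theta> J' <= C * n"
  proof -
  have "\<theta> J' <= \<theta> J' * 2 ^ Suc J'" using one_le_power[of "2::real" "Suc J'"]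
   by (auto simp: \<theta>_def mult_le_cancel_left1 simp del: power_Suc)
  also have "... <= C * N (ys J)" using C(2)[of J'] by (simp add: \<theta>_def J')
  also have "... <= C * n" unfolding n_def using C ys_pos J1 by (intro mult_left_mono N_mono) auto
  finally show ?thesis .
  qed
  have us: "us 0 (ys j) x <= n / N (ys j)" for j unfolding n_def by (rule us0_le[OF ys_pos x])
  have "P ta (%_. 1) x <= P (\<Sum>j\<le>J'. ta / 2 ^ Suc j) (%_. 1) x"
  using ta by (intro P_1_antimono sumta sum_pos) auto
  also have "... <= en (us 0 (ys 0) x) + (\<Sum>j<J'. en (\<theta> j) * en (us 0 (ys (Suc j)) x)) + en (\<theta> J')"
  unfolding \<theta>_def using ta ys_pos vs_nonneg vs_V by (intro P_1_dyadic) auto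
  also have "... = en (us 0 (ys 0) x + (\<Sum>j<J'. \<theta> j * us 0 (ys (Suc j)) x) + \<theta> J')"
  proof -
  have p: "0 <= us 0 (ys j) x" "0 <= \<theta> j" for j using us_nonneg[OF ys_pos] by (auto simp: \<theta>_def)
  then show ?thesis by (simp add: sum_nonneg flip: ennreal_mult' ennreal_plus)
  qed
  also have "... <= en (C' * n)"
  proof (rule ennreal_leI)
  have "(\<Sum>j<J'. \<theta> j * us 0 (ys (Suc j)) x) <= (\<Sum>j<J'. (C * (1 / 2) ^ Suc j) * n)"
  proof (rule sum_mono)
   fix j
   have "\<theta> j * us 0 (ys (Suc j)) x <= \<theta> j * (n / N (ys (Suc j)))" using us by (intro mult_left_mono) (auto simp: \<theta>_def)
   also have "... = \<theta> j / N (ys (Suc j)) * n" by simp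
   also have "... <= C * (1 / 2) ^ Suc j * n" using n by (intro mult_right_mono \<theta>) auto
   finally show "\<theta> j * us 0 (ys (Suc j)) x <= (C * (1 / 2) ^ Suc j) * n" .
  qed
  also have "... = (\<Sum>j<J'. C * (1 / 2) ^ Suc j) * n" by (rule sum_distrib_right[symmetric])
  also have "... <= C * n" using geo n by (intro mult_right_mono) auto
  finally show "us 0 (ys 0) x + (\<Sum>j<J'. \<theta> j * us 0 (ys (Suc j)) x) + \<theta> J' <= C' * n"
   using us[of 0] th unfolding C'_def by (simp add: distrib_right)
  qed
  finally show ?thesis by (simp add: n_def)
 qed
qed
qed

text \<open>At time \<open>T\<close> the surviving process is either at distance at least
  \<open>a sqrt T\<close>, which costs \<open>N (|x|^2) / N (a^2 T)\<close>, or in the ball of that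
  radius, which has conditional probability at most \<open>a\<close> given survival to
  \<open>T / 2\<close>.\<close>

lemma survival_step:
assumes T: "T > 0" and a: "0 < a" "a <= 1" and x: "x ~= 0"
shows "P T (%_. 1) x <= en (N ((norm x)^2) / N (a^2 * T)) + en a * P (T / 2) (%_. 1) x"
proof -
define Y where "Y = a^2 * T"
have Y: "Y > 0" using T a by (simp add: Y_def)
have "P T (%_. 1) x <= P T (%z. en (us 0 Y z) + ind {z. (norm z)^2 < Y} z) x"
 by (intro P_mono) (auto simp: us0[OF Y] split: split_indicator)
also have "... = P T (%z. en (us 0 Y z)) x + P T (ind {z. (norm z)^2 < Y}) x"
 using T by (intro P_add) auto
finally have 1: "P T (%_. 1) x <= P T (%z. en (us 0 Y z)) x + P T (ind {z. (norm z)^2 < Y}) x" .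
have "P T (%z. en (us 0 Y z)) x <= en (us 0 Y x)"
 using P_us_le[OF Y T, of "%z. en (us 0 Y z)" 0 x] by simp
also have "... <= en (N ((norm x)^2) / N Y)" by (intro ennreal_leI us0_le Y x)
finally have 2: "P T (%z. en (us 0 Y z)) x <= en (N ((norm x)^2) / N Y)" .
have 3: "P T (ind {z. (norm z)^2 < Y}) x <= en a * P (T / 2) (%_. 1) x"
 unfolding Y_def by (rule P_ball_le[OF T a])
show ?thesis using 1 add_mono[OF 2 3] unfolding Y_def by (rule order_trans)
qed

definition H :: "real => real^'n => real" where
"H T x = min 1 (N ((norm x)^2) / N T)"

lemma H_bounds: "T > 0 ==> x ~= 0 ==> 0 < H T x" "H T x <= 1" "H T x <= N ((norm x)^2) / N T"
using N_pos by (auto simp: H_def)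

text \<open>Iterate \<open>survival_step\<close> over halvings of \<open>T\<close> down to the
  interval \<open>[ta, 2 ta)\<close>, where \<open>survival_small\<close> starts the
  induction.\<close>

lemma survival_bound:
assumes ta: "ta > 0"
shows "\<exists>K\<ge>1. \<forall>T\<ge>ta. ALL x. x ~= 0 --> P T (%_. 1) x <= en (K * H T x)"
proof -
obtain C0 where C0: "C0 > 0" "!!x. x ~= 0 ==> P ta (%_. 1) x <= en (C0 * N ((norm x)^2))"
 using survival_small[OF ta] by blast
obtain C1 where C1: "C1 >= 1" "!!y c. y >= ta ==> c >= 1 ==> N (c * y) <= C1 * c * N y"
 using growth[OF ta] by blast
\<comment> \<open>Halving \<open>T\<close> loses the factor \<open>2 * C1\<close> in
  \<open>N\<close>; with this \<open>a\<close> the recursive term is at most half of the claimed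
  bound, and the other half pays for the escape term.\<close>
define a where "a = 1 / (4 * C1)"
have a: "0 < a" "a <= 1" using C1 by (auto simp: a_def)
have ata: "a^2 * ta > 0" using a ta by simp
obtain C2 where C2: "C2 >= 1" "!!y c. y >= a^2 * ta ==> c >= 1 ==> N (c * y) <= C2 * c * N y"
 using growth[OF ata] by blast
define Da where "Da = C2 * (1 / a^2)"
have Da: "Da > 0" using C2 a by (simp add: Da_def)
have NDa: "N T <= Da * N (a^2 * T)" if "T >= ta" for T
proof -
 have "a^2 <= 1" using a by (simp add: power_le_one)
 then have "1 <= 1 / a^2" using a by simp
 then show ?thesis using C2(2)[of "a^2 * T" "1 / a^2"] that a by (simp add: Da_def)
qed
have ND: "N T <= 2 * C1 * N (T / 2)" if "T / 2 >= ta" for T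
 using C1(2)[of "T / 2" 2] that by simp
define K where "K = max 1 (max (C0 * N (2 * ta)) (2 * Da))"
have K: "K >= 1" "K >= C0 * N (2 * ta)" "K >= 2 * Da" by (auto simp: K_def)
have main: "P T (%_. 1) x <= en (K * (N ((norm x)^2) / N T))" if "ta <= T" "T < ta * 2 ^ k" "x ~= 0" for T x k
 using that
proof (induction k arbitrary: T)
 case 0 then show ?case by simp
next
 case (Suc k)
 have NT: "N T > 0" and Nx: "N ((norm x)^2) > 0" using N_pos Suc ta by auto
 show ?case
 proof (cases "T < 2 * ta")
  case True
  have "P T (%_. 1) x <= P ta (%_. 1) x" using Suc ta by (intro P_1_antimono) auto
  also have "... <= en (C0 * N ((norm x)^2))" using Suc by (intro C0) auto
  also have "... <= en (K * (N ((norm x)^2) / N T))"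
  proof (rule ennreal_leI)
  have "C0 * N T <= C0 * N (2 * ta)" using True Suc ta C0 by (intro mult_left_mono N_mono) auto
  then have "C0 <= K / N T" using K(2) NT by (simp add: pos_le_divide_eq)
  then have "C0 * N ((norm x)^2) <= K / N T * N ((norm x)^2)" using Nx by (intro mult_right_mono) auto
  then show "C0 * N ((norm x)^2) <= K * (N ((norm x)^2) / N T)" by simp
  qed
  finally show ?thesis .
 next
  case False
  have T2: "ta <= T / 2" "T / 2 < ta * 2 ^ k" using False Suc by auto
  have NT2: "N (T / 2) > 0" "N (a^2 * T) > 0" using N_pos T2 ta a Suc by auto
  have "P T (%_. 1) x <= en (N ((norm x)^2) / N (a^2 * T)) + en a * P (T / 2) (%_. 1) x"
  using Suc ta a by (intro survival_step) auto
  also have "... <= en (N ((norm x)^2) / N (a^2 * T)) + en a * en (K * (N ((norm x)^2) / N (T / 2)))"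
  using Suc T2 by (intro add_left_mono mult_left_mono Suc.IH) auto
  also have "... = en (N ((norm x)^2) / N (a^2 * T) + a * (K * (N ((norm x)^2) / N (T / 2))))"
  using NT2 Nx a K by (simp flip: ennreal_mult' ennreal_plus)
  also have "... <= en (K * (N ((norm x)^2) / N T))"
  proof (rule ennreal_leI)
  have "N ((norm x)^2) / N (a^2 * T) <= N ((norm x)^2) * (Da / N T)"
   using NDa[OF Suc.prems(1)] NT NT2 Nx by (simp add: field_simps)
  moreover have "a * (K * (N ((norm x)^2) / N (T / 2))) <= a * (K * (N ((norm x)^2) * (2 * C1 / N T)))"
   using ND[OF T2(1)] NT NT2 Nx a K by (intro mult_left_mono) (auto simp: field_simps)
  moreover have "a * (K * (N ((norm x)^2) * (2 * C1 / N T))) = (K / 2) * (N ((norm x)^2) / N T)"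
   using C1 by (simp add: a_def field_simps)
  moreover have "Da * (N ((norm x)^2) / N T) <= (K / 2) * (N ((norm x)^2) / N T)"
   using K NT Nx by (intro mult_right_mono) auto
  ultimately show "N ((norm x)^2) / N (a^2 * T) + a * (K * (N ((norm x)^2) / N (T / 2))) <= K * (N ((norm x)^2) / N T)"
   by (simp add: field_simps)
  qed
  finally show ?thesis .
 qed
qed
show ?thesis
proof (intro exI[of _ K] conjI allI impI K(1))
 fix T and x :: "real^'n" assume T: "ta <= T" and x: "x ~= 0"
 obtain k :: nat where "T / ta < 2 ^ k" using real_arch_pow[of 2 "T / ta"] by auto
 then have "T < ta * 2 ^ k" using ta by (simp add: field_simps)
 from main[OF T this x] have "P T (%_. 1) x <= en (K * (N ((norm x)^2) / N T))" .
 moreover have "P T (%_. 1) x <= en (K * 1)"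
 proof -
  have "P T (%_. 1) x <= en 1" using P_const_le[of T 1 x] T ta by simp
  also have "... <= en (K * 1)" using K by (intro ennreal_leI) simp
  finally show ?thesis .
 qed
 ultimately show "P T (%_. 1) x <= en (K * H T x)" by (simp add: H_def min_def)
qed
qed

text \<open>For \<open>|x|^2 >= T\<close> the boundary factor is 1 and the free evolution suffices.
  Otherwise split at \<open>|z|^2 = T\<close>: outside use \<open>P_exp_outside\<close>, inside the
  weight is at most \<open>exp (|l| sqrt T)\<close> and \<open>survival_bound\<close> applies. The
  missing \<open>exp (l . x)\<close> costs another \<open>exp (|l| sqrt T)\<close>, which is
  absorbed into \<open>exp (c T |l|^2)\<close>.\<close>

lemma exp_bound:
assumes ta: "ta > 0"
shows "EX K c. K > 0 & c >= 1 & (\<forall>T\<ge>ta. ALL x l. x ~= 0 -->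
 P T (%z. en (exp (l \<bullet> z))) x <= en (K * exp (c * T * (norm l)^2) * exp (l \<bullet> x) * H T x))"
proof -
obtain K where K: "K >= 1" "!!T x. T >= ta ==> x ~= 0 ==> P T (%_. 1) x <= en (K * H T x)"
 using survival_bound[OF ta] by blast
\<comment> \<open>From \<open>|l| sqrt T <= 1 + T |l|^2\<close>, used for two factors, plus the heat
  growth \<open>T |l|^2\<close>; the summand \<open>1 / ta\<close> comes from
  \<open>|l| <= 1 + T |l|^2 / ta\<close>.\<close>
define c where "c = 3 + 1 / ta"
define K' where "K' = (K + 1) * exp 3"
show ?thesis
proof (rule exI[of _ K'], rule exI[of _ c], intro conjI allI impI)
 show "K' > 0" using K by (simp add: K'_def)
 show "c >= 1" using ta by (simp add: c_def)
 fix T and x l :: "real^'n" assume T: "ta <= T" and x: "x ~= 0"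
 have T0: "T > 0" using T ta by simp
 define L where "L = norm l"
 have HT: "0 < H T x" "H T x <= 1" using H_bounds(1)[OF T0 x] H_bounds(2) by auto
 have sq: "L * sqrt T <= 1 + T * L^2"
 proof -
  have "0 <= (L * sqrt T - 1)^2" by simp
  also have "... = T * L^2 - 2 * (L * sqrt T) + 1" using T0 by (simp add: power2_eq_square algebra_simps)
  finally show ?thesis using T0 by (simp add: L_def) (smt (verit) mult_nonneg_nonneg norm_ge_zero real_sqrt_ge_zero)
 qed
 have lin: "L <= 1 + T * L^2 / ta"
 proof -
  have "L <= 1 + L^2" using zero_le_power2[of "L - 1"] by (simp add: power2_eq_square algebra_simps L_def) (smt (verit) norm_ge_zero)
  also have "L^2 <= T * L^2 / ta" using T ta by (simp add: field_simps mult_right_mono)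
  finally show ?thesis by simp
 qed
 have ctL: "c * T * L^2 = 3 * (T * L^2) + T * L^2 / ta" using ta by (simp add: c_def algebra_simps)
 have TL: "0 <= T * L^2" "0 <= T * L^2 / ta" using T0 ta by auto
 show "P T (%z. en (exp (l \<bullet> z))) x <= en (K' * exp (c * T * (norm l)^2) * exp (l \<bullet> x) * H T x)"
 proof (cases "(norm x)^2 < T")
  case False
  then have "N T <= N ((norm x)^2)" using T0 by (intro N_mono) auto
  then have H1: "H T x = 1" using N_pos[OF T0] by (simp add: H_def)
  have "P T (%z. en (exp (l \<bullet> z))) x <= heat T (%z. en (exp (l \<bullet> z))) x" by (intro P_le_heat T0) auto
  also have "... = en (exp (T * L^2 + l \<bullet> x))" unfolding heat_def L_def by (rule nn_integral_gauss_exp[OF T0])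
  also have "... <= en (K' * exp (c * T * L^2) * exp (l \<bullet> x) * H T x)"
  proof (rule ennreal_leI)
  have "exp (T * L^2 + l \<bullet> x) <= 1 * exp (c * T * L^2) * exp (l \<bullet> x)"
   using TL by (simp add: ctL flip: exp_add)
  also have "... <= K' * exp (c * T * L^2) * exp (l \<bullet> x)"
  proof (intro mult_right_mono)
   have "1 * 1 <= (K + 1) * exp (3::real)" using K by (intro mult_mono) auto
   then show "1 <= K'" by (simp add: K'_def)
  qed auto
  finally show "exp (T * L^2 + l \<bullet> x) <= K' * exp (c * T * L^2) * exp (l \<bullet> x) * H T x" by (simp add: H1)
  qed
  finally show ?thesis by (simp add: L_def)
 next
  case True
  have xs: "norm x <= sqrt T" using True by (intro real_le_rsqrt) simp
  have lx: "1 <= exp (L * sqrt T) * exp (l \<bullet> x)"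
  proof -
  have "- (l \<bullet> x) <= L * norm x" using Cauchy_Schwarz_ineq2[of l x] by (simp add: L_def)
  also have "... <= L * sqrt T" using xs by (intro mult_left_mono) (auto simp: L_def)
  finally show ?thesis by (simp flip: exp_add)
  qed
  have Hx: "H T x = N ((norm x)^2) / N T"
  using N_mono[of "(norm x)^2" T] True x N_pos[OF T0] by (simp add: H_def)
  have "P T (%z. en (exp (l \<bullet> z))) x <= P T (%z. en (exp (l \<bullet> z)) * ind {z. T <= (norm z)^2} z + en (exp (L * sqrt T)) * 1) x"
  proof (intro P_mono)
  fix z :: "real^'n"
  show "en (exp (l \<bullet> z)) <= en (exp (l \<bullet> z)) * ind {z. T <= (norm z)^2} z + en (exp (L * sqrt T)) * 1"
  proof (cases "T <= (norm z)^2")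
   case False
   then have "norm z <= sqrt T" by (intro real_le_rsqrt) simp
   then have "l \<bullet> z <= L * sqrt T"
    using norm_cauchy_schwarz[of l z] mult_left_mono[of "norm z" "sqrt T" L] by (simp add: L_def)
   then show ?thesis using False by (simp add: ennreal_leI)
  qed auto
  qed
  also have "... = P T (%z. en (exp (l \<bullet> z)) * ind {z. T <= (norm z)^2} z) x + en (exp (L * sqrt T)) * P T (%_. 1) x"
  using T0 by (subst P_add) (auto simp: P_cmult[symmetric])
  also have "... <= en (exp (L^2 * T + L * (sqrt T + 1)) * (N ((norm x)^2) / N T)) + en (exp (L * sqrt T)) * en (K * H T x)"
  unfolding L_def using T x by (intro add_mono mult_left_mono P_exp_outside T0 x True K(2)) auto
  also have "... = en ((exp (L^2 * T + L * (sqrt T + 1)) + exp (L * sqrt T) * K) * H T x)"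
  unfolding Hx[symmetric] using K HT by (simp add: algebra_simps flip: ennreal_mult' ennreal_plus)
  also have "... <= en (K' * exp (c * T * L^2) * exp (l \<bullet> x) * H T x)"
  proof (intro ennreal_leI mult_right_mono)
  define E where "E = exp (2 + 2 * (T * L^2) + T * L^2 / ta)"
  have "L^2 * T + L * (sqrt T + 1) = T * L^2 + L * sqrt T + L" by (simp add: algebra_simps)
  also have "... <= 2 + 2 * (T * L^2) + T * L^2 / ta" using sq lin by linarith
  finally have e1: "exp (L^2 * T + L * (sqrt T + 1)) <= E" by (simp add: E_def)
  have "exp (L * sqrt T) <= E" unfolding E_def using sq TL by simp
  then have e2: "exp (L * sqrt T) * K <= E * K" using K by (intro mult_right_mono) auto
  have "exp (L^2 * T + L * (sqrt T + 1)) + exp (L * sqrt T) * K <= (K + 1) * E" using e1 e2 by (simp add: algebra_simps)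
  also have "... <= (K + 1) * E * (exp (L * sqrt T) * exp (l \<bullet> x))"
   using mult_left_mono[OF lx, of "(K + 1) * E"] K by (simp add: E_def)
  also have "... <= (K + 1) * E * (exp (1 + T * L^2) * exp (l \<bullet> x))"
  proof (rule mult_left_mono)
   show "exp (L * sqrt T) * exp (l \<bullet> x) <= exp (1 + T * L^2) * exp (l \<bullet> x)" using sq by simp
  qed (use K in \<open>simp add: E_def\<close>)
  also have "... = K' * exp (c * T * L^2) * exp (l \<bullet> x)"
  proof -
   have "E * exp (1 + T * L^2) = exp 3 * exp (c * T * L^2)"
    unfolding E_def ctL exp_add[symmetric] by (rule arg_cong[of _ _ exp]) simp
   then show ?thesis unfolding K'_def by (simp only: mult.assoc)  (simp only: mult.assoc[symmetric])
  qed
  finally show "exp (L^2 * T + L * (sqrt T + 1)) + exp (L * sqrt T) * K <= K' * exp (c * T * L^2) * exp (l \<bullet> x)" .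
  qed (use HT in auto)
  finally show ?thesis by (simp add: L_def)
 qed
qed
qed

text \<open>Split the time into three parts. The middle evolution is bounded by the free kernel,
  which \<open>gauss_q_le_exp\<close> separates into \<open>exp (l . z)\<close> and
  \<open>exp (- l . w)\<close>. The first part acts on the former; by symmetry the last part can be
  moved onto the latter. Each then yields its own boundary factor through
  \<open>exp_bound\<close>.\<close>

lemma kernel_upper:
assumes ta: "ta > 0"
obtains K c where "K > 0" "c >= 1" "!!T x l A. T >= ta ==> x ~= 0 ==> A \<in> sets borel ==>
 P (3 * T) (ind A) x <= (NN y. ind A y * en (K * (4 * pi * T) powr (- real CARD('n) / 2)
  * exp (c * T * (norm l)^2) * exp (l \<bullet> (x - y)) * H T x * H T y))"
proof -
obtain K c where K: "K > 0" "c >= 1" and B: "!!T x l. T >= ta ==> x ~= 0 ==>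
 P T (%z. en (exp (l \<bullet> z))) x <= en (K * exp (c * T * (norm l)^2) * exp (l \<bullet> x) * H T x)"
 using exp_bound[OF ta] by blast
show ?thesis
proof (rule that)
 show "K^2 > 0" "2 * c + 1 >= 1" using K by auto
 fix T and x l :: "real^'n" and A :: "(real^'n) set"
 assume T: "ta <= T" and x: "x ~= 0" and [measurable]: "A \<in> sets borel"
 have T0: "T > 0" using T ta by simp
 define q0 where "q0 = (4 * pi * T) powr (- real CARD('n) / 2) * exp (T * (norm l)^2)"
 have q0: "q0 >= 0" by (simp add: q0_def)
 define I where "I = (NN w. en (exp ((- l) \<bullet> w)) * P T (ind A) w)"
 have [measurable]: "P T (ind A) \<in> bm" using T0 by measurable
 have inner: "P T (P T (ind A)) z <= en q0 * I * en (exp (l \<bullet> z))" for z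
 proof -
  have "P T (P T (ind A)) z <= heat T (P T (ind A)) z" by (intro P_le_heat T0) measurable
  also have "... <= (NN w. en (q0 * exp (l \<bullet> z)) * (en (exp ((- l) \<bullet> w)) * P T (ind A) w))"
  unfolding heat_def
  proof (intro nn_integral_mono)
  fix w
  have "gauss_q T z w <= q0 * exp (l \<bullet> z) * exp ((- l) \<bullet> w)"
   using gauss_q_le_exp[OF T0, of z w l] by (simp add: q0_def)
  then have "en (gauss_q T z w) <= en (q0 * exp (l \<bullet> z)) * en (exp ((- l) \<bullet> w))"
   using q0 by (simp add: ennreal_leI flip: ennreal_mult')
  then show "en (gauss_q T z w) * P T (ind A) w <= en (q0 * exp (l \<bullet> z)) * (en (exp ((- l) \<bullet> w)) * P T (ind A) w)"
   by (metis mult.assoc mult_right_mono zero_le)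
  qed
  also have "... = en (q0 * exp (l \<bullet> z)) * I" unfolding I_def by (rule nn_integral_cmult) measurable
  finally show ?thesis using q0 by (simp add: ennreal_mult' mult_ac)
 qed
 have "P (3 * T) (ind A) x = P T (P T (P T (ind A))) x"
 proof -
  have "P (T + (T + T)) (ind A) x = P T (P (T + T) (ind A)) x" using T0 by (intro P_semigroup) auto
  also have "P (T + T) (ind A) = P T (P T (ind A))"
  using T0 by (intro ext P_semigroup) auto
  finally show ?thesis by simp
 qed
 also have "... <= P T (%z. en q0 * I * en (exp (l \<bullet> z))) x" by (intro P_mono inner)
 also have "... = en q0 * I * P T (%z. en (exp (l \<bullet> z))) x" using T0 by (intro P_cmult) auto
 also have "... <= en q0 * I * en (K * exp (c * T * (norm l)^2) * exp (l \<bullet> x) * H T x)"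
  by (intro mult_left_mono B T x) auto
 finally have "P (3 * T) (ind A) x <= en q0 * I * en (K * exp (c * T * (norm l)^2) * exp (l \<bullet> x) * H T x)" .
 also have "... <= en q0 * (NN y. ind A y * en (K * exp (c * T * (norm l)^2) * exp (- (l \<bullet> y)) * H T y))
  * en (K * exp (c * T * (norm l)^2) * exp (l \<bullet> x) * H T x)"
 proof (intro mult_left_mono mult_right_mono)
 have "I = (NN y. P T (%w. en (exp ((- l) \<bullet> w))) y * ind A y)"
  unfolding I_def using T0 by (intro P_symmetric) auto
 also have "... <= (NN y. ind A y * en (K * exp (c * T * (norm l)^2) * exp (- (l \<bullet> y)) * H T y))"
 proof (rule nn_integral_mono_AE)
  have "AE y in lborel. y ~= (0::real^'n)" by (rule AE_lborel_singleton)
  then show "AE y in lborel. P T (%w. en (exp ((- l) \<bullet> w))) y * ind A y <= ind A y * en (K * exp (c * T * (norm l)^2) * exp (- (l \<bullet> y)) * H T y)"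
  proof eventually_elim
  case (elim y)
  show ?case using B[OF T elim, of "- l"] by (auto split: split_indicator)
  qed
 qed
 finally show "I <= (NN y. ind A y * en (K * exp (c * T * (norm l)^2) * exp (- (l \<bullet> y)) * H T y))" .
 qed auto
 also have "en q0 * (NN y. ind A y * en (K * exp (c * T * (norm l)^2) * exp (- (l \<bullet> y)) * H T y))
  * en (K * exp (c * T * (norm l)^2) * exp (l \<bullet> x) * H T x)
  = (NN y. ind A y * en (K^2 * (4 * pi * T) powr (- real CARD('n) / 2)
  * exp ((2 * c + 1) * T * (norm l)^2) * exp (l \<bullet> (x - y)) * H T x * H T y))"
 proof -
  have Hm [measurable]: "(%y. ind A y * en (K * exp (c * T * (norm l)^2) * exp (- (l \<bullet> y)) * H T y)) \<in> borel_measurable (lborel :: (real^'n) measure)"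
  proof -
  have cN: "continuous_on {z. z ~= (0::real^'n)} (%z. N ((norm z)^2))"
   by (rule continuous_on_compose2[OF N_cont]) (auto intro!: continuous_intros)
  have [measurable]: "(%z::real^'n. ind {z. z ~= 0} z *\<^sub>R N ((norm z)^2)) \<in> bm"
   by (rule borel_measurable_continuous_on_indicator[OF _ cN]) measurable
  have "(%z::real^'n. N ((norm z)^2)) = (%z. if z = 0 then N 0 else ind {z. z ~= 0} z *\<^sub>R N ((norm z)^2))"
   by (auto simp: fun_eq_iff)
  also have "... \<in> bm" by measurable
  finally have [measurable]: "(%z::real^'n. N ((norm z)^2)) \<in> bm" .
  show ?thesis unfolding H_def by measurable
  qed
  define G where "G = q0 * (K * exp (c * T * (norm l)^2) * exp (l \<bullet> x) * H T x)"
  have Hx: "H T x >= 0" using H_bounds(1)[OF T0 x] by simp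
  have G: "G >= 0" using q0 K Hx by (simp add: G_def)
  have GE: "en G = en q0 * en (K * exp (c * T * (norm l)^2) * exp (l \<bullet> x) * H T x)"
  unfolding G_def using q0 by (rule ennreal_mult')
  have "en q0 * (NN y. ind A y * en (K * exp (c * T * (norm l)^2) * exp (- (l \<bullet> y)) * H T y))
  * en (K * exp (c * T * (norm l)^2) * exp (l \<bullet> x) * H T x)
  = en G * (NN y. ind A y * en (K * exp (c * T * (norm l)^2) * exp (- (l \<bullet> y)) * H T y))"
  unfolding GE by (simp only: mult_ac)
  also have "... = (NN y. en G * (ind A y * en (K * exp (c * T * (norm l)^2) * exp (- (l \<bullet> y)) * H T y)))"
  by (rule nn_integral_cmult[symmetric]) (rule Hm)
  also have "... = (NN y. ind A y * en (K^2 * (4 * pi * T) powr (- real CARD('n) / 2)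
  * exp ((2 * c + 1) * T * (norm l)^2) * exp (l \<bullet> (x - y)) * H T x * H T y))"
  proof (rule nn_integral_cong)
  fix y
  have "exp ((2 * c + 1) * T * (norm l)^2) = exp (T * (norm l)^2) * exp (c * T * (norm l)^2) * exp (c * T * (norm l)^2)"
   by (simp add: algebra_simps flip: exp_add)
  moreover have "exp (l \<bullet> (x - y)) = exp (l \<bullet> x) * exp (- (l \<bullet> y))"
   by (simp add: inner_diff_right flip: exp_add)
  ultimately have e: "G * (K * exp (c * T * (norm l)^2) * exp (- (l \<bullet> y)) * H T y) = K^2 * (4 * pi * T) powr (- real CARD('n) / 2)
  * exp ((2 * c + 1) * T * (norm l)^2) * exp (l \<bullet> (x - y)) * H T x * H T y"
   unfolding G_def q0_def by (simp add: power2_eq_square mult_ac)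
  then show "en G * (ind A y * en (K * exp (c * T * (norm l)^2) * exp (- (l \<bullet> y)) * H T y))
   = ind A y * en (K^2 * (4 * pi * T) powr (- real CARD('n) / 2)
  * exp ((2 * c + 1) * T * (norm l)^2) * exp (l \<bullet> (x - y)) * H T x * H T y)"
   by (simp only: mult.left_commute[of "en G" "ind A y"] ennreal_mult'[OF G, symmetric] e)
  qed
  finally show ?thesis .
 qed
 finally show "P (3 * T) (ind A) x <= (NN y. ind A y * en (K^2 * (4 * pi * T) powr (- real CARD('n) / 2)
  * exp ((2 * c + 1) * T * (norm l)^2) * exp (l \<bullet> (x - y)) * H T x * H T y))" .
qed
qed

end

section \<open>Subharmonic profiles\<close>

text \<open>The dual of \<open>super_profile\<close>: reversed inequalities and a convex kink. The
  term with \<open>ta\<close> in \<open>V_inner\<close> and the condition \<open>Q1_le\<close> pay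
  for the factor \<open>exp (-y/T)\<close> that localises the profile at scale
  \<open>sqrt T\<close>. \<open>n_0\<close> lets a small constant be subtracted so that the support
  avoids the origin. \<open>survival\<close> is the upper bound for the survival probability in
  terms of the same profile; it limits the mass lost to the wrong regions.\<close>

locale sub_profile = brownian_killing M W V
for M :: "real^'n => 'w measure" and W V +
fixes n F0 F1 F2 Q0 Q1 Q2 :: "real => real" and Y rh ta La :: real
assumes dF: "!!y. y > 0 ==> DERIV F0 y :> F1 y" "!!y. y > 0 ==> DERIV F1 y :> F2 y"
 "continuous_on {0<..} F2"
 and dQ: "!!y. y > 0 ==> DERIV Q0 y :> Q1 y" "!!y. y > 0 ==> DERIV Q1 y :> Q2 y"
 "continuous_on {0<..} Q2"
 and n_eq: "!!y. n y = (if y <= Y then F0 y else Q0 y)"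
 and Y: "Y > 0" and rh: "rh > 0" and ta: "ta > 0" and La: "La >= 0"
 and kink: "!!y. Y <= y ==> y < Y + rh ==> F0 y <= Q0 y" "!!y. Y - rh < y ==> y <= Y ==> Q0 y <= F0 y"
 and n_pos: "!!y. y > 0 ==> n y > 0"
 and n_mono: "!!y y'. 0 < y ==> y <= y' ==> n y <= n y'"
 and n_0: "!!et. et > 0 ==> \<exists>al>0. ALL y. 0 < y --> y < al --> n y <= et"
 and n_growth: "\<exists>C\<ge>1. \<forall>y\<ge>ta. \<forall>c\<ge>1. n (c * y) <= C * c * n y"
 and F1_nonneg: "!!y. 0 < y ==> y <= Y ==> 0 <= F1 y"
 and V_inner: "!!x. x ~= 0 ==> (norm x)^2 <= Y ==>
  V x * F0 ((norm x)^2) + 8 * (norm x)^2 * F1 ((norm x)^2) / ta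
   <= 4 * (norm x)^2 * F2 ((norm x)^2) + 2 * real CARD('n) * F1 ((norm x)^2)"
 and V_outer: "!!x. (norm x)^2 >= Y ==>
  V x * Q0 ((norm x)^2) <= 4 * (norm x)^2 * Q2 ((norm x)^2) + 2 * real CARD('n) * Q1 ((norm x)^2)"
 and Q1_le: "!!y. y >= Y ==> 8 * y * Q1 y <= La * Q0 y"
 and V_decay: "!!al. al > 0 ==> \<exists>C\<ge>0. ALL x. al <= (norm x)^2 --> V x <= C / (norm x)^2"
 and survival: "!!ta'. ta' > 0 ==> \<exists>K\<ge>1. \<forall>T\<ge>ta'. ALL x. x ~= 0 --> P T (%_. 1) x <= en (K * (n ((norm x)^2) / n T))"
begin

lemma glue: "F0 Y = Q0 Y" "y <= Y ==> n y = F0 y" "Y <= y ==> n y = Q0 y"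
proof -
show *: "F0 Y = Q0 Y" using kink(1)[of Y] kink(2)[of Y] rh by simp
show "y <= Y ==> n y = F0 y" "Y <= y ==> n y = Q0 y" using * by (auto simp: n_eq)
qed

lemma n_cont: "continuous_on {0<..} n"
proof -
have F: "continuous_on {0<..} F0" "continuous_on {0<..} Q0"
 using dF(1) dQ(1) by (auto intro!: continuous_at_imp_continuous_on DERIV_isCont)
have "F0 Y = Q0 Y" using kink(1)[of Y] kink(2)[of Y] rh by simp
then have "continuous_on {0<..} (%y. if y <= Y then F0 y else Q0 y)"
 by (intro continuous_on_cases_le continuous_on_subset[OF F(1)] continuous_on_subset[OF F(2)] continuous_intros) auto
then show ?thesis by (simp add: n_eq[abs_def])
qed

lemma n_measurable [measurable]: "(%z::real^'n. n ((norm z)^2)) \<in> bm"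
proof -
have cN: "continuous_on {z. z ~= (0::real^'n)} (%z. n ((norm z)^2))"
 by (rule continuous_on_compose2[OF n_cont]) (auto intro!: continuous_intros)
have [measurable]: "(%z::real^'n. ind {z. z ~= 0} z *\<^sub>R n ((norm z)^2)) \<in> bm"
 by (rule borel_measurable_continuous_on_indicator[OF _ cN]) measurable
have "(%z::real^'n. n ((norm z)^2)) = (%z. if z = 0 then n 0 else ind {z. z ~= 0} z *\<^sub>R n ((norm z)^2))"
 by (auto simp: fun_eq_iff)
also have "... \<in> bm" by measurable
finally show ?thesis .
qed

text \<open>The rate in \<open>chart\<close> comes from \<open>(n e\<^sup>-\<^sup>y\<^sup>/\<^sup>T)' = (n' - n/T) e\<^sup>-\<^sup>y\<^sup>/\<^sup>T\<close>.\<close>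
lemma chart:
assumes T: "T >= ta" and y: "y > 0" and f: "f >= 0" and et: "et >= 0" and v: "v >= 0"
 and le: "v * f + 8 * y * f1 / T <= 4 * y * f2 + 2 * d * f1 + La / T * f" and d: "d >= 0"
shows "(v - (La + 2 * d) / T) * (f * exp (- y / T) - et) - (La + 2 * d) / T * et
 <= 4 * y * ((f2 - 2 * f1 / T + f / T^2) * exp (- y / T)) + 2 * d * ((f1 - f / T) * exp (- y / T))"
proof -
have T0: "T > 0" using T ta by simp
define E where "E = exp (- y / T)"
have E: "E > 0" by (simp add: E_def)
have "(v - (La + 2 * d) / T) * f <= 4 * y * (f2 - 2 * f1 / T) + 2 * d * (f1 - f / T)"
 using le by (simp add: algebra_simps add_divide_distrib)
also have "... <= 4 * y * (f2 - 2 * f1 / T + f / T^2) + 2 * d * (f1 - f / T)"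
 using y f by (simp add: distrib_left)
finally have "(v - (La + 2 * d) / T) * f * E <= (4 * y * (f2 - 2 * f1 / T + f / T^2) + 2 * d * (f1 - f / T)) * E"
 using E by (intro mult_right_mono) auto
moreover have "(v - (La + 2 * d) / T) * (f * E - et) - (La + 2 * d) / T * et = (v - (La + 2 * d) / T) * f * E - v * et"
 by (simp only: right_diff_distrib left_diff_distrib mult.assoc)
moreover have "v * et >= 0" using v et by simp
ultimately show ?thesis unfolding E_def[symmetric] by (simp add: distrib_right mult.assoc)
qed

text \<open>Subtracting \<open>et\<close> makes the support a compact annulus, on which the
  potential is bounded. The set \<open>Om\<close> will be a half-line in dimension 1 and the whole
  space otherwise.\<close>

definition us :: "(real^'n) set => real => real => real^'n => real" where
"us Om T et z = ind (Om - {0}) z * max 0 (n ((norm z)^2) * exp (- (norm z)\<^sup>2 / T) - et)"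

lemma chart_derivs:
assumes "(f has_real_derivative f' y) (at y)" "(f' has_real_derivative f'' y) (at y)" "T > 0"
shows "((%y. f y * exp (- y / T) - et) has_real_derivative (f' y - f y / T) * exp (- y / T)) (at y)"
 "((%y. (f' y - f y / T) * exp (- y / T)) has_real_derivative (f'' y - 2 * f' y / T + f y / T^2) * exp (- y / T)) (at y)"
proof -
have E: "((%y. exp (- y / T)) has_real_derivative exp (- y / T) * (- 1 / T)) (at y)"
 using assms(3) by (auto intro!: derivative_eq_intros)
show "((%y. f y * exp (- y / T) - et) has_real_derivative (f' y - f y / T) * exp (- y / T)) (at y)"
 by (rule DERIV_cong[OF DERIV_diff[OF DERIV_mult[OF assms(1) E] DERIV_const]]) (simp add: algebra_simps)
show "((%y. (f' y - f y / T) * exp (- y / T)) has_real_derivative (f'' y - 2 * f' y / T + f y / T^2) * exp (- y / T)) (at y)"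
 by (rule DERIV_cong[OF DERIV_mult[OF DERIV_diff[OF assms(2) DERIV_cdivide[OF assms(1)]] E]])
  (use assms(3) in \<open>simp add: field_simps power2_eq_square\<close>)
qed

text \<open>The at most linear growth of \<open>n\<close> is beaten by half of the exponential,
  uniformly in \<open>T\<close>.\<close>

lemma n_exp_big: "\<exists>C\<ge>1. \<forall>T\<ge>ta. \<forall>y\<ge>T. n y * exp (- y / T) <= C * n T * exp (- y / (2 * T))"
proof -
obtain C where C: "C >= 1" "!!y c. y >= ta ==> c >= 1 ==> n (c * y) <= C * c * n y" using n_growth by blast
have "n y * exp (- y / T) <= 2 * C * n T * exp (- y / (2 * T))" if T: "ta <= T" and y: "T <= y" for y T
proof -
 have T0: "T > 0" using T ta by simp
 have nT: "n T > 0" using n_pos T0 by simp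
 have "n y <= C * (y / T) * n T" using C(2)[of T "y / T"] T T0 y by simp
 also have "... <= C * (2 * exp (y / (2 * T))) * n T"
 proof (intro mult_right_mono mult_left_mono)
  have "y / (2 * T) <= exp (y / (2 * T))" using exp_ge_add_one_self[of "y / (2 * T)"] by linarith
  then show "y / T <= 2 * exp (y / (2 * T))" by simp
 qed (use C nT in auto)
 finally have "n y * exp (- y / T) <= C * (2 * exp (y / (2 * T))) * n T * exp (- y / T)"
  by (rule mult_right_mono) simp
 also have "... = 2 * C * n T * (exp (y / (2 * T)) * exp (- y / T))" by simp
 also have "exp (y / (2 * T)) * exp (- y / T) = exp (- y / (2 * T))"
  unfolding exp_add[symmetric] using T0 by (intro arg_cong[of _ _ exp]) (simp add: field_simps)
 finally show ?thesis .
qed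
then show ?thesis using C(1) by (intro exI[of _ "2 * C"]) auto
qed

lemma n_exp_le:
assumes T: "T >= ta"
shows "\<exists>C>0. \<forall>y>0. n y * exp (- y / T) <= C & (T <= y --> n y * exp (- y / T) <= C * exp (- y / (2 * T)))"
proof -
have T0: "T > 0" using T ta by simp
obtain C where C: "C >= 1" "!!y. T <= y ==> n y * exp (- y / T) <= C * n T * exp (- y / (2 * T))" using n_exp_big T by blast
have nT: "n T > 0" using n_pos T0 by simp
note big = C(2)
show ?thesis
proof (intro exI[of _ "C * n T"] conjI allI impI big)
 show "C * n T > 0" using C nT by simp
 fix y :: real assume y: "y > 0"
 show "n y * exp (- y / T) <= C * n T"
 proof (cases "T <= y")
  case True
  have "C * n T * exp (- y / (2 * T)) <= C * n T * 1" using C nT y T0 by (intro mult_left_mono) auto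
  with big[OF True] show ?thesis by simp
 next
  case False
  have "n y * exp (- y / T) <= n T * 1" using n_mono[OF y, of T] False nT y T0 by (intro mult_mono) auto
  also have "... <= C * n T" using C nT by simp
  finally show ?thesis .
 qed
qed
qed

lemma us_support:
assumes T: "T >= ta" and et: "et > 0"
shows "\<exists>al be. 0 < al & al < Y & Y < be & (\<forall>y>0. et < n y * exp (- y / T) --> al <= y & y <= be)"
proof -
have T0: "T > 0" using T ta by simp
obtain C where C: "C > 0" "!!y. y > 0 ==> T <= y ==> n y * exp (- y / T) <= C * exp (- y / (2 * T))"
 using n_exp_le[OF T] by blast
obtain al where al: "al > 0" "!!y. 0 < y ==> y < al ==> n y <= et" using n_0[OF et] by blast
define be where "be = max (Y + 1) (max T (2 * T * (C / et)))"
show ?thesis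
proof (rule exI[of _ "min al (Y / 2)"], rule exI[of _ be], intro conjI allI impI)
 show "min al (Y / 2) > 0" "min al (Y / 2) < Y" "Y < be" using al Y by (auto simp: be_def)
 fix y assume y: "y > 0" and g: "et < n y * exp (- y / T)"
 have "n y * exp (- y / T) <= n y * 1" using n_pos[OF y] y T0 by (intro mult_left_mono) auto
 then have "\<not> y < al" using al(2)[OF y] g by auto
 then show "min al (Y / 2) <= y" by simp
 show "y <= be"
 proof (rule ccontr)
  assume "\<not> y <= be"
  then have b: "T <= y" "2 * T * (C / et) < y" by (auto simp: be_def)
  have "C / et < y / (2 * T)" using b T0 by (simp add: field_simps)
  also have "... <= exp (y / (2 * T))" using exp_ge_add_one_self[of "y / (2 * T)"] by linarith
  finally have "C * exp (- y / (2 * T)) < et" using et by (simp add: exp_minus field_simps)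
  with C(2)[OF y b(1)] g show False by simp
 qed
qed
qed

text \<open>Where \<open>us\<close> is positive it equals the active chart minus \<open>et\<close>
  and dominates that chart nearby, because the kink is convex and the positive part only increases.
  Points closer to \<open>x\<close> than the origin remain in \<open>Om\<close>, so its indicator
  does no harm.\<close>

lemma us_step:
assumes T: "T >= ta" and et: "et > 0" and e: "e > 0" and [measurable]: "Om \<in> sets borel"
 and Om: "!!x z. x \<in> Om ==> x ~= 0 ==> norm (z - x) < norm x ==> z \<in> Om"
defines "LaT \<equiv> (La + 2 * real CARD('n)) / T"
shows "\<exists>dt0>0. \<forall>dt x. 0 < dt & dt < dt0 & us Om T et x > 0 -->
  en (exp (- LaT * dt) * us Om T et x) <= en (exp (- dt * V x)) * heat dt (%z. en (us Om T et z)) x + en ((LaT * et + e) * dt)"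
proof -
have T0: "T > 0" using T ta by simp
have LaT: "LaT >= 0" "LaT * et >= 0" using La T0 et by (auto simp: LaT_def)
obtain B where B: "B > 0" "!!y. y > 0 ==> n y * exp (- y / T) <= B" using n_exp_le[OF T] by blast
obtain al be where ab: "0 < al" "al < Y" "Y < be" and sup: "!!y. y > 0 ==> et < n y * exp (- y / T) ==> al <= y & y <= be"
 using us_support[OF T et] by blast
have uB: "0 <= us Om T et z & us Om T et z <= B" for z
 using B(2)[of "(norm z)^2"] B(1) et by (cases "z = 0") (auto simp: us_def split: split_indicator)
have um [measurable]: "us Om T et \<in> bm" unfolding us_def by measurable
obtain C where C: "C >= 0" "!!x. al <= (norm x)^2 ==> V x <= C / (norm x)^2" using V_decay[OF ab(1)] by blast
have Vb: "0 <= V x & V x <= C / al" if "al <= (norm x)^2" for x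
proof -
 have "x ~= 0" using that ab by auto
 moreover have "C / (norm x)^2 <= C / al" using that ab C by (intro divide_left_mono) (auto simp: zero_less_mult_iff)
 ultimately show ?thesis using V_nonneg[of x] C(2)[OF that] by auto
qed
define R where "R = min (min (sqrt al) 1) (rh / (2 * sqrt be + 2))"
have sbe: "2 * sqrt be + 2 > 0" using ab by (simp add: add_nonneg_pos)
have R: "R > 0" "R <= sqrt al" "R <= 1" "R * (2 * sqrt be + 2) <= rh"
proof -
 show "R > 0" "R <= sqrt al" "R <= 1" using ab rh sbe by (auto simp: R_def)
 have "R <= rh / (2 * sqrt be + 2)" by (simp add: R_def)
 then show "R * (2 * sqrt be + 2) <= rh" using sbe by (simp only: pos_le_divide_eq)
qed
have near: "\<bar>(norm z)^2 - (norm x)^2\<bar> < rh & z \<in> Om & z ~= 0"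
 if x: "al <= (norm x)^2" "(norm x)^2 <= be" "x \<in> Om" and z: "norm (z - x) < R" for x z :: "real^'n"
proof -
 have xs: "norm x <= sqrt be" using x(2) by (rule real_le_rsqrt)
 have "\<bar>(norm z)^2 - (norm x)^2\<bar> <= R * (2 * norm x + 1)" by (rule sq_dist_le[OF z R(3)])
 also have "... < R * (2 * sqrt be + 2)" using xs R by (intro mult_strict_left_mono) auto
 also have "... <= rh" by (rule R(4))
 finally have 1: "\<bar>(norm z)^2 - (norm x)^2\<bar> < rh" .
 have "sqrt al <= norm x" using real_sqrt_le_mono[OF x(1)] by simp
 then have zx: "norm (z - x) < norm x" using z R by simp
 then show ?thesis using 1 Om[OF x(3) _ zx] by force
qed
have uz: "us Om T et z = max 0 (n ((norm z)^2) * exp (- (norm z)\<^sup>2 / T) - et)" if "z \<in> Om" "z ~= 0" for z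
 using that by (simp add: us_def)
define v where "v = C / al"
have "\<exists>dt0>0. \<forall>dt (x::real^'n) u. 0 < dt & dt < dt0 & al <= (norm x)^2 & (norm x)^2 <= Y & u \<in> bm
  & (ALL z. 0 <= u z & u z <= B) & (ALL z. norm (z - x) < R --> (%y. F0 y * exp (- y / T) - et) ((norm z)^2) <= u z)
  & 0 <= (%y. F0 y * exp (- y / T) - et) ((norm x)^2) & (%y. F0 y * exp (- y / T) - et) ((norm x)^2) <= B
 --> en (exp (- LaT * dt) * (%y. F0 y * exp (- y / T) - et) ((norm x)^2)) <= en (exp (- dt * V x)) * heat dt (%z. en (u z)) x + en ((LaT * et + e) * dt)"
proof (rule step_sub[where v = v])
 show "((%y. F0 y * exp (- y / T) - et) has_real_derivative (%y. (F1 y - F0 y / T) * exp (- y / T)) y) (at y)"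
  "((%y. (F1 y - F0 y / T) * exp (- y / T)) has_real_derivative (%y. (F2 y - 2 * F1 y / T + F0 y / T^2) * exp (- y / T)) y) (at y)" if "y > 0" for y
  by (rule chart_derivs[where f = F0 and f' = F1 and f'' = F2, OF dF(1,2)[OF that] T0])+
 have c: "continuous_on {0<..} F0" "continuous_on {0<..} F1"
  using dF(1,2) by (auto intro!: continuous_at_imp_continuous_on DERIV_isCont)
 show "continuous_on {0<..} (%y. (F2 y - 2 * F1 y / T + F0 y / T^2) * exp (- y / T))"
  using T0 by (intro continuous_intros dF c) auto
 fix x :: "real^'n" assume x: "al <= (norm x)^2" "(norm x)^2 <= Y"
 have x0: "(norm x)^2 > 0" using x ab by linarith
 have xn: "x ~= 0" using x0 by auto
 have f0: "F0 ((norm x)^2) >= 0" using glue(2)[OF x(2)] n_pos[OF x0] by simp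
 have "8 * (norm x)^2 * F1 ((norm x)^2) / T <= 8 * (norm x)^2 * F1 ((norm x)^2) / ta"
  using T ta F1_nonneg[OF x0 x(2)] by (intro divide_left_mono) auto
 moreover have "La / T * F0 ((norm x)^2) >= 0" using La T0 f0 by simp
 ultimately have le: "V x * F0 ((norm x)^2) + 8 * (norm x)^2 * F1 ((norm x)^2) / T
   <= 4 * (norm x)^2 * F2 ((norm x)^2) + 2 * real CARD('n) * F1 ((norm x)^2) + La / T * F0 ((norm x)^2)"
  using V_inner[OF xn x(2)] by linarith
 show "0 <= V x & V x <= v & (V x - LaT) * (%y. F0 y * exp (- y / T) - et) ((norm x)^2) - LaT * et
  <= 4 * (norm x)^2 * (%y. (F2 y - 2 * F1 y / T + F0 y / T^2) * exp (- y / T)) ((norm x)^2) + 2 * real CARD('n) * (%y. (F1 y - F0 y / T) * exp (- y / T)) ((norm x)^2)"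
  using Vb[OF x(1)] chart[OF T x0 f0 _ _ le, of et] et unfolding LaT_def v_def by auto
qed (use ab R B e LaT in auto)
then obtain dt1 where dt1: "dt1 > 0" and s1: "!!dt (x::real^'n) u. 0 < dt ==> dt < dt1 ==> al <= (norm x)^2 ==> (norm x)^2 <= Y ==> u \<in> bm
  ==> (!!z. 0 <= u z & u z <= B) ==> (!!z. norm (z - x) < R ==> F0 ((norm z)^2) * exp (- (norm z)\<^sup>2 / T) - et <= u z)
  ==> 0 <= F0 ((norm x)^2) * exp (- (norm x)\<^sup>2 / T) - et ==> F0 ((norm x)^2) * exp (- (norm x)\<^sup>2 / T) - et <= B
 ==> ennreal (exp (- LaT * dt) * (F0 ((norm x)^2) * exp (- (norm x)\<^sup>2 / T) - et)) <= en (exp (- dt * V x)) * heat dt (%z. en (u z)) x + en ((LaT * et + e) * dt)"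
 by blast
have "\<exists>dt0>0. \<forall>dt (x::real^'n) u. 0 < dt & dt < dt0 & Y <= (norm x)^2 & (norm x)^2 <= be & u \<in> bm
  & (ALL z. 0 <= u z & u z <= B) & (ALL z. norm (z - x) < R --> (%y. Q0 y * exp (- y / T) - et) ((norm z)^2) <= u z)
  & 0 <= (%y. Q0 y * exp (- y / T) - et) ((norm x)^2) & (%y. Q0 y * exp (- y / T) - et) ((norm x)^2) <= B
 --> en (exp (- LaT * dt) * (%y. Q0 y * exp (- y / T) - et) ((norm x)^2)) <= en (exp (- dt * V x)) * heat dt (%z. en (u z)) x + en ((LaT * et + e) * dt)"
proof (rule step_sub[where v = v])
 show "((%y. Q0 y * exp (- y / T) - et) has_real_derivative (%y. (Q1 y - Q0 y / T) * exp (- y / T)) y) (at y)"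
  "((%y. (Q1 y - Q0 y / T) * exp (- y / T)) has_real_derivative (%y. (Q2 y - 2 * Q1 y / T + Q0 y / T^2) * exp (- y / T)) y) (at y)" if "y > 0" for y
  by (rule chart_derivs[where f = Q0 and f' = Q1 and f'' = Q2, OF dQ(1,2)[OF that] T0])+
 have c: "continuous_on {0<..} Q0" "continuous_on {0<..} Q1"
  using dQ(1,2) by (auto intro!: continuous_at_imp_continuous_on DERIV_isCont)
 show "continuous_on {0<..} (%y. (Q2 y - 2 * Q1 y / T + Q0 y / T^2) * exp (- y / T))"
  using T0 by (intro continuous_intros dQ c) auto
 fix x :: "real^'n" assume x: "Y <= (norm x)^2" "(norm x)^2 <= be"
 have x0: "(norm x)^2 > 0" using x Y by linarith
 have f0: "Q0 ((norm x)^2) >= 0" using glue(3)[OF x(1)] n_pos[OF x0] by simp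
 have "8 * (norm x)^2 * Q1 ((norm x)^2) / T <= La * Q0 ((norm x)^2) / T"
  using T0 Q1_le[OF x(1)] by (intro divide_right_mono) auto
 then have le: "V x * Q0 ((norm x)^2) + 8 * (norm x)^2 * Q1 ((norm x)^2) / T
   <= 4 * (norm x)^2 * Q2 ((norm x)^2) + 2 * real CARD('n) * Q1 ((norm x)^2) + La / T * Q0 ((norm x)^2)"
  using V_outer[OF x(1)] by simp
 show "0 <= V x & V x <= v & (V x - LaT) * (%y. Q0 y * exp (- y / T) - et) ((norm x)^2) - LaT * et
  <= 4 * (norm x)^2 * (%y. (Q2 y - 2 * Q1 y / T + Q0 y / T^2) * exp (- y / T)) ((norm x)^2) + 2 * real CARD('n) * (%y. (Q1 y - Q0 y / T) * exp (- y / T)) ((norm x)^2)"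
  using Vb[of x] x ab chart[OF T x0 f0 _ _ le, of et] et unfolding LaT_def v_def by auto
qed (use ab R B e LaT Y in auto)
then obtain dt2 where dt2: "dt2 > 0" and s2: "!!dt (x::real^'n) u. 0 < dt ==> dt < dt2 ==> Y <= (norm x)^2 ==> (norm x)^2 <= be ==> u \<in> bm
  ==> (!!z. 0 <= u z & u z <= B) ==> (!!z. norm (z - x) < R ==> Q0 ((norm z)^2) * exp (- (norm z)\<^sup>2 / T) - et <= u z)
  ==> 0 <= Q0 ((norm x)^2) * exp (- (norm x)\<^sup>2 / T) - et ==> Q0 ((norm x)^2) * exp (- (norm x)\<^sup>2 / T) - et <= B
 ==> ennreal (exp (- LaT * dt) * (Q0 ((norm x)^2) * exp (- (norm x)\<^sup>2 / T) - et)) <= en (exp (- dt * V x)) * heat dt (%z. en (u z)) x + en ((LaT * et + e) * dt)"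
 by blast
show ?thesis
proof (intro exI[of _ "min dt1 dt2"] conjI allI impI)
 show "min dt1 dt2 > 0" using dt1 dt2 by simp
 fix dt x assume H: "0 < dt & dt < min dt1 dt2 & us Om T et x > 0"
 then have x: "x \<in> Om" "x ~= 0" and pos: "et < n ((norm x)^2) * exp (- (norm x)\<^sup>2 / T)"
  by (auto simp: us_def max_def split: split_indicator_asm if_splits)
 have ux: "us Om T et x = n ((norm x)^2) * exp (- (norm x)\<^sup>2 / T) - et" using uz[OF x] pos by simp
 have xab: "al <= (norm x)^2" "(norm x)^2 <= be" using sup[OF _ pos] x by auto
 have B': "n ((norm x)^2) * exp (- (norm x)\<^sup>2 / T) - et <= B" using B(2)[of "(norm x)^2"] x et by simp
 show "en (exp (- LaT * dt) * us Om T et x) <= en (exp (- dt * V x)) * heat dt (%z. en (us Om T et z)) x + en ((LaT * et + e) * dt)"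
 proof (cases "(norm x)^2 <= Y")
  case True
  show ?thesis unfolding ux glue(2)[OF True]
  proof (rule s1)
  fix z assume z: "norm (z - x) < R"
  from near[OF xab x(1) z] have "F0 ((norm z)^2) <= n ((norm z)^2)"
   using kink(1)[of "(norm z)^2"] True by (auto simp: n_eq abs_less_iff)
  then have "F0 ((norm z)^2) * exp (- (norm z)\<^sup>2 / T) <= n ((norm z)^2) * exp (- (norm z)\<^sup>2 / T)" by (rule mult_right_mono) simp
  then show "F0 ((norm z)^2) * exp (- (norm z)\<^sup>2 / T) - et <= us Om T et z" using uz[of z] near[OF xab x(1) z] by (simp add: le_max_iff_disj)
  qed (use H True xab uB B' pos glue(2)[OF True] in auto)
 next
  case False
  then have le: "Y <= (norm x)^2" by simp
  show ?thesis unfolding ux glue(3)[OF le]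
  proof (rule s2)
  fix z assume z: "norm (z - x) < R"
  from near[OF xab x(1) z] have "Q0 ((norm z)^2) <= n ((norm z)^2)"
   using kink(2)[of "(norm z)^2"] le by (auto simp: n_eq abs_less_iff)
  then have "Q0 ((norm z)^2) * exp (- (norm z)\<^sup>2 / T) <= n ((norm z)^2) * exp (- (norm z)\<^sup>2 / T)" by (rule mult_right_mono) simp
  then show "Q0 ((norm z)^2) * exp (- (norm z)\<^sup>2 / T) - et <= us Om T et z" using uz[of z] near[OF xab x(1) z] by (simp add: le_max_iff_disj)
  qed (use H le xab uB B' pos glue(3)[OF le] in auto)
 qed
qed
qed

text \<open>The permitted loss rate is of order \<open>1/T\<close>, so over time \<open>T\<close> it
  amounts to a constant independent of \<open>T\<close>. The subtracted constant tends to 0.\<close>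

lemma sub_bound:
assumes T: "T >= ta" and [measurable]: "Om \<in> sets borel"
 and Om: "!!x z. x \<in> Om ==> x ~= 0 ==> norm (z - x) < norm x ==> z \<in> Om"
 and x: "x \<in> Om" "x ~= 0"
shows "en (exp (- (La + 2 * real CARD('n))) * (n ((norm x)^2) * exp (- (norm x)\<^sup>2 / T)))
 <= P T (%z. en (ind (Om - {0}) z * (n ((norm z)^2) * exp (- (norm z)\<^sup>2 / T)))) x"
proof (rule ennreal_le_epsilon)
fix ep' :: real assume ep': "ep' > 0"
have T0: "T > 0" using T ta by simp
define L where "L = La + 2 * real CARD('n)"
have L: "L >= 0" using La by (simp add: L_def)
\<comment> \<open>The additive loss over time \<open>T\<close> is \<open>L * et\<close> and the
  subtracted constant contributes another \<open>et\<close>; together exactly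
  \<open>ep'\<close>.\<close>
define et where "et = ep' / (L + 1)"
have et: "et > 0" using ep' L by (simp add: et_def)
obtain B where B: "B > 0" "!!y. y > 0 ==> n y * exp (- y / T) <= B" using n_exp_le[OF T] by blast
obtain al be where ab: "0 < al" and sup: "!!y. y > 0 ==> et < n y * exp (- y / T) ==> al <= y & y <= be"
 using us_support[OF T et] by blast
obtain C where C: "C >= 0" "!!x. al <= (norm x)^2 ==> V x <= C / (norm x)^2" using V_decay[OF ab(1)] by blast
have "en (exp (- (L / T) * T) * us Om T et x) <= P T (%z. en (us Om T et z)) x + en (T * (L / T * et))"
proof (rule subsolution_bound[where ep = "sqrt al" and v = "C / al" and B = B])
 show "0 <= us Om T et z" "us Om T et z <= B" for z
  using B(2)[of "(norm z)^2"] B(1) et by (cases "z = 0"; auto simp: us_def split: split_indicator)+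
 show "us Om T et \<in> bm" unfolding us_def by measurable
 show "V z <= C / al" if "sqrt al <= norm z" for z
 proof -
  have z: "al <= (norm z)^2" using that ab by (simp add: sqrt_le_D)
  then have "C / (norm z)^2 <= C / al" using ab C by (intro divide_left_mono) (auto simp: zero_less_mult_iff)
  with C(2)[OF z] show ?thesis by simp
 qed
 show "us Om T et z = 0" if "norm z < sqrt al" for z
 proof (cases "z = 0")
  case False
  have "(norm z)^2 < al" using that ab by (metis norm_ge_zero real_sqrt_abs abs_norm_cancel real_sqrt_less_iff)
  then show ?thesis using sup[of "(norm z)^2"] False
  by (cases "et < n ((norm z)^2) * exp (- (norm z)\<^sup>2 / T)") (auto simp: us_def split: split_indicator)
 qed (simp add: us_def)
qed (use L et T0 ab us_step[OF T et _ assms(2) Om] in \<open>auto simp: L_def\<close>)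
then have le: "en (exp (- L) * us Om T et x) <= P T (%z. en (us Om T et z)) x + en (L * et)"
 using T0 by simp
have "exp (- L) * (n ((norm x)^2) * exp (- (norm x)\<^sup>2 / T)) <= exp (- L) * (us Om T et x + et)"
 using x by (intro mult_left_mono) (auto simp: us_def)
also have "... <= exp (- L) * us Om T et x + et" using L et by (simp add: distrib_left)
finally have "en (exp (- L) * (n ((norm x)^2) * exp (- (norm x)\<^sup>2 / T))) <= en (exp (- L) * us Om T et x + et)"
 by (rule ennreal_leI)
also have "... = en (exp (- L) * us Om T et x) + en et"
 using et by (intro ennreal_plus) (auto simp: us_def)
finally have "en (exp (- L) * (n ((norm x)^2) * exp (- (norm x)\<^sup>2 / T))) <= en (exp (- L) * us Om T et x) + en et" .
also have "... <= P T (%z. en (us Om T et z)) x + en (L * et) + en et" by (intro add_right_mono le)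
also have "... = P T (%z. en (us Om T et z)) x + en ep'"
proof -
 have "L * et + et = (L + 1) * et" by (simp add: algebra_simps)
 also have "... = ep'" using L by (simp add: et_def)
 finally show ?thesis using L et by (simp add: add.assoc flip: ennreal_plus)
qed
also have "... <= P T (%z. en (ind (Om - {0}) z * (n ((norm z)^2) * exp (- (norm z)\<^sup>2 / T)))) x + en ep'"
proof (intro add_right_mono P_mono ennreal_leI)
 fix z
 show "us Om T et z <= ind (Om - {0}) z * (n ((norm z)^2) * exp (- (norm z)\<^sup>2 / T))"
  using et n_pos[of "(norm z)^2"] by (auto simp: us_def split: split_indicator)
qed
finally show "en (exp (- (La + 2 * real CARD('n))) * (n ((norm x)^2) * exp (- (norm x)\<^sup>2 / T)))
 <= P T (%z. en (ind (Om - {0}) z * (n ((norm z)^2) * exp (- (norm z)\<^sup>2 / T)))) x + en ep'"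
 by (simp add: L_def)
qed

end

section \<open>Mass at scale \<open>sqrt T\<close> and transport between cubes\<close>

context sub_profile
begin

text \<open>By \<open>sub_bound\<close> the mean of \<open>n exp (-|z|^2/T)\<close> after time
  \<open>T\<close> is at least a constant times \<open>n (|x|^2)\<close>. The part from the ball of
  radius \<open>a sqrt T\<close> is small because the process rarely sits there, the part beyond
  \<open>sqrt (S T)\<close> because the weight is small there; both are measured with the survival
  bound. What remains comes from the annulus, where the weight is at most a constant times
  \<open>n T\<close>.\<close>

lemma mass_annulus:
obtains a S c where "0 < a" "a <= 1" "1 <= S" "0 < c" "!!T Om x. T >= ta ==> Om \<in> sets borel ==>
 (ALL x z. x \<in> Om --> x ~= 0 --> norm (z - x) < norm x --> z \<in> Om) ==> x \<in> Om ==> x ~= 0 ==> (norm x)^2 <= T ==>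
  en (c * (n ((norm x)^2) / n T)) <= P T (ind (Om \<inter> {z. a^2 * T <= (norm z)^2 & (norm z)^2 <= S * T})) x"
proof -
define L where "L = La + 2 * real CARD('n)"
define e where "e = exp (- L - 1)"
have e: "e > 0" by (simp add: e_def)
have "ta / 2 > 0" using ta by simp
from survival[OF this] obtain K where K: "K >= 1" "!!T x. T >= ta / 2 ==> x ~= 0 ==> P T (%_. 1) x <= en (K * (n ((norm x)^2) / n T))"
 by blast
obtain C where C: "C >= 1" "!!T y. T >= ta ==> T <= y ==> n y * exp (- y / T) <= C * n T * exp (- y / (2 * T))"
 using n_exp_big by blast
\<comment> \<open>The radii are chosen so that each of the two discarded parts is at most
  \<open>e / 4 * n (|x|^2)\<close>, half of the total; \<open>a <= 1 / 2\<close> also gives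
  \<open>a^2 T <= T / 2\<close>.\<close>
define a where "a = min (1 / 2) (e / (4 * K))"
define S where "S = max 1 (2 * ln (4 * C * K / e))"
have a: "0 < a" "a <= 1 / 2" "a * K <= e / 4"
proof -
 show "0 < a" "a <= 1 / 2" using e K by (auto simp: a_def)
 have "a <= e / (4 * K)" by (simp add: a_def)
 then have "a * K <= e / (4 * K) * K" using K by (intro mult_right_mono) auto
 then show "a * K <= e / 4" using K by simp
qed
have S: "1 <= S" "C * K * exp (- S / 2) <= e / 4"
proof -
 show "1 <= S" by (simp add: S_def)
 have p: "4 * C * K / e > 0" using C K e by simp
 have "ln (4 * C * K / e) <= S / 2" by (simp add: S_def)
 then have "exp (ln (4 * C * K / e)) <= exp (S / 2)" by simp
 then have "4 * C * K / e <= exp (S / 2)" using p by simp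
 then show "C * K * exp (- S / 2) <= e / 4" using e by (simp add: exp_minus field_simps)
qed
define c where "c = e / (2 * C)"
have c: "c > 0" using e C by (simp add: c_def)
show ?thesis
proof (rule that)
 show "0 < a" "a <= 1" "1 <= S" "0 < c" using a S c by auto
 fix T Om x assume T: "ta <= T" and [measurable]: "Om \<in> sets borel"
  and Om: "ALL x z. x \<in> Om --> x ~= (0::real^'n) --> norm (z - x) < norm x --> z \<in> Om"
  and x: "x \<in> Om" "x ~= 0" "(norm x)^2 <= T"
 define D where "D = Om \<inter> {z. a^2 * T <= (norm z)^2 & (norm z)^2 <= S * T}"
 have [measurable]: "D \<in> sets borel" unfolding D_def by measurable
 have T0: "T > 0" using T ta by simp
 define nx where "nx = n ((norm x)^2)"
 have nx: "nx > 0" using n_pos x by (simp add: nx_def)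
 have nT: "n T > 0" "n (T / 2) > 0" using n_pos T0 by auto
 define p where "p = enn2real (P T (ind D) x)"
 have "P T (ind D) x <= P T (%_. 1) x" by (intro P_mono) (auto split: split_indicator)
 also have "... <= 1" using P_const_le[OF T0, of 1 x] by simp
 finally have p: "P T (ind D) x = en p" "p >= 0"
  unfolding p_def using ennreal_enn2real[of "P T (ind D) x"] by (auto simp: top.extremum_strict order.strict_trans1)
 have an: "a^2 <= 1 / 2"
 proof -
  have "a^2 <= (1 / 2)^2" using a by (intro power_mono) auto
  then show ?thesis by (simp add: power2_eq_square)
 qed
 have a2: "n (a^2 * T) <= n (T / 2)" "n (a^2 * T) > 0"
 proof -
  have "a^2 * T <= 1 / 2 * T" using an T0 by (intro mult_right_mono) auto
  then show "n (a^2 * T) <= n (T / 2)" using a T0 by (intro n_mono) auto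
  show "n (a^2 * T) > 0" using a T0 by (intro n_pos) auto
 qed
 have s1: "P T (ind {z. (norm z)^2 < a^2 * T}) x <= en (a * (K * (nx / n (T / 2))))"
 proof -
  have "P T (ind {z. (norm z)^2 < a^2 * T}) x <= en a * P (T / 2) (%_. 1) x"
  using a by (intro P_ball_le T0) auto
  also have "... <= en a * en (K * (nx / n (T / 2)))" unfolding nx_def using T x by (intro mult_left_mono K(2)) auto
  also have "... = en (a * (K * (nx / n (T / 2))))" using a by (intro ennreal_mult'[symmetric]) simp
  finally show ?thesis .
 qed
 have s2: "P T (%_. 1) x <= en (K * (nx / n T))" unfolding nx_def using T x ta by (intro K(2)) auto
 have pt: "en (ind (Om - {0}) z * (n ((norm z)^2) * exp (- (norm z)\<^sup>2 / T)))
  <= en (n (a^2 * T)) * ind {z. (norm z)^2 < a^2 * T} z + (en (C * n T * exp (- S / 2)) * 1 + en (C * n T) * ind D z)" for z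
 proof (cases "z \<in> Om - {0}")
  case z: True
  define y where "y = (norm z)^2"
  have y: "y > 0" using z by (simp add: y_def)
  have le1: "n y * exp (- y / T) <= n y" using mult_left_mono[of "exp (- y / T)" 1 "n y"] y n_pos[OF y] T0 by simp
  consider "y < a^2 * T" | "a^2 * T <= y" "y <= S * T" | "S * T < y" by linarith
  then show ?thesis
  proof cases
  case 1
  have "n y * exp (- y / T) <= n (a^2 * T)" using le1 n_mono[OF y, of "a^2 * T"] 1 by linarith
  then have "en (n y * exp (- y / T)) <= en (n (a^2 * T))" by (rule ennreal_leI)
  then show ?thesis using z 1 by (simp add: y_def add_increasing2)
  next
  case 2
  have "n y * exp (- y / T) <= C * n T"
  proof (cases "T <= y")
   case True
   have "C * n T * exp (- y / (2 * T)) <= C * n T * 1" using C nT y T0 by (intro mult_left_mono) auto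
   with C(2)[OF T True] show ?thesis by simp
  next
   case False
   have "n y * exp (- y / T) <= n T" using le1 n_mono[OF y, of T] False by linarith
   also have "... <= C * n T" using C nT by simp
   finally show ?thesis .
  qed
  then have "en (n y * exp (- y / T)) <= en (C * n T)" by (rule ennreal_leI)
  then show ?thesis using z 2 by (simp add: y_def D_def add_increasing)
  next
  case 3
  have yT: "T <= y" using 3 S(1) T0 mult_right_mono[of 1 S T] by linarith
  have "S < y / T" using 3 T0 by (simp add: pos_less_divide_eq)
  then have "exp (- y / (2 * T)) <= exp (- S / 2)" by (simp add: field_simps)
  then have "C * n T * exp (- y / (2 * T)) <= C * n T * exp (- S / 2)" using C nT by (intro mult_left_mono) auto
  with C(2)[OF T yT] have "n y * exp (- y / T) <= C * n T * exp (- S / 2)" by simp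
  then have "en (n y * exp (- y / T)) <= en (C * n T * exp (- S / 2))" by (rule ennreal_leI)
  then show ?thesis using z 3 by (simp add: y_def add_increasing add_increasing2)
  qed
 qed simp
 have "en (exp (- L) * (nx * exp (- (norm x)\<^sup>2 / T)))
  <= P T (%z. en (ind (Om - {0}) z * (n ((norm z)^2) * exp (- (norm z)\<^sup>2 / T)))) x"
  unfolding nx_def L_def using Om by (intro sub_bound T x) auto
 also have "... <= P T (%z. en (n (a^2 * T)) * ind {z. (norm z)^2 < a^2 * T} z
  + (en (C * n T * exp (- S / 2)) * 1 + en (C * n T) * ind D z)) x" by (intro P_mono pt)
 also have "... = en (n (a^2 * T)) * P T (ind {z. (norm z)^2 < a^2 * T}) x
  + (en (C * n T * exp (- S / 2)) * P T (%_. 1) x + en (C * n T) * P T (ind D) x)"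
 proof -
  have 1: "P T (%z. en (n (a^2 * T)) * ind {z. (norm z)^2 < a^2 * T} z) x = en (n (a^2 * T)) * P T (ind {z. (norm z)^2 < a^2 * T}) x"
  by (intro P_cmult T0) auto
  have 2: "P T (%z. en (C * n T * exp (- S / 2)) * 1) x = en (C * n T * exp (- S / 2)) * P T (%_. 1) x"
  by (intro P_cmult T0) auto
  have 3: "P T (%z. en (C * n T) * ind D z) x = en (C * n T) * P T (ind D) x"
  by (intro P_cmult T0) auto
  have 4: "P T (%z. en (C * n T * exp (- S / 2)) * 1 + en (C * n T) * ind D z) x
  = P T (%z. en (C * n T * exp (- S / 2)) * 1) x + P T (%z. en (C * n T) * ind D z) x"
  by (rule P_add) (use T0 in measurable)
  show ?thesis unfolding 1[symmetric] 2[symmetric] 3[symmetric] 4[symmetric]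
  by (rule P_add) (use T0 in measurable)
 qed
 also have "... <= en (n (a^2 * T)) * en (a * (K * (nx / n (T / 2))))
  + (en (C * n T * exp (- S / 2)) * en (K * (nx / n T)) + en (C * n T) * en p)"
  unfolding p(1) by (intro add_mono mult_left_mono s1 s2) auto
 also have "... = en (n (a^2 * T) * (a * (K * (nx / n (T / 2)))) + (C * n T * exp (- S / 2) * (K * (nx / n T)) + C * n T * p))"
 proof -
  have nn: "0 <= n (a^2 * T) * (a * (K * (nx / n (T / 2))))" "0 <= C * n T * exp (- S / 2) * (K * (nx / n T))" "0 <= C * n T * p"
  using a a2 K C nx nT p by auto
  show ?thesis
  unfolding ennreal_plus[OF nn(1) add_nonneg_nonneg[OF nn(2,3)]] ennreal_plus[OF nn(2,3)]
  using a2 C nT by (intro arg_cong2[of _ _ _ _ "(+)"] ennreal_mult'[symmetric]) auto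
 qed
 finally have "en (exp (- L) * (nx * exp (- (norm x)\<^sup>2 / T))) <= en (n (a^2 * T) * (a * (K * (nx / n (T / 2)))) + (C * n T * exp (- S / 2) * (K * (nx / n T)) + C * n T * p))" .
 moreover have "0 <= n (a^2 * T) * (a * (K * (nx / n (T / 2)))) + (C * n T * exp (- S / 2) * (K * (nx / n T)) + C * n T * p)"
  using a a2 K C nx nT p by (intro add_nonneg_nonneg mult_nonneg_nonneg) auto
 ultimately have main: "exp (- L) * (nx * exp (- (norm x)\<^sup>2 / T)) <= n (a^2 * T) * (a * (K * (nx / n (T / 2)))) + (C * n T * exp (- S / 2) * (K * (nx / n T)) + C * n T * p)"
  by (simp only: ennreal_le_iff)
 have t0: "e * nx <= exp (- L) * (nx * exp (- (norm x)\<^sup>2 / T))"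
 proof -
  have "exp (- 1) <= exp (- (norm x)\<^sup>2 / T)" using x T0 by simp
  then have "exp (- L) * nx * exp (- 1) <= exp (- L) * nx * exp (- (norm x)\<^sup>2 / T)" using nx by (intro mult_left_mono) auto
  moreover have "e = exp (- L) * exp (- 1)" unfolding e_def by (simp flip: exp_add)
  ultimately show ?thesis by (simp add: mult_ac)
 qed
 have t1: "n (a^2 * T) * (a * (K * (nx / n (T / 2)))) <= e / 4 * nx"
 proof -
  have "n (a^2 * T) * (a * (K * (nx / n (T / 2)))) <= n (T / 2) * (a * (K * (nx / n (T / 2))))"
  using a2 a K nx nT by (intro mult_right_mono) auto
  also have "... = a * K * nx" using nT by simp
  also have "... <= e / 4 * nx" using a nx by (intro mult_right_mono) auto
  finally show ?thesis .
 qed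
 have t2: "C * n T * exp (- S / 2) * (K * (nx / n T)) <= e / 4 * nx"
 proof -
  have "C * n T * exp (- S / 2) * (K * (nx / n T)) = C * K * exp (- S / 2) * nx" using nT by simp
  also have "... <= e / 4 * nx" using S nx by (intro mult_right_mono) auto
  finally show ?thesis .
 qed
 have "e * nx / 2 <= C * n T * p" using main t0 t1 t2 by linarith
 then have "c * (nx / n T) <= p" using C nT by (simp add: c_def field_simps)
 then show "en (c * (n ((norm x)^2) / n T)) <= P T (ind (Om \<inter> {z. a^2 * T <= (norm z)^2 & (norm z)^2 <= S * T})) x"
  unfolding D_def[symmetric] p(1) nx_def[symmetric] by (rule ennreal_leI)
qed
qed

text \<open>Apply the half-space bound with the wall at half the distance. There the potential is at
  most \<open>C' / T\<close>, so killing over time \<open>T\<close> costs a constant, and for points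
  at the full distance the image correction leaves at least the factor
  \<open>1 - exp (- al^2 / 4)\<close>.\<close>

lemma hs_step:
assumes al: "al > 0"
obtains c where "c > 0" "!!T sgm i z f. T >= ta ==> f \<in> bm ==> (sgm = 1 | sgm = -1) ==> al * sqrt T <= sgm * z $ i ==>
 en c * (NN w. ind {w. al * sqrt T <= sgm * w $ i} w * (en (gauss_q T z w) * f w)) <= P T f z"
proof -
have "(al / 2)^2 * ta > 0" using al ta by simp
from V_decay[OF this] obtain C where C: "C >= 0" "!!x. (al / 2)^2 * ta <= (norm x)^2 ==> V x <= C / (norm x)^2" by blast
define C' where "C' = C / (al / 2)^2"
have C': "C' >= 0" using C by (simp add: C'_def)
define b where "b = 1 - exp (- (al^2 / 4))"
have b: "b > 0" "b <= 1" using al by (auto simp: b_def)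
show ?thesis
proof (rule that)
 show "exp (- C') * b > 0" using b by simp
 fix T sgm i and z :: "real^'n" and f :: "real^'n => ennreal"
 assume T: "ta <= T" and [measurable]: "f \<in> bm" and sgm: "sgm = 1 | sgm = -1" and z: "al * sqrt T <= sgm * z $ i"
 have T0: "T > 0" using T ta by simp
 define h where "h = al / 2 * sqrt T"
 have h: "h > 0" "al * sqrt T = 2 * h" using al T0 by (auto simp: h_def)
 have h2: "h^2 = (al / 2)^2 * T" using T0 unfolding h_def power_mult_distrib by simp
 have Vv: "V v <= C' / T" if "h < sgm * v $ i" for v
 proof -
  have "\<bar>v $ i\<bar> >= h" using that sgm by auto
  then have "h <= norm v" using component_le_norm_cart[of v i] by linarith
  then have hv: "h^2 <= (norm v)^2" using h by (intro power_mono) auto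
  have "(al / 2)^2 * ta <= (al / 2)^2 * T" using T by (intro mult_left_mono) auto
  then have "V v <= C / (norm v)^2" using hv h2 by (intro C) linarith
  also have "... <= C / h^2" using hv h C \<open>h <= norm v\<close> by (intro divide_left_mono mult_pos_pos) auto
  also have "... = C' / T" by (simp add: h2 C'_def)
  finally show ?thesis .
 qed
 have "h < sgm * z $ i" using z h by linarith
 from half_space_lower[OF h(1) sgm T0 Vv _ this, of f]
 have hl: "en (exp (- (C' / T) * T)) * (NN w. ind {w. h < sgm * w $ i} w *
  (en (gauss_q T z w * (1 - exp (- ((sgm * z $ i - h) * (sgm * w $ i - h) / T)))) * f w)) <= P T f z"
  by simp
 have "en (exp (- C') * b) * (NN w. ind {w. al * sqrt T <= sgm * w $ i} w * (en (gauss_q T z w) * f w))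
  = en (exp (- C')) * (NN w. en b * (ind {w. al * sqrt T <= sgm * w $ i} w * (en (gauss_q T z w) * f w)))"
  using b by (subst nn_integral_cmult) (auto simp: ennreal_mult' mult.assoc)
 also have "... <= en (exp (- C')) * (NN w. ind {w. h < sgm * w $ i} w *
  (en (gauss_q T z w * (1 - exp (- ((sgm * z $ i - h) * (sgm * w $ i - h) / T)))) * f w))"
 proof (intro mult_left_mono nn_integral_mono)
  fix w :: "real^'n"
  show "en b * (ind {w. al * sqrt T <= sgm * w $ i} w * (en (gauss_q T z w) * f w))
  <= ind {w. h < sgm * w $ i} w * (en (gauss_q T z w * (1 - exp (- ((sgm * z $ i - h) * (sgm * w $ i - h) / T)))) * f w)"
  proof (cases "al * sqrt T <= sgm * w $ i")
  case True
  then have w: "h < sgm * w $ i" using h by linarith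
  have "h * h <= (sgm * z $ i - h) * (sgm * w $ i - h)" using True z h by (intro mult_mono) auto
  then have "al^2 / 4 * T <= (sgm * z $ i - h) * (sgm * w $ i - h)" using h2 by (simp add: power2_eq_square)
  then have "al^2 / 4 <= (sgm * z $ i - h) * (sgm * w $ i - h) / T" using T0 by (simp add: pos_le_divide_eq)
  then have "b <= 1 - exp (- ((sgm * z $ i - h) * (sgm * w $ i - h) / T))" by (simp add: b_def)
  then have "gauss_q T z w * b <= gauss_q T z w * (1 - exp (- ((sgm * z $ i - h) * (sgm * w $ i - h) / T)))"
   using gauss_q_nonneg[of T z w] by (rule mult_left_mono)
  then have "en (b * gauss_q T z w) <= en (gauss_q T z w * (1 - exp (- ((sgm * z $ i - h) * (sgm * w $ i - h) / T))))"
   by (intro ennreal_leI) (simp only: mult.commute[of b])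
  then have "en b * en (gauss_q T z w) * f w <= en (gauss_q T z w * (1 - exp (- ((sgm * z $ i - h) * (sgm * w $ i - h) / T)))) * f w"
   using b by (intro mult_right_mono) (auto simp: ennreal_mult')
  then show ?thesis using True w by (simp add: mult.assoc)
  qed simp
 qed simp
 also have "... <= P T f z" using hl T0 by simp
 finally show "en (exp (- C') * b) * (NN w. ind {w. al * sqrt T <= sgm * w $ i} w * (en (gauss_q T z w) * f w)) <= P T f z" .
qed
qed

lemma cube_norm_le:
fixes p w :: "real^'n"
assumes "w \<in> cube p s" "!!j. \<bar>p $ j\<bar> <= 2 * s" "s >= 0"
shows "(norm w)^2 <= real CARD('n) * (9 * s^2)"
proof -
have "(norm w)^2 = (\<Sum>j\<in>UNIV. (w $ j)^2)" by (simp add: norm_vec_def L2_set_def sum_nonneg)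
also have "... <= (\<Sum>j\<in>(UNIV :: 'n set). 9 * s^2)"
proof (rule sum_mono)
 fix j
 have "\<bar>w $ j - p $ j\<bar> <= s" using assms(1) by (simp add: mem_cube)
 then have "\<bar>w $ j\<bar> <= 3 * s" using assms(2)[of j] by linarith
 then have "\<bar>w $ j\<bar>^2 <= (3 * s)^2" by (intro power_mono) auto
 then show "(w $ j)^2 <= 9 * s^2" by (simp add: power_mult_distrib)
qed
also have "... = real CARD('n) * (9 * s^2)" by simp
finally show ?thesis .
qed

text \<open>The target cube lies in the half-space at distance \<open>al sqrt T\<close> and within a
  multiple of \<open>sqrt T\<close> of the origin, so \<open>|z - w|^2 <= 2 |z|^2 + 2 |w|^2\<close>
  bounds the Gaussian below by \<open>T^(-d/2) exp (-|z|^2 / (2T))\<close> up to a constant.\<close>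

lemma box_step:
assumes al: "al > 0"
obtains c where "c > 0" "!!T sgm i z p f. T >= ta ==> f \<in> bm ==> (sgm = 1 | sgm = -1) ==> al * sqrt T <= sgm * z $ i ==>
 sgm * p $ i = 2 * (al * sqrt T) ==> (ALL j. \<bar>p $ j\<bar> <= 2 * (al * sqrt T)) ==>
 en (c * (1 / sqrt T) ^ CARD('n) * exp (- (norm z)\<^sup>2 / (2 * T))) * (NN w. ind (cube p (al * sqrt T)) w * f w) <= P T f z"
proof -
obtain c where c: "c > 0" and hs: "!!T sgm i z f. T >= ta ==> f \<in> bm ==> (sgm = 1 | sgm = -1) ==> al * sqrt T <= sgm * z $ i ==>
 en c * (NN w. ind {w. al * sqrt T <= sgm * w $ i} w * (en (gauss_q T z w) * f w)) <= P T f z"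
 by (rule hs_step[OF al]) (rule that)
define b where "b = (1 / sqrt (4 * pi)) ^ CARD('n) * exp (- (real CARD('n) * 9 * al^2) / 2)"
have b: "b > 0" by (simp add: b_def)
show ?thesis
proof (rule that)
 show "c * b > 0" using b c by simp
 fix T sgm i and z p :: "real^'n" and f :: "real^'n => ennreal"
 assume T: "ta <= T" and [measurable]: "f \<in> bm" and sgm: "sgm = 1 | sgm = -1" and z: "al * sqrt T <= sgm * z $ i"
  and pi: "sgm * p $ i = 2 * (al * sqrt T)" and pj: "ALL j. \<bar>p $ j\<bar> <= 2 * (al * sqrt T)"
 have T0: "T > 0" using T ta by simp
 define Q where "Q = cube p (al * sqrt T)"
 have [measurable]: "Q \<in> sets borel" by (simp add: Q_def)
 define r where "r = b * (1 / sqrt T) ^ CARD('n) * exp (- (norm z)\<^sup>2 / (2 * T))"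
 have r: "r >= 0" using b T0 by (simp add: r_def)
 have q: "r <= gauss_q T z w & al * sqrt T <= sgm * w $ i" if w: "w \<in> Q" for w
 proof
  have "\<bar>w $ i - p $ i\<bar> <= al * sqrt T" using w by (simp add: Q_def mem_cube)
  then have "\<bar>sgm * w $ i - sgm * p $ i\<bar> <= al * sqrt T" using sgm by auto
  then show "al * sqrt T <= sgm * w $ i" using pi by linarith
  have "(norm w)^2 <= real CARD('n) * (9 * (al * sqrt T)^2)"
  using w pj al T0 by (intro cube_norm_le[of w p]) (auto simp: Q_def)
  then have nw: "(norm w)^2 <= (real CARD('n) * 9 * al^2) * T" using T0 by (simp add: power_mult_distrib)
  have "(norm (z - w))^2 <= (norm z + norm w)^2" by (intro power_mono norm_triangle_ineq4) auto
  also have "... <= 2 * (norm z)^2 + 2 * (norm w)^2" using zero_le_power2[of "norm z - norm w"] by (simp add: power2_eq_square algebra_simps)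
  finally have "(norm (z - w))^2 <= 2 * (norm z)^2 + 2 * (real CARD('n) * 9 * al^2) * T" using nw by simp
  then have "(norm (z - w))^2 / (4 * T) <= (2 * (norm z)^2 + 2 * (real CARD('n) * 9 * al^2) * T) / (4 * T)" using T0 by (intro divide_right_mono) auto
  also have "... = (norm z)^2 / (2 * T) + real CARD('n) * 9 * al^2 / 2" using T0 by (simp add: field_simps)
  finally have ex: "exp (- (real CARD('n) * 9 * al^2) / 2) * exp (- (norm z)\<^sup>2 / (2 * T)) <= exp (- (norm (z - w))\<^sup>2 / (4 * T))"
  by (simp flip: exp_add)
  have "(4 * pi * T) powr (- real CARD('n) / 2) = (1 / sqrt (4 * pi * T)) ^ CARD('n)" using T0 by (rule gauss_norm_const)
  also have "... = (1 / sqrt (4 * pi)) ^ CARD('n) * (1 / sqrt T) ^ CARD('n)"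
  by (simp add: real_sqrt_mult power_mult_distrib power_divide)
  finally have pw: "(4 * pi * T) powr (- real CARD('n) / 2) = (1 / sqrt (4 * pi)) ^ CARD('n) * (1 / sqrt T) ^ CARD('n)" .
  have "r = ((1 / sqrt (4 * pi)) ^ CARD('n) * (1 / sqrt T) ^ CARD('n)) * (exp (- (real CARD('n) * 9 * al^2) / 2) * exp (- (norm z)\<^sup>2 / (2 * T)))"
  by (simp add: r_def b_def mult_ac)
  also have "... <= gauss_q T z w" unfolding gauss_q_def pw using T0 by (intro mult_left_mono ex) auto
  finally show "r <= gauss_q T z w" .
 qed
 have "en (c * b * (1 / sqrt T) ^ CARD('n) * exp (- (norm z)\<^sup>2 / (2 * T))) * (NN w. ind Q w * f w)
  = en c * (NN w. en r * (ind Q w * f w))"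
 proof -
  have "c * b * (1 / sqrt T) ^ CARD('n) * exp (- (norm z)\<^sup>2 / (2 * T)) = c * r" by (simp add: r_def mult_ac)
  then show ?thesis using c r by (subst nn_integral_cmult) (auto simp: ennreal_mult' mult.assoc)
 qed
 also have "... <= en c * (NN w. ind {w. al * sqrt T <= sgm * w $ i} w * (en (gauss_q T z w) * f w))"
 proof (intro mult_left_mono nn_integral_mono)
  fix w :: "real^'n"
  show "en r * (ind Q w * f w) <= ind {w. al * sqrt T <= sgm * w $ i} w * (en (gauss_q T z w) * f w)"
  proof (cases "w \<in> Q")
  case True
  then have "en r * f w <= en (gauss_q T z w) * f w" using q by (intro mult_right_mono ennreal_leI) auto
  then show ?thesis using True q[OF True] by simp
  qed simp
 qed simp
 also have "... <= P T f z" by (intro hs T sgm z) measurable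
 finally show "en (c * b * (1 / sqrt T) ^ CARD('n) * exp (- (norm z)\<^sup>2 / (2 * T))) * (NN w. ind (cube p (al * sqrt T)) w * f w) <= P T f z"
  by (simp only: Q_def)
qed
qed

end

context sub_profile
begin

text \<open>A lower bound on the cube is passed on to \<open>z\<close>: the volume of the cube, of
  order \<open>T^(d/2)\<close>, cancels the normalisation of the Gaussian.\<close>

lemma box_pass:
assumes al: "al > 0"
obtains c where "c > 0" "!!T sgm i z p m f. T >= ta ==> f \<in> bm ==> (sgm = 1 | sgm = -1) ==> al * sqrt T <= sgm * z $ i ==>
 sgm * p $ i = 2 * (al * sqrt T) ==> (ALL j. \<bar>p $ j\<bar> <= 2 * (al * sqrt T)) ==> (\<forall>w\<in>cube p (al * sqrt T). m <= f w) ==>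
 en (c * exp (- (norm z)\<^sup>2 / (2 * T))) * m <= P T f z"
proof -
obtain c where c: "c > 0" and bs: "!!T sgm i z p f. T >= ta ==> f \<in> bm ==> (sgm = 1 | sgm = -1) ==> al * sqrt T <= sgm * z $ i ==>
 sgm * p $ i = 2 * (al * sqrt T) ==> (ALL j. \<bar>p $ j\<bar> <= 2 * (al * sqrt T)) ==>
 en (c * (1 / sqrt T) ^ CARD('n) * exp (- (norm z)\<^sup>2 / (2 * T))) * (NN w. ind (cube p (al * sqrt T)) w * f w) <= P T f z"
 by (rule box_step[OF al]) (rule that)
define d where "d = (2 * al) ^ CARD('n)"
have d: "d > 0" using al by (simp add: d_def)
show ?thesis
proof (rule that)
 show "c * d > 0" using c d by simp
 fix T sgm i m and z p :: "real^'n" and f :: "real^'n => ennreal"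
 assume T: "ta <= T" and [measurable]: "f \<in> bm" and sgm: "sgm = 1 | sgm = -1" and z: "al * sqrt T <= sgm * z $ i"
  and pi: "sgm * p $ i = 2 * (al * sqrt T)" and pj: "ALL j. \<bar>p $ j\<bar> <= 2 * (al * sqrt T)" and m: "\<forall>w\<in>cube p (al * sqrt T). m <= f w"
 have T0: "T > 0" using T ta by simp
 let ?Q = "cube p (al * sqrt T)"
 define E where "E = exp (- (norm z)\<^sup>2 / (2 * T))"
 have "(2 * (al * sqrt T)) ^ CARD('n) = d * sqrt T ^ CARD('n)" by (simp add: d_def power_mult_distrib)
 then have eq: "c * (1 / sqrt T) ^ CARD('n) * E * (2 * (al * sqrt T)) ^ CARD('n) = c * d * E"
  using T0 by (simp add: power_one_over)
 have "en (c * d * E) * m = en (c * (1 / sqrt T) ^ CARD('n) * E) * (m * en ((2 * (al * sqrt T)) ^ CARD('n)))"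
  unfolding eq[symmetric] using c T0 al by (subst ennreal_mult) (auto simp: E_def mult_ac)
 also have "m * en ((2 * (al * sqrt T)) ^ CARD('n)) = (NN w. m * ind ?Q w)"
  using al T0 by (subst nn_integral_cmult_indicator) (auto simp: emeasure_cube)
 also have "en (c * (1 / sqrt T) ^ CARD('n) * E) * (NN w. m * ind ?Q w)
  <= en (c * (1 / sqrt T) ^ CARD('n) * E) * (NN w. ind ?Q w * f w)"
  using m by (intro mult_left_mono nn_integral_mono) (auto split: split_indicator)
 also have "... <= P T f z" unfolding E_def by (intro bs[OF T _ sgm z pi pj]) measurable
 finally show "en (c * d * exp (- (norm z)\<^sup>2 / (2 * T))) * m <= P T f z" by (simp only: E_def)
qed
qed

lemma cube_coord:
assumes "w \<in> cube p s" "sgm = 1 | sgm = -1" "sgm * p $ i = 2 * s"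
shows "s <= sgm * w $ i"
proof -
have "\<bar>w $ i - p $ i\<bar> <= s" using assms(1) by (simp add: mem_cube)
then have "\<bar>sgm * w $ i - sgm * p $ i\<bar> <= s" using assms(2) by auto
then show ?thesis using assms(3) by linarith
qed

text \<open>Three successive half-spaces. The cube at \<open>p2\<close> lies in the half-space of
  \<open>z\<close> and in the middle one, the cube at \<open>p1\<close> in the middle one and in
  that of the base, and \<open>p0\<close> is the base. Within cubes the exponential factor is
  bounded below by \<open>e\<close>, so only the factor at the start remains.\<close>

lemma chain3:
assumes al: "al > 0"
obtains c where "c > 0" "!!T sgm0 sgm1 sgm2 i0 i1 i2 z p0 p1 p2 f. T >= ta ==> f \<in> bm ==>
 (sgm0 = 1 | sgm0 = -1) ==> (sgm1 = 1 | sgm1 = -1) ==> (sgm2 = 1 | sgm2 = -1) ==> al * sqrt T <= sgm2 * z $ i2 ==>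
 sgm2 * p2 $ i2 = 2 * (al * sqrt T) ==> sgm1 * p2 $ i1 = 2 * (al * sqrt T) ==> sgm1 * p1 $ i1 = 2 * (al * sqrt T) ==>
 sgm0 * p1 $ i0 = 2 * (al * sqrt T) ==> sgm0 * p0 $ i0 = 2 * (al * sqrt T) ==>
 (ALL j. \<bar>p0 $ j\<bar> <= 2 * (al * sqrt T)) ==> (ALL j. \<bar>p1 $ j\<bar> <= 2 * (al * sqrt T)) ==> (ALL j. \<bar>p2 $ j\<bar> <= 2 * (al * sqrt T)) ==>
 en (c * (1 / sqrt T) ^ CARD('n) * exp (- (norm z)\<^sup>2 / (2 * T))) * (NN w. ind (cube p0 (al * sqrt T)) w * f w) <= P (3 * T) f z"
proof -
obtain c1 where c1: "c1 > 0" and bs: "!!T sgm i z p f. T >= ta ==> f \<in> bm ==> (sgm = 1 | sgm = -1) ==> al * sqrt T <= sgm * z $ i ==>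
 sgm * p $ i = 2 * (al * sqrt T) ==> (ALL j. \<bar>p $ j\<bar> <= 2 * (al * sqrt T)) ==>
 en (c1 * (1 / sqrt T) ^ CARD('n) * exp (- (norm z)\<^sup>2 / (2 * T))) * (NN w. ind (cube p (al * sqrt T)) w * f w) <= P T f z"
 by (rule box_step[OF al]) (rule that)
obtain c2 where c2: "c2 > 0" and bp: "!!T sgm i z p m f. T >= ta ==> f \<in> bm ==> (sgm = 1 | sgm = -1) ==> al * sqrt T <= sgm * z $ i ==>
 sgm * p $ i = 2 * (al * sqrt T) ==> (ALL j. \<bar>p $ j\<bar> <= 2 * (al * sqrt T)) ==> (\<forall>w\<in>cube p (al * sqrt T). m <= f w) ==>
 en (c2 * exp (- (norm z)\<^sup>2 / (2 * T))) * m <= P T f z"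
 by (rule box_pass[OF al]) (rule that)
define e where "e = exp (- (real CARD('n) * (9 * al^2)) / 2)"
have e: "e > 0" by (simp add: e_def)
show ?thesis
proof (rule that)
 show "c2 * (c2 * e * (c1 * e)) > 0" using c1 c2 e by simp
 fix T sgm0 sgm1 sgm2 i0 i1 i2 and z p0 p1 p2 :: "real^'n" and f :: "real^'n => ennreal"
 assume T: "ta <= T" and [measurable]: "f \<in> bm"
  and sgm: "sgm0 = 1 | sgm0 = -1" "sgm1 = 1 | sgm1 = -1" "sgm2 = 1 | sgm2 = -1"
  and z: "al * sqrt T <= sgm2 * z $ i2" and p: "sgm2 * p2 $ i2 = 2 * (al * sqrt T)" "sgm1 * p2 $ i1 = 2 * (al * sqrt T)"
  "sgm1 * p1 $ i1 = 2 * (al * sqrt T)" "sgm0 * p1 $ i0 = 2 * (al * sqrt T)" "sgm0 * p0 $ i0 = 2 * (al * sqrt T)"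
  and pj: "ALL j. \<bar>p0 $ j\<bar> <= 2 * (al * sqrt T)" "ALL j. \<bar>p1 $ j\<bar> <= 2 * (al * sqrt T)" "ALL j. \<bar>p2 $ j\<bar> <= 2 * (al * sqrt T)"
 have T0: "T > 0" using T ta by simp
 have eQ: "e <= exp (- (norm w)\<^sup>2 / (2 * T))" if "w \<in> cube p (al * sqrt T)" "ALL j. \<bar>p $ j\<bar> <= 2 * (al * sqrt T)" for w p :: "real^'n"
 proof -
  have "(norm w)^2 <= real CARD('n) * (9 * (al * sqrt T)^2)" using that al T0 by (intro cube_norm_le[of w p]) auto
  then have "(norm w)^2 <= real CARD('n) * (9 * al^2) * T" using T0 by (simp add: power_mult_distrib)
  then have "(norm w)^2 / (2 * T) <= real CARD('n) * (9 * al^2) / 2" using T0 by (simp add: field_simps)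
  then show ?thesis by (simp add: e_def)
 qed
 define I where "I = (NN w. ind (cube p0 (al * sqrt T)) w * f w)"
 define k where "k = (1 / sqrt T) ^ CARD('n)"
 have k: "k >= 0" using T0 by (simp add: k_def)
 have [measurable]: "P T f \<in> bm" "P T (P T f) \<in> bm" using T0 by measurable
 have m1: "en (c1 * e * k) * I <= P T f w" if w: "w \<in> cube p1 (al * sqrt T)" for w
 proof -
  have "en (c1 * e * k) * I <= en (c1 * (1 / sqrt T) ^ CARD('n) * exp (- (norm w)\<^sup>2 / (2 * T))) * I"
  using mult_left_mono[OF eQ[OF w pj(2)], of "c1 * k"] c1 k by (intro mult_right_mono ennreal_leI) (auto simp: k_def mult_ac)
  also have "... <= P T f w" unfolding I_def by (intro bs[OF T _ sgm(1) cube_coord[OF w sgm(1) p(4)] p(5) pj(1)]) measurable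
  finally show ?thesis .
 qed
 have m2: "en (c2 * e * (c1 * e * k)) * I <= P T (P T f) w" if w: "w \<in> cube p2 (al * sqrt T)" for w
 proof -
  have "en (c2 * e * (c1 * e * k)) * I = en (c2 * e) * (en (c1 * e * k) * I)"
  using c2 e by (simp add: ennreal_mult' mult.assoc)
  also have "... <= en (c2 * exp (- (norm w)\<^sup>2 / (2 * T))) * (en (c1 * e * k) * I)"
  using eQ[OF w pj(3)] c2 by (intro mult_right_mono ennreal_leI mult_left_mono) auto
  also have "... <= P T (P T f) w" by (rule bp[OF T _ sgm(2) cube_coord[OF w sgm(2) p(2)] p(3) pj(2) ballI[OF m1]]) measurable
  finally show ?thesis .
 qed
 have "en (c2 * (c2 * e * (c1 * e)) * k * exp (- (norm z)\<^sup>2 / (2 * T))) * I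
  = en (c2 * exp (- (norm z)\<^sup>2 / (2 * T))) * (en (c2 * e * (c1 * e * k)) * I)"
 proof -
  have "c2 * (c2 * e * (c1 * e)) * k * exp (- (norm z)\<^sup>2 / (2 * T)) = c2 * exp (- (norm z)\<^sup>2 / (2 * T)) * (c2 * e * (c1 * e * k))"
  by (simp add: mult_ac)
  also have "ennreal ... = en (c2 * exp (- (norm z)\<^sup>2 / (2 * T))) * en (c2 * e * (c1 * e * k))"
  using c2 by (intro ennreal_mult') auto
  finally show ?thesis by (simp only: mult.assoc)
 qed
 also have "... <= P T (P T (P T f)) z" by (rule bp[OF T _ sgm(3) z p(1) pj(3) ballI[OF m2]]) measurable
 also have "... = P (T + (T + T)) f z"
 proof -
  have "P (T + (T + T)) f z = P T (P (T + T) f) z" using T0 by (intro P_semigroup) auto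
  also have "P (T + T) f = P T (P T f)" using T0 by (intro ext P_semigroup) auto
  finally show ?thesis by simp
 qed
 finally show "en (c2 * (c2 * e * (c1 * e)) * (1 / sqrt T) ^ CARD('n) * exp (- (norm z)\<^sup>2 / (2 * T))) * (NN w. ind (cube p0 (al * sqrt T)) w * f w) <= P (3 * T) f z"
  by (simp add: I_def k_def)
qed
qed

text \<open>Which half-spaces communicate with the base half-space without passing the origin.
  Opposite half-spaces of the same axis do so only if there is a second axis.\<close>

definition reach :: "'n => real => 'n => real => bool" where
"reach i0 sgm0 i sgm \<longleftrightarrow> i ~= i0 | sgm = sgm0 | (EX j. j ~= i0)"

definition base :: "'n => real => real => (real^'n) set" where
"base i0 sgm0 s = cube (axis i0 (2 * s * sgm0)) s"

text \<open>Half-spaces of different axes share a cube around a diagonal point. Opposite half-spaces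
  are joined by going around the origin through the half-space of another axis
  \<open>j\<close>.\<close>

lemma chain:
assumes al: "al > 0"
obtains c where "c > 0" "!!T sgm0 sgm i0 i z f. T >= ta ==> f \<in> bm ==>
 (sgm0 = 1 | sgm0 = -1) ==> (sgm = 1 | sgm = -1) ==> reach i0 sgm0 i sgm ==> al * sqrt T <= sgm * z $ i ==>
 en (c * (1 / sqrt T) ^ CARD('n) * exp (- (norm z)\<^sup>2 / (2 * T))) * (NN w. ind (base i0 sgm0 (al * sqrt T)) w * f w) <= P (3 * T) f z"
proof -
obtain c where c: "c > 0" and ch: "!!T sgm0 sgm1 sgm2 i0 i1 i2 z p0 p1 p2 f. T >= ta ==> f \<in> bm ==>
 (sgm0 = 1 | sgm0 = -1) ==> (sgm1 = 1 | sgm1 = -1) ==> (sgm2 = 1 | sgm2 = -1) ==> al * sqrt T <= sgm2 * z $ i2 ==>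
 sgm2 * p2 $ i2 = 2 * (al * sqrt T) ==> sgm1 * p2 $ i1 = 2 * (al * sqrt T) ==> sgm1 * p1 $ i1 = 2 * (al * sqrt T) ==>
 sgm0 * p1 $ i0 = 2 * (al * sqrt T) ==> sgm0 * p0 $ i0 = 2 * (al * sqrt T) ==>
 (ALL j. \<bar>p0 $ j\<bar> <= 2 * (al * sqrt T)) ==> (ALL j. \<bar>p1 $ j\<bar> <= 2 * (al * sqrt T)) ==> (ALL j. \<bar>p2 $ j\<bar> <= 2 * (al * sqrt T)) ==>
 en (c * (1 / sqrt T) ^ CARD('n) * exp (- (norm z)\<^sup>2 / (2 * T))) * (NN w. ind (cube p0 (al * sqrt T)) w * f w) <= P (3 * T) f z"
 by (rule chain3[OF al]) (rule that)
show ?thesis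
proof (rule that[OF c])
 fix T sgm0 sgm i0 i and z :: "real^'n" and f :: "real^'n => ennreal"
 assume T: "ta <= T" and f: "f \<in> bm" and sgm: "sgm0 = 1 | sgm0 = -1" "sgm = 1 | sgm = -1"
  and r: "reach i0 sgm0 i sgm" and z: "al * sqrt T <= sgm * z $ i"
 have T0: "T > 0" using T ta by simp
 define s where "s = al * sqrt T"
 have s: "s > 0" using al T0 by (simp add: s_def)
 have sq: "sgm * (2 * s * sgm) = 2 * s" "sgm0 * (2 * s * sgm0) = 2 * s" "\<bar>2 * s * sgm\<bar> <= 2 * s" "\<bar>2 * s * sgm0\<bar> <= 2 * s" using sgm s by auto
 let ?p0 = "axis i0 (2 * s * sgm0) :: real^'n"
 have ab: "ALL j. \<bar>(axis k (2 * s * sgm') :: real^'n) $ j\<bar> <= 2 * s" if "sgm' = 1 | sgm' = -1" for k sgm'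
  using that s by (auto simp: axis_def)
 have ab2: "ALL j. \<bar>((axis k (2 * s * sgm') :: real^'n) + axis l (2 * s * sgm'')) $ j\<bar> <= 2 * s" if "sgm' = 1 | sgm' = -1" "sgm'' = 1 | sgm'' = -1" "k ~= l" for k l sgm' sgm''
  using that s by (auto simp: axis_def)
 consider "i ~= i0" | "i = i0" "sgm = sgm0" | j where "i = i0" "j ~= i0" using r by (auto simp: reach_def)
 then show "en (c * (1 / sqrt T) ^ CARD('n) * exp (- (norm z)\<^sup>2 / (2 * T))) * (NN w. ind (base i0 sgm0 (al * sqrt T)) w * f w) <= P (3 * T) f z"
  unfolding base_def s_def[symmetric]
 proof cases
  case 1
  show "en (c * (1 / sqrt T) ^ CARD('n) * exp (- (norm z)\<^sup>2 / (2 * T))) * (NN w. ind (cube ?p0 s) w * f w) <= P (3 * T) f z"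
  by (rule ch[of T f sgm0 sgm0 sgm z i "axis i (2 * s * sgm) + ?p0" i0 ?p0 i0 ?p0, folded s_def])
   (use 1 T f sgm z sq ab[OF sgm(1)] ab2[OF sgm(2,1) 1] in \<open>simp_all add: s_def[symmetric] axis_def\<close>)
 next
  case 2
  show "en (c * (1 / sqrt T) ^ CARD('n) * exp (- (norm z)\<^sup>2 / (2 * T))) * (NN w. ind (cube ?p0 s) w * f w) <= P (3 * T) f z"
  by (rule ch[of T f sgm0 sgm0 sgm z i ?p0 i0 ?p0 i0 ?p0, folded s_def])
   (use 2 T f sgm z sq ab[OF sgm(1)] in \<open>simp_all add: s_def[symmetric] axis_def\<close>)
 next
  case 3
  have o: "(1::real) = 1 | (1::real) = -1" by simp
  show "en (c * (1 / sqrt T) ^ CARD('n) * exp (- (norm z)\<^sup>2 / (2 * T))) * (NN w. ind (cube ?p0 s) w * f w) <= P (3 * T) f z"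
  by (rule ch[of T f sgm0 1 sgm z i "axis j (2 * s * 1) + axis i (2 * s * sgm)" j "axis j (2 * s * 1) + ?p0" i0 ?p0, folded s_def])
   (use 3 T f sgm z sq ab[OF sgm(1)] ab2[OF o sgm(1) 3(2)] ab2[OF o sgm(2) 3(2)] in \<open>simp_all add: s_def[symmetric] axis_def\<close>)
 qed
qed
qed

text \<open>Stability under moves shorter than the distance to the origin makes the punctured set
  open and closed in the punctured space, that is, a union of its components; the last clause says
  that from all of it the base cube can be reached.\<close>

definition good :: "(real^'n) set => 'n => real => bool" where
"good Om i0 sgm0 \<longleftrightarrow> Om \<in> sets borel & (sgm0 = 1 | sgm0 = -1) &
 (ALL x z. x \<in> Om --> x ~= 0 --> norm (z - x) < norm x --> z \<in> Om) &
 (\<forall>z\<in>Om. \<forall>i sgm. (sgm = 1 | sgm = -1) --> 0 < sgm * z $ i --> reach i0 sgm0 i sgm)"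

definition H :: "real => real^'n => real" where
"H T x = min 1 (n ((norm x)^2) / n T)"

lemma large_coord:
fixes z :: "real^'n"
assumes "rh' <= (norm z)^2" "rh' >= 0"
shows "\<exists>i sgm. (sgm = 1 | sgm = -1) & sqrt (rh' / real CARD('n)) <= sgm * z $ i"
proof -
have "EX i. rh' / real CARD('n) <= (z $ i)^2"
proof (rule ccontr)
 assume "\<not> ?thesis"
 then have "(\<Sum>i\<in>UNIV. (z $ i)^2) < (\<Sum>i\<in>(UNIV :: 'n set). rh' / real CARD('n))" by (intro sum_strict_mono) (auto simp: not_le)
 also have "... = rh'" by simp
 finally show False using assms by (simp add: norm_vec_def L2_set_def sum_nonneg)
qed
then obtain i where "rh' / real CARD('n) <= (z $ i)^2" by blast
then have "sqrt (rh' / real CARD('n)) <= \<bar>z $ i\<bar>" using real_sqrt_le_mono by fastforce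
then show ?thesis by (cases "z $ i >= 0") (force intro!: exI[of _ i])+
qed

text \<open>If \<open>|x|^2 <= T\<close>, spend time \<open>T\<close> to reach the annulus, where
  the boundary factor arises, then \<open>3 T\<close> on the chain. If \<open>|x|^2 > T\<close>,
  some coordinate of \<open>x\<close> is already of order \<open>sqrt T\<close>: run the chain at
  once and spend the remaining time \<open>T\<close> staying around the base cube.\<close>

lemma to_base:
obtains c al where "c > 0" "al > 0" "!!T Om i0 sgm0 x f. T >= ta ==> good Om i0 sgm0 ==> x \<in> Om ==> x ~= 0 ==> f \<in> bm ==>
 en (c * H T x * (1 / sqrt T) ^ CARD('n) * exp (- (norm x)\<^sup>2 / (2 * T))) * (NN w. ind (base i0 sgm0 (al * sqrt T)) w * f w) <= P (4 * T) f x"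
proof -
obtain a S c0 where a: "0 < a" "a <= 1" and S: "1 <= S" and c0: "0 < c0" and ann: "!!T Om x. T >= ta ==> Om \<in> sets borel ==>
 (ALL x z. x \<in> Om --> x ~= 0 --> norm (z - x) < norm x --> z \<in> Om) ==> x \<in> Om ==> x ~= 0 ==> (norm x)^2 <= T ==>
  en (c0 * (n ((norm x)^2) / n T)) <= P T (ind (Om \<inter> {z. a^2 * T <= (norm z)^2 & (norm z)^2 <= S * T})) x"
 by (rule mass_annulus) (rule that)
define al where "al = a / sqrt (real CARD('n))"
have al: "al > 0" using a by (simp add: al_def)
obtain c1 where c1: "c1 > 0" and ch: "!!T sgm0 sgm i0 i z f. T >= ta ==> f \<in> bm ==>
 (sgm0 = 1 | sgm0 = -1) ==> (sgm = 1 | sgm = -1) ==> reach i0 sgm0 i sgm ==> al * sqrt T <= sgm * z $ i ==>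
 en (c1 * (1 / sqrt T) ^ CARD('n) * exp (- (norm z)\<^sup>2 / (2 * T))) * (NN w. ind (base i0 sgm0 (al * sqrt T)) w * f w) <= P (3 * T) f z"
 by (rule chain[OF al]) (rule that)
obtain c2 where c2: "c2 > 0" and bp: "!!T sgm i z p m f. T >= ta ==> f \<in> bm ==> (sgm = 1 | sgm = -1) ==> al * sqrt T <= sgm * z $ i ==>
 sgm * p $ i = 2 * (al * sqrt T) ==> (ALL j. \<bar>p $ j\<bar> <= 2 * (al * sqrt T)) ==> (\<forall>w\<in>cube p (al * sqrt T). m <= f w) ==>
 en (c2 * exp (- (norm z)\<^sup>2 / (2 * T))) * m <= P T f z"
 by (rule box_pass[OF al]) (rule that)
obtain c3 where c3: "c3 > 0" and bs: "!!T sgm i z p f. T >= ta ==> f \<in> bm ==> (sgm = 1 | sgm = -1) ==> al * sqrt T <= sgm * z $ i ==>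
 sgm * p $ i = 2 * (al * sqrt T) ==> (ALL j. \<bar>p $ j\<bar> <= 2 * (al * sqrt T)) ==>
 en (c3 * (1 / sqrt T) ^ CARD('n) * exp (- (norm z)\<^sup>2 / (2 * T))) * (NN w. ind (cube p (al * sqrt T)) w * f w) <= P T f z"
 by (rule box_step[OF al]) (rule that)
define e where "e = exp (- (real CARD('n) * (9 * al^2)) / 2)"
define kf where "kf = c1 * (c3 * e * (2 * al) ^ CARD('n))"
define kn where "kn = c0 * (c1 * exp (- S / 2))"
have k: "kf > 0" "kn > 0" using c0 c1 c3 al by (auto simp: kf_def kn_def e_def)
show ?thesis
proof (rule that[OF _ al])
 show "min kf kn > 0" using k by simp
 fix T Om i0 sgm0 and x :: "real^'n" and f :: "real^'n => ennreal"
 assume T: "ta <= T" and g: "good Om i0 sgm0" and x: "x \<in> Om" "x ~= 0" and [measurable]: "f \<in> bm"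
 from g have [measurable]: "Om \<in> sets borel" and sgm0: "sgm0 = 1 | sgm0 = -1"
  and Om: "ALL x z. x \<in> Om --> x ~= 0 --> norm (z - x) < norm x --> z \<in> Om"
  and re: "!!z i sgm. z \<in> Om ==> (sgm = 1 | sgm = -1) ==> 0 < sgm * z $ i ==> reach i0 sgm0 i sgm" by (auto simp: good_def)
 have T0: "T > 0" using T ta by simp
 define s where "s = al * sqrt T"
 have s: "s > 0" using al T0 by (simp add: s_def)
 define B where "B = base i0 sgm0 s"
 have [measurable]: "B \<in> sets borel" by (simp add: B_def base_def)
 define I where "I = (NN w. ind B w * f w)"
 define k where "k = (1 / sqrt T) ^ CARD('n)"
 have k0: "k >= 0" using T0 by (simp add: k_def)
 have as: "sqrt (a^2 * T / real CARD('n)) = s" using a by (simp add: s_def al_def real_sqrt_mult real_sqrt_divide)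
 have nx: "n ((norm x)^2) > 0" "n T > 0" using n_pos x T0 by auto
 have Hx: "0 <= H T x" "H T x <= 1" "H T x <= n ((norm x)^2) / n T" using nx by (auto simp: H_def)
 have [measurable]: "P T f \<in> bm" "P (3 * T) f \<in> bm" using T0 by (auto intro!: P_measurable)
 show "en (min kf kn * H T x * (1 / sqrt T) ^ CARD('n) * exp (- (norm x)\<^sup>2 / (2 * T))) * (NN w. ind (base i0 sgm0 (al * sqrt T)) w * f w) <= P (4 * T) f x"
  unfolding s_def[symmetric] B_def[symmetric] I_def[symmetric] k_def[symmetric]
 proof (cases "(norm x)^2 <= T")
  case False
  have "a^2 * T <= 1 * T" using a T0 by (intro mult_right_mono) (auto simp: power_le_one)
  then have "a^2 * T <= (norm x)^2" using False by simp
  from large_coord[OF this] obtain i sgm where i: "sgm = 1 | sgm = -1" "s <= sgm * x $ i" using as a T0 by auto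
  have pp: "sgm0 * (axis i0 (2 * s * sgm0) :: real^'n) $ i0 = 2 * s" "ALL j. \<bar>(axis i0 (2 * s * sgm0) :: real^'n) $ j\<bar> <= 2 * s"
  using sgm0 s by (auto simp: axis_def)
  have inB: "en (c3 * e * k) * I <= P T f w" if w: "w \<in> B" for w
  proof -
  have w': "w \<in> cube (axis i0 (2 * s * sgm0)) s" using w by (simp add: B_def base_def)
  have "(norm w)^2 <= real CARD('n) * (9 * s^2)" using w' pp s by (intro cube_norm_le[of w "axis i0 (2 * s * sgm0)"]) auto
  then have "(norm w)^2 <= real CARD('n) * (9 * al^2) * T" using T0 by (simp add: s_def power_mult_distrib)
  then have "(norm w)^2 / (2 * T) <= real CARD('n) * (9 * al^2) / 2" using T0 by (simp add: field_simps)
  then have "e <= exp (- (norm w)\<^sup>2 / (2 * T))" by (simp add: e_def)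
  then have "c3 * k * e <= c3 * k * exp (- (norm w)\<^sup>2 / (2 * T))" using c3 k0 by (intro mult_left_mono) auto
  then have "c3 * e * k <= c3 * k * exp (- (norm w)\<^sup>2 / (2 * T))" by (simp only: mult.assoc mult.commute[of e])
  then have "en (c3 * e * k) * I <= en (c3 * k * exp (- (norm w)\<^sup>2 / (2 * T))) * I" by (intro mult_right_mono[OF ennreal_leI]) auto
  also have "... <= P T f w"
   unfolding I_def B_def base_def k_def s_def
   using cube_coord[OF w' sgm0 pp(1)] pp T sgm0 by (intro bs[of T f sgm0 w i0]) (auto simp: s_def)
  finally show ?thesis .
  qed
  have "0 < sgm * x $ i" using i s by linarith
  have "en (c1 * k * exp (- (norm x)\<^sup>2 / (2 * T))) * (NN w. ind B w * P T f w) <= P (3 * T) (P T f) x"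
  unfolding k_def B_def s_def using i(2) by (intro ch[OF T _ sgm0 i(1) re[OF x(1) i(1) \<open>0 < sgm * x $ i\<close>]]) (auto simp: s_def)
  also have "... = P (4 * T) f x" using P_semigroup[of "3 * T" T f x] T0 by (simp add: algebra_simps)
  finally have 1: "en (c1 * k * exp (- (norm x)\<^sup>2 / (2 * T))) * (NN w. ind B w * P T f w) <= P (4 * T) f x" .
  have "en (c3 * e * k) * I * en ((2 * s) ^ CARD('n)) = (NN w. (en (c3 * e * k) * I) * ind B w)"
  using s by (subst nn_integral_cmult_indicator) (auto simp: B_def base_def emeasure_cube)
  also have "... <= (NN w. ind B w * P T f w)"
  using inB by (intro nn_integral_mono) (auto split: split_indicator)
  finally have 2: "en (c3 * e * k) * I * en ((2 * s) ^ CARD('n)) <= (NN w. ind B w * P T f w)" .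
  have ks: "k * (2 * s) ^ CARD('n) = (2 * al) ^ CARD('n)"
  unfolding k_def s_def power_mult_distrib[symmetric] using T0 by simp
  have eq: "kf * k * exp (- (norm x)\<^sup>2 / (2 * T)) = (c1 * k * exp (- (norm x)\<^sup>2 / (2 * T))) * ((c3 * e * k) * (2 * s) ^ CARD('n))"
  unfolding kf_def ks[symmetric] by (simp add: mult_ac)
  have "min kf kn * H T x * k * exp (- (norm x)\<^sup>2 / (2 * T)) <= kf * 1 * k * exp (- (norm x)\<^sup>2 / (2 * T))"
  using Hx k k0 by (intro mult_right_mono mult_mono) auto
  then have "en (min kf kn * H T x * k * exp (- (norm x)\<^sup>2 / (2 * T))) * I <= en (kf * k * exp (- (norm x)\<^sup>2 / (2 * T))) * I"
  by (intro mult_right_mono[OF ennreal_leI]) auto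
  also have "... = en (c1 * k * exp (- (norm x)\<^sup>2 / (2 * T))) * (en (c3 * e * k) * I * en ((2 * s) ^ CARD('n)))"
  proof -
  have "en (kf * k * exp (- (norm x)\<^sup>2 / (2 * T))) = en (c1 * k * exp (- (norm x)\<^sup>2 / (2 * T))) * (en (c3 * e * k) * en ((2 * s) ^ CARD('n)))"
   unfolding eq using c1 c3 k0 s by (subst ennreal_mult, simp, simp add: e_def, subst ennreal_mult) (auto simp: e_def)
  then show ?thesis by (simp only: mult_ac)
  qed
  also have "... <= P (4 * T) f x" using 1 mult_left_mono[OF 2, of "en (c1 * k * exp (- (norm x)\<^sup>2 / (2 * T)))"] by (auto intro: order_trans)
  finally show "en (min kf kn * H T x * k * exp (- (norm x)\<^sup>2 / (2 * T))) * I <= P (4 * T) f x" .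
 next
  case True
  define D where "D = Om \<inter> {z. a^2 * T <= (norm z)^2 & (norm z)^2 <= S * T}"
  have [measurable]: "D \<in> sets borel" unfolding D_def by measurable
  have inD: "en (c1 * exp (- S / 2) * k) * I <= P (3 * T) f z" if z: "z \<in> D" for z
  proof -
  have z': "z \<in> Om" "a^2 * T <= (norm z)^2" "(norm z)^2 <= S * T" using z by (auto simp: D_def)
  from large_coord[OF z'(2)] obtain i sgm where i: "sgm = 1 | sgm = -1" "s <= sgm * z $ i" using as a T0 by auto
  have i0: "0 < sgm * z $ i" using i s by linarith
  have "(norm z)^2 / (2 * T) <= S / 2" using z' T0 by (simp add: field_simps)
  then have "exp (- S / 2) <= exp (- (norm z)\<^sup>2 / (2 * T))" by simp
  then have "c1 * k * exp (- S / 2) <= c1 * k * exp (- (norm z)\<^sup>2 / (2 * T))" using c1 k0 by (intro mult_left_mono) auto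
  then have "c1 * exp (- S / 2) * k <= c1 * k * exp (- (norm z)\<^sup>2 / (2 * T))" by (simp only: mult.assoc mult.commute[of "exp (- S / 2)"])
  then have "en (c1 * exp (- S / 2) * k) * I <= en (c1 * k * exp (- (norm z)\<^sup>2 / (2 * T))) * I" by (intro mult_right_mono[OF ennreal_leI]) auto
  also have "... <= P (3 * T) f z"
   unfolding k_def I_def B_def s_def using i(2) by (intro ch[OF T _ sgm0 i(1) re[OF z'(1) i(1) i0]]) (auto simp: s_def)
  finally show ?thesis .
  qed
  have "min kf kn * H T x * k * exp (- (norm x)\<^sup>2 / (2 * T)) <= kn * (n ((norm x)^2) / n T) * k * 1"
  using Hx k k0 T0 nx by (intro mult_mono) auto
  then have "en (min kf kn * H T x * k * exp (- (norm x)\<^sup>2 / (2 * T))) * I <= en (kn * (n ((norm x)^2) / n T) * k) * I"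
  by (intro mult_right_mono[OF ennreal_leI]) auto
  also have "... = en (c1 * exp (- S / 2) * k) * I * en (c0 * (n ((norm x)^2) / n T))"
  proof -
  have "kn * (n ((norm x)^2) / n T) * k = (c1 * exp (- S / 2) * k) * (c0 * (n ((norm x)^2) / n T))" by (simp add: kn_def mult_ac)
  also have "ennreal ... = en (c1 * exp (- S / 2) * k) * en (c0 * (n ((norm x)^2) / n T))"
   using c1 k0 by (intro ennreal_mult') auto
  finally show ?thesis by (simp only: mult_ac)
  qed
  also have "... <= en (c1 * exp (- S / 2) * k) * I * P T (ind D) x"
  unfolding D_def by (intro mult_left_mono ann T Om x True) auto
  also have "... = P T (%z. en (c1 * exp (- S / 2) * k) * I * ind D z) x"
  using T0 by (intro P_cmult[symmetric]) auto
  also have "... <= P T (P (3 * T) f) x"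
  using inD by (intro P_mono) (auto split: split_indicator)
  also have "... = P (4 * T) f x" using P_semigroup[of T "3 * T" f x] T0 by (simp add: algebra_simps)
  finally show "en (min kf kn * H T x * k * exp (- (norm x)\<^sup>2 / (2 * T))) * I <= P (4 * T) f x" .
 qed
qed
qed

end

section \<open>The integrated lower bound for the kernel\<close>

context sub_profile
begin

lemma near_coord:
fixes x y :: "real^'n"
assumes "T <= (norm x)^2" "T > 0" "(norm (x - y))^2 < (norm x)^2 / (4 * real CARD('n))"
 "sgm = 1 | sgm = -1" "sqrt ((norm x)^2 / real CARD('n)) <= sgm * x $ i"
shows "sqrt (T / real CARD('n)) / 2 <= sgm * y $ i"
proof -
have "norm (x - y) = sqrt ((norm (x - y))^2)" by simp
also have "... <= sqrt ((norm x)^2 / (4 * real CARD('n)))" using assms(3) by (intro real_sqrt_le_mono) simp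
also have "... = sqrt ((norm x)^2 / real CARD('n)) / 2" by (simp add: real_sqrt_divide real_sqrt_mult)
finally have "norm (x - y) <= sqrt ((norm x)^2 / real CARD('n)) / 2" .
moreover have "\<bar>x $ i - y $ i\<bar> <= norm (x - y)" using component_le_norm_cart[of "x - y" i] by simp
moreover have "\<bar>sgm * x $ i - sgm * y $ i\<bar> = \<bar>x $ i - y $ i\<bar>" using assms(4) by auto
moreover have "sqrt (T / real CARD('n)) <= sqrt ((norm x)^2 / real CARD('n))"
 using assms(1) by (intro real_sqrt_le_mono divide_right_mono) auto
ultimately show ?thesis using assms(5) by linarith
qed

text \<open>If \<open>|x|\<close> is at most \<open>sqrt T\<close> or at most a multiple of
  \<open>|x - y|\<close>, then \<open>|x|^2 + |y|^2\<close> is bounded by a multiple of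
  \<open>T + |x - y|^2\<close>, so the Gaussian factors in \<open>|x|\<close> and \<open>|y|\<close>
  separately cost no more than one in \<open>|x - y|\<close>.\<close>

lemma far_exp:
fixes x y :: "real^'n"
assumes "T > 0" "(norm x)^2 < T | (norm x)^2 / (4 * real CARD('n)) <= (norm (x - y))^2"
shows "exp (- 3 / 2) * exp (- (6 * real CARD('n) + 1) * (norm (x - y))^2 / T)
 <= exp (- (norm x)\<^sup>2 / (2 * T)) * exp (- (norm y)\<^sup>2 / (2 * T))"
proof -
let ?d = "real CARD('n)"
define r where "r = (norm (x - y))^2"
have d: "?d >= 1" by (simp add: Suc_leI)
have r: "r >= 0" by (simp add: r_def)
have "norm y <= norm x + norm (x - y)" using norm_triangle_ineq4[of x "x - y"] by simp
then have "(norm y)^2 <= (norm x + norm (x - y))^2" by (intro power_mono) auto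
also have "... <= 2 * (norm x)^2 + 2 * r"
 unfolding r_def using zero_le_power2[of "norm x - norm (x - y)"] by (simp add: power2_eq_square algebra_simps)
finally have y: "(norm y)^2 <= 2 * (norm x)^2 + 2 * r" .
have x: "(norm x)^2 <= T + 4 * ?d * r"
proof (cases "(norm x)^2 < T")
 case True then show ?thesis using r by (simp add: add_increasing2)
next
 case False
 then have "(norm x)^2 / (4 * ?d) <= r" using assms(2) by (simp add: r_def)
 then have "(norm x)^2 <= r * (4 * ?d)" using d by (subst (asm) pos_divide_le_eq) auto
 then show ?thesis using assms(1) by (simp add: mult_ac)
qed
have "(norm x)^2 + (norm y)^2 <= 3 * T + 2 * (6 * ?d + 1) * r" using x y by (simp add: algebra_simps)
then have "((norm x)^2 + (norm y)^2) / (2 * T) <= (3 * T + 2 * (6 * ?d + 1) * r) / (2 * T)"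
 using assms(1) by (intro divide_right_mono) auto
also have "... = 3 / 2 + (6 * ?d + 1) * r / T" using assms(1) by (simp add: field_simps)
finally have "- 3 / 2 + - (6 * ?d + 1) * r / T <= - (norm x)\<^sup>2 / (2 * T) + - (norm y)\<^sup>2 / (2 * T)"
 unfolding add_divide_distrib mult_minus_left minus_divide_left[symmetric] by linarith
then show ?thesis unfolding r_def[symmetric] exp_add[symmetric] by (simp only: exp_le_cancel_iff)
qed

text \<open>In the far regime split \<open>8 T\<close> into two halves: \<open>to_base\<close> at
  \<open>x\<close> and, by symmetry of the semigroup, at \<open>y\<close>, both ending in the base
  cube. Two normalisations \<open>T^(-d/2)\<close> against one cube volume leave
  \<open>T^(-d/2)\<close>. The near regime is a single half-space step.\<close>

lemma kernel_lower:
obtains c where "c > 0" "!!T Om i0 sgm0 x A. T >= ta ==> good Om i0 sgm0 ==> x \<in> Om ==> x ~= 0 ==> A \<in> sets borel ==> A \<subseteq> Om - {0} ==>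
 (NN y. ind A y * en (c * H T x * H T y * (1 / sqrt T) ^ CARD('n) * exp (- (6 * real CARD('n) + 1) * (norm (x - y))^2 / T)))
  <= P (8 * T) (ind A) x"
proof -
obtain c1 al where c1: "c1 > 0" and al: "al > 0" and tb: "!!T Om i0 sgm0 x f. T >= ta ==> good Om i0 sgm0 ==> x \<in> Om ==> x ~= 0 ==> f \<in> bm ==>
 en (c1 * H T x * (1 / sqrt T) ^ CARD('n) * exp (- (norm x)\<^sup>2 / (2 * T))) * (NN w. ind (base i0 sgm0 (al * sqrt T)) w * f w) <= P (4 * T) f x"
 by (rule to_base) (rule that)
\<comment> \<open>With this constant, \<open>al' * sqrt (8 T)\<close> is the coordinate bound that
  \<open>near_coord\<close> provides for points near \<open>x\<close>.\<close>
define al' where "al' = 1 / (2 * sqrt (8 * real CARD('n)))"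
have al': "al' > 0" by (simp add: al'_def)
obtain c2 where c2: "c2 > 0" and hs: "!!T sgm i z f. T >= ta ==> f \<in> bm ==> (sgm = 1 | sgm = -1) ==> al' * sqrt T <= sgm * z $ i ==>
 en c2 * (NN w. ind {w. al' * sqrt T <= sgm * w $ i} w * (en (gauss_q T z w) * f w)) <= P T f z"
 by (rule hs_step[OF al']) (rule that)
define cn where "cn = c2 * (1 / sqrt (32 * pi)) ^ CARD('n)"
define cf where "cf = c1 * c1 * (2 * al) ^ CARD('n) * exp (- 3 / 2)"
have cnf: "cn > 0" "cf > 0" using c1 c2 al by (auto simp: cn_def cf_def)
define g where "g T x y = H T x * H T y * (1 / sqrt T) ^ CARD('n) * exp (- (6 * real CARD('n) + 1) * (norm (x - y))^2 / T)" for T and x y :: "real^'n"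
have [measurable]: "(%y. g T x y) \<in> bm" for T x unfolding g_def H_def by measurable
have "0 < min cn cf" using cnf by simp
then show ?thesis
proof (rule that)
 fix T Om i0 sgm0 and x :: "real^'n" and A
 assume T: "ta <= T" and go: "good Om i0 sgm0" and x: "x \<in> Om" "x ~= 0" and [measurable]: "A \<in> sets borel" and A: "A \<subseteq> Om - {0}"
 have T0: "T > 0" using T ta by simp
 have Hb: "0 <= H T z & H T z <= 1" if "z ~= 0" for z using n_pos[of "(norm z)^2"] n_pos[of T] that T0 by (auto simp: H_def)
 define k where "k = (1 / sqrt T) ^ CARD('n)"
 have k: "k >= 0" using T0 by (simp add: k_def)
 \<comment> \<open>The targets for which the far argument fails: \<open>x\<close> is far from the
   origin and \<open>y\<close> is close to it. Both points then lie in one half-space at distance of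
   order \<open>sqrt T\<close>, and the boundary factors in the claim are simply bounded by
   1.\<close>
 define N where "N = {y. T <= (norm x)^2 & (norm (x - y))^2 < (norm x)^2 / (4 * real CARD('n))}"
 have [measurable]: "N \<in> sets borel" unfolding N_def by measurable
 have near: "(NN y. ind (A \<inter> N) y * en (cn * g T x y)) <= P (8 * T) (ind (A \<inter> N)) x"
 proof (cases "T <= (norm x)^2")
  case True
  from large_coord[of "(norm x)^2" x] obtain i sgm where i: "sgm = 1 | sgm = -1" "sqrt ((norm x)^2 / real CARD('n)) <= sgm * x $ i" by auto
  have as: "al' * sqrt (8 * T) = sqrt (T / real CARD('n)) / 2"
  by (simp add: al'_def real_sqrt_mult real_sqrt_divide)
  have co: "al' * sqrt (8 * T) <= sgm * y $ i" if "y \<in> N" for y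
  unfolding as using that True T0 i by (intro near_coord[of T x]) (auto simp: N_def)
  have xN: "x \<in> N" using True x by (simp add: N_def)
  have "(NN y. ind (A \<inter> N) y * en (cn * g T x y))
  <= (NN w. en c2 * (ind {w. al' * sqrt (8 * T) <= sgm * w $ i} w * (en (gauss_q (8 * T) x w) * ind (A \<inter> N) w)))"
  proof (intro nn_integral_mono)
  fix y
  show "ind (A \<inter> N) y * en (cn * g T x y) <= en c2 * (ind {w. al' * sqrt (8 * T) <= sgm * w $ i} y * (en (gauss_q (8 * T) x y) * ind (A \<inter> N) y))"
  proof (cases "y \<in> A \<inter> N")
   case y: True
   have y0: "y ~= 0" using y A by auto
   have "g T x y <= 1 * 1 * k * exp (- (norm (x - y))\<^sup>2 / (4 * (8 * T)))"
    unfolding g_def k_def[symmetric]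
   proof (intro mult_mono)
    show "exp (- (6 * real CARD('n) + 1) * (norm (x - y))^2 / T) <= exp (- (norm (x - y))\<^sup>2 / (4 * (8 * T)))"
    proof -
    have "1 / 32 * ((norm (x - y))^2 / T) <= (6 * real CARD('n) + 1) * ((norm (x - y))^2 / T)" using T0 by (intro mult_right_mono) auto
    then have "(norm (x - y))^2 / (4 * (8 * T)) <= (6 * real CARD('n) + 1) * (norm (x - y))^2 / T" by simp
    then show ?thesis unfolding exp_le_cancel_iff mult_minus_left minus_divide_left[symmetric] by linarith
    qed
   qed (use Hb[OF x(2)] Hb[OF y0] k in auto)
   moreover have "gauss_q (8 * T) x y = (1 / sqrt (32 * pi)) ^ CARD('n) * (k * exp (- (norm (x - y))\<^sup>2 / (4 * (8 * T))))"
   proof -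
    have "(4 * pi * (8 * T)) powr (- real CARD('n) / 2) = (1 / sqrt (4 * pi * (8 * T))) ^ CARD('n)" using T0 by (intro gauss_norm_const) simp
    also have "sqrt (4 * pi * (8 * T)) = sqrt (32 * pi) * sqrt T" by (simp flip: real_sqrt_mult)
    also have "(1 / (sqrt (32 * pi) * sqrt T)) ^ CARD('n) = (1 / sqrt (32 * pi)) ^ CARD('n) * k"
    unfolding k_def power_mult_distrib[symmetric] by simp
    finally show ?thesis unfolding gauss_q_def by simp
   qed
   ultimately have "cn * g T x y <= c2 * gauss_q (8 * T) x y"
    unfolding cn_def using c2 by (simp add: mult_left_mono mult.assoc)
   then have "en (cn * g T x y) <= en c2 * en (gauss_q (8 * T) x y)"
    using c2 gauss_q_nonneg[of "8 * T" x y] by (simp add: ennreal_leI flip: ennreal_mult)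
   then show ?thesis using y co[of y] by simp
  qed simp
  qed
  also have "... = en c2 * (NN w. ind {w. al' * sqrt (8 * T) <= sgm * w $ i} w * (en (gauss_q (8 * T) x w) * ind (A \<inter> N) w))"
  by (rule nn_integral_cmult) measurable
  also have "... <= P (8 * T) (ind (A \<inter> N)) x"
  using T ta by (intro hs i(1) co[OF xN]) auto
  finally show ?thesis .
 next
  case False
  then have "N = {}" by (simp add: N_def)
  then show ?thesis by simp
 qed
 have far: "(NN y. ind (A - N) y * en (cf * g T x y)) <= P (8 * T) (ind (A - N)) x"
 proof -
  define s where "s = al * sqrt T"
  have s: "s > 0" using al T0 by (simp add: s_def)
  define B where "B = base i0 sgm0 s"
  have [measurable]: "B \<in> sets borel" by (simp add: B_def base_def)
  have ks: "k * (2 * s) ^ CARD('n) = (2 * al) ^ CARD('n)"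
  unfolding k_def s_def power_mult_distrib[symmetric] using T0 by simp
  have [measurable]: "P (4 * T) (ind (A - N)) \<in> bm" "P (4 * T) (ind B) \<in> bm"
  using T0 by (auto intro!: P_measurable)
  define hx where "hx = c1 * H T x * k * exp (- (norm x)\<^sup>2 / (2 * T))"
  have hx: "hx >= 0" using c1 Hb[OF x(2)] k by (simp add: hx_def)
  have "(NN y. ind (A - N) y * en (cf * g T x y))
  <= (NN y. en hx * (P (4 * T) (ind B) y * ind (A - N) y))"
  proof (intro nn_integral_mono)
  fix y
  show "ind (A - N) y * en (cf * g T x y) <= en hx * (P (4 * T) (ind B) y * ind (A - N) y)"
  proof (cases "y \<in> A - N")
   case y: True
   then have y0: "y ~= 0" "y \<in> Om" using A by auto
   define hy where "hy = c1 * H T y * k * exp (- (norm y)\<^sup>2 / (2 * T))"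
   have "en (hy * (2 * s) ^ CARD('n)) = en hy * (NN w. ind B w * ind B w)"
   proof -
    have "(NN w. ind B w * ind B w) = emeasure lborel B"
    by (subst nn_integral_indicator[symmetric]) (auto simp: indicator_inter_arith[symmetric])
    also have "... = en ((2 * s) ^ CARD('n))" using s by (simp add: B_def base_def emeasure_cube)
    finally show ?thesis using c1 Hb[OF y0(1)] k by (simp add: ennreal_mult' hy_def)
   qed
   also have "... <= P (4 * T) (ind B) y"
    unfolding hy_def k_def B_def s_def by (rule tb[OF T go y0(2,1)]) (simp add: base_def)
   finally have *: "en (hy * (2 * s) ^ CARD('n)) <= P (4 * T) (ind B) y" .
   have "cf * g T x y <= hx * (hy * (2 * s) ^ CARD('n))"
   proof -
    have "(norm x)^2 < T | (norm x)^2 / (4 * real CARD('n)) <= (norm (x - y))^2" using y by (auto simp: N_def)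
    from far_exp[OF T0 this]
    have "c1 * c1 * (2 * al) ^ CARD('n) * (H T x * H T y * k) * (exp (- 3 / 2) * exp (- (6 * real CARD('n) + 1) * (norm (x - y))^2 / T))
    <= c1 * c1 * (2 * al) ^ CARD('n) * (H T x * H T y * k) * (exp (- (norm x)\<^sup>2 / (2 * T)) * exp (- (norm y)\<^sup>2 / (2 * T)))"
    using c1 al Hb[OF x(2)] Hb[OF y0(1)] k by (intro mult_left_mono) auto
    moreover have "hx * (hy * (2 * s) ^ CARD('n)) = c1 * c1 * (k * (2 * s) ^ CARD('n)) * (H T x * H T y * k) * (exp (- (norm x)\<^sup>2 / (2 * T)) * exp (- (norm y)\<^sup>2 / (2 * T)))"
    by (simp add: hx_def hy_def mult_ac)
    ultimately show ?thesis unfolding ks cf_def g_def k_def[symmetric] by (simp only: mult_ac)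
   qed
   then have "en (cf * g T x y) <= en (hx * (hy * (2 * s) ^ CARD('n)))" by (rule ennreal_leI)
   also have "... = en hx * en (hy * (2 * s) ^ CARD('n))" using hx by (rule ennreal_mult')
   also have "... <= en hx * P (4 * T) (ind B) y" by (intro mult_left_mono *) simp
   finally show ?thesis using y by simp
  qed simp
  qed
  also have "... = en hx * (NN y. P (4 * T) (ind B) y * ind (A - N) y)"
  by (rule nn_integral_cmult) measurable
  also have "(NN y. P (4 * T) (ind B) y * ind (A - N) y) = (NN y. ind B y * P (4 * T) (ind (A - N)) y)"
  using T0 by (intro P_symmetric[symmetric]) auto
  also have "en hx * ... <= P (4 * T) (P (4 * T) (ind (A - N))) x"
  unfolding hx_def k_def B_def s_def by (intro tb[OF T go x]) measurable
  also have "... = P (8 * T) (ind (A - N)) x" using P_semigroup[of "4 * T" "4 * T" "ind (A - N)" x] T0 by simp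
  finally show ?thesis .
 qed
 have g0: "g T x y >= 0" if "y ~= 0" for y using Hb[OF x(2)] Hb[OF that] k by (simp add: g_def k_def[symmetric])
 have "(NN y. ind A y * en (min cn cf * g T x y))
  <= (NN y. ind (A \<inter> N) y * en (cn * g T x y) + ind (A - N) y * en (cf * g T x y))"
 proof (intro nn_integral_mono)
  fix y
  show "ind A y * en (min cn cf * g T x y) <= ind (A \<inter> N) y * en (cn * g T x y) + ind (A - N) y * en (cf * g T x y)"
  using g0[of y] A by (auto split: split_indicator intro!: ennreal_leI mult_right_mono)
 qed
 also have "... = (NN y. ind (A \<inter> N) y * en (cn * g T x y)) + (NN y. ind (A - N) y * en (cf * g T x y))"
  by (rule nn_integral_add) measurable
 also have "... <= P (8 * T) (ind (A \<inter> N)) x + P (8 * T) (ind (A - N)) x" by (intro add_mono near far)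
 also have "... = P (8 * T) (%z. ind (A \<inter> N) z + ind (A - N) z) x"
  using T0 by (intro P_add[symmetric]) auto
 also have "(%z. ind (A \<inter> N) z + ind (A - N) z :: ennreal) = ind A" by (auto simp: fun_eq_iff split: split_indicator)
 finally show "(NN y. ind A y * en (min cn cf * H T x * H T y * (1 / sqrt T) ^ CARD('n) * exp (- (6 * real CARD('n) + 1) * (norm (x - y))^2 / T)))
  <= P (8 * T) (ind A) x"
  by (simp add: g_def mult.assoc)
qed
qed

end

section \<open>The radial profile away from the origin\<close>

lemma powr_deriv: "y > 0 ==> ((%y. y powr r) has_real_derivative r * y powr r / y) (at y)"
by (rule DERIV_cong[OF has_real_derivative_powr]) (auto simp: powr_diff)

lemma powr_over_deriv:
assumes "y > 0"
shows "((%y. y powr r / y) has_real_derivative (r - 1) * y powr r / y^2) (at y)"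
by (rule DERIV_cong[OF DERIV_divide[OF powr_deriv[OF assms] DERIV_ident]])
 (use assms in \<open>auto simp: field_simps power2_eq_square\<close>)

text \<open>The growing radial harmonic function as a function of \<open>y = |x|^2\<close>:
  \<open>|x|\<close> in dimension 1, \<open>1 + 2 ln |x|\<close> in dimension 2, a constant from
  dimension 3 on.\<close>

definition po :: "nat => real => real" where
"po d y = (if d = 1 then y powr (1 / 2) else if d = 2 then 1 + ln y else 1)"
definition po1 :: "nat => real => real" where
"po1 d y = (if d = 1 then 1 / 2 * (y powr (1 / 2) / y) else if d = 2 then 1 / y else 0)"
definition po2 :: "nat => real => real" where
"po2 d y = (if d = 1 then 1 / 2 * (- (1 / 2) * y powr (1 / 2) / y^2) else if d = 2 then - 1 / y^2 else 0)"

lemma po_deriv: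
assumes "y > 0"
shows "(po d has_real_derivative po1 d y) (at y)" "(po1 d has_real_derivative po2 d y) (at y)"
 "4 * y * po2 d y + 2 * real d * po1 d y = 0 | d = 0"
proof -
have f: "po d = (%y. if d = 1 then y powr (1 / 2) else if d = 2 then 1 + ln y else 1)"
 "po1 d = (%y. if d = 1 then 1 / 2 * (y powr (1 / 2) / y) else if d = 2 then 1 / y else 0)"
 by (auto simp: fun_eq_iff po_def po1_def)
show "(po d has_real_derivative po1 d y) (at y)"
 using powr_deriv[OF assms, of "1 / 2"] assms unfolding f(1) po1_def
 by (auto intro!: derivative_eq_intros)
have i: "((%y. 1 / y) has_real_derivative - 1 / y^2) (at y)"
 using assms by (auto intro!: derivative_eq_intros simp: power2_eq_square)
show "(po1 d has_real_derivative po2 d y) (at y)"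
 using DERIV_cmult[OF powr_over_deriv[OF assms, of "1 / 2"], of "1 / 2"] i unfolding f(2) po2_def
 by auto
show "4 * y * po2 d y + 2 * real d * po1 d y = 0 | d = 0"
 using assms by (auto simp: po1_def po2_def power2_eq_square)
qed

lemma po2_cont: "continuous_on {0<..} (po2 d)"
proof -
have "continuous_on {0<..} (%y. if d = 1 then 1 / 2 * (- (1 / 2) * y powr (1 / 2) / y^2) else if d = 2 then - 1 / y^2 else 0 :: real)"
 by (cases "d = 1"; cases "d = 2") (auto intro!: continuous_intros)
then show ?thesis by (simp add: po2_def[abs_def])
qed

lemma po_props:
assumes "y > 0"
shows "0 <= po1 d y" "1 <= y ==> 1 <= po d y"
 "1 <= y ==> 1 <= c ==> po d (c * y) <= c * po d y"
proof -
show "0 <= po1 d y" using assms by (auto simp: po1_def)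
show "1 <= po d y" if "1 <= y" using that ge_one_powr_ge_zero[of y "1 / 2"] by (auto simp: po_def)
show "po d (c * y) <= c * po d y" if y: "1 <= y" and c: "1 <= c"
proof -
 have "c powr (1 / 2) <= c powr 1" using c by (intro powr_mono) auto
 then have 1: "c powr (1 / 2) * y powr (1 / 2) <= c * y powr (1 / 2)" using c by (intro mult_right_mono) auto
 have "ln c <= c - 1" using c by (intro ln_le_minus_one) auto
 moreover have "0 <= (c - 1) * ln y" using c y by (intro mult_nonneg_nonneg) auto
 ultimately have "1 + (ln c + ln y) <= c * (1 + ln y)" by (simp add: algebra_simps)
 then show ?thesis using 1 c y by (auto simp: po_def powr_mult ln_mult)
qed
qed

lemma outer_derivs:
fixes c s Y :: real
assumes "y > 0"
shows "((%y. po d y - po d Y + c * (y powr s - Y powr s)) has_real_derivative po1 d y + c * s * (y powr s / y)) (at y)"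
 "((%y. po1 d y + c * s * (y powr s / y)) has_real_derivative po2 d y + c * s * ((s - 1) * y powr s / y^2)) (at y)"
proof -
show "((%y. po d y - po d Y + c * (y powr s - Y powr s)) has_real_derivative po1 d y + c * s * (y powr s / y)) (at y)"
 by (rule DERIV_cong[OF DERIV_add[OF DERIV_diff[OF po_deriv(1)[OF assms] DERIV_const]
   DERIV_cmult[OF DERIV_diff[OF powr_deriv[OF assms] DERIV_const]]]]) simp
show "((%y. po1 d y + c * s * (y powr s / y)) has_real_derivative po2 d y + c * s * ((s - 1) * y powr s / y^2)) (at y)"
 by (rule DERIV_add[OF po_deriv(2)[OF assms] DERIV_cmult[OF powr_over_deriv[OF assms]]])
qed

text \<open>A bounded perturbation of the harmonic radial function that is strictly subharmonic near infinity:
the term \<open>y\<^sup>s\<close> contributes \<open>4 s (s + d/2 - 1) y\<^sup>s\<close>.\<close>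
lemma outer_sub:
assumes d: "d >= 1" and C2: "C2 > 0" and g: "0 < g" "g <= 1 / 8"
obtains Y O0 O1 O2 La m where "Y >= 1" "La >= 0" "m > 0" "O0 Y = 0"
 "!!y. y > 0 ==> DERIV O0 y :> O1 y" "!!y. y > 0 ==> DERIV O1 y :> O2 y"
 "continuous_on {0<..} O2"
 "!!y. y >= Y ==> 0 < O1 y" "!!y. y >= Y ==> 8 * y * O1 y <= La * (1 + O0 y)" "!!y. y >= Y ==> 0 <= O0 y"
 "!!y. y >= Y ==> C2 * y powr (- 2 * g) * (1 + O0 y) <= y * (4 * y * O2 y + 2 * real d * O1 y)"
 "!!y. y >= Y ==> m * po d y <= 1 + O0 y" "!!y. y >= Y ==> 1 + O0 y <= 2 * po d y"
proof -
\<comment> \<open>Large enough that the gain from the perturbation beats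
  \<open>C2 * y powr (- 2 * g)\<close> times the profile in each of the three dimension regimes.
  \<open>Y\<close> is chosen so that the relative size \<open>r y = X * y powr (- g)\<close> of the
  perturbation is 1 at \<open>Y\<close> and smaller beyond.\<close>
define X where "X = 1 + 8 * C2 / (3 * g) + C2 * (1 + 1 / g) / (2 * g)"
have X: "X >= 1" "8 * C2 / (3 * g) <= X" "C2 * (1 + 1 / g) / (2 * g) <= X" using C2 g by (auto simp: X_def)
define Y where "Y = X powr (1 / g)"
have Y: "Y >= 1" "Y powr g = X" using X g by (auto simp: Y_def powr_powr ge_one_powr_ge_zero)
have Y0: "Y > 0" using Y by simp
\<comment> \<open>The perturbation \<open>c * y powr s\<close> behaves like
  \<open>y powr (- g)\<close> times a power solution, and the sign of \<open>c\<close> is such that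
  \<open>c * s * (s + d/2 - 1)\<close> is positive: \<open>c\<close> is positive only in dimension
  2.\<close>
define s where "s = (if d = 1 then 1 / 2 else 0) - g"
define c where "c = (if d = 1 then - X / 2 else if d = 2 then X / (2 * g) else - X)"
define O0 where "O0 y = po d y - po d Y + c * (y powr s - Y powr s)" for y
define O1 where "O1 y = po1 d y + c * s * (y powr s / y)" for y
define O2 where "O2 y = po2 d y + c * s * ((s - 1) * y powr s / y^2)" for y
define r where "r y = X * y powr (- g)" for y
have r: "0 < r y & r y <= 1" if "y >= Y" for y
proof -
 have y: "y > 0" using that Y0 by simp
 have "Y powr g <= y powr g" using that Y0 g by (intro powr_mono2) auto
 then show ?thesis using y X by (simp add: r_def Y powr_minus field_simps)
qed
have yg: "r y = X * y powr g * y powr (- 2 * g)" "y powr g >= 1" if "y >= Y" for y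
proof -
 have y: "y >= 1" using that Y by simp
 show "r y = X * y powr g * y powr (- 2 * g)" using y by (simp add: r_def powr_add[symmetric])
 show "y powr g >= 1" using y g by (intro ge_one_powr_ge_zero) auto
qed
have rY: "r Y = 1" using Y0 X Y by (simp add: r_def powr_minus)
have lap: "y * (4 * y * O2 y + 2 * real d * O1 y) = c * (4 * s * (s + real d / 2 - 1)) * y powr s" if "y > 0" for y
proof -
 have "4 * y * po2 d y + 2 * real d * po1 d y = 0" using po_deriv(3)[OF that, of d] d by auto
 moreover have "y * (4 * y * O2 y + 2 * real d * O1 y) = y * (4 * y * po2 d y + 2 * real d * po1 d y)
  + y * (4 * y * (c * s * ((s - 1) * y powr s / y^2)) + 2 * real d * (c * s * (y powr s / y)))"
  unfolding O1_def O2_def by (simp add: algebra_simps)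
 ultimately have "y * (4 * y * O2 y + 2 * real d * O1 y) = y * (4 * y * (c * s * ((s - 1) * y powr s / y^2)) + 2 * real d * (c * s * (y powr s / y)))"
  by simp
 also have "... = c * (4 * s * (s + real d / 2 - 1)) * y powr s" using that by (simp add: field_simps power2_eq_square)
 finally show ?thesis .
qed
have O0Y: "O0 Y = 0" by (simp add: O0_def)
have der: "DERIV O0 y :> O1 y" "DERIV O1 y :> O2 y" if "y > 0" for y
 using outer_derivs(1)[OF that, where d = d and Y = Y and c = c and s = s] outer_derivs(2)[OF that, where d = d and c = c and s = s] unfolding O0_def[abs_def] O1_def[abs_def] O2_def by auto
have cont: "continuous_on {0<..} O2"
 unfolding O2_def[abs_def] by (intro continuous_intros po2_cont) auto
consider "d = 1" | "d = 2" | "d >= 3" using d by linarith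
then show ?thesis
proof cases
 case 1
 define m where "m = 1 / (2 * sqrt Y)"
 have m: "m > 0" using Y0 by (simp add: m_def)
 have sq: "y powr (1 / 2) = sqrt y" if "y >= Y" for y using that Y0 by (intro powr_half_sqrt) simp
 have cs: "c * y powr s = - (r y / 2) * sqrt y" if "y >= Y" for y
 proof -
  have y: "y > 0" using that Y0 by simp
  have "y powr s = y powr (1 / 2) * y powr (- g)" using 1 y by (simp add: s_def powr_add[symmetric])
  then show ?thesis using 1 sq[OF that] by (simp add: c_def r_def)
 qed
 have sY: "1 <= sqrt Y" "sqrt Y <= sqrt y" if "y >= Y" for y using Y that by auto
 have O0: "O0 y = sqrt y * (1 - r y / 2) - sqrt Y / 2" if "y >= Y" for y
 proof -
  have "O0 y = sqrt y - sqrt Y + (c * y powr s - c * Y powr s)"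
  using 1 sq[OF that] sq[of Y] by (simp add: O0_def po_def algebra_simps)
  then show ?thesis unfolding cs[OF that] cs[OF order_refl] rY by (simp add: algebra_simps)
 qed
 have O0b: "sqrt y / 2 - sqrt Y / 2 <= O0 y" "O0 y <= sqrt y" if "y >= Y" for y
 proof -
  have "sqrt y * (1 / 2) <= sqrt y * (1 - r y / 2)" "sqrt y * (1 - r y / 2) <= sqrt y * 1"
  using r[OF that] that Y0 by (auto intro!: mult_left_mono)
  then show "sqrt y / 2 - sqrt Y / 2 <= O0 y" "O0 y <= sqrt y" using O0[OF that] sY(1)[OF that] by linarith+
 qed
 have yO1: "y * O1 y = sqrt y * (1 / 2 - (1 / 2 - g) * (r y / 2))" if "y >= Y" for y
 proof -
  have y: "y > 0" using that Y0 by simp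
  have "y * O1 y = sqrt y / 2 + s * (c * y powr s)"
  using 1 y sq[OF that] by (simp add: O1_def po1_def field_simps)
  moreover have "s = 1 / 2 - g" using 1 by (simp add: s_def)
  ultimately show ?thesis unfolding cs[OF that] by (simp add: algebra_simps add_divide_distrib diff_divide_distrib)
 qed
 have fr: "1 / 4 <= 1 / 2 - (1 / 2 - g) * (r y / 2)" "1 / 2 - (1 / 2 - g) * (r y / 2) <= 1 / 2" if "y >= Y" for y
 proof -
  have "(1 / 2 - g) * (r y / 2) <= (1 / 2) * (1 / 2)" by (rule mult_mono) (use g r[OF that] in auto)
  moreover have "0 <= (1 / 2 - g) * (r y / 2)" by (rule mult_nonneg_nonneg) (use g r[OF that] in auto)
  ultimately show "1 / 4 <= 1 / 2 - (1 / 2 - g) * (r y / 2)" "1 / 2 - (1 / 2 - g) * (r y / 2) <= 1 / 2" by linarith+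
 qed
 have lower: "m * po d y <= 1 + O0 y" if "y >= Y" for y
 proof -
  define q where "q = sqrt y / sqrt Y"
  have q: "q >= 1" "sqrt y = q * sqrt Y" using sY[OF that] Y0 by (auto simp: q_def)
  have "1 * (q - 1) <= sqrt Y * (q - 1)" using q sY[OF that] by (intro mult_right_mono) auto
  then have "q / 2 <= 1 + (sqrt y / 2 - sqrt Y / 2)" using q by (simp add: algebra_simps)
  moreover have "m * po d y = q / 2" using 1 sq[OF that] by (simp add: po_def m_def q_def)
  ultimately show ?thesis using O0b(1)[OF that] by linarith
 qed
 show ?thesis
 proof (rule that[of Y "4 / m" m O0 O1 O2])
  fix y assume y: "y >= Y"
  have y0: "y > 0" using y Y0 by simp
  have "0 < 1 / 2 - (1 / 2 - g) * (r y / 2)" using fr(1)[OF y] by linarith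
  then have "0 < y * O1 y" unfolding yO1[OF y] using y0 by (intro mult_pos_pos) auto
  then show "0 < O1 y" using y0 by (simp add: zero_less_mult_iff)
  have "y * O1 y <= sqrt y * (1 / 2)" unfolding yO1[OF y] using fr[OF y] y0 by (intro mult_left_mono) auto
  then have "8 * y * O1 y <= 4 * sqrt y" by simp
  also have "... = 4 / m * (m * po d y)" using m 1 sq[OF y] by (simp add: po_def)
  also have "... <= 4 / m * (1 + O0 y)" using m lower[OF y] by (intro mult_left_mono) auto
  finally show "8 * y * O1 y <= 4 / m * (1 + O0 y)" .
  show "0 <= O0 y" using O0b[OF y] sY[OF y] by linarith
  show "m * po d y <= 1 + O0 y" by (rule lower[OF y])
  have "1 <= sqrt y" using sY[OF y] by linarith
  then have u: "1 + O0 y <= 2 * sqrt y" using O0b(2)[OF y] by linarith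
  then show "1 + O0 y <= 2 * po d y" using 1 sq[OF y] by (simp add: po_def)
  have "C2 * y powr (- 2 * g) * (1 + O0 y) <= C2 * y powr (- 2 * g) * (2 * sqrt y)" using C2 u by (intro mult_left_mono) auto
  also have "... = 8 * C2 / (3 * g) * (3 / 4 * g * (y powr (- 2 * g) * sqrt y))" using g by simp
  also have "... <= X * y powr g * (3 / 4 * g * (y powr (- 2 * g) * sqrt y))"
  proof (rule mult_right_mono)
  have "X * 1 <= X * y powr g" using X yg(2)[OF y] by (intro mult_left_mono) auto
  then show "8 * C2 / (3 * g) <= X * y powr g" using X(2) by linarith
  qed (use g y0 in auto)
  also have "... = 3 / 4 * g * (r y * sqrt y)" unfolding yg(1)[OF y] by simp
  also have "... <= 2 * g * (1 / 2 - g) * (r y * sqrt y)"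
  proof (rule mult_right_mono)
  have "g * (3 / 4) <= g * (2 * (1 / 2 - g))" using g by (intro mult_left_mono) auto
  then show "3 / 4 * g <= 2 * g * (1 / 2 - g)" by (simp only: mult_ac)
  qed (use r[OF y] y0 in auto)
  also have "... = (4 * s * (s + real d / 2 - 1)) * (c * y powr s)" 
  proof -
  have s: "s = 1 / 2 - g" and d1: "real d = 1" using 1 by (simp_all add: s_def)
  show ?thesis unfolding cs[OF y] unfolding s d1 by (simp add: algebra_simps)
  qed
  also have "... = y * (4 * y * O2 y + 2 * real d * O1 y)" unfolding lap[OF y0] by simp
  finally show "C2 * y powr (- 2 * g) * (1 + O0 y) <= y * (4 * y * O2 y + 2 * real d * O1 y)" .
 qed (use Y m O0Y der cont in auto)
next
 case 2
 define m where "m = 1 / (2 * (1 + ln Y))"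
 have lY: "ln Y >= 0" using Y by simp
 have m: "m > 0" using lY by (simp add: m_def add_pos_nonneg)
 have cs: "c * y powr s = r y / (2 * g)" for y using 2 by (simp add: c_def s_def r_def)
 have O0: "O0 y = ln y - ln Y + (r y - 1) / (2 * g)" for y
 proof -
  have "O0 y = ln y - ln Y + (c * y powr s - c * Y powr s)" using 2 by (simp add: O0_def po_def algebra_simps)
  then show ?thesis unfolding cs rY by (simp add: diff_divide_distrib)
 qed
 have lr: "1 - r y <= g * (ln y - ln Y)" if "y >= Y" for y
 proof -
  have y: "y > 0" using that Y0 by simp
  have "ln (r y) = g * ln Y - g * ln y" using y X Y0 unfolding r_def Y(2)[symmetric] by (simp add: ln_mult ln_powr)
  moreover have "ln (r y) <= r y - 1" using r[OF that] by (intro ln_le_minus_one) auto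
  ultimately show ?thesis by (simp add: algebra_simps)
 qed
 have O0b: "(ln y - ln Y) / 2 <= O0 y" "O0 y <= ln y" if "y >= Y" for y
 proof -
  have "(1 - r y) / (2 * g) <= (g * (ln y - ln Y)) / (2 * g)" using lr[OF that] g by (intro divide_right_mono) auto
  then have "(1 - r y) / (2 * g) <= (ln y - ln Y) / 2" using g by simp
  moreover define w where "w = (1 - r y) / (2 * g)"
  moreover have O0w: "O0 y = ln y - ln Y - w" unfolding O0 w_def by (simp add: diff_divide_distrib)
  ultimately have w: "w <= (ln y - ln Y) / 2" by simp
  then have "(ln y - ln Y) / 2 <= (ln y - ln Y) - w" by (simp add: field_simps)
  then show "(ln y - ln Y) / 2 <= O0 y" by (simp only: O0w)
  have "0 <= w" unfolding w_def using r[OF that] g by simp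
  then show "O0 y <= ln y" unfolding O0w using lY by simp
 qed
 have yO1: "y * O1 y = 1 - r y / 2" if "y >= Y" for y
 proof -
  have y: "y > 0" using that Y0 by simp
  have "y * O1 y = 1 + s * (c * y powr s)" using 2 y by (simp add: O1_def po1_def field_simps)
  then show ?thesis unfolding cs using 2 g by (simp add: s_def)
 qed
 have lower: "m * po d y <= 1 + O0 y" if "y >= Y" for y
 proof -
  have ly: "ln Y <= ln y" using that Y0 by simp
  have "m * po d y = (1 + ln Y + (ln y - ln Y)) / (2 * (1 + ln Y))" using 2 by (simp add: po_def m_def)
  also have "... = 1 / 2 + (ln y - ln Y) / (2 * (1 + ln Y))" using lY by (simp add: field_simps)
  also have "(ln y - ln Y) / (2 * (1 + ln Y)) <= (ln y - ln Y) / 2" using lY ly by (intro divide_left_mono) auto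
  finally show ?thesis using O0b(1)[OF that] by linarith
 qed
 show ?thesis
 proof (rule that[of Y 8 m O0 O1 O2])
  fix y assume y: "y >= Y"
  have y0: "y > 0" using y Y0 by simp
  have ly: "ln Y <= ln y" using y Y0 by simp
  have "0 < y * O1 y" unfolding yO1[OF y] using r[OF y] by simp
  then show "0 < O1 y" using y0 by (simp add: zero_less_mult_iff)
  have "0 <= (ln y - ln Y) / 2" using ly by simp
  with O0b(1)[OF y] show nn: "0 <= O0 y" by (rule order_trans[rotated])
  have "8 * y * O1 y <= 8" using yO1[OF y] r[OF y] by simp
  then show "8 * y * O1 y <= 8 * (1 + O0 y)" using nn by (simp add: distrib_left)
  show "m * po d y <= 1 + O0 y" by (rule lower[OF y])
  have u: "1 + O0 y <= 1 + ln y" using O0b(2)[OF y] by linarith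
  have "0 <= ln y" using ly lY by linarith
  then show "1 + O0 y <= 2 * po d y" using 2 u by (simp add: po_def)
  have "ln (y powr g) <= y powr g - 1" using y0 by (intro ln_le_minus_one) auto
  then have "g * ln y <= y powr g" using y0 by (simp add: ln_powr)
  then have "ln y <= y powr g / g" using g by (simp add: pos_le_divide_eq mult.commute)
  then have l: "1 + ln y <= y powr g * (1 + 1 / g)" using yg(2)[OF y] by (simp add: distrib_left)
  have "C2 * y powr (- 2 * g) * (1 + O0 y) <= C2 * y powr (- 2 * g) * (y powr g * (1 + 1 / g))" using C2 u l by (intro mult_left_mono) auto
  also have "... = C2 * (1 + 1 / g) / (2 * g) * (2 * g * (y powr g * y powr (- 2 * g)))" using g by simp
  also have "... <= X * (2 * g * (y powr g * y powr (- 2 * g)))" using X(3) g by (intro mult_right_mono) auto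
  also have "... = 2 * g * r y" unfolding yg(1)[OF y] by simp
  also have "... = (4 * s * (s + real d / 2 - 1)) * (c * y powr s)" 
  proof -
  have "s = - g" "real d = 2" using 2 by (simp_all add: s_def)
  then show ?thesis unfolding cs using g by simp
  qed
  also have "... = y * (4 * y * O2 y + 2 * real d * O1 y)" unfolding lap[OF y0] by simp
  finally show "C2 * y powr (- 2 * g) * (1 + O0 y) <= y * (4 * y * O2 y + 2 * real d * O1 y)" .
 qed (use Y m O0Y der cont in auto)
next
 case 3
 have cs: "c * y powr s = - r y" for y using 3 by (simp add: c_def s_def r_def)
 have O0: "O0 y = 1 - r y" for y
 proof -
  have "O0 y = c * y powr s - c * Y powr s" using 3 by (simp add: O0_def po_def algebra_simps)
  then show ?thesis unfolding cs rY by simp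
 qed
 have yO1: "y * O1 y = g * r y" if "y >= Y" for y
 proof -
  have y: "y > 0" using that Y0 by simp
  have "y * O1 y = s * (c * y powr s)" using 3 y by (simp add: O1_def po1_def field_simps)
  then show ?thesis unfolding cs using 3 by (simp add: s_def)
 qed
 show ?thesis
 proof (rule that[of Y 8 "1 / 2" O0 O1 O2])
  fix y assume y: "y >= Y"
  have y0: "y > 0" using y Y0 by simp
  have "0 < y * O1 y" unfolding yO1[OF y] using r[OF y] g by simp
  then show "0 < O1 y" using y0 by (simp add: zero_less_mult_iff)
  show nn: "0 <= O0 y" using O0 r[OF y] by simp
  have "g * r y <= 1 * 1" using r[OF y] g by (intro mult_mono) auto
  then have "8 * y * O1 y <= 8" using yO1[OF y] by simp
  then show "8 * y * O1 y <= 8 * (1 + O0 y)" using nn by (simp add: distrib_left)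
  have u: "1 + O0 y <= 2" using O0 r[OF y] by simp
  show "1 / 2 * po d y <= 1 + O0 y" "1 + O0 y <= 2 * po d y" using 3 u nn by (auto simp: po_def)
  have "C2 * y powr (- 2 * g) * (1 + O0 y) <= C2 * y powr (- 2 * g) * 2" using C2 u by (intro mult_left_mono) auto
  also have "... = 8 * C2 / (3 * g) * (3 / 4 * g * y powr (- 2 * g))" using g by simp
  also have "... <= X * y powr g * (3 / 4 * g * y powr (- 2 * g))"
  proof (rule mult_right_mono)
  have "X * 1 <= X * y powr g" using X yg(2)[OF y] by (intro mult_left_mono) auto
  then show "8 * C2 / (3 * g) <= X * y powr g" using X(2) by linarith
  qed (use g y0 in auto)
  also have "... = 3 / 4 * g * r y" unfolding yg(1)[OF y] by simp
  also have "... <= (4 * g * (real d / 2 - 1 - g)) * r y"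
  proof (rule mult_right_mono)
  have "g * (3 / 4) <= g * (4 * (real d / 2 - 1 - g))" using g 3 by (intro mult_left_mono) auto
  then show "3 / 4 * g <= 4 * g * (real d / 2 - 1 - g)" by (simp only: mult_ac)
  qed (use r[OF y] in auto)
  also have "... = (4 * s * (s + real d / 2 - 1)) * (c * y powr s)" 
  proof -
  have "s = - g" using 3 by (simp add: s_def)
  then show ?thesis unfolding cs by (simp add: algebra_simps)
  qed
  also have "... = y * (4 * y * O2 y + 2 * real d * O1 y)" unfolding lap[OF y0] by simp
  finally show "C2 * y powr (- 2 * g) * (1 + O0 y) <= y * (4 * y * O2 y + 2 * real d * O1 y)" .
 qed (use Y O0Y der cont in auto)
qed
qed

section \<open>Gluing, and the WKB profile near the origin\<close>

text \<open>A strict order of the slopes at a matching point orders the two functions oppositely on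
  its two sides. This is how concave and convex kinks are produced.\<close>

lemma kink_of_derivs:
fixes f g :: "real => real"
assumes "f y = g y" "(f has_real_derivative f') (at y)" "(g has_real_derivative g') (at y)" "f' < g'"
obtains rh where "rh > 0" "!!z. y <= z ==> z < y + rh ==> f z <= g z" "!!z. y - rh < z ==> z <= y ==> g z <= f z"
proof -
have D: "((%z. g z - f z) has_real_derivative g' - f') (at y)" by (rule DERIV_diff[OF assms(3,2)])
have p: "0 < g' - f'" using assms(4) by simp
obtain d1 where d1: "d1 > 0" "!!h. 0 < h ==> h < d1 ==> g y - f y < g (y + h) - f (y + h)"
 using DERIV_pos_inc_right[OF D p] by blast
obtain d2 where d2: "d2 > 0" "!!h. 0 < h ==> h < d2 ==> g (y - h) - f (y - h) < g y - f y"
 using DERIV_pos_inc_left[OF D p] by blast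
show ?thesis
proof (rule that[of "min d1 d2"])
 show "min d1 d2 > 0" using d1 d2 by simp
 show "f z <= g z" if "y <= z" "z < y + min d1 d2" for z
 proof (cases "z = y")
  case False
  then have "0 < z - y" "z - y < d1" using that by linarith+
  from d1(2)[OF this] show ?thesis using assms(1) by simp
 qed (use assms(1) in simp)
 show "g z <= f z" if "y - min d1 d2 < z" "z <= y" for z
 proof (cases "z = y")
  case False
  then have "0 < y - z" "y - z < d2" using that by linarith+
  from d2(2)[OF this] show ?thesis using assms(1) by simp
 qed (use assms(1) in simp)
qed
qed

lemma glued_mono:
fixes F Q :: "real => real"
assumes F: "!!y. 0 < y ==> y <= Y ==> EX D. DERIV F y :> D & 0 <= D"
 and Q: "!!y. Y <= y ==> EX D. DERIV Q y :> D & 0 <= D"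
 and g: "F Y = Q Y" and N: "!!y. N y = (if y <= Y then F y else Q y)" and y: "0 < y" "y <= y'"
shows "N y <= N y'"
proof -
have f: "F a <= F b" if "0 < a" "a <= b" "b <= Y" for a b
proof (rule DERIV_nonneg_imp_nondecreasing[OF that(2)])
 fix x assume "a <= x" "x <= b"
 then show "EX D. (F has_real_derivative D) (at x) & 0 <= D" using that by (intro F) auto
qed
have q: "Q a <= Q b" if "Y <= a" "a <= b" for a b
proof (rule DERIV_nonneg_imp_nondecreasing[OF that(2)])
 fix x assume "a <= x" "x <= b"
 then show "EX D. (Q has_real_derivative D) (at x) & 0 <= D" using that by (intro Q) auto
qed
consider "y' <= Y" | "y <= Y" "Y < y'" | "Y < y" by linarith
then show ?thesis
proof cases
 case 1 then show ?thesis using f[of y y'] y by (simp add: N)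
next
 case 2 then show ?thesis using f[of y Y] q[of Y y'] y g by (simp add: N)
next
 case 3 then show ?thesis using q[of y y'] y by (simp add: N)
qed
qed

text \<open>With \<open>y = r^2\<close>, \<open>\<beta> = 2 b\<close> and
  \<open>k = sqrt \<kappa> / \<beta>\<close>, the function \<open>exp (- k y^(-b)) y^a\<close> is
  \<open>h_bk\<close> for \<open>r < 1\<close>. The exponent \<open>e\<close> measures how well the
  coefficient of \<open>V\<close> approaches \<open>\<kappa>\<close> at 0, \<open>g\<close> the
  decay of \<open>V\<close> at infinity, and \<open>C\<close> bounds all constants.\<close>

locale potential_profile =
fixes d :: nat and b k a e g C :: real
assumes d: "d >= 1" and b: "b > 0" and k: "k > 0" and a: "a = (b + 1 - real d / 2) / 2"
 and e: "e > 0" "4 * e <= b" "e <= 1 / 4" and g: "g > 0" "2 * g <= b - 2 * e" "g <= 1 / 8" and C: "C > 0"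
begin

text \<open>The logarithm of the profile with a correction \<open>A * y powr e\<close>. The
  functions \<open>pP\<close> and \<open>pR\<close> are its first and second derivatives with
  respect to \<open>ln y\<close>.\<close>

definition ps :: "real => real => real" where "ps A y = - k * y powr (- b) + a * ln y + A * y powr e"
definition pP :: "real => real => real" where "pP A y = k * b * y powr (- b) + a + A * e * y powr e"
definition pR :: "real => real => real" where "pR A y = - (k * b * b * y powr (- b)) + A * e * e * y powr e"
definition FA :: "real => real => real" where "FA A y = exp (ps A y)"
definition FA1 :: "real => real => real" where "FA1 A y = FA A y * pP A y / y"
definition FA2 :: "real => real => real" where "FA2 A y = FA A y * ((pP A y)^2 - pP A y + pR A y) / y^2"
definition c0 :: real where "c0 = b * a - a^2"
text \<open>The bounding potentials multiplied by \<open>|x|^2\<close>. The main term is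
  \<open>\<kappa> r^(-2 \<beta>)\<close>, because \<open>4 k^2 b^2 = \<kappa>\<close>; the others
  are the admissible errors at 0 and at infinity.\<close>

definition yVm :: "real => real" where "yVm y = max 0 (4 * k^2 * b^2 * (y powr (- b))^2 - C * y powr (2 * e - b))"
definition yVp :: "real => real" where "yVp y = 4 * k^2 * b^2 * (y powr (- b))^2 + C * (y powr (2 * e - b) + y powr (- 2 * g))"
abbreviation Vm :: "'a::real_normed_vector => real" where "Vm x == yVm ((norm x)^2) / (norm x)^2"
abbreviation Vp :: "'a::real_normed_vector => real" where "Vp x == yVp ((norm x)^2) / (norm x)^2"
text \<open>The target shape. It need not be continuous at 1, as it is used only up to constant
  factors.\<close>

definition prof :: "real => real" where "prof y = (if y < 1 then FA 0 y else po d y)"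

lemma FA_pos: "FA A y > 0" by (simp add: FA_def)

lemma FA_deriv:
assumes y: "y > 0"
shows "(FA A has_real_derivative FA1 A y) (at y)" "(FA1 A has_real_derivative FA2 A y) (at y)"
proof -
have ps: "(ps A has_real_derivative pP A y / y) (at y)"
 unfolding ps_def[abs_def]
 by (rule DERIV_cong[OF DERIV_add[OF DERIV_add[OF DERIV_cmult[OF powr_deriv[OF y]] DERIV_cmult[OF DERIV_ln_divide[OF y]]] DERIV_cmult[OF powr_deriv[OF y]]]])
  (use y in \<open>simp add: pP_def field_simps\<close>)
have pP: "(pP A has_real_derivative pR A y / y) (at y)"
 unfolding pP_def[abs_def]
 by (rule DERIV_cong[OF DERIV_add[OF DERIV_add[OF DERIV_cmult[OF powr_deriv[OF y]] DERIV_const] DERIV_cmult[OF powr_deriv[OF y]]]])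
  (use y in \<open>simp add: pR_def field_simps\<close>)
show F: "(FA A has_real_derivative FA1 A y) (at y)"
 unfolding FA_def[abs_def] FA1_def by (rule DERIV_cong[OF DERIV_chain2[OF DERIV_exp ps]]) simp
show "(FA1 A has_real_derivative FA2 A y) (at y)"
 unfolding FA1_def[abs_def]
 by (rule DERIV_cong[OF DERIV_divide[OF DERIV_mult[OF F pP] DERIV_ident]])
  (use y in \<open>auto simp: FA1_def FA2_def field_simps power2_eq_square\<close>)
qed

lemma FA2_cont: "continuous_on {0<..} (FA2 A)"
unfolding FA2_def[abs_def] FA_def[abs_def] ps_def[abs_def] pP_def[abs_def] pR_def[abs_def]
by (intro continuous_intros) auto

text \<open>The leading term reproduces the main part of the potential and the choice of
  \<open>a\<close> cancels the term of order \<open>y^(-b)\<close>. With \<open>A = 0\<close> only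
  the constant \<open>c0\<close> is left over; the correction brings in the cross term
  \<open>8 k b A e y^(e - b)\<close>, dominant near 0 and of the sign of \<open>A\<close>.\<close>

lemma FA_lap:
assumes y: "y > 0"
shows "y * (4 * y * FA2 A y + 2 * real d * FA1 A y) = FA A y * (4 * k^2 * b^2 * (y powr (- b))^2
 + 4 * (2 * k * b * (A * e * y powr e) * y powr (- b) + (A * e * y powr e)^2 + (b + e) * (A * e * y powr e) + c0))"
proof -
define u q where "u = y powr (- b)" and "q = A * e * y powr e"
have dd: "real d = 2 * b + 2 - 4 * a" using a by simp
have P: "pP A y = k * b * u + a + q" "pR A y = - (k * b * b * u) + e * q" by (simp_all add: pP_def pR_def u_def q_def)
have "y * (4 * y * FA2 A y + 2 * real d * FA1 A y) = FA A y * (4 * ((pP A y)^2 - pP A y + pR A y) + 2 * real d * pP A y)"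
 using y by (simp add: FA1_def FA2_def field_simps power2_eq_square)
also have "4 * ((pP A y)^2 - pP A y + pR A y) + 2 * real d * pP A y
 = 4 * k^2 * b^2 * u^2 + 4 * (2 * k * b * q * u + q^2 + (b + e) * q + c0)"
 unfolding dd P c0_def by (simp add: algebra_simps power2_eq_square)
finally show ?thesis unfolding u_def q_def .
qed

lemma powr_at_0: "r > 0 ==> ((%y::real. y powr r) \<longlongrightarrow> 0) (at_right 0)"
by real_asymp

text \<open>For \<open>A = -1\<close> the cross term is a gain of order \<open>y^(e - b)\<close>. As
  \<open>y\<close> tends to 0 it beats the error \<open>C y^(2e - b)\<close> of the potential as
  well as the bounded terms, because \<open>0 < e < b\<close>.\<close>

lemma super_small:
obtains y0 where "0 < y0" "y0 < 1"
 "!!y. 0 < y ==> y <= y0 ==> 0 < pP (- 1) y"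
 "!!y. 0 < y ==> y <= y0 ==> y * (4 * y * FA2 (- 1) y + 2 * real d * FA1 (- 1) y) <= yVm y * FA (- 1) y"
 "!!y. 0 < y ==> y <= y0 ==> 2 * k^2 * b^2 * (y powr (- b))^2 <= yVm y"
proof -
have t1: "((%y::real. C * y powr e + 4 * e^2 * y powr (e + b) + 4 * (abs c0) * y powr (b - e)) \<longlongrightarrow> C * 0 + 4 * e^2 * 0 + 4 * (abs c0) * 0) (at_right 0)"
 using e b by (intro tendsto_intros powr_at_0) auto
have t2: "((%y::real. C * y powr (2 * e + b)) \<longlongrightarrow> C * 0) (at_right 0)"
 using e b by (intro tendsto_intros powr_at_0) auto
have t3: "((%y::real. (abs a) * y powr b + e * y powr (e + b)) \<longlongrightarrow> (abs a) * 0 + e * 0) (at_right 0)"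
 using e b by (intro tendsto_intros powr_at_0) auto
have p: "0 < 8 * k * b * e" "0 < 2 * k^2 * b^2" "0 < k * b" using k b e by auto
have "eventually (%y. C * y powr e + 4 * e^2 * y powr (e + b) + 4 * (abs c0) * y powr (b - e) < 8 * k * b * e
  & C * y powr (2 * e + b) < 2 * k^2 * b^2 & (abs a) * y powr b + e * y powr (e + b) < k * b) (at_right 0)"
 using p by (intro eventually_conj order_tendstoD(2)[OF t1] order_tendstoD(2)[OF t2] order_tendstoD(2)[OF t3]) simp_all
then obtain z where z: "z > 0" and E: "!!y. 0 < y ==> y < z ==> C * y powr e + 4 * e^2 * y powr (e + b) + 4 * (abs c0) * y powr (b - e) < 8 * k * b * e
  & C * y powr (2 * e + b) < 2 * k^2 * b^2 & (abs a) * y powr b + e * y powr (e + b) < k * b"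
 unfolding eventually_at_right_field by auto
define y0 where "y0 = min (z / 2) (1 / 2)"
show ?thesis
proof (rule that[of y0])
 show "0 < y0" "y0 < 1" using z by (auto simp: y0_def)
 fix y :: real assume y: "0 < y" "y <= y0"
 then have yz: "y < z" using z by (auto simp: y0_def)
 note E = E[OF y(1) yz]
 define u where "u = y powr (- b)"
 have u: "u > 0" using y by (simp add: u_def)
 have "(abs a) * y powr b * u + e * y powr (e + b) * u < k * b * u"
  using E u mult_strict_right_mono[of "(abs a) * y powr b + e * y powr (e + b)" "k * b" u] by (simp add: distrib_right)
 moreover have yb: "y powr b * u = 1" "y powr (e + b) * u = y powr e" using y by (auto simp: u_def powr_add[symmetric])
 ultimately have "(abs a) + e * y powr e < k * b * u" by (simp add: mult.assoc)
 then show "0 < pP (- 1) y" unfolding pP_def u_def by (simp add: abs_if split: if_splits)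
 have "C * y powr (2 * e - b) = C * y powr (2 * e + b) * u^2"
  using y by (simp add: u_def power2_eq_square powr_add[symmetric])
 also have "... <= 2 * k^2 * b^2 * u^2" using E by (intro mult_right_mono) auto
 finally show "2 * k^2 * b^2 * (y powr (- b))^2 <= yVm y" unfolding yVm_def u_def[symmetric] by simp
 define w where "w = y powr (e - b)"
 have w: "w > 0" using y by (simp add: w_def)
 have "(C * y powr e + 4 * e^2 * y powr (e + b) + 4 * (abs c0) * y powr (b - e)) * w <= 8 * k * b * e * w"
  using E w by (intro mult_right_mono) auto
 moreover have "y powr e * w = y powr (2 * e - b)" "y powr (e + b) * w = (y powr e)^2" "y powr (b - e) * w = 1"
  using y by (auto simp: w_def power2_eq_square powr_add[symmetric])
 ultimately have m: "C * y powr (2 * e - b) + 4 * e^2 * (y powr e)^2 + 4 * (abs c0) <= 8 * k * b * e * w"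
  by (simp add: distrib_right mult.assoc)
 have w': "w = y powr e * u" using y by (simp add: w_def u_def powr_add[symmetric])
 have q0: "0 <= (b + e) * (e * y powr e)" using b e by simp
 have c: "c0 <= (abs c0)" by simp
 have "4 * k^2 * b^2 * u^2 + 4 * (2 * k * b * (- 1 * e * y powr e) * u + (- 1 * e * y powr e)^2 + (b + e) * (- 1 * e * y powr e) + c0)
  = 4 * k^2 * b^2 * u^2 - 8 * k * b * e * w + 4 * e^2 * (y powr e)^2 - 4 * ((b + e) * (e * y powr e)) + 4 * c0"
  unfolding w' by (simp add: algebra_simps power2_eq_square)
 also have "... <= 4 * k^2 * b^2 * u^2 - C * y powr (2 * e - b)" using m q0 c by linarith
 also have "... <= yVm y" unfolding yVm_def u_def by simp
 finally show "y * (4 * y * FA2 (- 1) y + 2 * real d * FA1 (- 1) y) <= yVm y * FA (- 1) y"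
  unfolding FA_lap[OF y(1)] u_def[symmetric] using FA_pos[of "- 1" y] by (simp add: mult.commute mult_left_mono)
qed
qed

lemma powr_exp_le:
fixes y :: real
assumes "0 < y" "y <= 1" "r <= s"
shows "y powr s <= y powr r"
using powr_mono'[of r s y] assms by simp

lemma powr_le_one: "0 < y ==> y <= 1 ==> 0 <= r ==> y powr r <= (1::real)"
using powr_exp_le[of y 0 r] by simp

text \<open>With \<open>A\<close> large the gain has two parts: the cross term, linear in
  \<open>A\<close> and of size \<open>y^(e - b)\<close>, wins near 0, and the square of the
  correction, of size \<open>A^2 y^(2e)\<close>, wins elsewhere on the bounded range. The drift term
  with \<open>ta\<close> grows only linearly in \<open>A\<close>.\<close>

lemma sub_inner:
assumes Y: "Y >= 1" and ta: "ta > 0"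
obtains A where "A >= 0" "!!y. 0 < y ==> y <= Y ==> 0 <= pP A y"
 "!!y. 0 < y ==> y <= Y ==> yVp y * FA A y + 8 * y * (FA A y * pP A y) / ta <= y * (4 * y * FA2 A y + 2 * real d * FA1 A y)"
proof -
define t where "t = 8 / ta"
have t: "t > 0" using ta by (simp add: t_def)
define R where "R = 2 * C * Y + t * (k * b + (abs a)) * Y + 4 * (abs c0) * Y"
have R: "R >= 0" using C Y t k b by (simp add: R_def)
define dt where "dt = ((abs a) / (k * b) + 1) powr (- 1 / b)"
have "(abs a) / (k * b) + 1 > 0" using k b by (intro add_nonneg_pos) auto
then have dt: "dt > 0" by (simp add: dt_def)
\<comment> \<open>\<open>R / (8 * k * b)\<close> lets the cross term absorb \<open>R * s1\<close>;
  \<open>1 + R + t * Y\<close> lets the squared correction absorb the rest together with the drift;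
  the last summand keeps \<open>pP\<close> nonnegative where \<open>k * b * u\<close> is smaller
  than the absolute value of \<open>a\<close>, which forces \<open>y >= dt\<close>.\<close>
define X where "X = 1 + R + t * Y + R / (8 * k * b) + (abs a) / dt powr e"
have X: "X >= 1 + R + t * Y" "X >= R / (8 * k * b)" "X >= (abs a) / dt powr e"
 using R t Y k b by (auto simp: X_def)
have X0: "X > 0" using X(1) R t Y by (smt (verit) mult_nonneg_nonneg)
define A where "A = X / e"
have Ae: "A * e = X" using e by (simp add: A_def)
show ?thesis
proof (rule that[of A])
 show "A >= 0" using X0 e by (simp add: A_def)
 fix y assume y: "0 < y" "y <= Y"
 define u q where "u = y powr (- b)" and "q = X * y powr e"
 have u: "u > 0" and q: "q > 0" using y X0 by (auto simp: u_def q_def)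
 have P: "pP A y = k * b * u + a + q" by (simp add: pP_def Ae u_def q_def)
 show "0 <= pP A y"
 proof (cases "(abs a) / (k * b) <= u")
  case True
  then have "(abs a) <= k * b * u" using k b by (simp add: pos_divide_le_eq mult.commute)
  then show ?thesis unfolding P using q by linarith
 next
  case False
  then have "u powr (- 1 / b) >= dt" unfolding dt_def using u b k by (intro powr_mono2') auto
  moreover have "u powr (- 1 / b) = y" using y b by (simp add: u_def powr_powr)
  ultimately have "dt powr e <= y powr e" using dt e by (intro powr_mono2) auto
  then have "(abs a) / dt powr e * dt powr e <= X * y powr e" using X(3) X0 by (intro mult_mono) auto
  then have "(abs a) <= q" using dt by (simp add: q_def)
  moreover have "0 <= k * b * u" using k b u by simp
  ultimately show ?thesis unfolding P by linarith
 qed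
 define s1 s2 where "s1 = y powr (e - b)" and "s2 = y powr (2 * e)"
 have s: "s1 > 0" "s2 > 0" using y by (auto simp: s1_def s2_def)
 have uq: "u * q = X * s1" "q^2 = X^2 * s2"
  using y by (auto simp: u_def q_def s1_def s2_def power2_eq_square powr_add[symmetric] power_mult_distrib)
 define S where "S = s1 + s2"
 have bd: "y powr (2 * e - b) <= Y * S" "y powr (- 2 * g) <= Y * S" "y * u <= Y * S" "y <= Y * S" "1 <= Y * S" "y * q <= X * (Y * s2)"
 proof -
  have yu: "y * u = y powr (1 - b)" "y * q = X * y powr (1 + e)" using y
  by (auto simp: u_def q_def powr_diff powr_minus powr_add field_simps)
  have *: "y powr (2 * e - b) <= Y * S & y powr (- 2 * g) <= Y * S & y powr (1 - b) <= Y * S & y <= Y * S & 1 <= Y * S & y powr (1 + e) <= Y * s2"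
  proof (cases "y <= 1")
  case True
  have S1: "s1 <= Y * S" using mult_mono[of 1 Y s1 S] Y s by (simp add: S_def)
  have "y powr r <= Y * S" if "e - b <= r" for r
   using powr_exp_le[OF y(1) True that] S1 by (simp add: s1_def)
  from this[of "2 * e - b"] this[of "- 2 * g"] this[of "1 - b"] this[of 1] this[of 0]
  have "y powr (2 * e - b) <= Y * S & y powr (- 2 * g) <= Y * S & y powr (1 - b) <= Y * S & y <= Y * S & 1 <= Y * S"
   using e g b y by auto
  moreover have "y powr (1 + e) <= s2" unfolding s2_def using e by (intro powr_exp_le[OF y(1) True]) auto
  moreover have "s2 <= Y * s2" using Y s by simp
  ultimately show ?thesis by auto
  next
  case False
  then have y1: "y >= 1" by simp
  have S2: "s2 <= Y * S" using mult_mono[of 1 Y s2 S] Y s by (simp add: S_def)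
  have s21: "1 <= s2" unfolding s2_def using y1 e by (intro ge_one_powr_ge_zero) auto
  have a1: "y powr r <= Y * S" if "r <= 2 * e" for r
   using powr_mono[OF that y1] S2 by (simp add: s2_def)
  have yS: "y <= Y * S"
  proof -
   have "y * 1 <= Y * S" using y s21 s Y by (intro mult_mono) (auto simp: S_def)
   then show ?thesis by simp
  qed
  have "y powr (1 - b) <= y powr 1" using y1 b by (intro powr_mono) auto
  then have "y powr (1 - b) <= Y * S" using yS y by simp
  moreover have "y powr (1 + e) <= Y * s2"
  proof -
   have "y powr (1 + e) = y * y powr e" using y by (simp add: powr_add)
   also have "... <= Y * s2" unfolding s2_def using y y1 e Y by (intro mult_mono powr_mono) auto
   finally show ?thesis .
  qed
  ultimately show ?thesis using a1[of "2 * e - b"] a1[of "- 2 * g"] s21 S2 e b g yS by auto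
  qed
  then show "y powr (2 * e - b) <= Y * S" "y powr (- 2 * g) <= Y * S" "y * u <= Y * S" "y <= Y * S" "1 <= Y * S"
  unfolding yu by auto
  show "y * q <= X * (Y * s2)" unfolding yu using * X0 by (intro mult_left_mono) auto
 qed
 have r1: "C * (y powr (2 * e - b) + y powr (- 2 * g)) <= 2 * C * Y * S"
  using mult_left_mono[of "y powr (2 * e - b) + y powr (- 2 * g)" "2 * (Y * S)" C] bd C by (simp add: mult_ac)
 have r2: "t * (y * pP A y) <= t * (k * b + (abs a)) * Y * S + t * Y * X * s2"
 proof -
  have "y * pP A y = k * b * (y * u) + a * y + y * q" unfolding P by (simp add: algebra_simps)
  also have "k * b * (y * u) <= k * b * (Y * S)" using bd k b by (intro mult_left_mono) auto
  also have "a * y <= (abs a) * (Y * S)" using bd y by (intro mult_mono) auto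
  finally have "y * pP A y <= k * b * (Y * S) + (abs a) * (Y * S) + X * (Y * s2)" using bd(6) by simp
  then have "t * (y * pP A y) <= t * (k * b * (Y * S) + (abs a) * (Y * S) + X * (Y * s2))" using t by (intro mult_left_mono) auto
  then show ?thesis by (simp add: algebra_simps)
 qed
 have r3: "- (4 * c0) <= 4 * (abs c0) * Y * S"
  using mult_left_mono[OF bd(5), of "4 * (abs c0)"] by (simp add: mult_ac)
 have l1: "R * s1 <= 8 * k * b * (u * q)"
 proof -
  have "R <= X * (8 * k * b)" using X(2) k b by (subst (asm) pos_divide_le_eq) auto
  then have "R * s1 <= X * (8 * k * b) * s1" using s by (intro mult_right_mono) auto
  then show ?thesis unfolding uq by (simp add: mult_ac)
 qed
 have l2: "(R + t * Y * X) * s2 <= 4 * q^2"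
 proof -
  have "R * 1 + t * Y * X <= R * X + t * Y * X" using R t Y X(1) by (intro add_mono mult_left_mono) (auto intro: order_trans[rotated])
  also have "... <= X * X" using X(1) X0 mult_right_mono[of "R + t * Y" X X] by (simp add: algebra_simps)
  also have "... <= 4 * X^2" by (simp add: power2_eq_square)
  finally show ?thesis unfolding uq using s mult_right_mono[of "R + t * Y * X" "4 * X^2" s2] by (simp add: mult_ac)
 qed
 have "yVp y + t * (y * pP A y) <= 4 * k^2 * b^2 * u^2 + 4 * (2 * k * b * q * u + q^2 + (b + e) * q + c0)"
 proof -
  have aux: "a1 + a2 <= n1 + n2 + 4 * n3 + c'"
  if "a1 <= T1" "a2 <= T2 + T4" "- c' <= T3" "RS = T1 + T2 + T3" "RS + T4 = m1 + m2" "m1 <= n1" "m2 <= n2" "0 <= n3"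
  for a1 a2 n1 n2 n3 c' T1 T2 T3 T4 RS m1 m2 :: real using that by linarith
  have RS: "R * S = 2 * C * Y * S + t * (k * b + (abs a)) * Y * S + 4 * (abs c0) * Y * S" by (simp add: R_def algebra_simps)
  have RS2: "R * S + t * Y * X * s2 = R * s1 + (R + t * Y * X) * s2" by (simp add: S_def algebra_simps)
  have nn: "0 <= (b + e) * q" using b e q by simp
  have "C * (y powr (2 * e - b) + y powr (- 2 * g)) + t * (y * pP A y) <= 4 * (2 * k * b * q * u + q^2 + (b + e) * q + c0)"
  using aux[OF r1 r2 r3 RS RS2 l1 l2 nn] by (simp add: algebra_simps)
  then show ?thesis unfolding yVp_def u_def[symmetric] by simp
 qed
 then have "FA A y * (yVp y + t * (y * pP A y)) <= FA A y * (4 * k^2 * b^2 * u^2 + 4 * (2 * k * b * q * u + q^2 + (b + e) * q + c0))"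
  using FA_pos[of A y] by (intro mult_left_mono) auto
 also have "... = y * (4 * y * FA2 A y + 2 * real d * FA1 A y)" unfolding FA_lap[OF y(1)] Ae u_def q_def by simp
 finally show "yVp y * FA A y + 8 * y * (FA A y * pP A y) / ta <= y * (4 * y * FA2 A y + 2 * real d * FA1 A y)"
  by (simp add: t_def algebra_simps)
qed
qed

lemma prof_pos: "y > 0 ==> prof y > 0"
using FA_pos po_props(2)[of y d] by (auto simp: prof_def intro: less_le_trans[of 0 1])

lemma po_mono: "0 < y ==> y <= z ==> po d y <= po d z"
by (auto simp: po_def intro!: powr_mono2)

lemma prof_bounds:
assumes "0 < dt" "dt < 1" "1 <= R"
obtains m Mx where "m > 0" "!!y. dt <= y ==> y <= R ==> m <= prof y & prof y <= Mx"
proof -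
have c: "continuous_on {dt..1} (FA 0)"
 using assms by (intro continuous_at_imp_continuous_on ballI DERIV_isCont[OF FA_deriv(1)]) auto
obtain l where l: "l \<in> {dt..1}" "!!y. y \<in> {dt..1} ==> FA 0 l <= FA 0 y"
 using continuous_attains_inf[OF compact_Icc _ c] assms by fastforce
obtain h where h: "h \<in> {dt..1}" "!!y. y \<in> {dt..1} ==> FA 0 y <= FA 0 h"
 using continuous_attains_sup[OF compact_Icc _ c] assms by fastforce
show ?thesis
proof (rule that[of "min 1 (FA 0 l)" "max (FA 0 h) (po d R)"])
 show "min 1 (FA 0 l) > 0" using FA_pos by simp
 fix y assume y: "dt <= y" "y <= R"
 show "min 1 (FA 0 l) <= prof y & prof y <= max (FA 0 h) (po d R)"
  using l(2)[of y] h(2)[of y] y assms po_props(2)[of y d] po_mono[of y R]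
  by (auto simp: prof_def min_le_iff_disj le_max_iff_disj)
qed
qed

definition cmp :: "(real => real) => bool" where
"cmp N \<longleftrightarrow> (\<exists>c>0. \<forall>y>0. c * prof y <= N y & c * N y <= prof y)"

text \<open>Comparability has to be checked only near 0 and near infinity: between, both functions
  are bounded above and away from 0, \<open>N\<close> by monotonicity and \<open>prof\<close> by
  continuity of its pieces.\<close>

lemma cmpI:
assumes dt: "0 < dt" "dt < 1" and R: "1 <= R" and c1: "c1 > 0" "!!y. 0 < y ==> y < dt ==> c1 * prof y <= N y & c1 * N y <= prof y"
 and c2: "c2 > 0" "!!y. R < y ==> c2 * prof y <= N y & c2 * N y <= prof y"
 and pos: "!!y. 0 < y ==> 0 < N y" and mono: "!!y z. 0 < y ==> y <= z ==> N y <= N z"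
shows "cmp N"
proof -
obtain m Mx where m: "m > 0" "!!y. dt <= y ==> y <= R ==> m <= prof y & prof y <= Mx" using prof_bounds[OF dt R] by blast
have Mx: "Mx > 0" using m(2)[of 1] m(1) dt R by linarith
have N: "N dt > 0" "N R > 0" using pos dt R by auto
define c where "c = min (min c1 c2) (min (N dt / Mx) (m / N R))"
have c: "c > 0" "c <= c1" "c <= c2" "c <= N dt / Mx" "c <= m / N R" using c1 c2 m N Mx by (auto simp: c_def)
show ?thesis unfolding cmp_def
proof (intro exI[of _ c] conjI allI impI c(1))
 fix y :: real assume y: "y > 0"
 note pp = prof_pos[OF y] pos[OF y]
 consider "y < dt" | "dt <= y" "y <= R" | "R < y" by linarith
 then have "c * prof y <= N y & c * N y <= prof y"
 proof cases
  case 1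
  show ?thesis using c1(2)[OF y 1] order_trans[OF mult_right_mono[OF c(2) less_imp_le[OF pp(1)]]]
   order_trans[OF mult_right_mono[OF c(2) less_imp_le[OF pp(2)]]] by blast
 next
  case 2
  have "c * prof y <= N dt / Mx * Mx" using c m(2)[OF 2] pp N Mx by (intro mult_mono) auto
  also have "... <= N y" using Mx mono[OF dt(1) 2(1)] by simp
  finally have 1: "c * prof y <= N y" .
  have "c * N y <= m / N R * N R" using c mono[OF y 2(2)] pp m N by (intro mult_mono) auto
  also have "... <= prof y" using m(2)[OF 2] N by simp
  finally show ?thesis using 1 by simp
 next
  case 3
  show ?thesis using c2(2)[OF 3] order_trans[OF mult_right_mono[OF c(3) less_imp_le[OF pp(1)]]]
   order_trans[OF mult_right_mono[OF c(3) less_imp_le[OF pp(2)]]] by blast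
 qed
 then show "c * prof y <= N y" "c * N y <= prof y" by auto
qed
qed

lemma growth_of_cmp:
assumes cm: "cmp N" and pos: "!!y. 0 < y ==> 0 < N y" and mono: "!!y z. 0 < y ==> y <= z ==> N y <= N z"
 and y1: "y1 > 0"
shows "\<exists>C\<ge>1. \<forall>y\<ge>y1. \<forall>c\<ge>1. N (c * y) <= C * c * N y"
proof -
obtain c where c: "c > 0" "!!y. y > 0 ==> c * prof y <= N y & c * N y <= prof y" using cm by (auto simp: cmp_def)
have big: "N (r * y) <= 1 / c^2 * r * N y" if "y >= 1" "r >= 1" for y r
proof -
 have ry: "r * y >= 1" using that mult_mono[of 1 r 1 y] by simp
 have "c * N (r * y) <= po d (r * y)" using c(2)[of "r * y"] ry by (simp add: prof_def)
 also have "... <= r * po d y" using that by (intro po_props) auto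
 finally have "c * (c * N (r * y)) <= c * (r * po d y)" using c by (intro mult_left_mono) auto
 also have "... = r * (c * po d y)" by simp
 also have "... <= r * N y" using c(2)[of y] that by (intro mult_left_mono) (auto simp: prof_def)
 finally show ?thesis using c by (simp add: power2_eq_square field_simps)
qed
define C' where "C' = 1 + 1 / c^2 + 1 / c^2 * (N 1 / N y1)"
have p: "0 <= 1 / c^2" "0 <= 1 / c^2 * (N 1 / N y1)" using pos[OF y1] pos[of 1] by auto
have Cb: "C' >= 1" "1 / c^2 <= C'" "1 / c^2 * (N 1 / N y1) <= C'" using p unfolding C'_def by linarith+
show ?thesis
proof (intro exI[of _ C'] conjI allI impI Cb(1))
 fix y r assume y: "y1 <= y" and r: "1 <= (r::real)"
 have y0: "y > 0" using y y1 by simp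
 note Ny = pos[OF y0]
 show "N (r * y) <= C' * r * N y"
 proof (cases "1 <= y")
  case True
  have "1 / c^2 * r * N y <= C' * r * N y" using Cb(2) r Ny by (intro mult_right_mono) auto
  with big[OF True r] show ?thesis by linarith
 next
  case False
  have "N (r * y) <= N (r * 1)" using False r y0 by (intro mono mult_left_mono) auto
  also have "... <= 1 / c^2 * r * N 1" using r by (intro big) auto
  also have "... = 1 / c^2 * (N 1 / N y1) * r * N y1" using pos[OF y1] by simp
  also have "... <= C' * r * N y" using Cb(3) r mono[OF y1 y] pos[OF y1] Cb(1) by (intro mult_mono) auto
  finally show ?thesis .
 qed
qed
qed

text \<open>With \<open>z = y0 / 2^(j+1)\<close> and \<open>w = z powr (- b)\<close>, the exponent
  from killing at scale \<open>j\<close> is \<open>K * w^2\<close>, while the logarithm of the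
  profile at \<open>z\<close> is only linear in \<open>w\<close> up to a logarithm. Completing the
  square absorbs the linear part and the factor \<open>2^(j+1)\<close>.\<close>

lemma dyadic_bound:
assumes y0: "0 < y0" "y0 < 1" and ta: "ta > 0"
shows "\<exists>B\<ge>0. \<forall>j::nat. exp (- (2 * k^2 * b^2 * ((y0 / 2 ^ j) powr (- b))^2 / (y0 / 2 ^ j)) * (ta / 2 ^ Suc j)) * 2 ^ Suc j
 <= B * FA 0 (y0 / 2 ^ Suc j)"
proof -
define K where "K = 2 * k^2 * b^2 * (2 powr (- b))^2 * ta / (2 * y0)"
have K: "K > 0" using k b ta y0 by (simp add: K_def)
define L where "L = k + \<bar>a + 1\<bar> / b"
show ?thesis
proof (intro exI[of _ "y0 * exp (L^2 / (4 * K))"] conjI allI)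
 show "0 <= y0 * exp (L^2 / (4 * K))" using y0 by simp
 fix j :: nat
 define z where "z = y0 / 2 ^ Suc j"
 have z: "0 < z" "z < 1"
 proof -
  show "0 < z" using y0 by (simp add: z_def)
  have "y0 / 2 ^ Suc j <= y0 / 1" using y0 by (intro divide_left_mono) (auto intro: order_trans[OF _ mult_mono[of 1 2 1 "2 ^ j"]])
  then have "z <= y0" by (simp only: z_def div_by_1)
  then show "z < 1" using y0 by linarith
 qed
 define w where "w = z powr (- b)"
 have w: "w >= 1" using powr_exp_le[of z "- b" 0] z b by (simp add: w_def)
 have zj: "y0 / 2 ^ j = 2 * z" "2 ^ Suc j = y0 / z" using y0 by (auto simp: z_def)
 have "2 * k^2 * b^2 * ((2 * z) powr (- b))^2 / (2 * z) * (ta / (y0 / z)) = K * w^2"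
  using z y0 by (simp add: K_def w_def powr_mult field_simps power_mult_distrib)
 then have ex: "- (2 * k^2 * b^2 * ((y0 / 2 ^ j) powr (- b))^2 / (y0 / 2 ^ j)) * (ta / 2 ^ Suc j) = - (K * w^2)"
  unfolding zj by simp
 have lw: "ln w = - b * ln z" using z by (simp add: w_def ln_powr)
 have "- (a + 1) * ln z <= \<bar>a + 1\<bar> / b * w"
 proof -
  have "- (a + 1) * ln z = (a + 1) / b * ln w" unfolding lw using b by (simp add: field_simps)
  also have "... <= \<bar>a + 1\<bar> / b * ln w" using w b by (intro mult_right_mono divide_right_mono) auto
  also have "... <= \<bar>a + 1\<bar> / b * w" using w b ln_le_minus_one[of w] by (intro mult_left_mono) auto
  finally show ?thesis .
 qed
 moreover have "0 <= (2 * K * w - L)^2" by simp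
 then have "4 * K * (L * w - K * w^2) <= L^2" by (simp add: power2_eq_square algebra_simps)
 then have "L * w - K * w^2 <= L^2 / (4 * K)" using K by (simp add: pos_le_divide_eq mult.commute)
 ultimately have "- (K * w^2) - ln z <= L^2 / (4 * K) + (- k * w + a * ln z)" by (simp add: L_def algebra_simps)
 then have "exp (- (K * w^2) - ln z) <= exp (L^2 / (4 * K) + (- k * w + a * ln z))" by simp
 then have "exp (- (K * w^2)) / z <= exp (L^2 / (4 * K)) * FA 0 z"
 proof -
  have "exp (- (K * w^2) - ln z) = exp (- (K * w^2)) / z" using z by (simp add: exp_diff)
  moreover have "FA 0 z = exp (- k * w + a * ln z)" by (simp add: FA_def ps_def w_def)
  ultimately show ?thesis using \<open>exp (- (K * w^2) - ln z) <= _\<close> exp_add[of "L^2 / (4 * K)" "- k * w + a * ln z"] by simp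
 qed
 then have "y0 * (exp (- (K * w^2)) / z) <= y0 * (exp (L^2 / (4 * K)) * FA 0 z)" using y0 by (intro mult_left_mono) auto
 then show "exp (- (2 * k^2 * b^2 * ((y0 / 2 ^ j) powr (- b))^2 / (y0 / 2 ^ j)) * (ta / 2 ^ Suc j)) * 2 ^ Suc j
  <= y0 * exp (L^2 / (4 * K)) * FA 0 (y0 / 2 ^ Suc j)"
  unfolding ex unfolding z_def[symmetric] unfolding zj(2) by (simp add: mult_ac)
qed
qed

lemma FA_0_tendsto: "((%y::real. exp (- k * y powr (- b) + a * ln y)) \<longlongrightarrow> 0) (at_right 0)"
using k b by real_asymp

end

section \<open>Existence of the glued super- and subharmonic profiles\<close>

context potential_profile
begin

lemma yVm_nonneg: "0 <= yVm y" by (simp add: yVm_def)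

lemma yVp_nonneg: "0 <= yVp y" using C by (simp add: yVp_def)

lemma FA_eq: "FA A y = FA 0 y * exp (A * y powr e)"
by (simp add: FA_def ps_def exp_add)

text \<open>The inner piece is the corrected profile with \<open>A = -1\<close>; the outer one is an
  affine function of the harmonic function \<open>po\<close>, which is a supersolution as the
  potential is nonnegative.\<close>

lemma super_exists:
fixes M :: "real^'n => 'w measure"
assumes bk: "brownian_killing M W (%x::real^'n. Vm x)" and dn: "d = CARD('n)"
obtains N F0 F1 F2 Q0 Q1 Q2 y0 rh ys vs where
 "super_growth M W Vm N F0 F1 F2 Q0 Q1 Q2 y0 rh ys vs" "cmp N"
proof -
obtain y0 where y0: "0 < y0" "y0 < 1" and pP0: "!!y. 0 < y ==> y <= y0 ==> 0 < pP (- 1) y"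
 and lap: "!!y. 0 < y ==> y <= y0 ==> y * (4 * y * FA2 (- 1) y + 2 * real d * FA1 (- 1) y) <= yVm y * FA (- 1) y"
 and vm: "!!y. 0 < y ==> y <= y0 ==> 2 * k^2 * b^2 * (y powr (- b))^2 <= yVm y"
 by (rule super_small) (rule that)
define f0 where "f0 = FA (- 1) y0"
have f0: "f0 > 0" by (simp add: f0_def FA_pos)
define p where "p = pP (- 1) y0"
have p: "p > 0" unfolding p_def using y0 by (intro pP0) auto
have po1: "po1 d y0 >= 0" using y0 by (intro po_props)
\<comment> \<open>So small that the slope of the outer piece at \<open>y0\<close> is below that of
  the inner one: a concave kink.\<close>
define m where "m = min 1 (p / (2 * y0 * (po1 d y0 + 1)))"
have m: "0 < m" "m <= 1" using p y0 po1 by (auto simp: m_def)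
have slope: "m * po1 d y0 < p / y0"
proof -
 have "m <= p / (2 * y0 * (po1 d y0 + 1))" by (simp add: m_def)
 then have "m * (po1 d y0 + 1) <= p / (2 * y0 * (po1 d y0 + 1)) * (po1 d y0 + 1)" using po1 by (intro mult_right_mono) auto
 also have "... = p / y0 / 2" using po1 by simp
 also have "... < p / y0"
 proof -
  have "x / 2 < x" if "0 < x" for x :: real using that by simp
  then show ?thesis using divide_pos_pos[OF p y0(1)] .
 qed
 finally show ?thesis using m by (simp add: distrib_left)
qed
define Q0 where "Q0 y = f0 * (1 + m * (po d y - po d y0))" for y
define Q1 where "Q1 y = f0 * (m * po1 d y)" for y
define Q2 where "Q2 y = f0 * (m * po2 d y)" for y
define N where "N y = (if y <= y0 then FA (- 1) y else Q0 y)" for y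
have dQ: "DERIV Q0 y :> Q1 y" "DERIV Q1 y :> Q2 y" if "y > 0" for y
proof -
 show "DERIV Q0 y :> Q1 y" unfolding Q0_def[abs_def] Q1_def
  by (rule DERIV_cong[OF DERIV_cmult[OF DERIV_add[OF DERIV_const DERIV_cmult[OF DERIV_diff[OF po_deriv(1)[OF that] DERIV_const]]]]]) simp
 show "DERIV Q1 y :> Q2 y" unfolding Q1_def[abs_def] Q2_def
  by (intro DERIV_cmult po_deriv(2)[OF that])
qed
have g0: "Q0 y0 = FA (- 1) y0" by (simp add: Q0_def f0_def)
have "Q1 y0 < FA1 (- 1) y0"
 using mult_strict_left_mono[OF slope f0] by (simp add: Q1_def FA1_def f0_def p_def)
then obtain rh where rh: "rh > 0" "!!z. y0 <= z ==> z < y0 + rh ==> Q0 z <= FA (- 1) z" "!!z. y0 - rh < z ==> z <= y0 ==> FA (- 1) z <= Q0 z"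
 using kink_of_derivs[OF g0 dQ(1)[OF y0(1)] FA_deriv(1)[OF y0(1)]] by blast
have Qpos: "f0 <= Q0 y" if "y0 <= y" for y
proof -
 have "0 <= m * (po d y - po d y0)" using m po_mono[OF y0(1) that] by simp
 then show ?thesis using f0 by (simp add: Q0_def distrib_left)
qed
have Npos: "0 < N y" if "0 < y" for y
 using Qpos[of y] f0 FA_pos[of "- 1" y] by (auto simp: N_def)
have Nmono: "N y <= N z" if "0 < y" "y <= z" for y z
proof (rule glued_mono[where N = N and F = "FA (- 1)" and Q = Q0 and Y = y0])
 show "EX D. (FA (- 1) has_real_derivative D) (at y) & 0 <= D" if "0 < y" "y <= y0" for y
  using FA_deriv(1)[OF that(1), of "- 1"] FA_pos[of "- 1" y] pP0[OF that] that
  by (intro exI[of _ "FA1 (- 1) y"]) (auto simp: FA1_def)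
 show "EX D. DERIV Q0 y :> D & 0 <= D" if "y0 <= y" for y
  using dQ(1)[of y] that y0 f0 m po_props(1)[of y d] by (intro exI[of _ "Q1 y"]) (auto simp: Q1_def)
qed (use g0 that in \<open>auto simp: N_def\<close>)
have cm: "cmp N"
proof (rule cmpI[where dt = y0 and R = 1 and ?c1.0 = "exp (- 1)" and ?c2.0 = "min (f0 * m) (1 / (f0 * (2 + \<bar>po d y0\<bar>)))"])
 fix y assume y: "0 < y" "y < y0"
 have N: "N y = FA 0 y * exp (- (y powr e))" "prof y = FA 0 y"
  using y y0 FA_eq[of "- 1" y] by (auto simp: N_def prof_def)
 have "y powr e <= 1" using y y0 e by (intro powr_le_one) auto
 then have "FA 0 y * exp (- 1) <= FA 0 y * exp (- (y powr e))" using FA_pos[of 0 y] by (intro mult_left_mono) auto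
 moreover have "exp (- 1) * (FA 0 y * exp (- (y powr e))) <= 1 * (FA 0 y * 1)"
  using FA_pos[of 0 y] by (intro mult_mono) auto
 ultimately show "exp (- 1) * prof y <= N y & exp (- 1) * N y <= prof y" unfolding N by (simp add: mult.commute)
next
 show "min (f0 * m) (1 / (f0 * (2 + \<bar>po d y0\<bar>))) > 0" using f0 m by (auto intro!: divide_pos_pos mult_pos_pos)
 fix y :: real assume y: "1 < y"
 define c where "c = min (f0 * m) (1 / (f0 * (2 + \<bar>po d y0\<bar>)))"
 have c: "c <= f0 * m" "c <= 1 / (f0 * (2 + \<bar>po d y0\<bar>))" by (auto simp: c_def)
 have py: "prof y = po d y" "1 <= po d y" "N y = Q0 y" using y y0 po_props(2)[of y d] by (auto simp: prof_def N_def)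
 have "po d y0 <= po d 1" using y0 by (intro po_mono) auto
 then have p1: "po d y0 <= 1" by (auto simp: po_def split: if_splits)
 have "m * po d y0 <= m * 1" using m p1 by (intro mult_left_mono) auto
 then have "m * po d y0 <= 1" using m by linarith
 then have "m * po d y <= 1 + m * (po d y - po d y0)" by (simp add: right_diff_distrib)
 then have "f0 * (m * po d y) <= Q0 y" unfolding Q0_def using f0 by (intro mult_left_mono) auto
 moreover have "c * po d y <= f0 * m * po d y" using c py by (intro mult_right_mono) auto
 ultimately have 1: "c * po d y <= Q0 y" by simp
 have "m * (po d y - po d y0) <= 1 * (po d y + \<bar>po d y0\<bar>)" using m py p1 by (intro mult_mono) auto
 moreover have "\<bar>po d y0\<bar> * 1 <= \<bar>po d y0\<bar> * po d y" using py by (intro mult_left_mono) auto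
 ultimately have "1 + m * (po d y - po d y0) <= (2 + \<bar>po d y0\<bar>) * po d y" using py by (simp add: distrib_right)
 then have q: "Q0 y <= f0 * ((2 + \<bar>po d y0\<bar>) * po d y)" unfolding Q0_def using f0 by (intro mult_left_mono) auto
 have Q0p: "0 <= Q0 y" using Qpos[of y] f0 y y0 by simp
 have "c * Q0 y <= 1 / (f0 * (2 + \<bar>po d y0\<bar>)) * (f0 * ((2 + \<bar>po d y0\<bar>) * po d y))"
  using c q Q0p f0 by (intro mult_mono) auto
 also have "... = po d y" using f0 by (simp add: add_nonneg_eq_0_iff)
 finally show "min (f0 * m) (1 / (f0 * (2 + \<bar>po d y0\<bar>))) * prof y <= N y & min (f0 * m) (1 / (f0 * (2 + \<bar>po d y0\<bar>))) * N y <= prof y"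
  using 1 by (simp add: py c_def)
qed (use y0 Npos Nmono in auto)
define ys where "ys j = y0 / 2 ^ j" for j :: nat
\<comment> \<open>Half of the main term of the potential, evaluated at the outer end of the ball
  where it is smallest; near 0 \<open>Vm\<close> stays above this half.\<close>
define vs where "vs j = 2 * k^2 * b^2 * (ys j powr (- b))^2 / ys j" for j
have ysp: "ys j > 0" "ys j <= y0" for j
proof -
 show "ys j > 0" using y0 by (simp add: ys_def)
 have "y0 / 2 ^ j <= y0 / 1" using y0 by (intro divide_left_mono) auto
 then show "ys j <= y0" by (simp add: ys_def)
qed
have "super_growth M W Vm N (FA (- 1)) (FA1 (- 1)) (FA2 (- 1)) Q0 Q1 Q2 y0 rh ys vs"
proof (intro super_growth.intro super_profile.intro bk super_profile_axioms.intro super_growth_axioms.intro)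
 show "continuous_on {0<..} (FA2 (- 1))" by (rule FA2_cont)
 show "continuous_on {0<..} Q2" unfolding Q2_def[abs_def] by (intro continuous_intros po2_cont)
 fix x :: "real^'n"
 {
  assume x: "x ~= 0" "(norm x)^2 <= y0"
  then have x0: "(norm x)^2 > 0" by simp
  from lap[OF x0 x(2)] show "4 * (norm x)^2 * FA2 (- 1) ((norm x)^2) + 2 * real CARD('n) * FA1 (- 1) ((norm x)^2) <= Vm x * FA (- 1) ((norm x)^2)"
  using x0 unfolding dn by (simp add: pos_le_divide_eq mult.commute)
 }
 {
  assume x: "y0 <= (norm x)^2"
  then have x0: "(norm x)^2 > 0" using y0 by linarith
  have "4 * (norm x)^2 * po2 d ((norm x)^2) + 2 * real d * po1 d ((norm x)^2) = 0" using po_deriv(3)[OF x0, of d] d by auto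
  then have "f0 * m * (4 * (norm x)^2 * po2 d ((norm x)^2) + 2 * real d * po1 d ((norm x)^2)) = 0" by simp
  then have "4 * (norm x)^2 * Q2 ((norm x)^2) + 2 * real CARD('n) * Q1 ((norm x)^2) = 0"
  unfolding dn Q1_def Q2_def by (simp only: distrib_left mult_ac)
  moreover have "0 <= Vm x * Q0 ((norm x)^2)" using Qpos[OF x] f0 yVm_nonneg by simp
  ultimately show "4 * (norm x)^2 * Q2 ((norm x)^2) + 2 * real CARD('n) * Q1 ((norm x)^2) <= Vm x * Q0 ((norm x)^2)" by simp
 }
 {
  fix j assume x: "x ~= 0" "(norm x)^2 < ys j"
  then have x0: "(norm x)^2 > 0" by simp
  have "(ys j powr (- b))^2 <= ((norm x)\<^sup>2 powr (- b))^2"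
  using x x0 b by (intro power_mono powr_mono2') auto
  then have "2 * k^2 * b^2 * (ys j powr (- b))^2 <= 2 * k^2 * b^2 * ((norm x)\<^sup>2 powr (- b))^2" by (intro mult_left_mono) auto
  also have "... <= yVm ((norm x)^2)" using x ysp(2)[of j] by (intro vm x0) auto
  finally have "2 * k^2 * b^2 * (ys j powr (- b))^2 / ys j <= Vm x"
  using x x0 yVm_nonneg by (intro frac_le) auto
  then show "vs j <= Vm x" by (simp add: vs_def)
 }
next
 fix y :: real assume "y > 0"
 obtain j where "y0 / y < 2 ^ j" using real_arch_pow[of 2 "y0 / y"] by auto
 then have "ys j <= y" using \<open>y > 0\<close> by (simp add: ys_def field_simps)
 then show "EX j. ys j <= y" by blast
next
 fix ta :: real assume ta: "ta > 0"
 obtain c where c: "c > 0" "!!y. y > 0 ==> c * prof y <= N y" using cm by (auto simp: cmp_def)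
 obtain B where B: "B >= 0" "!!j. exp (- (2 * k^2 * b^2 * ((y0 / 2 ^ j) powr (- b))^2 / (y0 / 2 ^ j)) * (ta / 2 ^ Suc j)) * 2 ^ Suc j
  <= B * FA 0 (y0 / 2 ^ Suc j)" using dyadic_bound[OF y0 ta] by blast
 show "\<exists>C\<ge>0. ALL j. exp (- vs j * (ta / 2 ^ Suc j)) * 2 ^ Suc j <= C * N (ys (Suc j))"
 proof (intro exI[of _ "B / c"] conjI allI)
  show "0 <= B / c" using B c by simp
  fix j
  have "exp (- vs j * (ta / 2 ^ Suc j)) * 2 ^ Suc j <= B * FA 0 (ys (Suc j))"
  using B(2)[of j] unfolding vs_def ys_def .
  also have "FA 0 (ys (Suc j)) = prof (ys (Suc j))" using ysp(2)[of "Suc j"] y0 by (simp add: prof_def)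
  also have "B * prof (ys (Suc j)) <= B / c * N (ys (Suc j))"
  using mult_left_mono[OF c(2)[OF ysp(1)[of "Suc j"]], of "B / c"] B c by simp
  finally show "exp (- vs j * (ta / 2 ^ Suc j)) * 2 ^ Suc j <= B / c * N (ys (Suc j))" .
 qed
next
 show "vs j >= 0" for j using ysp(1)[of j] by (simp add: vs_def)
qed (use FA_deriv dQ y0 rh Npos Nmono N_def ysp growth_of_cmp[OF cm Npos Nmono] in auto)
then show ?thesis using cm by (rule that)
qed

text \<open>The inner piece is the corrected profile with a large \<open>A\<close>, valid up to the
  radius where the outer piece of \<open>outer_sub\<close> takes over.\<close>

lemma sub_exists:
fixes M :: "real^'n => 'w measure"
assumes bk: "brownian_killing M W (%x::real^'n. Vp x)" and dn: "d = CARD('n)" and ta: "ta > 0"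
 and surv: "!!ta'. ta' > 0 ==> \<exists>K\<ge>1. \<forall>T\<ge>ta'. ALL x. x ~= 0 -->
  brownian_killing.P M W Vp T (%_. 1) x <= en (K * (prof ((norm x)^2) / prof T))"
obtains n F0 F1 F2 Q0 Q1 Q2 Y rh La where
 "sub_profile M W Vp n F0 F1 F2 Q0 Q1 Q2 Y rh ta La" "cmp n"
proof -
\<comment> \<open>Beyond \<open>y = 1\<close> all terms of \<open>yVp\<close> are at most multiples
  of \<open>y powr (- 2 * g)\<close>, with this total constant.\<close>
define C2 where "C2 = 4 * k^2 * b^2 + 2 * C"
have C2: "C2 > 0" using C by (simp add: C2_def add_nonneg_pos)
obtain Y O0 O1 O2 La m where Y: "Y >= 1" "La >= 0" "m > 0" "O0 Y = 0"
 and dO: "!!y. y > 0 ==> DERIV O0 y :> O1 y" "!!y. y > 0 ==> DERIV O1 y :> O2 y"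
 "continuous_on {0<..} O2"
 and O: "!!y. y >= Y ==> 0 < O1 y" "!!y. y >= Y ==> 8 * y * O1 y <= La * (1 + O0 y)" "!!y. y >= Y ==> 0 <= O0 y"
 "!!y. y >= Y ==> C2 * y powr (- 2 * g) * (1 + O0 y) <= y * (4 * y * O2 y + 2 * real d * O1 y)"
 "!!y. y >= Y ==> m * po d y <= 1 + O0 y" "!!y. y >= Y ==> 1 + O0 y <= 2 * po d y"
 by (rule outer_sub[OF d C2 g(1) g(3)]) (rule that)
have Y0: "Y > 0" using Y by simp
obtain A where A: "A >= 0" "!!y. 0 < y ==> y <= Y ==> 0 <= pP A y"
 "!!y. 0 < y ==> y <= Y ==> yVp y * FA A y + 8 * y * (FA A y * pP A y) / ta <= y * (4 * y * FA2 A y + 2 * real d * FA1 A y)"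
 by (rule sub_inner[OF Y(1) ta]) (rule that)
define f0 where "f0 = FA A Y"
have f0: "f0 > 0" by (simp add: f0_def FA_pos)
define p where "p = pP A Y"
have p: "p >= 0" unfolding p_def using Y0 by (intro A(2)) auto
have O1Y: "O1 Y > 0" by (rule O(1)) simp
\<comment> \<open>Steepens the outer piece so that its slope at \<open>Y\<close> exceeds that of the
  inner one: a convex kink. Since \<open>K >= 1\<close>, the outer inequalities survive the
  steepening.\<close>
define K where "K = 1 + p / (Y * O1 Y)"
have K: "K >= 1" using p Y0 O1Y by (simp add: K_def)
have slope: "p / Y < K * O1 Y"
 using p Y0 O1Y by (simp add: K_def field_simps)
define Q0 where "Q0 y = f0 * (1 + K * O0 y)" for y
define Q1 where "Q1 y = f0 * (K * O1 y)" for y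
define Q2 where "Q2 y = f0 * (K * O2 y)" for y
define n where "n y = (if y <= Y then FA A y else Q0 y)" for y
have dQ: "DERIV Q0 y :> Q1 y" "DERIV Q1 y :> Q2 y" if "y > 0" for y
proof -
 show "DERIV Q0 y :> Q1 y" unfolding Q0_def[abs_def] Q1_def
  by (rule DERIV_cong[OF DERIV_cmult[OF DERIV_add[OF DERIV_const DERIV_cmult[OF dO(1)[OF that]]]]]) simp
 show "DERIV Q1 y :> Q2 y" unfolding Q1_def[abs_def] Q2_def
  by (intro DERIV_cmult dO(2)[OF that])
qed
have g0: "FA A Y = Q0 Y" by (simp add: Q0_def f0_def Y)
have "FA1 A Y < Q1 Y"
 using mult_strict_left_mono[OF slope f0] by (simp add: Q1_def FA1_def f0_def p_def)
then obtain rh where rh: "rh > 0" "!!z. Y <= z ==> z < Y + rh ==> FA A z <= Q0 z" "!!z. Y - rh < z ==> z <= Y ==> Q0 z <= FA A z"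
 using kink_of_derivs[OF g0 FA_deriv(1)[OF Y0] dQ(1)[OF Y0]] by blast
have Qpos: "f0 <= Q0 y" if "Y <= y" for y
 using O(3)[OF that] K f0 by (simp add: Q0_def)
have npos: "0 < n y" for y
 using Qpos[of y] f0 FA_pos[of A y] by (auto simp: n_def)
have FA1nn: "0 <= FA1 A y" if "0 < y" "y <= Y" for y
 using A(2)[OF that] FA_pos[of A y] that by (simp add: FA1_def)
have nmono: "n y <= n z" if "0 < y" "y <= z" for y z
proof (rule glued_mono[where N = n and F = "FA A" and Q = Q0 and Y = Y])
 show "EX D. (FA A has_real_derivative D) (at y) & 0 <= D" if "0 < y" "y <= Y" for y
  using FA_deriv(1)[OF that(1), of A] FA1nn[OF that] by blast
 show "EX D. DERIV Q0 y :> D & 0 <= D" if "Y <= y" for y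
  using dQ(1)[of y] that Y0 f0 K O(1)[OF that] by (intro exI[of _ "Q1 y"]) (auto simp: Q1_def)
qed (use g0 that in \<open>auto simp: n_def\<close>)
have FA_le: "FA 0 y <= FA A y & FA A y <= exp A * FA 0 y" if "0 < y" "y <= 1" for y
proof -
 have "y powr e <= 1" using that e by (intro powr_le_one) auto
 then have "A * y powr e <= A * 1" "0 <= A * y powr e" using A(1) mult_left_mono[of "y powr e" 1 A] by auto
 then have "1 <= exp (A * y powr e)" "exp (A * y powr e) <= exp A" by auto
 then show ?thesis unfolding FA_eq[of A] using FA_pos[of 0 y] by (auto simp: mult.commute)
qed
have cm: "cmp n"
proof (rule cmpI[where dt = "1 / 2" and R = Y and ?c1.0 = "exp (- A)" and ?c2.0 = "min (f0 * m) (1 / (f0 * (2 * K)))"])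
 fix y :: real assume y: "0 < y" "y < 1 / 2"
 have N: "n y = FA A y" "prof y = FA 0 y" using y Y by (auto simp: n_def prof_def)
 have "exp (- A) * FA 0 y <= 1 * FA 0 y" using A(1) FA_pos[of 0 y] by (intro mult_right_mono) auto
 moreover have "exp (- A) * FA A y <= exp (- A) * (exp A * FA 0 y)" using FA_le[of y] y by (intro mult_left_mono) auto
 moreover have "exp (- A) * (exp A * FA 0 y) = FA 0 y" by (simp add: exp_minus)
 ultimately show "exp (- A) * prof y <= n y & exp (- A) * n y <= prof y" unfolding N using FA_le[of y] y by auto
next
 show "min (f0 * m) (1 / (f0 * (2 * K))) > 0" using f0 Y K by auto
 fix y :: real assume y: "Y < y"
 then have yY: "Y <= y" by simp
 define c where "c = min (f0 * m) (1 / (f0 * (2 * K)))"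
 have c: "c <= f0 * m" "c <= 1 / (f0 * (2 * K))" by (auto simp: c_def)
 have py: "prof y = po d y" "1 <= po d y" "n y = Q0 y" using y Y po_props(2)[of y d] by (auto simp: prof_def n_def)
 have k1: "1 + O0 y <= 1 + K * O0 y" "1 + K * O0 y <= K * (1 + O0 y)"
  using K O(3)[OF yY] mult_right_mono[of 1 K "O0 y"] by (auto simp: distrib_left)
 have "f0 * (m * po d y) <= Q0 y" unfolding Q0_def using f0 O(5)[OF yY] k1 by (intro mult_left_mono) auto
 moreover have "c * po d y <= f0 * m * po d y" using c py by (intro mult_right_mono) auto
 ultimately have 1: "c * po d y <= Q0 y" by simp
 have "K * (1 + O0 y) <= K * (2 * po d y)" using K O(6)[OF yY] by (intro mult_left_mono) auto
 then have "1 + K * O0 y <= K * (2 * po d y)" using k1 by linarith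
 then have q: "Q0 y <= f0 * (K * (2 * po d y))" unfolding Q0_def using f0 by (intro mult_left_mono) auto
 have Q0p: "0 <= Q0 y" using Qpos[OF yY] f0 by simp
 have "c * Q0 y <= 1 / (f0 * (2 * K)) * (f0 * (K * (2 * po d y)))"
  using c q Q0p f0 K by (intro mult_mono) auto
 also have "... = po d y" using f0 K by simp
 finally show "min (f0 * m) (1 / (f0 * (2 * K))) * prof y <= n y & min (f0 * m) (1 / (f0 * (2 * K))) * n y <= prof y"
  using 1 by (simp add: py c_def)
qed (use Y npos nmono in auto)
obtain c where c: "c > 0" "!!y. y > 0 ==> c * prof y <= n y" "!!y. y > 0 ==> c * n y <= prof y" using cm by (auto simp: cmp_def)
have yVp_anti: "yVp y <= yVp z" if "0 < z" "z <= y" for y z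
 unfolding yVp_def using that C e g b
 by (intro add_mono mult_left_mono power_mono powr_mono2') auto
have "sub_profile M W Vp n (FA A) (FA1 A) (FA2 A) Q0 Q1 Q2 Y rh ta (La * K)"
proof (intro sub_profile.intro bk sub_profile_axioms.intro)
 show "continuous_on {0<..} (FA2 A)" by (rule FA2_cont)
 show "continuous_on {0<..} Q2" unfolding Q2_def[abs_def] by (intro continuous_intros dO)
 show "0 <= La * K" using Y K by simp
 show "\<exists>C\<ge>1. \<forall>y\<ge>ta. \<forall>r\<ge>1. n (r * y) <= C * r * n y" by (rule growth_of_cmp[OF cm npos nmono ta])
next
 fix et :: real assume et: "et > 0"
 have "eventually (%y::real. exp (- k * y powr (- b) + a * ln y) < et / exp A) (at_right 0)"
  using order_tendstoD(2)[OF FA_0_tendsto, of "et / exp A"] et by simp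
 then obtain z where z: "z > 0" "!!y. 0 < y ==> y < z ==> exp (- k * y powr (- b) + a * ln y) < et / exp A"
  unfolding eventually_at_right_field by auto
 show "\<exists>al>0. ALL y. 0 < y --> y < al --> n y <= et"
 proof (intro exI[of _ "min z 1"] conjI allI impI)
  show "min z 1 > 0" using z by simp
  fix y :: real assume y: "0 < y" "y < min z 1"
  have "FA 0 y < et / exp A" using z(2)[of y] y by (simp add: FA_def ps_def)
  then have "exp A * FA 0 y < et" by (simp add: pos_less_divide_eq mult.commute)
  then show "n y <= et" using FA_le[of y] y Y by (auto simp: n_def)
 qed
next
 fix x :: "real^'n" assume x: "x ~= 0" "(norm x)^2 <= Y"
 define y where "y = (norm x)^2"
 have y: "y > 0" "y <= Y" using x by (auto simp: y_def)
 have F1: "FA A y * pP A y = y * FA1 A y" using y by (simp add: FA1_def)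
 have "y * (yVp y / y * FA A y + 8 * y * FA1 A y / ta) <= y * (4 * y * FA2 A y + 2 * real d * FA1 A y)"
  using A(3)[OF y] y unfolding F1 by (simp add: algebra_simps)
 then have "yVp y / y * FA A y + 8 * y * FA1 A y / ta <= 4 * y * FA2 A y + 2 * real d * FA1 A y"
  using y by (simp only: mult_le_cancel_left_pos)
 then show "Vp x * FA A ((norm x)^2) + 8 * (norm x)^2 * FA1 A ((norm x)^2) / ta
   <= 4 * (norm x)^2 * FA2 A ((norm x)^2) + 2 * real CARD('n) * FA1 A ((norm x)^2)"
  by (simp only: y_def dn)
next
 fix x :: "real^'n" assume x: "Y <= (norm x)^2"
 define y where "y = (norm x)^2"
 have y: "y >= Y" "y > 0" "y >= 1" using x Y by (auto simp: y_def)
 have "(y powr (- b))^2 = y powr (- 2 * b)" using y by (simp add: power2_eq_square powr_add[symmetric])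
 also have "... <= y powr (- 2 * g)" using y b e g by (intro powr_mono) auto
 finally have e1: "(y powr (- b))^2 <= y powr (- 2 * g)" .
 have e2: "y powr (2 * e - b) <= y powr (- 2 * g)" using y b e g by (intro powr_mono) auto
 have "yVp y <= 4 * k^2 * b^2 * y powr (- 2 * g) + C * (y powr (- 2 * g) + y powr (- 2 * g))"
  unfolding yVp_def using e1 e2 C by (intro add_mono mult_left_mono) auto
 also have "... = C2 * y powr (- 2 * g)" by (simp add: C2_def algebra_simps)
 finally have v: "yVp y <= C2 * y powr (- 2 * g)" .
 have k1: "1 + K * O0 y <= K * (1 + O0 y)" "0 <= 1 + K * O0 y" using K O(3)[OF y(1)] by (auto simp: distrib_left)
 have "yVp y * (1 + K * O0 y) <= C2 * y powr (- 2 * g) * (K * (1 + O0 y))"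
  using v k1 C2 by (intro mult_mono) auto
 also have "... = K * (C2 * y powr (- 2 * g) * (1 + O0 y))" by simp
 also have "... <= K * (y * (4 * y * O2 y + 2 * real d * O1 y))" using K O(4)[OF y(1)] by (intro mult_left_mono) auto
 finally have "f0 * (yVp y * (1 + K * O0 y)) <= f0 * (K * (y * (4 * y * O2 y + 2 * real d * O1 y)))" using f0 by (intro mult_left_mono) auto
 moreover have "f0 * (yVp y * (1 + K * O0 y)) = y * (yVp y / y * Q0 y)" using y by (simp add: Q0_def)
 moreover have "f0 * (K * (y * (4 * y * O2 y + 2 * real d * O1 y))) = y * (4 * y * Q2 y + 2 * real d * Q1 y)"
  unfolding Q1_def Q2_def by (simp only: distrib_left mult_ac)
 ultimately have "y * (yVp y / y * Q0 y) <= y * (4 * y * Q2 y + 2 * real d * Q1 y)" by simp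
 then have "yVp y / y * Q0 y <= 4 * y * Q2 y + 2 * real d * Q1 y" using y(2) by (simp only: mult_le_cancel_left_pos)
 then show "Vp x * Q0 ((norm x)^2) <= 4 * (norm x)^2 * Q2 ((norm x)^2) + 2 * real CARD('n) * Q1 ((norm x)^2)"
  by (simp only: y_def dn)
next
 fix y assume y: "y >= Y"
 have k1: "1 + O0 y <= 1 + K * O0 y" using K O(3)[OF y] mult_right_mono[of 1 K "O0 y"] by auto
 have "8 * y * Q1 y = f0 * K * (8 * y * O1 y)" by (simp add: Q1_def)
 also have "... <= f0 * K * (La * (1 + K * O0 y))"
  using O(2)[OF y] k1 mult_left_mono[OF k1, of La] Y f0 K by (intro mult_left_mono) auto
 also have "... = La * K * Q0 y" by (simp add: Q0_def)
 finally show "8 * y * Q1 y <= La * K * Q0 y" .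
next
 fix al :: real assume al: "al > 0"
 show "\<exists>C\<ge>0. \<forall>x::real^'n. al <= (norm x)^2 --> Vp x <= C / (norm x)^2"
  using yVp_nonneg yVp_anti[OF al] by (intro exI[of _ "yVp al"]) (auto intro!: divide_right_mono)
next
 fix ta' :: real assume ta': "ta' > 0"
 obtain L where L: "L >= 1" "!!T x. T >= ta' ==> x ~= 0 ==>
  brownian_killing.P M W Vp T (%_. 1) x <= en (L * (prof ((norm x)^2) / prof T))"
  using surv[OF ta'] by blast
 show "\<exists>K\<ge>1. \<forall>T\<ge>ta'. ALL x. x ~= 0 -->
  brownian_killing.P M W Vp T (%_. 1) x <= en (K * (n ((norm x)^2) / n T))"
 proof (intro exI[of _ "max 1 (L / c^2)"] conjI allI impI)
  show "1 <= max 1 (L / c^2)" by simp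
  fix T and x :: "real^'n" assume T: "ta' <= T" and x: "x ~= 0"
  have T0: "T > 0" and x0: "(norm x)^2 > 0" using T ta' x by auto
  have "prof ((norm x)^2) / prof T <= (n ((norm x)^2) / c) / (c * n T)"
  using c(1) c(2)[OF x0] c(3)[OF T0] npos[of T] npos[of "(norm x)^2"]
  by (intro frac_le) (auto simp: pos_le_divide_eq mult.commute)
  then have "L * (prof ((norm x)^2) / prof T) <= L * ((n ((norm x)^2) / c) / (c * n T))" using L by (intro mult_left_mono) auto
  also have "... = L / c^2 * (n ((norm x)^2) / n T)" by (simp add: power2_eq_square)
  also have "... <= max 1 (L / c^2) * (n ((norm x)^2) / n T)"
  using less_imp_le[OF npos] by (intro mult_right_mono) auto
  finally show "brownian_killing.P M W Vp T (%_. 1) x <= en (max 1 (L / c^2) * (n ((norm x)^2) / n T))"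
  using L(2)[OF T x] by (auto intro: order_trans ennreal_leI)
 qed
qed (use FA_deriv dQ Y0 rh npos nmono n_def ta FA1nn in auto)
then show ?thesis using cm by (rule that)
qed

end

section \<open>From radial potentials to \<open>V\<close>, and from integrals to densities\<close>

lemma set_integrable_bounded_path:
fixes V :: "real^'n => real" and w :: "real => real^'n"
assumes [measurable]: "V \<in> bm" and V: "!!K. compact K ==> 0 \<notin> K ==> bounded (V ` K)"
 and w: "continuous_on {a..b} w" "\<forall>s\<in>{a..b}. w s ~= 0"
shows "set_integrable lborel {a..b} (%s. V (w s))"
proof -
have "compact (w ` {a..b})" "0 \<notin> w ` {a..b}" using w by (auto intro: compact_continuous_image)
from V[OF this] obtain B where B: "\<forall>s\<in>{a..b}. norm (V (w s)) <= B" by (auto simp: bounded_iff)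
have [measurable]: "(%s. ind {a..b} s *\<^sub>R w s) \<in> bm"
 by (rule borel_measurable_continuous_on_indicator[OF _ w(1)]) simp
have "integrable lborel (%s. ind {a..b} s *\<^sub>R V (ind {a..b} s *\<^sub>R w s))"
 by (rule integrableI_bounded_set_indicator[where B = B]) (use B in \<open>auto simp: emeasure_lborel_Icc_eq\<close>)
also have "(%s. ind {a..b} s *\<^sub>R V (ind {a..b} s *\<^sub>R w s)) = (%s. ind {a..b} s *\<^sub>R V (w s))"
 by (auto simp: fun_eq_iff split: split_indicator)
finally show ?thesis by (simp add: set_integrable_def)
qed

lemma killed_sandwich:
fixes V :: "real^'n => real"
assumes Vm: "V \<in> bm" and Vb: "!!K. compact K ==> 0 \<notin> K ==> bounded (V ` K)"
 and lo: "brownian_killing M W V1" "!!x. x ~= 0 ==> V1 x <= V x" and hi: "brownian_killing M W V2" "!!x. x ~= 0 ==> V x <= V2 x"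
 and den: "killed_FK_density M W V p" and t: "t > 0" and x: "x ~= 0" and A: "A \<in> sets borel" "0 \<notin> A"
shows "brownian_killing.P M W V2 t (ind A) x <= (NN y. ind A y * en (p t x y))"
 "(NN y. ind A y * en (p t x y)) <= brownian_killing.P M W V1 t (ind A) x"
proof -
have A0: "A - {0} = A" using A by auto
have eq: "(NN y. ind A y * en (p t x y)) = (\<integral>\<^sup>+ om. en (ind {om. \<forall>s\<in>{0..t}. W x s om ~= 0} om
    * exp (- (LINT s:{0..t}|lborel. V (W x s om))) * ind A (W x t om)) \<partial>M x)"
 using den t x A unfolding killed_FK_density_def by (auto simp: A0 mult.commute)
have pw: "surv0 V2 0 t (%s. W x s om) * ind A (W x t om) <= en (ind {om. \<forall>s\<in>{0..t}. W x s om ~= 0} om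
    * exp (- (LINT s:{0..t}|lborel. V (W x s om))) * ind A (W x t om))
 & en (ind {om. \<forall>s\<in>{0..t}. W x s om ~= 0} om
    * exp (- (LINT s:{0..t}|lborel. V (W x s om))) * ind A (W x t om)) <= surv0 V1 0 t (%s. W x s om) * ind A (W x t om)"
 if om: "om \<in> space (M x)" for om
proof (cases "\<forall>s\<in>{0..t}. W x s om ~= 0")
 case True
 have c: "continuous_on {0..t} (%s. W x s om)" using brownian_killing.W_continuous[OF lo(1) om] by simp
 \<comment> \<open>Integrability is essential here: the Lebesgue integral of a non-integrable
   function is 0 by convention, which would break the comparison. Local boundedness of
   \<open>V\<close> along a path avoiding 0 provides it.\<close>
 have i: "set_integrable lborel {0..t} (%s. V (W x s om))" by (rule set_integrable_bounded_path[OF Vm Vb c True])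
 have i1: "set_integrable lborel {0..t} (%s. V1 (W x s om))" by (rule LINT_potential_path(1)[OF brownian_killing.V_cont[OF lo(1)] c True])
 have i2: "set_integrable lborel {0..t} (%s. V2 (W x s om))" by (rule LINT_potential_path(1)[OF brownian_killing.V_cont[OF hi(1)] c True])
 have "(LINT s:{0..t}|lborel. V1 (W x s om)) <= (LINT s:{0..t}|lborel. V (W x s om))"
  using True lo by (intro set_integral_mono i i1) auto
 moreover have "(LINT s:{0..t}|lborel. V (W x s om)) <= (LINT s:{0..t}|lborel. V2 (W x s om))"
  using True hi by (intro set_integral_mono i i2) auto
 ultimately show ?thesis using True by (auto simp: surv0_def ennreal_leI split: split_indicator)
next
 case False
 then show ?thesis by (auto simp: surv0_def)
qed
show "brownian_killing.P M W V2 t (ind A) x <= (NN y. ind A y * en (p t x y))"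
 unfolding eq brownian_killing.P_def[OF hi(1)] using pw by (intro nn_integral_mono) auto
show "(NN y. ind A y * en (p t x y)) <= brownian_killing.P M W V1 t (ind A) x"
 unfolding eq brownian_killing.P_def[OF lo(1)] using pw by (intro nn_integral_mono) auto
qed

text \<open>If the inequality failed at \<open>y\<close>, two levels \<open>c1 < c2\<close> would
  separate the functions on a whole ball, and integrating over that ball gives a
  contradiction.\<close>

lemma pointwise_of_integral:
fixes R f :: "real^'n => real"
assumes U: "open U" and R: "continuous_on U R" and f: "continuous_on U f" "!!y. y \<in> U ==> 0 <= f y"
 and le: "!!A. A \<in> sets borel ==> A \<subseteq> U ==> (NN y. ind A y * en (R y)) <= (NN y. ind A y * en (f y))"
 and y: "y \<in> U"
shows "R y <= f y"
proof (rule ccontr)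
assume "\<not> R y <= f y"
then have lt: "f y < R y" by simp
define c1 c2 where "c1 = f y + (R y - f y) / 3" and "c2 = f y + 2 * ((R y - f y) / 3)"
have c: "f y < c1" "c1 < c2" "c2 < R y" using lt unfolding c1_def c2_def by (auto simp: field_simps)
have c0: "0 < c1" using c f(2)[OF y] by linarith
have "isCont f y" "isCont R y" using U R f y by (auto simp: continuous_on_eq_continuous_at)
then have "eventually (%z. f z < c1 & c2 < R z & z \<in> U) (nhds y)"
 using c y U by (intro eventually_conj order_tendstoD[of f] order_tendstoD[of R] eventually_nhds_in_open)
  (auto simp: isCont_def tendsto_at_iff_tendsto_nhds)
then obtain r where r: "r > 0" "!!z. dist z y < r ==> f z < c1 & c2 < R z & z \<in> U"
 unfolding eventually_nhds_metric by blast
define B where "B = ball y r"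
have [measurable]: "B \<in> sets borel" by (simp add: B_def)
have B: "f z < c1 & c2 < R z & z \<in> U" if "z \<in> B" for z using that r(2)[of z] by (simp add: B_def dist_commute)
have B': "f z <= c1" "c2 <= R z" if "z \<in> B" for z using B[OF that] by auto
have mB: "emeasure lborel B < \<infinity>" "emeasure lborel B ~= 0"
 using content_ball_pos[OF r(1), of y] emeasure_lborel_ball_finite[of y r]
 by (auto simp: B_def measure_def)
have "en c2 * emeasure lborel B = (NN z. en c2 * ind B z)"
 by (rule nn_integral_cmult_indicator[symmetric]) simp
also have "... <= (NN z. ind B z * en (R z))"
 using B' by (intro nn_integral_mono) (auto split: split_indicator intro!: ennreal_leI)
also have "... <= (NN z. ind B z * en (f z))" using B by (intro le) auto
also have "... <= (NN z. en c1 * ind B z)"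
 using B' by (intro nn_integral_mono) (auto split: split_indicator intro!: ennreal_leI)
also have "... = en c1 * emeasure lborel B" by (rule nn_integral_cmult_indicator) simp
finally have "en c2 * emeasure lborel B <= en c1 * emeasure lborel B" .
moreover have "emeasure lborel B = en (measure lborel B)" using mB by (simp add: emeasure_eq_ennreal_measure)
moreover have "measure lborel B > 0" using mB calculation(2) by (metis ennreal_0 measure_nonneg order_le_less)
ultimately have "c2 * measure lborel B <= c1 * measure lborel B"
 using c0 c by (simp flip: ennreal_mult add: ennreal_le_iff)
then show False using \<open>measure lborel B > 0\<close> c by simp
qed

lemma min_one_le:
fixes a b K :: real
assumes "a <= K * b" "K >= 1"
shows "min 1 a <= K * min 1 b"
using assms by (auto simp: min_def)

section \<open>Two-sided bounds for the density and comparison with \<open>H_bk\<close>\<close>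

context potential_profile
begin

text \<open>A form of the boundary factor that is uniform in the dimension; \<open>H_compare\<close>
  relates it to \<open>H_bk\<close>.\<close>

definition hh :: "real => real^'n => real" where
"hh t x = min 1 (prof ((norm x)^2) / po d t)"

lemma hh_nonneg: "t >= 4 ==> x ~= 0 ==> 0 <= hh t x"
using prof_pos[of "(norm x)^2"] po_props(2)[of t d] by (auto simp: hh_def)

text \<open>The kernel bounds are stated at time \<open>T = t / m\<close>, with \<open>m = 3\<close>
  above and \<open>m = 8\<close> below, and in terms of the constructed profiles. Comparability and
  doubling replace both by \<open>prof\<close> and \<open>t\<close>.\<close>

lemma ratio_compare:
fixes m :: real
assumes cm: "cmp N" and pos: "!!y. 0 < y ==> 0 < N y" and mono: "!!y z. 0 < y ==> y <= z ==> N y <= N z" and m: "1 <= m" "m <= 8"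
obtains K where "K >= 1" "!!t y. t >= 4 ==> y > 0 ==> min 1 (N y / N (t / m)) <= K * min 1 (prof y / po d t)"
 "!!t y. t >= 4 ==> y > 0 ==> min 1 (prof y / po d t) <= K * min 1 (N y / N (t / m))"
proof -
obtain c where c: "c > 0" "!!y. y > 0 ==> c * prof y <= N y" "!!y. y > 0 ==> c * N y <= prof y" using cm by (auto simp: cmp_def)
have "(1 / 2 :: real) > 0" by simp
from growth_of_cmp[OF cm pos mono this] obtain G where G: "G >= 1" "!!y r. y >= 1 / 2 ==> r >= 1 ==> N (r * y) <= G * r * N y" by blast
define K where "K = max 1 (max (G * m / c^2) (1 / c^2))"
have K: "K >= 1" "K >= G * m / c^2" "K >= 1 / c^2" by (auto simp: K_def)
have main: "N y / N (t / m) <= K * (prof y / po d t) & prof y / po d t <= K * (N y / N (t / m))" if t: "t >= 4" and y: "y > 0" for t y :: real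
proof -
 have tm: "t / m >= 1 / 2" "t / m <= t" "t / m > 0" using t m by (auto simp: field_simps)
 have pt: "prof t = po d t" "po d t >= 1" using t po_props(2)[of t d] by (auto simp: prof_def)
 have N: "N y > 0" "N (t / m) > 0" "N t > 0" "prof y > 0" using pos prof_pos y tm t by auto
 have "c * po d t <= N t" using c(2)[of t] t pt by simp
 also have "... <= G * m * N (t / m)" using G(2)[of "t / m" m] tm m by simp
 finally have 1: "c * po d t <= G * m * N (t / m)" .
 have "N y / N (t / m) <= (prof y / c) / (c * po d t / (G * m))"
  using c(3)[OF y] 1 c(1) N pt G m by (intro frac_le) (auto simp: pos_le_divide_eq pos_divide_le_eq mult_ac)
 also have "... = G * m / c^2 * (prof y / po d t)" by (simp add: power2_eq_square mult_ac)
 also have "... <= K * (prof y / po d t)" using K N pt by (intro mult_right_mono) auto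
 finally have A: "N y / N (t / m) <= K * (prof y / po d t)" .
 have "c * N (t / m) <= c * N t" using c tm by (intro mult_left_mono mono) auto
 also have "... <= po d t" using c(3)[of t] t pt by simp
 finally have 2: "c * N (t / m) <= po d t" .
 have "prof y / po d t <= (N y / c) / (c * N (t / m))"
  using c(2)[OF y] 2 c(1) N by (intro frac_le) (auto simp: pos_le_divide_eq mult.commute)
 also have "... = 1 / c^2 * (N y / N (t / m))" by (simp add: power2_eq_square)
 also have "... <= K * (N y / N (t / m))" using K N by (intro mult_right_mono) auto
 finally show ?thesis using A by simp
qed
show ?thesis by (rule that[OF K(1)]) (use main K(1) in \<open>auto intro!: min_one_le\<close>)
qed

lemma upper:
fixes M :: "real^'n => 'w measure" and V :: "real^'n => real"
assumes bk: "brownian_killing M W (%x::real^'n. Vm x)"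
 and bk2: "brownian_killing M W (%x::real^'n. Vp x)" and dn: "d = CARD('n)"
 and V: "V \<in> bm" "!!K. compact K ==> 0 \<notin> K ==> bounded (V ` K)"
 and lo: "!!x. x ~= 0 ==> Vm x <= V x" and hi: "!!x. x ~= 0 ==> V x <= Vp x"
 and den: "killed_FK_density M W V p"
 and sg: "super_growth M W Vm N F0 F1 F2 Q0 Q1 Q2 y0 rh ys vs" and cm: "cmp N"
obtains c3 c4 where "c3 > 0" "c4 > 0" "!!t x y. t >= 4 ==> x ~= 0 ==> y ~= 0 ==> p t x y <= c3 * hh t x * hh t y * gauss_q (c4 * t) x y"
proof -
interpret U: super_growth M W "Vm" N F0 F1 F2 Q0 Q1 Q2 y0 rh ys vs by (rule sg)
obtain K c where K: "K > 0" "c >= 1" and ku: "!!T x l A. T >= 1 ==> x ~= 0 ==> A \<in> sets borel ==>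
 U.P (3 * T) (ind A) x <= (NN y. ind A y * en (K * (4 * pi * T) powr (- real CARD('n) / 2)
  * exp (c * T * (norm l)^2) * exp (l \<bullet> (x - y)) * U.H T x * U.H T y))"
 by (rule U.kernel_upper[OF zero_less_one]) (rule that)
obtain L where L: "L >= 1" "!!t y. t >= 4 ==> y > 0 ==> min 1 (N y / N (t / 3)) <= L * min 1 (prof y / po d t)"
 "!!t y. t >= 4 ==> y > 0 ==> min 1 (prof y / po d t) <= L * min 1 (N y / N (t / 3))"
 by (rule ratio_compare[where m = 3, OF cm U.N_pos U.N_mono]) (assumption, assumption, assumption, simp, simp, rule that)
define c3 where "c3 = K * c powr (real CARD('n) / 2) * L^2"
show ?thesis
proof (rule that[of c3 "c / 3"])
 show "c3 > 0" "c / 3 > 0" using K L by (auto simp: c3_def)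
 fix t :: real and x y :: "real^'n" assume t: "t >= 4" and x: "x ~= 0" and y: "y ~= 0"
 define T where "T = t / 3"
 have T: "T >= 1" "T > 0" "t = 3 * T" using t by (auto simp: T_def)
 have HL: "0 <= U.H T z" "U.H T z <= L * hh t z" if "z ~= 0" for z
  using U.H_bounds(1)[OF T(2) that] L(2)[OF t, of "(norm z)^2"] that by (auto simp: U.H_def hh_def T_def)
 \<comment> \<open>The minimiser of \<open>c T |l|^2 + l . (x - y)\<close>. It is fixed for the
   given pair: the integrated bound holds for every target set with this \<open>l\<close>, and its
   density \<open>f\<close> is then evaluated at the same point \<open>y\<close>.\<close>
 define l where "l = (1 / (2 * c * T)) *\<^sub>R (y - x)"
 define f where "f y = K * (4 * pi * T) powr (- real CARD('n) / 2)
  * exp (c * T * (norm l)^2) * exp (l \<bullet> (x - y)) * U.H T x * U.H T y" for y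
 have Hc: "continuous_on (- {0}) (U.H T)"
 proof -
  have "continuous_on (- {0}) (%z::real^'n. N ((norm z)^2))"
  by (rule continuous_on_compose2[OF U.N_cont]) (auto intro!: continuous_intros)
  then show ?thesis unfolding U.H_def[abs_def] using U.N_pos[OF T(2)] by (intro continuous_intros) auto
 qed
 have "p t x y <= f y"
 proof (rule pointwise_of_integral[of "- {0}"])
  have "continuous_on ({x. x ~= 0} \<times> {y. y ~= 0}) (%(x, y). p t x y)" using den t unfolding killed_FK_density_def by auto
  moreover have "continuous_on (- {0}) (%y::real^'n. (x, y))" by (intro continuous_intros)
  moreover have "(%y. (x, y)) ` (- {0}) \<subseteq> {x. x ~= 0} \<times> {y. y ~= 0}" using x by auto
  ultimately have "continuous_on (- {0}) (%y. case (x, y) of (x, y) => p t x y)" by (rule continuous_on_compose2)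
  then show "continuous_on (- {0}) (p t x)" by simp
  show "continuous_on (- {0}) f" unfolding f_def by (intro continuous_intros Hc)
  show "0 <= f z" if "z \<in> - {0}" for z using HL(1)[OF x] HL(1)[of z] that K by (simp add: f_def)
  fix A :: "(real^'n) set" assume A: "A \<in> sets borel" "A \<subseteq> - {0}"
  then have "(NN z. ind A z * en (p t x z)) <= U.P t (ind A) x"
  using t x by (intro killed_sandwich(2)[OF V bk lo bk2 hi den]) auto
  also have "... <= (NN z. ind A z * en (f z))" unfolding T(3) f_def using A by (intro ku T x) auto
  finally show "(NN z. ind A z * en (p t x z)) <= (NN z. ind A z * en (f z))" .
 qed (use y in auto)
 also have "f y = K * c powr (real CARD('n) / 2) * gauss_q (c * T) x y * (U.H T x * U.H T y)"
 proof -
  have "c * T * (norm l)^2 = (norm (x - y))^2 / (4 * (c * T))"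
  proof -
  have nl: "norm l = norm (x - y) / (2 * c * T)"
   unfolding l_def norm_scaleR using K T by (simp add: norm_minus_commute)
  show ?thesis unfolding nl using K T by (simp add: power2_eq_square field_simps)
  qed
  moreover have "l \<bullet> (x - y) = - (2 * ((norm (x - y))^2 / (4 * (c * T))))"
  proof -
  have "l \<bullet> (x - y) = (1 / (2 * c * T)) * ((y - x) \<bullet> (x - y))" by (simp add: l_def)
  also have "(y - x) \<bullet> (x - y) = - (norm (x - y))\<^sup>2" by (simp add: power2_norm_eq_inner inner_diff_left inner_diff_right inner_commute)
  finally show ?thesis by simp
  qed
  ultimately have E: "exp (c * T * (norm l)^2) * exp (l \<bullet> (x - y)) = exp (- (norm (x - y))\<^sup>2 / (4 * (c * T)))"
  by (simp flip: exp_add)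
  have Pw: "c powr (real CARD('n) / 2) * (4 * pi * (c * T)) powr (- real CARD('n) / 2) = (4 * pi * T) powr (- real CARD('n) / 2)"
  proof -
  have "(c * (4 * pi * T)) powr s = c powr s * (4 * pi * T) powr s" for s
   by (intro powr_mult)
  from this[of "- real CARD('n) / 2"]
  have "(4 * pi * (c * T)) powr (- real CARD('n) / 2) = c powr (- (real CARD('n) / 2)) * (4 * pi * T) powr (- real CARD('n) / 2)"
   by (simp add: mult_ac)
  moreover have "c powr (real CARD('n) / 2) * c powr (- (real CARD('n) / 2)) = 1" using K by (simp add: powr_minus)
  ultimately show ?thesis by (simp add: mult.assoc[symmetric])
  qed
  have "f y = K * (4 * pi * T) powr (- real CARD('n) / 2) * (exp (c * T * (norm l)^2) * exp (l \<bullet> (x - y))) * (U.H T x * U.H T y)"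
  unfolding f_def by (simp only: mult.assoc)
  then show ?thesis unfolding E Pw[symmetric] gauss_q_def by (simp only: mult.assoc)
 qed
 also have "... <= K * c powr (real CARD('n) / 2) * gauss_q (c * T) x y * ((L * hh t x) * (L * hh t y))"
  using HL[OF x] HL[OF y] K gauss_q_nonneg[of "c * T" x y] by (intro mult_left_mono mult_mono) auto
 also have "... = c3 * hh t x * hh t y * gauss_q (c / 3 * t) x y" by (simp add: c3_def T_def power2_eq_square)
 finally show "p t x y <= c3 * hh t x * hh t y * gauss_q (c / 3 * t) x y" .
qed
qed

lemma lower:
fixes M :: "real^'n => 'w measure" and V :: "real^'n => real"
assumes bk: "brownian_killing M W (%x::real^'n. Vm x)"
 and bk2: "brownian_killing M W (%x::real^'n. Vp x)" and dn: "d = CARD('n)"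
 and V: "V \<in> bm" "!!K. compact K ==> 0 \<notin> K ==> bounded (V ` K)"
 and lo: "!!x. x ~= 0 ==> Vm x <= V x" and hi: "!!x. x ~= 0 ==> V x <= Vp x"
 and den: "killed_FK_density M W V p"
 and sp: "sub_profile M W Vp n F0 F1 F2 Q0 Q1 Q2 Y rh (1 / 2) La" and cm: "cmp n"
obtains c1 c2 where "c1 > 0" "c2 > 0" "!!t x y. t >= 4 ==> x ~= 0 ==> y ~= 0 ==> (CARD('n) = 1 --> (ALL i. x $ i * y $ i > 0)) ==>
 c1 * hh t x * hh t y * gauss_q (c2 * t) x y <= p t x y"
proof -
interpret S: sub_profile M W "Vp" n F0 F1 F2 Q0 Q1 Q2 Y rh "1 / 2" La by (rule sp)
obtain c where c: "c > 0" and kl: "!!T Om i0 sgm0 x A. T >= 1 / 2 ==> S.good Om i0 sgm0 ==> x \<in> Om ==> x ~= 0 ==> A \<in> sets borel ==> A \<subseteq> Om - {0} ==>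
 (NN y. ind A y * en (c * S.H T x * S.H T y * (1 / sqrt T) ^ CARD('n) * exp (- (6 * real CARD('n) + 1) * (norm (x - y))^2 / T)))
  <= S.P (8 * T) (ind A) x"
 by (rule S.kernel_lower) (rule that)
obtain L where L: "L >= 1" "!!t y. t >= 4 ==> y > 0 ==> min 1 (n y / n (t / 8)) <= L * min 1 (prof y / po d t)"
 "!!t y. t >= 4 ==> y > 0 ==> min 1 (prof y / po d t) <= L * min 1 (n y / n (t / 8))"
 by (rule ratio_compare[where m = 8, OF cm S.n_pos S.n_mono]) (assumption, assumption, assumption, simp, simp, rule that)
define D where "D = 6 * real CARD('n) + 1"
have D: "D > 0" by (simp add: D_def)
\<comment> \<open>Normalisation that turns \<open>T^(-d/2) exp (- D |x - y|^2 / T)\<close> into the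
  Gaussian kernel at the time \<open>s\<close> with \<open>4 * s = T / D\<close>.\<close>
define w where "w = sqrt (pi / D) ^ CARD('n)"
have w: "w > 0" using D by (simp add: w_def)
define c1 where "c1 = c * w / L^2"
have c1: "c1 > 0" using c w L by (simp add: c1_def)
show ?thesis
proof (rule that[of c1 "1 / (32 * D)"])
 show "c1 > 0" "1 / (32 * D) > 0" using c1 D by auto
 fix t :: real and x y :: "real^'n" assume t: "t >= 4" and x: "x ~= 0" and y: "y ~= 0"
  and side: "CARD('n) = 1 --> (ALL i. x $ i * y $ i > 0)"
 define T where "T = t / 8"
 have T: "T >= 1 / 2" "T > 0" "t = 8 * T" using t by (auto simp: T_def)
 have HL: "0 <= hh t z" "hh t z <= L * S.H T z" "0 <= S.H T z" if "z ~= 0" for z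
  using hh_nonneg[OF t that] L(3)[OF t, of "(norm z)^2"] that S.n_pos[of "(norm z)^2"] S.n_pos[OF T(2)] by (auto simp: S.H_def hh_def T_def)
 \<comment> \<open>In dimension 1 this is the half-line containing both points, by the sign
   condition; otherwise the whole space, where a second axis provides the detour.\<close>
 obtain Om i0 sgm0 where Om: "S.good Om i0 sgm0" "x \<in> Om" "y \<in> Om" "open Om"
 proof (cases "CARD('n) = 1")
  case True
  then obtain i0 :: 'n where i0: "(UNIV :: 'n set) = {i0}" by (auto simp: card_1_singleton_iff)
  then have ii: "i = i0" for i by auto
  define sgm0 where "sgm0 = (if x $ i0 > 0 then 1 else -1 :: real)"
  have xy: "x $ i0 * y $ i0 > 0" using side True by blast
  have nrm: "norm z = \<bar>z $ i0\<bar>" for z :: "real^'n" by (simp add: norm_vec_def L2_set_def i0)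
  show ?thesis
  proof (rule that[of "{z. 0 < sgm0 * z $ i0}" i0 sgm0])
  show "open {z::real^'n. 0 < sgm0 * z $ i0}" by (intro open_Collect_less continuous_intros)
  then have "{z::real^'n. 0 < sgm0 * z $ i0} \<in> sets borel" by simp
  then show "S.good {z. 0 < sgm0 * z $ i0} i0 sgm0"
   unfolding S.good_def S.reach_def nrm by (auto simp: sgm0_def split: if_splits)
  show "x \<in> {z. 0 < sgm0 * z $ i0}" "y \<in> {z. 0 < sgm0 * z $ i0}" using xy by (auto simp: sgm0_def zero_less_mult_iff)
  qed
 next
  case False
  obtain i0 :: 'n where True by simp
  have "EX j. j ~= i0"
  proof (rule ccontr)
  assume "\<nexists>j. j ~= i0"
  then have "(UNIV :: 'n set) = {i0}" by auto
  from arg_cong[OF this, of card] False show False by simp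
  qed
  then show ?thesis by (intro that[of UNIV i0 1]) (auto simp: S.good_def S.reach_def)
 qed
 define R where "R y = c * S.H T x * S.H T y * (1 / sqrt T) ^ CARD('n) * exp (- (6 * real CARD('n) + 1) * (norm (x - y))^2 / T)" for y
 have "continuous_on (Om - {0}) (S.H T)"
 proof -
  have "continuous_on (Om - {0}) (%z::real^'n. n ((norm z)^2))"
  by (rule continuous_on_compose2[OF S.n_cont]) (auto intro!: continuous_intros)
  then show ?thesis unfolding S.H_def[abs_def] using S.n_pos[OF T(2)] by (intro continuous_intros) auto
 qed
 then have Rc: "continuous_on (Om - {0}) R" unfolding R_def using T by (intro continuous_intros) auto
 have Rp: "R y <= p t x y"
 proof (rule pointwise_of_integral[of "Om - {0}", OF _ Rc])
  show "open (Om - {0})" using Om by (intro open_Diff) auto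
  have "continuous_on ({x. x ~= 0} \<times> {y. y ~= 0}) (%(x, y). p t x y)" using den t unfolding killed_FK_density_def by auto
  moreover have "continuous_on (- {0}) (%y::real^'n. (x, y))" by (intro continuous_intros)
  moreover have "(%y. (x, y)) ` (- {0}) \<subseteq> {x. x ~= 0} \<times> {y. y ~= 0}" using x by auto
  ultimately have "continuous_on (- {0}) (%y. case (x, y) of (x, y) => p t x y)" by (rule continuous_on_compose2)
  then have "continuous_on (- {0}) (p t x)" by simp
  then show "continuous_on (Om - {0}) (p t x)" by (rule continuous_on_subset) auto
  show "0 <= p t x z" if "z \<in> Om - {0}" for z using den t x that unfolding killed_FK_density_def by auto
  fix A :: "(real^'n) set" assume A: "A \<in> sets borel" "A \<subseteq> Om - {0}"
  have "(NN z. ind A z * en (R z)) <= S.P (8 * T) (ind A) x"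
  unfolding R_def by (rule kl[OF T(1) Om(1,2) x A])
  also have "... <= (NN z. ind A z * en (p t x z))"
  unfolding T(3)[symmetric] using A t x by (intro killed_sandwich(1)[OF V bk lo bk2 hi den]) auto
  finally show "(NN z. ind A z * en (R z)) <= (NN z. ind A z * en (p t x z))" .
 qed (use Om y in auto)
 define s where "s = 1 / (32 * D) * t"
 have s: "4 * s = T / D" "s > 0" using D T by (auto simp: s_def)
 have "w * gauss_q s x y = (1 / sqrt T) ^ CARD('n) * exp (- D * (norm (x - y))^2 / T)"
 proof -
  have "4 * pi * s = pi * (4 * s)" by simp
  then have "4 * pi * s = pi / D * T" unfolding s(1) by simp
  then have p1: "(4 * pi * s) powr (- real CARD('n) / 2) = (1 / sqrt (pi / D * T)) ^ CARD('n)"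
  using gauss_norm_const[OF s(2), of "CARD('n)"] by simp
  have p2: "w * (1 / sqrt (pi / D * T)) ^ CARD('n) = (1 / sqrt T) ^ CARD('n)"
  unfolding w_def power_mult_distrib[symmetric] real_sqrt_mult using D by simp
  have p3: "- (norm (x - y))\<^sup>2 / (4 * s) = - D * (norm (x - y))^2 / T" unfolding s(1) by simp
  show ?thesis unfolding gauss_q_def p1 p3 mult.assoc[symmetric] p2 ..
 qed
 then have Req: "R y = c * S.H T x * S.H T y * (w * gauss_q s x y)" unfolding R_def D_def[symmetric] by (simp add: mult.assoc)
 have "c1 * hh t x * hh t y * gauss_q s x y = c1 * gauss_q s x y * (hh t x * hh t y)" by simp
 also have "... <= c1 * gauss_q s x y * ((L * S.H T x) * (L * S.H T y))"
  using HL[OF x] HL[OF y] c1 gauss_q_nonneg[of s x y] L by (intro mult_left_mono mult_mono) auto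
 also have "... = R y" unfolding Req c1_def using L by (simp add: power2_eq_square)
 also note Rp
 finally show "c1 * hh t x * hh t y * gauss_q (1 / (32 * D) * t) x y <= p t x y" by (simp add: s_def)
qed
qed

lemma Logp_compare:
assumes s: "s >= 1"
shows "Logp s <= 1 + 2 * ln s" "1 + 2 * ln s <= 4 * Logp s" "1 <= Logp s"
proof -
have e1: "exp 1 > (1::real)" by simp
have p: "0 < exp 1 - 1 + s" using e1 s by linarith
have "exp 1 - 1 + s <= exp 1 * s" using mult_left_mono[OF s, of "exp 1 - 1"] by (simp add: algebra_simps)
moreover have "0 < exp 1 * s" using s by simp
ultimately have "Logp s <= ln (exp 1 * s)" unfolding Logp_def using ln_le_cancel_iff[OF p] by blast
also have "... = 1 + ln s" using s by (simp add: ln_mult)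
finally show "Logp s <= 1 + 2 * ln s" using ln_ge_zero[OF s] by linarith
have "exp 1 <= exp 1 - 1 + s" using s by simp
then have "ln (exp 1) <= Logp s" unfolding Logp_def using ln_le_cancel_iff[OF exp_gt_zero p] by blast
then show 1: "1 <= Logp s" by simp
have "0 < s" "s <= exp 1 - 1 + s" using s e1 by linarith+
then have "ln s <= Logp s" unfolding Logp_def using ln_le_cancel_iff[OF _ p] by blast
with 1 show "1 + 2 * ln s <= 4 * Logp s" by linarith
qed

text \<open>For \<open>r < 1\<close> the function \<open>prof\<close> is exactly
  \<open>h_bk\<close>. For \<open>r >= 1\<close> it is \<open>r\<close> in dimension 1; in dimension
  2 it is \<open>1 + 2 ln r\<close>, within a factor 4 of \<open>Log r\<close>. From dimension 3 on,
  where \<open>H_bk\<close> is not capped by 1, it is the constant 1 against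
  \<open>exp (- k)\<close>.\<close>

lemma H_compare:
assumes cm: "cmp N" and mono: "!!y z. 0 < y ==> y <= z ==> N y <= N z"
 and be: "be = 2 * b" "sqrt \<kappa> / be = k"
obtains c where "c > 0" "!!t x. t >= 4 ==> x ~= (0::real^'n) ==> c * H_bk d be \<kappa> t (norm x) <= hh t x"
 "!!t x. t >= 4 ==> x ~= (0::real^'n) ==> c * hh t x <= H_bk d be \<kappa> t (norm x)"
proof -
obtain c where c: "c > 0" "!!y. y > 0 ==> c * prof y <= N y" using cm by (auto simp: cmp_def)
define S where "S = max 1 (N 1 / c)"
have S: "prof y <= S" if "0 < y" "y <= 1" for y
proof -
 have "c * prof y <= N 1" using c(2)[OF that(1)] mono[OF that] by linarith
 then have "prof y <= N 1 / c" using c by (simp add: pos_le_divide_eq mult.commute)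
 then show ?thesis by (simp add: S_def)
qed
have S1: "S >= 1" by (simp add: S_def)
have h_small: "h_bk d be \<kappa> r = prof (r^2)" if "0 < r" "r < 1" for r
proof -
 have r2: "r^2 < 1" using that by (simp add: power_less_one_iff)
 have sq: "r\<^sup>2 powr z = r powr (2 * z)" for z using that by (simp add: powr_powr flip: powr_numeral)
 have "r powr (- (real d - 2 - be) / 2) = exp (a * ln (r^2))"
  using that unfolding a be(1) by (simp add: powr_def ln_realpow field_simps)
 moreover have "exp (- sqrt \<kappa> / (be * r powr be)) = exp (- k * r\<^sup>2 powr (- b))"
  unfolding sq be(2)[symmetric] using that be(1) by (simp add: powr_minus field_simps)
 ultimately show ?thesis using r2 that by (simp add: h_bk_def prof_def FA_def ps_def mult_exp_exp)
qed
\<comment> \<open>The three bounds serve the logarithms in dimension 2, the cap by 1 via the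
  supremum \<open>S\<close> of \<open>prof\<close> on the unit ball, and the value
  \<open>exp (- k)\<close> of \<open>h_bk\<close> outside.\<close>
define c' where "c' = min (1 / 4) (min (1 / S) (exp (- k)))"
have c': "c' > 0" "c' <= 1 / 4" "c' <= 1 / S" "c' <= exp (- k)" using S1 by (auto simp: c'_def)
have main: "c' * H_bk d be \<kappa> t (norm x) <= hh t x & c' * hh t x <= H_bk d be \<kappa> t (norm x)"
 if t: "t >= 4" and x: "x ~= (0::real^'n)" for t x
proof -
 define r where "r = norm x"
 have r: "r > 0" using x by (simp add: r_def)
 have pr: "prof (r^2) > 0" using r by (intro prof_pos) simp
 have r1: "r^2 >= 1 \<longleftrightarrow> r >= 1" using r by (simp add: power2_ge_1_iff)
 have hn: "0 <= hh t x" by (rule hh_nonneg[OF t x])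
 have hx: "hh t x = min 1 (prof (r^2) / po d t)" by (simp add: hh_def r_def)
 have scale: "c' * u <= v" if "u <= 4 * v" "0 <= u" for u v :: real
  using mult_right_mono[OF c'(2) that(2)] that by linarith
 consider "d = 1" | "d = 2" | "d >= 3" using d by linarith
 then show ?thesis
 proof cases
  case 1
  have po: "po d t = sqrt t" using 1 t by (simp add: po_def powr_half_sqrt)
  have hb: "H_bk d be \<kappa> t r = min 1 ((if r < 1 then h_bk d be \<kappa> r else r) / sqrt t)"
  unfolding H_bk_def using 1 by simp
  have big: "prof (r^2) = r" if "\<not> r < 1"
  proof -
  have "\<not> r^2 < 1" using r1 that by linarith
  then show ?thesis unfolding prof_def po_def using 1 r by (simp add: powr_half_sqrt)
  qed
  have "H_bk d be \<kappa> t r = hh t x"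
  unfolding hb hx po using h_small[OF r] big by (cases "r < 1") auto
  then show ?thesis unfolding r_def[symmetric] using hn by (auto intro!: scale)
 next
  case 2
  have st: "sqrt t >= 1" using t by simp
  have lt: "po d t = 1 + 2 * ln (sqrt t)" using 2 t by (simp add: po_def ln_sqrt)
  note Lt = Logp_compare[OF st]
  have hb: "H_bk d be \<kappa> t r = min 1 ((if r < 1 then h_bk d be \<kappa> r else Logp r) / Logp (sqrt t))"
  unfolding H_bk_def using 2 by simp
  have big: "prof (r^2) = 1 + 2 * ln r" if "\<not> r < 1"
  proof -
  have "\<not> r^2 < 1" using r1 that by linarith
  then show ?thesis unfolding prof_def po_def using 2 r by (simp add: ln_realpow)
  qed
  have num: "\<exists>q>0. H_bk d be \<kappa> t r = min 1 (q / Logp (sqrt t)) & q <= prof (r^2) & prof (r^2) <= 4 * q"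
  proof (cases "r < 1")
  case True
  then show ?thesis using h_small[OF r True] pr by (intro exI[of _ "prof (r^2)"]) (auto simp: hb)
  next
  case False
  then show ?thesis using big Logp_compare[of r] by (intro exI[of _ "Logp r"]) (auto simp: hb)
  qed
  then obtain q where q: "q > 0" "H_bk d be \<kappa> t r = min 1 (q / Logp (sqrt t))" "q <= prof (r^2)" "prof (r^2) <= 4 * q" by blast
  have po1: "po d t >= 1" using t by (intro po_props) auto
  have "q / Logp (sqrt t) <= prof (r^2) / (po d t / 4)" using q Lt lt po1 by (intro frac_le) auto
  then have "H_bk d be \<kappa> t r <= 4 * hh t x" unfolding q hx by (intro min_one_le) (auto simp: mult.commute)
  moreover have "prof (r^2) / po d t <= 4 * q / Logp (sqrt t)" using q Lt lt pr by (intro frac_le) auto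
  then have "hh t x <= 4 * H_bk d be \<kappa> t r" unfolding q hx by (intro min_one_le) (auto simp: mult.commute)
  moreover have "0 <= H_bk d be \<kappa> t r" using q Lt by auto
  ultimately show ?thesis unfolding r_def[symmetric] using hn by (auto intro!: scale)
 next
  case 3
  have po: "po d t = 1" using 3 by (simp add: po_def)
  have H: "H_bk d be \<kappa> t r = h_bk d be \<kappa> r" using 3 by (simp add: H_bk_def)
  show ?thesis
  proof (cases "r < 1")
  case True
  then have "prof (r^2) <= S" using S[of "r^2"] r r1 by auto
  then have "c' * prof (r^2) <= 1 / S * S" using c' pr S1 by (intro mult_mono) auto
  moreover have "c' * prof (r^2) <= 1 * prof (r^2)" using c' pr by (intro mult_right_mono) auto
  ultimately have "c' * prof (r^2) <= hh t x" unfolding hx po using S1 by simp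
  moreover have "c' * hh t x <= 1 * prof (r^2)" using c' hn unfolding hx po by (intro mult_mono) auto
  ultimately show ?thesis unfolding r_def[symmetric] H h_small[OF r True] by simp
  next
  case False
  then have "\<not> r^2 < 1" using r1 by linarith
  then have "prof (r^2) = 1" unfolding prof_def po_def using 3 by simp
  then have "hh t x = 1" by (simp add: hx po)
  moreover have "h_bk d be \<kappa> r = exp (- k)" using False be(2) by (simp add: h_bk_def min_def)
  moreover have "c' * exp (- k) <= 1 * 1" using c' k by (intro mult_mono) auto
  ultimately show ?thesis unfolding r_def[symmetric] H using c' by simp
  qed
 qed
qed
show ?thesis by (rule that[OF c'(1)]) (use main in auto)
qed

lemma brownian_killing_bounds:
fixes M :: "real^'n => 'w measure"
assumes bf: "brownian_family M W"
shows "brownian_killing M W (%x::real^'n. Vm x)"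
 "brownian_killing M W (%x::real^'n. Vp x)"
proof -
have "continuous_on {0<..} yVm" unfolding yVm_def[abs_def] by (intro continuous_intros) auto
from continuous_on_compose2[OF this, of "{x::real^'n. x ~= 0}" "%x. (norm x)^2"]
have "continuous_on {x::real^'n. x ~= 0} (%x. yVm ((norm x)^2))" by (force intro!: continuous_intros)
then show "brownian_killing M W (%x::real^'n. Vm x)"
 using bf yVm_nonneg by unfold_locales (auto intro!: continuous_on_divide continuous_on_power continuous_on_norm continuous_on_id)
have "continuous_on {0<..} yVp" unfolding yVp_def[abs_def] by (intro continuous_intros) auto
from continuous_on_compose2[OF this, of "{x::real^'n. x ~= 0}" "%x. (norm x)^2"]
have "continuous_on {x::real^'n. x ~= 0} (%x. yVp ((norm x)^2))" by (force intro!: continuous_intros)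
then show "brownian_killing M W (%x::real^'n. Vp x)"
 using bf yVp_nonneg by unfold_locales (auto intro!: continuous_on_divide continuous_on_power continuous_on_norm continuous_on_id)
qed

text \<open>The larger potential \<open>Vp\<close> kills more, so the survival bound proved for
  \<open>Vm\<close> carries over; comparability replaces \<open>N\<close> by \<open>prof\<close>.
  This is the survival hypothesis of the subharmonic profile.\<close>

lemma survival_prof:
fixes M :: "real^'n => 'w measure"
assumes bf: "brownian_family M W" and le: "!!x::real^'n. x ~= 0 ==> Vm x <= Vp x"
 and sg: "super_growth M W Vm N F0 F1 F2 Q0 Q1 Q2 y0 rh ys vs" and cm: "cmp N" and ta: "ta > 0"
shows "\<exists>K\<ge>1. \<forall>T\<ge>ta. ALL x. x ~= 0 -->
  brownian_killing.P M W Vp T (%_. 1) x <= en (K * (prof ((norm x)^2) / prof T))"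
proof -
interpret U: super_growth M W "Vm" N F0 F1 F2 Q0 Q1 Q2 y0 rh ys vs by (rule sg)
obtain c where c: "c > 0" "!!y. y > 0 ==> c * prof y <= N y" "!!y. y > 0 ==> c * N y <= prof y" using cm by (auto simp: cmp_def)
obtain L where L: "L >= 1" "!!T x. T >= ta ==> x ~= 0 ==> U.P T (%_. 1) x <= en (L * U.H T x)"
 using U.survival_bound[OF ta] by blast
show ?thesis
proof (intro exI[of _ "max 1 (L / c^2)"] conjI allI impI)
 show "1 <= max 1 (L / c^2)" by simp
 fix T and x :: "real^'n" assume T: "ta <= T" and x: "x ~= 0"
 have T0: "T > 0" and x0: "(norm x)^2 > 0" using T ta x by auto
 note p0 = prof_pos[OF T0] prof_pos[OF x0]
 have "N ((norm x)^2) / N T <= (prof ((norm x)^2) / c) / (c * prof T)"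
  using c(1) c(3)[OF x0] c(2)[OF T0] p0 by (intro frac_le) (auto simp: pos_le_divide_eq mult.commute)
 then have "U.H T x <= (prof ((norm x)^2) / c) / (c * prof T)" using U.H_bounds(3)[of T x] by simp
 then have "L * U.H T x <= L * ((prof ((norm x)^2) / c) / (c * prof T))" using L by (intro mult_left_mono) auto
 also have "... = L / c^2 * (prof ((norm x)^2) / prof T)" by (simp add: power2_eq_square)
 also have "... <= max 1 (L / c^2) * (prof ((norm x)^2) / prof T)"
  using p0 by (intro mult_right_mono) auto
 finally have 1: "en (L * U.H T x) <= en (max 1 (L / c^2) * (prof ((norm x)^2) / prof T))" by (rule ennreal_leI)
 have "brownian_killing.P M W Vp T (%_. 1) x <= U.P T (%_. 1) x"
  by (rule P_antimono[OF brownian_killing_bounds[OF bf] le])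
 also have "... <= en (L * U.H T x)" by (rule L(2)[OF T x])
 also note 1
 finally show "brownian_killing.P M W Vp T (%_. 1) x <= en (max 1 (L / c^2) * (prof ((norm x)^2) / prof T))" .
qed
qed

text \<open>In the unit ball the deviation of \<open>|x|^2 V\<close> from the main term is at most
  \<open>C0 r^(\<theta> - 2 \<beta>)\<close>, hence at most \<open>C r^(4 e - \<beta>)\<close>.
  Outside, \<open>\<kappa> <= C\<close> makes the lower potential vanish, and the decay of
  \<open>V\<close> is covered by the term \<open>C r^(- 4 g)\<close>.\<close>

lemma potential_sandwich:
fixes x :: "real^'n"
assumes be: "be = 2 * b" and \<kappa>: "\<kappa> = 4 * k^2 * b^2" and C': "\<kappa> <= C" "C0 <= C" "C3 <= C" "C0 >= 0"
 and \<theta>: "4 * e <= \<theta> - be" and \<gamma>: "4 * g <= \<gamma>"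
 and near: "norm x <= 1 ==> V x = c x * norm x powr (- 2 - 2 * be) & \<bar>c x - \<kappa>\<bar> <= C0 * norm x powr \<theta>"
 and far: "norm x > 1 ==> V x <= C3 * norm x powr (- 2 - \<gamma>)" and nn: "0 <= V x" and x: "x ~= 0"
shows "Vm x <= V x" "V x <= Vp x"
proof -
define r where "r = norm x"
have r: "r > 0" using x by (simp add: r_def)
have pw: "r\<^sup>2 powr z = r powr (2 * z)" for z using r by (simp add: powr_powr flip: powr_numeral)
have sq: "(r\<^sup>2 powr (- b))^2 = r powr (- 2 * be)" unfolding pw using r by (simp add: be power2_eq_square powr_add[symmetric])
have p1: "r\<^sup>2 powr (2 * e - b) = r powr (4 * e - be)" "r\<^sup>2 powr (- 2 * g) = r powr (- 4 * g)" unfolding pw by (simp_all add: be)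
have m: "yVm (r^2) = max 0 (\<kappa> * r powr (- 2 * be) - C * r powr (4 * e - be))"
 and v: "yVp (r^2) = \<kappa> * r powr (- 2 * be) + C * (r powr (4 * e - be) + r powr (- 4 * g))"
 unfolding yVm_def yVp_def sq p1 \<kappa> by simp_all
have split: "r powr (- 2 - z) * r^2 = r powr (- z)" for z
 using r by (simp add: powr_diff powr_minus field_simps)
have "yVm (r^2) <= V x * r^2 & V x * r^2 <= yVp (r^2)"
proof (cases "r <= 1")
 case True
 note N = near[unfolded r_def[symmetric], OF True]
 have Vr: "V x * r^2 = c x * r powr (- 2 * be)" using N split[of "2 * be"] by (simp add: mult.assoc)
 have "r powr \<theta> * r powr (- 2 * be) = r powr (\<theta> - 2 * be)" using r by (simp add: powr_add[symmetric])
 also have "... <= r powr (4 * e - be)" using \<theta> by (intro powr_exp_le[OF r True]) auto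
 finally have "C0 * (r powr \<theta> * r powr (- 2 * be)) <= C * r powr (4 * e - be)" using C' by (intro mult_mono) auto
 moreover have "\<bar>c x - \<kappa>\<bar> * r powr (- 2 * be) <= C0 * r powr \<theta> * r powr (- 2 * be)" using N by (intro mult_right_mono) auto
 moreover have "\<bar>c x - \<kappa>\<bar> * r powr (- 2 * be) = \<bar>c x * r powr (- 2 * be) - \<kappa> * r powr (- 2 * be)\<bar>"
  by (simp add: abs_mult flip: left_diff_distrib)
 ultimately have "\<bar>c x * r powr (- 2 * be) - \<kappa> * r powr (- 2 * be)\<bar> <= C * r powr (4 * e - be)" by (simp add: mult.assoc)
 moreover have "0 <= V x * r^2" "0 <= C * r powr (- 4 * g)" using nn C by auto
 ultimately show ?thesis unfolding m v Vr by (auto simp: distrib_left)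
next
 case False
 then have r1: "r >= 1" by simp
 have "r powr (- 2 * be) <= r powr (4 * e - be)" using r1 be b e by (intro powr_mono) auto
 then have "\<kappa> * r powr (- 2 * be) <= C * r powr (4 * e - be)" using C' C by (intro mult_mono) auto
 then have "yVm (r^2) = 0" unfolding m by simp
 moreover have "V x * r^2 <= C3 * r powr (- 2 - \<gamma>) * r^2" using far False by (intro mult_right_mono) (auto simp: r_def)
 then have "V x * r^2 <= C3 * r powr (- \<gamma>)" using split[of \<gamma>] by (simp add: mult.assoc)
 moreover have "C3 * r powr (- \<gamma>) <= C * r powr (- 4 * g)"
  using C' C \<gamma> r1 by (intro mult_mono powr_mono) auto
 moreover have "0 <= \<kappa> * r powr (- 2 * be)" "0 <= C * r powr (4 * e - be)" using \<kappa> C by auto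
 moreover have "0 <= V x * r^2" using nn by simp
 ultimately show ?thesis unfolding v by (auto simp: distrib_left)
qed
then show "Vm x <= V x" "V x <= Vp x"
 using x by (auto simp: r_def pos_divide_le_eq pos_le_divide_eq)
qed

end

section \<open>Assembly of the two bounds\<close>

theorem theorem6p1:
  fixes V :: "real^'n \<Rightarrow> real"
    and M :: "real^'n \<Rightarrow> 'w measure"
    and W :: "real^'n \<Rightarrow> real \<Rightarrow> 'w \<Rightarrow> real^'n"
    and p :: "real \<Rightarrow> real^'n \<Rightarrow> real^'n \<Rightarrow> real"
    and \<beta> \<kappa> :: real
  assumes "\<beta> > 0" and "\<kappa> > 0"
    and "admissible_V V"
    and "class_K \<beta> \<kappa> V"
    and "brownian_family M W"
    and "killed_FK_density M W V p"
  shows "\<exists>c1 c2 c3 c4 :: real. c1 > 0 \<and> c2 > 0 \<and> c3 > 0 \<and> c4 > 0 \<and>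
    (\<forall>t x y. t \<ge> 4 \<and> x \<noteq> 0 \<and> y \<noteq> 0 \<and>
       (CARD('n) = 1 \<longrightarrow> (\<forall>i. x $ i * y $ i > 0)) \<longrightarrow>
       c1 * H_bk CARD('n) \<beta> \<kappa> t (norm x) * H_bk CARD('n) \<beta> \<kappa> t (norm y) * gauss_q (c2 * t) x y
         \<le> p t x y \<and>
       p t x y \<le>
         c3 * H_bk CARD('n) \<beta> \<kappa> t (norm x) * H_bk CARD('n) \<beta> \<kappa> t (norm y) * gauss_q (c4 * t) x y)"
proof -
note bf = assms(5) and den = assms(6)
have Vm: "V \<in> bm" and Vn: "!!x. x ~= 0 ==> 0 <= V x" and Vb: "!!K. compact K ==> 0 \<notin> K ==> bounded (V ` K)"
 using assms(3) by (auto simp: admissible_V_def)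
obtain c C0 \<theta> where C0: "C0 > 0" "\<theta> > \<beta>" and near: "!!x. 0 < norm x ==> norm x <= 1 ==>
  V x = c x * norm x powr (- 2 - 2 * \<beta>) & \<bar>c x - \<kappa>\<bar> <= C0 * norm x powr \<theta>"
 using assms(4) unfolding class_K_def by blast
obtain C3 \<gamma> where C3: "C3 > 0" "\<gamma> > 0" and far: "!!x. norm x > 1 ==> V x <= C3 * norm x powr (- 2 - \<gamma>)"
 using assms(4) unfolding class_K_def by blast
define b k a where "b = \<beta> / 2" and "k = sqrt \<kappa> / \<beta>" and "a = (\<beta> / 2 + 1 - real CARD('n) / 2) / 2"
\<comment> \<open>A quarter of the excess of \<open>\<theta>\<close> over \<open>\<beta>\<close>,
  reduced so that the correction \<open>y powr e\<close> stays subordinate to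
  \<open>y powr (- b)\<close>; \<open>g\<close> is obtained in the same way from the decay exponent
  at infinity.\<close>
define e where "e = min ((\<theta> - \<beta>) / 4) (min (b / 4) (1 / 4))"
define g where "g = min (\<gamma> / 4) (min (b / 4) (1 / 8))"
define C where "C = \<kappa> + C0 + C3"
have b: "b > 0" using assms(1) by (simp add: b_def)
have k: "k > 0" using assms(1,2) by (simp add: k_def)
have "e <= (\<theta> - \<beta>) / 4" "e <= b / 4" "g <= \<gamma> / 4" "g <= b / 4" "e <= 1 / 4" "g <= 1 / 8" unfolding e_def g_def by linarith+
moreover have "e > 0" "g > 0" using C0 C3 b by (simp_all add: e_def g_def)
ultimately have e: "e > 0" "4 * e <= \<theta> - \<beta>" "4 * e <= b" "e <= 1 / 4" and g: "g > 0" "4 * g <= \<gamma>" "4 * g <= b" "g <= 1 / 8"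
 by (simp_all add: field_simps)
interpret Q: potential_profile "CARD('n)" b k a e g C
 using b k e g C0 C3 assms(2) by unfold_locales (auto simp: a_def b_def C_def Suc_le_eq)
have \<beta>: "\<beta> = 2 * b" by (simp add: b_def)
have \<kappa>: "\<kappa> = 4 * k^2 * b^2" using assms(1,2) by (simp add: k_def b_def power_divide)
have sand: "Q.Vm x <= V x" "V x <= Q.Vp x" if "x ~= 0" for x
 by (rule Q.potential_sandwich[OF \<beta> \<kappa>, where ?C0.0 = C0 and ?C3.0 = C3 and \<theta> = \<theta> and \<gamma> = \<gamma> and c = c];
  use that C0 C3 assms(2) e g near[of x] far[of x] Vn[OF that] in \<open>auto simp: C_def\<close>)+
note bk = Q.brownian_killing_bounds[OF bf]
obtain N F0 F1 F2 Q0 Q1 Q2 y0 rh ys vs where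
 sg: "super_growth M W Q.Vm N F0 F1 F2 Q0 Q1 Q2 y0 rh ys vs" and cN: "Q.cmp N"
 by (rule Q.super_exists[OF bk(1) refl]) (rule that)
have surv: "\<exists>K\<ge>1. \<forall>T\<ge>ta'. ALL x. x ~= 0 -->
  brownian_killing.P M W Q.Vp T (%_. 1) x <= en (K * (Q.prof ((norm x)^2) / Q.prof T))"
 if "ta' > 0" for ta'
 by (rule Q.survival_prof[OF bf order_trans[OF sand] sg cN that])
\<comment> \<open>The lower bound is used with \<open>T = t / 8\<close>, and \<open>t >= 4\<close>
  gives \<open>T >= 1 / 2\<close>.\<close>
have half: "(1 / 2 :: real) > 0" by simp
obtain n F0' F1' F2' Q0' Q1' Q2' Y rh' La where
 sp: "sub_profile M W Q.Vp n F0' F1' F2' Q0' Q1' Q2' Y rh' (1 / 2) La" and cn: "Q.cmp n"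
 by (rule Q.sub_exists[OF bk(2) refl half surv]) (assumption, rule that)
obtain u3 u4 where u: "u3 > 0" "u4 > 0" "!!t x y. t >= 4 ==> x ~= 0 ==> y ~= 0 ==> p t x y <= u3 * Q.hh t x * Q.hh t y * gauss_q (u4 * t) x y"
 by (rule Q.upper[OF bk refl Vm Vb sand den sg cN]) (assumption, assumption, assumption, assumption, rule that)
obtain l1 l2 where l: "l1 > 0" "l2 > 0" "!!t x y. t >= 4 ==> x ~= 0 ==> y ~= 0 ==> (CARD('n) = 1 --> (ALL i. x $ i * y $ i > 0)) ==>
 l1 * Q.hh t x * Q.hh t y * gauss_q (l2 * t) x y <= p t x y"
 by (rule Q.lower[OF bk refl Vm Vb sand den sp cn]) (assumption, assumption, assumption, assumption, rule that)
interpret U: super_growth M W "Q.Vm" N F0 F1 F2 Q0 Q1 Q2 y0 rh ys vs by (rule sg)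
let ?H = "%t x::real^'n. H_bk CARD('n) \<beta> \<kappa> t (norm x)"
obtain h where h: "h > 0" "!!t x. t >= 4 ==> x ~= (0::real^'n) ==> h * ?H t x <= Q.hh t x"
 "!!t x. t >= 4 ==> x ~= (0::real^'n) ==> h * Q.hh t x <= ?H t x"
 by (rule Q.H_compare[OF cN U.N_mono \<beta> k_def[symmetric]]) (assumption, assumption, rule that)
show ?thesis
proof (rule exI[of _ "l1 * h^2"], rule exI[of _ l2], rule exI[of _ "u3 / h^2"], rule exI[of _ u4], intro conjI allI impI)
 show "0 < l1 * h^2" "0 < l2" "0 < u3 / h^2" "0 < u4" using u l h by auto
 fix t :: real and x y :: "real^'n"
 assume A: "t >= 4 & x ~= 0 & y ~= 0 & (CARD('n) = 1 --> (ALL i. x $ i * y $ i > 0))"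
 then have t: "t >= 4" and x: "x ~= 0" and y: "y ~= 0" by auto
 have hn: "0 <= Q.hh t x" "0 <= Q.hh t y" using Q.hh_nonneg[OF t] x y by auto
 have hH: "0 <= h * ?H t z" if "z ~= 0" for z
 proof -
  have "0 <= h * Q.hh t z" using h Q.hh_nonneg[OF t that] by simp
  then have "0 <= ?H t z" using h(3)[OF t that] by linarith
  then show ?thesis using h by simp
 qed
 have "l1 * h^2 * ?H t x * ?H t y * gauss_q (l2 * t) x y = l1 * gauss_q (l2 * t) x y * ((h * ?H t x) * (h * ?H t y))"
  by (simp add: power2_eq_square)
 also have "... <= l1 * gauss_q (l2 * t) x y * (Q.hh t x * Q.hh t y)"
  using h(2)[OF t x] h(2)[OF t y] hH[OF x] hH[OF y] hn l gauss_q_nonneg[of "l2 * t" x y] by (intro mult_left_mono mult_mono) auto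
 also have "... = l1 * Q.hh t x * Q.hh t y * gauss_q (l2 * t) x y" by simp
 also have "... <= p t x y" using A by (intro l(3)) auto
 finally show "l1 * h^2 * ?H t x * ?H t y * gauss_q (l2 * t) x y <= p t x y" .
 have "p t x y <= u3 * Q.hh t x * Q.hh t y * gauss_q (u4 * t) x y" by (rule u(3)[OF t x y])
 also have "... = u3 / h^2 * gauss_q (u4 * t) x y * ((h * Q.hh t x) * (h * Q.hh t y))"
  using h by (simp add: power2_eq_square)
 also have "... <= u3 / h^2 * gauss_q (u4 * t) x y * (?H t x * ?H t y)"
  using h(1) h(3)[OF t x] h(3)[OF t y] hn u gauss_q_nonneg[of "u4 * t" x y] hH[OF x] by (intro mult_left_mono mult_mono) (auto simp: zero_le_mult_iff)
 also have "... = u3 / h^2 * ?H t x * ?H t y * gauss_q (u4 * t) x y" by simp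
 finally show "p t x y <= u3 / h^2 * ?H t x * ?H t y * gauss_q (u4 * t) x y" .
qed
qed

end
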